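(* Let $\eta$ be a Poisson process on $\mathbb X$ with locally finite (not necessarily diffuse) intensity measure $\lambda$. Let $f:\mathbf N\to\mathbb R$ be measurable with $\mathbb E[f(\eta)^2]<\infty$ and let $f(\eta)=\sum_{k=0}^\infty I_k(u_k)$ be its Wiener–Itô chaos expansion. Assume that $f$ is determined by a randomized stopping set $Z=Z^Y$ for which there exists an increasing sequence of randomized stopping sets $Z_j=Z_j^Y$, $j\ge1$ (with the same randomization $Y$), such that $\mathbb P(\eta(Z_j(\eta))<\infty)=1$ for every $j\ge1$ and $Z=\bigcup_{j\ge1}Z_j$. Then, for all $k\ge1$, $$\mathbb E[I_k(u_k)^2]\le k\,\delta(Z)\,\mathbb E[f(\eta)^2],\qquad \delta(Z):=\sup_{x\in\mathbb X}\mathbb P(x\in Z(\eta)).$$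
   Context: $(\mathbb X,\mathcal X)$ is a Borel space (measurably isomorphic to a Borel subset of $[0,1]$). Fix an increasing sequence $B_n\in\mathcal X$ with $B_n\uparrow\mathbb X$, and let $\mathcal X_0:=\{B\cap B_n:B\in\mathcal X,n\in\mathbb N\}$. A measure on $\mathbb X$ is locally finite if it is finite on $\mathcal X_0$. $\mathbf N$ is the set of all measures on $\mathbb X$ that are $\mathbb N_0$-valued on $\mathcal X_0$, with the $\sigma$-field generated by $\mu\mapsto\mu(B)$, $B\in\mathcal X$. For a measure $\nu$ and $B\in\mathcal X$, $\nu_B:=\nu(\cdot\cap B)$. A Poisson process with intensity $\lambda$ is a random element $\eta$ of $\mathbf N$ with $\eta(B)$ Poisson of mean $\lambda(B)$ and independent values on disjoint sets. Stopping set: a map $Z:\mathbf N\to\mathcal X$ such that $(x,\mu)\mapsto\mathbf 1\{x\in Z(\mu)\}$ is measurable and $Z(\mu)=Z(\mu_{Z(\mu)}+\psi_{Z(\mu)^c})$ for all $\mu,\psi\in\mathbf N$. Randomized stopping set: $Z^Y$, where $Y$ is a random element of a measurable space $\mathbb Y$ independent of $\eta$, $Z^y$ is a stopping set for $\mathbb P(Y\in\cdot)$-a.e. $y$, and $(\mu,x,y)\mapsto\mathbf 1\{x\in Z^y(\mu)\}$ is jointly measurable; $Z(\eta)$ means $Z^Y(\eta)$. A function $f$ is determined by a stopping set $Z$ if $f(\mu)=f(\mu_{Z(\mu)})$ for all $\mu\in\mathbf N$, and by a randomized stopping set $Z^Y$ if it is determined by $Z^y$ for $\mathbb P(Y\in\cdot)$-a.e.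 $y$. Chaos expansion: every square-integrable $f(\eta)$ is uniquely $\sum_{k\ge0}I_k(u_k)$ in $L^2(\mathbb P)$, where $I_0(u_0)=u_0=\mathbb E[f(\eta)]$, $I_k$ is the multiple Wiener–Itô integral of order $k$ with respect to $\eta-\lambda$, and $u_k\in L^2(\lambda^k)$ is symmetric; explicitly $u_k(x_1,\dots,x_k)=\frac1{k!}\mathbb E[D^k_{x_1,\dots,x_k}f(\eta)]$ with $D_xf(\mu)=f(\mu+\delta_x)-f(\mu)$ and $D^k$ its iterate. One has $\mathbb E[I_k(u)^2]=k!\|u\|^2_{L^2(\lambda^k)}$. *)

theory Defs
  imports "HOL-Probability.Probability" "HOL-Combinatorics.Permutations"
begin

text \<open>
  Throughout, \<open>X :: 'a measure\<close> only serves as a measurable space: its measure is never used.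
\<close>

definition borel_space :: "'a measure \<Rightarrow> bool" where
  "borel_space X \<longleftrightarrow> (\<exists>S\<in>sets (borel :: real measure). S \<subseteq> {0..1} \<and>
     (\<exists>\<phi>. bij_betw \<phi> (space X) S \<and> \<phi> \<in> X \<rightarrow>\<^sub>M restrict_space borel S \<and>
          inv_into (space X) \<phi> \<in> restrict_space borel S \<rightarrow>\<^sub>M X))"

definition localizing_sequence :: "'a measure \<Rightarrow> (nat \<Rightarrow> 'a set) \<Rightarrow> bool" where
  "localizing_sequence X B \<longleftrightarrow> range B \<subseteq> sets X \<and> incseq B \<and> (\<Union>n. B n) = space X"

definition local_sets :: "'a measure \<Rightarrow> (nat \<Rightarrow> 'a set) \<Rightarrow> 'a set set" where
  "local_sets X B = {A \<inter> B n | A n. A \<in> sets X}"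

definition locally_finite :: "'a measure \<Rightarrow> (nat \<Rightarrow> 'a set) \<Rightarrow> 'a measure \<Rightarrow> bool" where
  "locally_finite X B \<mu> \<longleftrightarrow> sets \<mu> = sets X \<and> (\<forall>C\<in>local_sets X B. emeasure \<mu> C < \<infinity>)"

definition counting_measures :: "'a measure \<Rightarrow> (nat \<Rightarrow> 'a set) \<Rightarrow> 'a measure set" where
  "counting_measures X B =
     {\<mu>. sets \<mu> = sets X \<and> (\<forall>C\<in>local_sets X B. \<exists>n::nat. emeasure \<mu> C = of_nat n)}"

definition counting_space :: "'a measure \<Rightarrow> (nat \<Rightarrow> 'a set) \<Rightarrow> 'a measure measure" where
  "counting_space X B =
     (SUP A\<in>sets X. vimage_algebra (counting_measures X B) (\<lambda>\<mu>. emeasure \<mu> A) borel)"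

lemma space_counting_space [simp]: "space (counting_space X B) = counting_measures X B"
  unfolding counting_space_def by (subst space_Sup_eq_UN) auto

lemma measurable_emeasure_counting_space:
  assumes "A \<in> sets X"
  shows "(\<lambda>\<mu>. emeasure \<mu> A) \<in> borel_measurable (counting_space X B)"
  unfolding counting_space_def
  by (rule measurable_Sup1[OF imageI[OF assms]])
     (auto intro!: measurable_vimage_algebra1)

definition restr :: "'a measure \<Rightarrow> 'a set \<Rightarrow> 'a measure" where
  "restr \<mu> A = density \<mu> (indicator A)"

lemma emeasure_restr:
  "A \<in> sets \<mu> \<Longrightarrow> C \<in> sets \<mu> \<Longrightarrow> emeasure (restr \<mu> A) C = emeasure \<mu> (C \<inter> A)"
  by (simp add: restr_def emeasure_density Int_commute flip: indicator_inter_arith)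

definition add_measure :: "'a measure \<Rightarrow> 'a measure \<Rightarrow> 'a measure" where
  "add_measure \<mu> \<nu> = measure_of (space \<mu>) (sets \<mu>) (\<lambda>A. emeasure \<mu> A + emeasure \<nu> A)"

lemma sets_add_measure [simp]: "sets (add_measure \<mu> \<nu>) = sets \<mu>"
  by (simp add: add_measure_def)

lemma emeasure_add_measure:
  assumes "sets \<nu> = sets \<mu>" "A \<in> sets \<mu>"
  shows "emeasure (add_measure \<mu> \<nu>) A = emeasure \<mu> A + emeasure \<nu> A"
  unfolding add_measure_def
proof (rule emeasure_measure_of_sigma)
  show "sigma_algebra (space \<mu>) (sets \<mu>)" by (rule sets.sigma_algebra_axioms)
  show "positive (sets \<mu>) (\<lambda>A. emeasure \<mu> A + emeasure \<nu> A)" by (simp add: positive_def)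
  show "countably_additive (sets \<mu>) (\<lambda>A. emeasure \<mu> A + emeasure \<nu> A)"
    using assms by (auto simp: countably_additive_def suminf_add[symmetric] suminf_emeasure)
qed (use assms in auto)

text \<open>The Poisson distribution with mean \<open>\<infinity>\<close> is the unit mass at \<open>\<infinity>\<close>. The point probabilities are
  written out because \<open>poisson_pmf\<close> requires a strictly positive rate.\<close>

definition poisson_distributed :: "'w measure \<Rightarrow> ('w \<Rightarrow> ennreal) \<Rightarrow> ennreal \<Rightarrow> bool" where
  "poisson_distributed M V m \<longleftrightarrow>
     (if m = \<infinity> then AE \<omega> in M. V \<omega> = \<infinity>
      else \<forall>n::nat. measure M {\<omega>\<in>space M. V \<omega> = of_nat n} =
             exp (- enn2real m) * enn2real m ^ n / fact n)"

definition poisson_process ::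
  "'w measure \<Rightarrow> 'a measure \<Rightarrow> (nat \<Rightarrow> 'a set) \<Rightarrow> 'a measure \<Rightarrow> ('w \<Rightarrow> 'a measure) \<Rightarrow> bool" where
  "poisson_process M X B \<Lambda> \<eta> \<longleftrightarrow>
     \<eta> \<in> M \<rightarrow>\<^sub>M counting_space X B \<and>
     (\<forall>A\<in>sets X. poisson_distributed M (\<lambda>\<omega>. emeasure (\<eta> \<omega>) A) (emeasure \<Lambda> A)) \<and>
     (\<forall>(n::nat) A. range A \<subseteq> sets X \<longrightarrow> disjoint_family_on A {..<n} \<longrightarrow>
        prob_space.indep_vars M (\<lambda>_. borel) (\<lambda>i \<omega>. emeasure (\<eta> \<omega>) (A i)) {..<n})"

definition stopping_set ::
  "'a measure \<Rightarrow> (nat \<Rightarrow> 'a set) \<Rightarrow> ('a measure \<Rightarrow> 'a set) \<Rightarrow> bool" where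
  "stopping_set X B Z \<longleftrightarrow>
     (\<forall>\<mu>\<in>counting_measures X B. Z \<mu> \<in> sets X) \<and>
     Measurable.pred (X \<Otimes>\<^sub>M counting_space X B) (\<lambda>(x, \<mu>). x \<in> Z \<mu>) \<and>
     (\<forall>\<mu>\<in>counting_measures X B. \<forall>\<psi>\<in>counting_measures X B.
        Z \<mu> = Z (add_measure (restr \<mu> (Z \<mu>)) (restr \<psi> (space X - Z \<mu>))))"

definition determined_by ::
  "'a measure \<Rightarrow> (nat \<Rightarrow> 'a set) \<Rightarrow> ('a measure \<Rightarrow> real) \<Rightarrow> ('a measure \<Rightarrow> 'a set) \<Rightarrow> bool" where
  "determined_by X B f Z \<longleftrightarrow> (\<forall>\<mu>\<in>counting_measures X B. f \<mu> = f (restr \<mu> (Z \<mu>)))"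

text \<open>\<open>independent_elements\<close> is \<open>indep_var\<close> for random elements whose values have different types
  (compare \<open>indep_var_eq\<close>).\<close>

definition independent_elements ::
  "'w measure \<Rightarrow> 'b measure \<Rightarrow> ('w \<Rightarrow> 'b) \<Rightarrow> 'c measure \<Rightarrow> ('w \<Rightarrow> 'c) \<Rightarrow> bool" where
  "independent_elements M S U T V \<longleftrightarrow> U \<in> M \<rightarrow>\<^sub>M S \<and> V \<in> M \<rightarrow>\<^sub>M T \<and>
     prob_space.indep_set M {U -` A \<inter> space M | A. A \<in> sets S} {V -` A \<inter> space M | A. A \<in> sets T}"

definition randomized_stopping_set ::
  "'w measure \<Rightarrow> 'a measure \<Rightarrow> (nat \<Rightarrow> 'a set) \<Rightarrow> ('w \<Rightarrow> 'a measure) \<Rightarrow>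
   'y measure \<Rightarrow> ('w \<Rightarrow> 'y) \<Rightarrow> ('y \<Rightarrow> 'a measure \<Rightarrow> 'a set) \<Rightarrow> bool" where
  "randomized_stopping_set M X B \<eta> \<Y> Y Z \<longleftrightarrow>
     independent_elements M (counting_space X B) \<eta> \<Y> Y \<and>
     (AE y in distr M \<Y> Y. stopping_set X B (Z y)) \<and>
     Measurable.pred (counting_space X B \<Otimes>\<^sub>M X \<Otimes>\<^sub>M \<Y>) (\<lambda>(\<mu>, x, y). x \<in> Z y \<mu>)"

definition determined_by_randomized ::
  "'w measure \<Rightarrow> 'a measure \<Rightarrow> (nat \<Rightarrow> 'a set) \<Rightarrow> 'y measure \<Rightarrow> ('w \<Rightarrow> 'y) \<Rightarrow>
   ('a measure \<Rightarrow> real) \<Rightarrow> ('y \<Rightarrow> 'a measure \<Rightarrow> 'a set) \<Rightarrow> bool" where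
  "determined_by_randomized M X B \<Y> Y f Z \<longleftrightarrow>
     (AE y in distr M \<Y> Y. determined_by X B f (Z y))"

text \<open>The supremum is taken in \<open>ennreal\<close>, so that it is \<open>0\<close> when \<open>X\<close> is empty.\<close>

definition max_revealment ::
  "'w measure \<Rightarrow> 'a measure \<Rightarrow> ('w \<Rightarrow> 'a measure) \<Rightarrow> ('w \<Rightarrow> 'y) \<Rightarrow>
   ('y \<Rightarrow> 'a measure \<Rightarrow> 'a set) \<Rightarrow> ennreal" where
  "max_revealment M X \<eta> Y Z = (SUP x\<in>space X. emeasure M {\<omega>\<in>space M. x \<in> Z (Y \<omega>) (\<eta> \<omega>)})"

text \<open>Points of the \<open>k\<close>-fold product are functions in the extensional product over \<open>{..<k}\<close>.\<close>

abbreviation pow_measure :: "'a measure \<Rightarrow> nat \<Rightarrow> (nat \<Rightarrow> 'a) measure" where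
  "pow_measure \<mu> k \<equiv> PiM {..<k} (\<lambda>_. \<mu>)"

text \<open>Factorial measures of a counting measure. If \<open>\<mu>\<close> is the sum of the Dirac masses at
  points \<open>z\<^sub>1, z\<^sub>2, \<dots>\<close> (possibly with repetitions), then \<open>factorial_measure \<mu> k\<close> is the sum of the
  Dirac masses at all \<open>(z\<^bsub>i(1)\<^esub>, \<dots>, z\<^bsub>i(k)\<^esub>)\<close> with pairwise distinct indices. The recursion is the
  usual one: extend a \<open>k\<close>-tuple by a point of \<open>\<mu>\<close> and discard the \<open>k\<close> points already used. The
  truncated difference of extended nonnegative reals is a true difference almost everywhere.\<close>

primrec factorial_measure :: "'a measure \<Rightarrow> nat \<Rightarrow> (nat \<Rightarrow> 'a) measure" where
  "factorial_measure \<mu> 0 = return (pow_measure \<mu> 0) (\<lambda>_. undefined)"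
| "factorial_measure \<mu> (Suc k) =
     measure_of (space (pow_measure \<mu> (Suc k))) (sets (pow_measure \<mu> (Suc k)))
       (\<lambda>C. \<integral>\<^sup>+x. ((\<integral>\<^sup>+z. indicator C (x(k := z)) \<partial>\<mu>) - (\<Sum>j<k. indicator C (x(k := x j))))
              \<partial>factorial_measure \<mu> k)"

text \<open>The integrands for which the integral is defined pathwise: symmetric, bounded, measurable
  and supported by some \<open>(B n)\<^sup>k\<close>.\<close>

definition elementary_integrands ::
  "'a measure \<Rightarrow> (nat \<Rightarrow> 'a set) \<Rightarrow> nat \<Rightarrow> ((nat \<Rightarrow> 'a) \<Rightarrow> real) set" where
  "elementary_integrands X B k =
     {g \<in> borel_measurable (pow_measure X k).
        (\<forall>p. p permutes {..<k} \<longrightarrow> (\<forall>x\<in>space (pow_measure X k). g (x \<circ> p) = g x)) \<and>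
        (\<exists>c. \<forall>x\<in>space (pow_measure X k). \<bar>g x\<bar> \<le> c) \<and>
        (\<exists>n. \<forall>x\<in>space (pow_measure X k). g x \<noteq> 0 \<longrightarrow> x \<in> (\<Pi>\<^sub>E i\<in>{..<k}. B n))}"

text \<open>Integral of \<open>g\<close> against the \<open>k\<close>-fold product of \<open>\<mu> - \<Lambda>\<close>, with all powers of \<open>\<mu>\<close> replaced by
  factorial measures, i.e. the sum over \<open>J \<subseteq> {..<k}\<close> of \<open>(-1)\<^sup>k\<^sup>-\<^sup>|\<^sup>J\<^sup>|\<close> times the integral
  with \<open>\<mu>\<close> in the coordinates in \<open>J\<close> and \<open>\<Lambda>\<close> in the others; by the symmetry of \<open>g\<close> the summand
  depends on \<open>|J|\<close> only. No diffuseness is needed here.\<close>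

definition pathwise_integral ::
  "'a measure \<Rightarrow> nat \<Rightarrow> ((nat \<Rightarrow> 'a) \<Rightarrow> real) \<Rightarrow> 'a measure \<Rightarrow> real" where
  "pathwise_integral \<Lambda> k g \<mu> =
     (\<Sum>j\<le>k. (-1) ^ (k - j) * real (k choose j) *
        (\<integral>x. (\<integral>y. g (merge {..<j} {j..<k} (x, y)) \<partial>PiM {j..<k} (\<lambda>_. \<Lambda>)) \<partial>factorial_measure \<mu> j))"

definition symmetric_L2 :: "'a measure \<Rightarrow> nat \<Rightarrow> ((nat \<Rightarrow> 'a) \<Rightarrow> real) set" where
  "symmetric_L2 \<Lambda> k =
     {u \<in> borel_measurable (pow_measure \<Lambda> k).
        (\<integral>\<^sup>+x. ennreal ((u x)\<^sup>2) \<partial>pow_measure \<Lambda> k) < \<infinity> \<and>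
        (\<forall>p. p permutes {..<k} \<longrightarrow> (AE x in pow_measure \<Lambda> k. u (x \<circ> p) = u x))}"

text \<open>\<open>F\<close> is a version of \<open>I\<^sub>k(u)\<close>. The integral is the extension of the pathwise integral by
  \<open>L\<^sup>2\<close>-continuity (isometry up to the factor \<open>k!\<close>), hence determined up to almost sure equality.\<close>

definition has_wiener_ito_integral ::
  "'w measure \<Rightarrow> 'a measure \<Rightarrow> (nat \<Rightarrow> 'a set) \<Rightarrow> 'a measure \<Rightarrow> ('w \<Rightarrow> 'a measure) \<Rightarrow>
   nat \<Rightarrow> ((nat \<Rightarrow> 'a) \<Rightarrow> real) \<Rightarrow> ('w \<Rightarrow> real) \<Rightarrow> bool" where
  "has_wiener_ito_integral M X B \<Lambda> \<eta> k u F \<longleftrightarrow>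
     u \<in> symmetric_L2 \<Lambda> k \<and> F \<in> borel_measurable M \<and>
     (\<exists>g. (\<forall>n::nat. g n \<in> elementary_integrands X B k) \<and>
        (\<lambda>n. \<integral>\<^sup>+x. ennreal ((g n x - u x)\<^sup>2) \<partial>pow_measure \<Lambda> k) \<longlonglongrightarrow> 0 \<and>
        (\<lambda>n. \<integral>\<^sup>+\<omega>. ennreal ((pathwise_integral \<Lambda> k (g n) (\<eta> \<omega>) - F \<omega>)\<^sup>2) \<partial>M) \<longlonglongrightarrow> 0)"

text \<open>\<open>F = \<Sum>k. I\<^sub>k(u\<^sub>k)\<close> in \<open>L\<^sup>2\<close>, where \<open>J k\<close> is a version of \<open>I\<^sub>k(u\<^sub>k)\<close>.\<close>

definition chaos_expansion ::
  "'w measure \<Rightarrow> 'a measure \<Rightarrow> (nat \<Rightarrow> 'a set) \<Rightarrow> 'a measure \<Rightarrow> ('w \<Rightarrow> 'a measure) \<Rightarrow>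
   ('w \<Rightarrow> real) \<Rightarrow> (nat \<Rightarrow> (nat \<Rightarrow> 'a) \<Rightarrow> real) \<Rightarrow> (nat \<Rightarrow> 'w \<Rightarrow> real) \<Rightarrow> bool" where
  "chaos_expansion M X B \<Lambda> \<eta> F u J \<longleftrightarrow>
     (\<forall>k. has_wiener_ito_integral M X B \<Lambda> \<eta> k (u k) (J k)) \<and>
     (\<lambda>n. \<integral>\<^sup>+\<omega>. ennreal ((F \<omega> - (\<Sum>k\<le>n. J k \<omega>))\<^sup>2) \<partial>M) \<longlonglongrightarrow> 0"

end

theory Submission
  imports Defs
begin

text \<open>The argument is that of Schramm and Steif. Approximate \<open>J k\<close> in \<open>L\<^sup>2\<close> by the multiple integral \<open>I\<close> of
  a bounded symmetric integrand \<open>g\<close> supported in \<open>B p ^ k\<close>. Freezing \<open>Y\<close> and the points outside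
  \<open>B p\<close> leaves a Poisson process with finite intensity, realised as a random finite list, for which
  \<open>I\<close> is a polynomial in the points and \<open>Z\<close> is again a stopping set.

  The points outside \<open>Z\<close> can be replaced by those of an independent copy without changing the law of
  the process, and \<open>f\<close> only depends on the points inside \<open>Z\<close>. Hence the covariance of \<open>f\<close> and \<open>I\<close> does
  not change when \<open>I\<close> is replaced by its conditional expectation given the points inside \<open>Z\<close>. By
  orthogonality of the multiple integrals over the complement of \<open>Z\<close>, the conditional variance of \<open>I\<close>
  is at least \<open>k!\<close> times the integral of \<open>g\<^sup>2\<close> over \<open>k\<close>-tuples of points outside \<open>Z\<close>. So the second moment
  of the conditional expectation is at most \<open>k!\<close> times the mean integral of \<open>g\<^sup>2\<close> over tuples which meet
  \<open>Z\<close>, and by the union bound at most \<open>k \<delta>(Z)\<close> times the second moment of \<open>I\<close>.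
  Cauchy-Schwarz bounds the squared covariance of \<open>f\<close> and \<open>I\<close>; in the limit the covariance of \<open>f\<close> and
  \<open>J k\<close> is the second moment of \<open>J k\<close>.\<close>

section \<open>Lists of points\<close>

text \<open>The obstacle is the conditional expectation given the points inside a random set that
  itself depends on the process. In a window of finite intensity it becomes elementary: the law of
  the points is an explicit series of product measures, and the conditional expectation is an
  integral over an independent copy, so that neither a filtration nor an abstract conditional
  expectation enters. The window also settles integrability, since a bounded integrand yields a
  functional of polynomial growth in the number of points. The intensity may have atoms, so points
  may coincide. Configurations in the window are therefore lists or multisets, and distinctness
  always refers to positions, never to locations. The union bound has to wait until the environment,
  that is \<open>Y\<close> and the points outside the window, has been averaged: the revealment
  bounds the probability of meeting a point only on average. Hence Cauchy-Schwarz is applied twice,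
  first in a frozen environment and then over environments. The factor \<open>k\<close> is the
  number of coordinates of a tuple; the factorials of the isometry cancel.\<close>

definition list_code :: "'a measure \<Rightarrow> 'a list \<Rightarrow> nat \<times> (nat \<Rightarrow> 'a)" where
  "list_code X xs = (length xs, \<lambda>i. if i < length xs then xs ! i else SOME x. x \<in> space X)"

text \<open>The length and the entries, padded to a full sequence by an arbitrary point, determine
  the list. Pulling the sigma-algebra back along this code reduces questions of measurability to
  countably many product spaces.\<close>

definition list_space :: "'a measure \<Rightarrow> 'a list measure" where
  "list_space X =
     vimage_algebra (lists (space X)) (list_code X) (count_space UNIV \<Otimes>\<^sub>M PiM UNIV (\<lambda>_. X))"

lemma space_list_space [simp]: "space (list_space X) = lists (space X)"
  by (simp add: list_space_def)

locale nonempty_space =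
  fixes X :: "'a measure"
  assumes nonempty: "space X \<noteq> {}"
begin

abbreviation "LS \<equiv> list_space X"
abbreviation "SQ \<equiv> PiM (UNIV :: nat set) (\<lambda>_. X)"

lemma some_point: "(SOME x. x \<in> space X) \<in> space X"
  using nonempty by (simp add: some_in_eq)

lemma measurable_list_code: "list_code X \<in> LS \<rightarrow>\<^sub>M count_space UNIV \<Otimes>\<^sub>M SQ"
  unfolding list_space_def
  by (rule measurable_vimage_algebra1)
     (auto simp: list_code_def space_pair_measure space_PiM PiE_def extensional_def some_point
        in_lists_conv_set)

lemma measurable_length [measurable]: "length \<in> LS \<rightarrow>\<^sub>M count_space UNIV"
proof -
  have "(\<lambda>xs. fst (list_code X xs)) \<in> LS \<rightarrow>\<^sub>M count_space UNIV"
    using measurable_list_code by measurable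
  then show ?thesis by (simp add: list_code_def)
qed

lemma measurable_list_fixed_length:
  assumes len: "\<And>\<omega>. \<omega> \<in> space \<Omega> \<Longrightarrow> length (F \<omega>) = n"
    and nth: "\<And>i. i < n \<Longrightarrow> (\<lambda>\<omega>. F \<omega> ! i) \<in> \<Omega> \<rightarrow>\<^sub>M X"
  shows "F \<in> \<Omega> \<rightarrow>\<^sub>M LS"
  unfolding list_space_def
proof (rule measurable_vimage_algebra2)
  show "F \<in> space \<Omega> \<rightarrow> lists (space X)"
    using len measurable_space[OF nth] by (auto simp: in_lists_conv_set in_set_conv_nth)
  have "(\<lambda>\<omega>. (n, \<lambda>i. if i < n then F \<omega> ! i else SOME x. x \<in> space X))
      \<in> \<Omega> \<rightarrow>\<^sub>M count_space UNIV \<Otimes>\<^sub>M SQ"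
  proof (intro measurable_Pair measurable_PiM_single')
    fix i show "(\<lambda>\<omega>. if i < n then F \<omega> ! i else SOME x. x \<in> space X) \<in> \<Omega> \<rightarrow>\<^sub>M X"
      by (cases "i < n") (auto simp: some_point nth)
    show "(\<lambda>\<omega> i. if i < n then F \<omega> ! i else SOME x. x \<in> space X) \<in> space \<Omega> \<rightarrow> UNIV \<rightarrow>\<^sub>E space X"
      using some_point measurable_space[OF nth] by auto
  qed simp
  then show "(\<lambda>\<omega>. list_code X (F \<omega>)) \<in> \<Omega> \<rightarrow>\<^sub>M count_space UNIV \<Otimes>\<^sub>M SQ"
    by (subst measurable_cong) (auto simp: list_code_def len)
qed

text \<open>A list of length \<open>n\<close> is an initial segment of its coded sequence, and there
  are only countably many lengths, so each length may be tested separately.\<close>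

lemma measurable_from_list:
  assumes "\<And>n. (\<lambda>x. F (map x [0..<n])) \<in> SQ \<rightarrow>\<^sub>M K"
  shows "F \<in> LS \<rightarrow>\<^sub>M K"
proof -
  have "(\<lambda>xs. (\<lambda>x. F (map x [0..<fst (list_code X xs)])) (snd (list_code X xs))) \<in> LS \<rightarrow>\<^sub>M K"
    by (rule measurable_compose_countable[where f="\<lambda>n xs. F (map (snd (list_code X xs)) [0..<n])"])
       (intro measurable_compose[OF _ assms] measurable_compose[OF measurable_list_code] measurable_snd
         measurable_fst)+
  moreover have "map (snd (list_code X xs)) [0..<fst (list_code X xs)] = xs" for xs
    by (auto simp: list_code_def intro: nth_equalityI)
  ultimately show ?thesis by simp
qed

lemma measurable_from_pair_list:
  assumes "\<And>n. (\<lambda>(\<omega>, x). F \<omega> (map x [0..<n])) \<in> \<Omega> \<Otimes>\<^sub>M SQ \<rightarrow>\<^sub>M K"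
  shows "(\<lambda>(\<omega>, xs). F \<omega> xs) \<in> \<Omega> \<Otimes>\<^sub>M LS \<rightarrow>\<^sub>M K"
proof -
  have c: "(\<lambda>p. list_code X (snd p)) \<in> \<Omega> \<Otimes>\<^sub>M LS \<rightarrow>\<^sub>M count_space UNIV \<Otimes>\<^sub>M SQ"
    using measurable_list_code by measurable
  have "(\<lambda>p. F (fst p) (map (snd (list_code X (snd p))) [0..<fst (list_code X (snd p))]))
      \<in> \<Omega> \<Otimes>\<^sub>M LS \<rightarrow>\<^sub>M K"
  proof (rule measurable_compose_countable[where
        f="\<lambda>n p. F (fst p) (map (snd (list_code X (snd p))) [0..<n])"])
    show "(\<lambda>p. fst (list_code X (snd p))) \<in> \<Omega> \<Otimes>\<^sub>M LS \<rightarrow>\<^sub>M count_space UNIV"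
      using c by measurable
    fix n
    have "(\<lambda>p. (fst p, snd (list_code X (snd p)))) \<in> \<Omega> \<Otimes>\<^sub>M LS \<rightarrow>\<^sub>M \<Omega> \<Otimes>\<^sub>M SQ"
      using c by measurable
    from measurable_compose[OF this assms[of n]]
    show "(\<lambda>p. F (fst p) (map (snd (list_code X (snd p))) [0..<n])) \<in> \<Omega> \<Otimes>\<^sub>M LS \<rightarrow>\<^sub>M K"
      by simp
  qed
  moreover have "map (snd (list_code X xs)) [0..<fst (list_code X xs)] = xs" for xs
    by (auto simp: list_code_def intro: nth_equalityI)
  ultimately show ?thesis by (simp add: case_prod_beta)
qed

lemma measurable_Cons [measurable]:
  assumes [measurable]: "f \<in> \<Omega> \<rightarrow>\<^sub>M X" "g \<in> \<Omega> \<rightarrow>\<^sub>M LS"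
  shows "(\<lambda>\<omega>. f \<omega> # g \<omega>) \<in> \<Omega> \<rightarrow>\<^sub>M LS"
proof -
  have "(\<lambda>(x, xs). x # xs) \<in> X \<Otimes>\<^sub>M LS \<rightarrow>\<^sub>M LS"
  proof (rule measurable_from_pair_list)
    fix n show "(\<lambda>(y, x). y # map x [0..<n]) \<in> X \<Otimes>\<^sub>M SQ \<rightarrow>\<^sub>M LS"
    proof (rule measurable_list_fixed_length[where n="Suc n"])
      fix i assume "i < Suc n"
      then show "(\<lambda>p. (case p of (y, x) \<Rightarrow> y # map x [0..<n]) ! i) \<in> X \<Otimes>\<^sub>M SQ \<rightarrow>\<^sub>M X"
        by (cases i) (auto simp: case_prod_beta)
    qed auto
  qed
  from measurable_compose[OF measurable_Pair[OF assms] this] show ?thesis by simp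
qed

lemma measurable_append [measurable]:
  assumes [measurable]: "f \<in> \<Omega> \<rightarrow>\<^sub>M LS" "g \<in> \<Omega> \<rightarrow>\<^sub>M LS"
  shows "(\<lambda>\<omega>. f \<omega> @ g \<omega>) \<in> \<Omega> \<rightarrow>\<^sub>M LS"
proof -
  have "(\<lambda>(ys, xs). xs @ ys) \<in> LS \<Otimes>\<^sub>M LS \<rightarrow>\<^sub>M LS"
  proof (rule measurable_from_pair_list)
    fix n show "(\<lambda>(ys, x). map x [0..<n] @ ys) \<in> LS \<Otimes>\<^sub>M SQ \<rightarrow>\<^sub>M LS"
      unfolding case_prod_beta
    proof (induction n)
      case (Suc n)
      have "(\<lambda>p. (snd p n # fst p, snd p)) \<in> LS \<Otimes>\<^sub>M SQ \<rightarrow>\<^sub>M LS \<Otimes>\<^sub>M SQ"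
        by measurable
      from measurable_compose[OF this Suc] show ?case by simp
    qed simp
  qed
  from measurable_compose[OF measurable_Pair[OF assms(2,1)] this] show ?thesis by simp
qed

lemma measurable_filter [measurable]:
  assumes P: "Measurable.pred (\<Omega> \<Otimes>\<^sub>M X) (\<lambda>(\<omega>, x). P \<omega> x)"
    and [measurable]: "g \<in> \<Omega> \<rightarrow>\<^sub>M LS"
  shows "(\<lambda>\<omega>. filter (P \<omega>) (g \<omega>)) \<in> \<Omega> \<rightarrow>\<^sub>M LS"
proof -
  have [measurable]: "Measurable.pred (\<Omega> \<Otimes>\<^sub>M X) (\<lambda>p. P (fst p) (snd p))"
    using P by (simp add: case_prod_beta)
  have "(\<lambda>(\<omega>, xs). filter (P \<omega>) xs) \<in> \<Omega> \<Otimes>\<^sub>M LS \<rightarrow>\<^sub>M LS"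
  proof (rule measurable_from_pair_list)
    fix n show "(\<lambda>(\<omega>, x). filter (P \<omega>) (map x [0..<n])) \<in> \<Omega> \<Otimes>\<^sub>M SQ \<rightarrow>\<^sub>M LS"
      unfolding case_prod_beta
    proof (induction n)
      case (Suc n)
      have [measurable]: "Measurable.pred (\<Omega> \<Otimes>\<^sub>M SQ) (\<lambda>p. P (fst p) (snd p n))"
        by (rule measurable_compose[of "\<lambda>p. (fst p, snd p n)" _ "\<Omega> \<Otimes>\<^sub>M X" "\<lambda>p. P (fst p) (snd p)", simplified])
           measurable
      have "(\<lambda>p. filter (P (fst p)) (map (snd p) [0..<n]) @ (if P (fst p) (snd p n) then [snd p n] else []))
        \<in> \<Omega> \<Otimes>\<^sub>M SQ \<rightarrow>\<^sub>M LS"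
        using Suc by measurable
      then show ?case by (rule back_subst[of "\<lambda>f. f \<in> \<Omega> \<Otimes>\<^sub>M SQ \<rightarrow>\<^sub>M LS"]) auto
    qed simp
  qed
  from measurable_compose[OF measurable_Pair[OF measurable_ident_sets[OF refl] assms(2)] this]
  show ?thesis by simp
qed

text \<open>Filtering keeps the length exactly when all entries pass, and lengths are
  measurable.\<close>

lemma measurable_all_list [measurable]:
  assumes P: "Measurable.pred (\<Omega> \<Otimes>\<^sub>M X) (\<lambda>(\<omega>, x). P \<omega> x)"
    and [measurable]: "g \<in> \<Omega> \<rightarrow>\<^sub>M LS"
  shows "Measurable.pred \<Omega> (\<lambda>\<omega>. \<forall>x\<in>set (g \<omega>). P \<omega> x)"
proof -
  have [measurable]: "(\<lambda>\<omega>. length (filter (P \<omega>) (g \<omega>))) \<in> \<Omega> \<rightarrow>\<^sub>M count_space UNIV"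
    by (rule measurable_compose[OF measurable_filter[OF assms] measurable_length])
  have "Measurable.pred \<Omega> (\<lambda>\<omega>. length (filter (P \<omega>) (g \<omega>)) = length (g \<omega>))"
    by (rule measurable_compose_countable[where f="\<lambda>n \<omega>. length (filter (P \<omega>) (g \<omega>)) = n",
          OF _ measurable_compose[OF assms(2) measurable_length]]) measurable
  moreover have "length (filter (P \<omega>) (g \<omega>)) = length (g \<omega>) \<longleftrightarrow> (\<forall>x\<in>set (g \<omega>). P \<omega> x)" for \<omega>
    by (metis filter_id_conv length_filter_less less_irrefl)
  ultimately show ?thesis by simp
qed

lemma measurable_length_filter:
  assumes "A \<in> sets X"
  shows "(\<lambda>xs. length (filter (\<lambda>x. x \<in> A) xs)) \<in> LS \<rightarrow>\<^sub>M count_space UNIV"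
  by (rule measurable_compose[OF _ measurable_length], rule measurable_filter) (use assms in auto)

text \<open>Deleting a value from the multiset amounts to deleting the position at which it was
  read, and this is a fixed coordinate map. Positions are compared instead of points, which may
  coincide.\<close>

lemma sum_mset_map_upt:
  "(\<Sum>z\<in>#mset (map x [0..<n]). \<phi> z (mset (map x [0..<n]) - {#z#})) =
   (\<Sum>i<n. \<phi> (x i) (mset (map x (remove1 i [0..<n]))))"
proof -
  have "mset (map x [0..<n]) - {#x i#} = mset (map x (remove1 i [0..<n]))" if "i < n" for i
    using that by (simp add: image_mset_Diff)
  then have "(\<Sum>i<n. \<phi> (x i) (mset (map x (remove1 i [0..<n])))) =
      (\<Sum>i<n. \<phi> (x i) (mset (map x [0..<n]) - {#x i#}))"
    by simp
  also have "\<dots> = (\<Sum>i\<in>#mset [0..<n]. \<phi> (x i) (mset (map x [0..<n]) - {#x i#}))"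
    by (simp add: sum_unfold_sum_mset atLeast0LessThan flip: mset_set_upto_eq_mset_upto)
  finally show ?thesis by (simp add: multiset.map_comp comp_def)
qed

lemma measurable_sum_delete:
  fixes \<phi> :: "'c \<Rightarrow> 'a \<Rightarrow> 'a multiset \<Rightarrow> 'b :: {second_countable_topology, topological_comm_monoid_add}"
  assumes \<phi>: "(\<lambda>(\<omega>, x, xs). \<phi> \<omega> x (mset xs)) \<in> borel_measurable (\<Omega> \<Otimes>\<^sub>M X \<Otimes>\<^sub>M LS)"
  shows "(\<lambda>(\<omega>, xs). \<Sum>z\<in>#mset xs. \<phi> \<omega> z (mset xs - {#z#})) \<in> borel_measurable (\<Omega> \<Otimes>\<^sub>M LS)"
proof (rule measurable_from_pair_list)
  fix n
  have *: "(\<lambda>p. \<phi> (fst p) (snd p i) (mset (map (snd p) (remove1 i [0..<n])))) \<in> borel_measurable (\<Omega> \<Otimes>\<^sub>M SQ)"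
    for i
  proof -
    have [measurable]: "(\<lambda>p. map (snd p) (remove1 i [0..<n])) \<in> \<Omega> \<Otimes>\<^sub>M SQ \<rightarrow>\<^sub>M LS"
      by (rule measurable_list_fixed_length[where n="length (remove1 i [0..<n])"]) auto
    have "(\<lambda>p. (fst p, snd p i, map (snd p) (remove1 i [0..<n]))) \<in> \<Omega> \<Otimes>\<^sub>M SQ \<rightarrow>\<^sub>M \<Omega> \<Otimes>\<^sub>M X \<Otimes>\<^sub>M LS"
      by measurable
    from measurable_compose[OF this \<phi>] show ?thesis by simp
  qed
  show "(\<lambda>(\<omega>, x). \<Sum>z\<in>#mset (map x [0..<n]). \<phi> \<omega> z (mset (map x [0..<n]) - {#z#}))
      \<in> borel_measurable (\<Omega> \<Otimes>\<^sub>M SQ)"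
    unfolding sum_mset_map_upt case_prod_beta by (intro borel_measurable_sum *)
qed

end

lemma ennreal_suminf_triangle:
  fixes f :: "nat \<Rightarrow> nat \<Rightarrow> ennreal"
  shows "(\<Sum>n. \<Sum>m\<le>n. f m (n - m)) = (\<Sum>m. \<Sum>l. f m l)"
proof -
  define h where "h m n = (if m \<le> n then f m (n - m) else 0)" for m n
  have "(\<Sum>m\<le>n. f m (n - m)) = (\<Sum>m. h m n)" for n
    by (subst suminf_finite[of "{..n}"]) (auto simp: h_def)
  then have "(\<Sum>n. \<Sum>m\<le>n. f m (n - m)) = (\<Sum>n. \<Sum>m. h m n)" by simp
  also have "\<dots> = (\<integral>\<^sup>+n. (\<Sum>m. h m n) \<partial>count_space UNIV)"
    by (simp add: nn_integral_count_space_nat)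
  also have "\<dots> = (\<Sum>m. \<integral>\<^sup>+n. h m n \<partial>count_space UNIV)"
    by (rule nn_integral_suminf) auto
  also have "\<dots> = (\<Sum>m. \<Sum>n. h m n)"
    by (simp add: nn_integral_count_space_nat)
  also have "\<dots> = (\<Sum>m. \<Sum>l. f m l)"
  proof (rule suminf_cong)
    show "(\<Sum>n. h m n) = (\<Sum>l. f m l)" for m
      by (subst suminf_offset[where i=m]) (auto simp: h_def)
  qed
  finally show ?thesis .
qed

section \<open>Splitting a finite Poisson process\<close>

text \<open>The 2^n ways to colour \<open>n\<close> entries with two colours, keeping the order.
  Equal values at different positions are coloured independently of each other.\<close>

primrec splits :: "'a list \<Rightarrow> ('a list \<times> 'a list) list" where
  "splits [] = [([], [])]"
| "splits (x # xs) = map (\<lambda>(as, bs). (x # as, bs)) (splits xs) @ map (\<lambda>(as, bs). (as, x # bs)) (splits xs)"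

definition sum_splits :: "('a list \<Rightarrow> 'a list \<Rightarrow> ennreal) \<Rightarrow> 'a list \<Rightarrow> ennreal" where
  "sum_splits G xs = (\<Sum>(as, bs)\<leftarrow>splits xs. G as bs)"

lemma sum_splits_Nil [simp]: "sum_splits G [] = G [] []"
  by (simp add: sum_splits_def)

lemma sum_splits_Cons [simp]:
  "sum_splits G (x # xs) = sum_splits (\<lambda>as bs. G (x # as) bs) xs + sum_splits (\<lambda>as bs. G as (x # bs)) xs"
  by (auto simp: sum_splits_def comp_def
      intro!: arg_cong2[where f="(+)"] arg_cong[where f=sum_list] map_cong)

lemma mset_splits: "(as, bs) \<in> set (splits xs) \<Longrightarrow> mset xs = mset as + mset bs"
  by (induction xs arbitrary: as bs) auto

lemma sum_splits_cong:
  assumes "\<And>as bs. mset xs = mset as + mset bs \<Longrightarrow> G as bs = G' as bs"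
  shows "sum_splits G xs = sum_splits G' xs"
  unfolding sum_splits_def
  by (intro arg_cong[where f=sum_list] map_cong refl) (auto dest: mset_splits intro!: assms)

lemma sum_splits_const_0 [simp]: "sum_splits (\<lambda>_ _. 0) xs = 0"
  by (induction xs) auto

text \<open>Exactly one splitting passes the test, namely the one that sends the entries in
  \<open>C\<close> to the left and all others to the right.\<close>

lemma sum_splits_filter:
  "sum_splits (\<lambda>as bs. H as bs * of_bool (set as \<subseteq> C \<and> set bs \<inter> C = {})) xs =
   H (filter (\<lambda>x. x \<in> C) xs) (filter (\<lambda>x. x \<notin> C) xs)"
proof (induction xs arbitrary: H)
  case (Cons x xs)
  show ?case
  proof (cases "x \<in> C")
    case True
    then show ?thesis using Cons[of "\<lambda>as. H (x # as)"] by simp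
  next
    case False
    then show ?thesis using Cons[of "\<lambda>as bs. H as (x # bs)"] by simp
  qed
qed simp

section \<open>Powers of a finite intensity and its Poisson process as a random list\<close>

locale finite_intensity = nonempty_space X + finite_measure L
  for X L :: "'a measure" +
  assumes sets_L [measurable_cong]: "sets L = sets X"
begin

lemma space_L: "space L = space X"
  using sets_L by (rule sets_eq_imp_space_eq)

abbreviation "\<tau> \<equiv> measure L (space L)"

text \<open>The \<open>n\<close>-th power of \<open>L\<close>, transported to lists. It is left
  unnormalised, with total mass \<tau>^n, which covers \<tau> = 0 without a separate case.\<close>

primrec points :: "nat \<Rightarrow> 'a list measure" where
  "points 0 = return LS []"
| "points (Suc n) = distr (L \<Otimes>\<^sub>M points n) LS (\<lambda>(x, xs). x # xs)"

lemma sets_points [measurable_cong, simp]: "sets (points n) = sets LS"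
  by (induction n) auto

lemma space_points [simp]: "space (points n) = lists (space X)"
  using sets_eq_imp_space_eq[OF sets_points] by simp

lemma finite_measure_points: "finite_measure (points n)"
proof (induction n)
  case 0
  show ?case by (auto intro!: prob_space.finite_measure prob_space_return)
next
  case (Suc n)
  have "finite_measure (L \<Otimes>\<^sub>M points n)"
    by (intro finite_measure_pair_measure Suc finite_measure_axioms)
  then show ?case
    by (simp add: finite_measure.finite_measure_distr)
qed

lemma sigma_finite_points: "sigma_finite_measure (points n)"
  using finite_measure_points finite_measure.axioms(1) by blast

lemma nn_integral_points_0:
  "f \<in> borel_measurable LS \<Longrightarrow> (\<integral>\<^sup>+xs. f xs \<partial>points 0) = f []"
  by (simp add: nn_integral_return)

lemma nn_integral_points_Suc:
  assumes [measurable]: "f \<in> borel_measurable LS"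
  shows "(\<integral>\<^sup>+xs. f xs \<partial>points (Suc n)) = (\<integral>\<^sup>+x. \<integral>\<^sup>+xs. f (x # xs) \<partial>points n \<partial>L)"
proof -
  interpret P: sigma_finite_measure "points n" by (rule sigma_finite_points)
  show ?thesis
    by (simp add: nn_integral_distr case_prod_beta) (subst P.nn_integral_fst[symmetric], auto)
qed

lemma emeasure_points_lists_in:
  assumes W [measurable]: "W \<in> sets X"
  shows "emeasure (points n) {xs\<in>space LS. set xs \<subseteq> W} = emeasure L W ^ n"
proof (induction n)
  case 0
  have [measurable]: "Measurable.pred LS (\<lambda>xs. \<forall>x\<in>set xs. x \<in> W)" by measurable
  have "{xs\<in>space LS. set xs \<subseteq> W} = {xs\<in>space LS. \<forall>x\<in>set xs. x \<in> W}" by auto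
  also have "\<dots> \<in> sets LS" by measurable
  finally show ?case by (simp add: emeasure_return)
next
  case (Suc n)
  have [measurable]: "Measurable.pred LS (\<lambda>xs. \<forall>x\<in>set xs. x \<in> W)" by measurable
  have eq: "{xs\<in>space LS. set xs \<subseteq> W} = {xs\<in>space LS. \<forall>x\<in>set xs. x \<in> W}" by auto
  have S: "{xs\<in>space LS. set xs \<subseteq> W} \<in> sets LS" unfolding eq by measurable
  note [measurable] = S S[simplified]
  have "emeasure (points (Suc n)) {xs\<in>space LS. set xs \<subseteq> W} =
      (\<integral>\<^sup>+xs. indicator {xs\<in>space LS. set xs \<subseteq> W} xs \<partial>points (Suc n))"
    by (rule nn_integral_indicator[symmetric]) (simp only: sets_points, measurable)
  also have "\<dots> = (\<integral>\<^sup>+x. \<integral>\<^sup>+xs. indicator W x * indicator {xs\<in>space LS. set xs \<subseteq> W} xs \<partial>points n \<partial>L)"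
    by (subst nn_integral_points_Suc)
       (auto intro!: nn_integral_cong simp: indicator_def space_L sets.sets_into_space[OF W, THEN subsetD])
  also have "\<dots> = emeasure L W ^ Suc n"
    by (simp add: nn_integral_cmult nn_integral_multc Suc[simplified] mult.commute)
  finally show ?case .
qed

text \<open>A Poisson number of points, with weights exp(-\<tau>) \<tau>^n / n!, which are
  independent with law L/\<tau> given their number; the powers of \<tau> cancel.\<close>

definition poisson_lists :: "'a list measure" where
  "poisson_lists = measure_of (space LS) (sets LS)
     (\<lambda>A. \<Sum>n. ennreal (exp (- \<tau>) / fact n) * emeasure (points n) A)"

lemma sets_poisson_lists [measurable_cong, simp]: "sets poisson_lists = sets LS"
  unfolding poisson_lists_def by (rule sets.sets_measure_of_eq)

lemma space_poisson_lists [simp]: "space poisson_lists = lists (space X)"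
  using sets_eq_imp_space_eq[OF sets_poisson_lists] by simp

lemma emeasure_poisson_lists:
  assumes "A \<in> sets LS"
  shows "emeasure poisson_lists A = (\<Sum>n. ennreal (exp (- \<tau>) / fact n) * emeasure (points n) A)"
proof -
  have "countably_additive (sets LS) (\<lambda>A. \<Sum>n. ennreal (exp (- \<tau>) / fact n) * emeasure (points n) A)"
  proof (rule countably_additiveI)
    fix A :: "nat \<Rightarrow> 'a list set"
    assume A: "range A \<subseteq> sets LS" "disjoint_family A" "\<Union> (range A) \<in> sets LS"
    have "(\<Sum>i. \<Sum>n. ennreal (exp (- \<tau>) / fact n) * emeasure (points n) (A i)) =
        (\<integral>\<^sup>+n. (\<Sum>i. ennreal (exp (- \<tau>) / fact n) * emeasure (points n) (A i)) \<partial>count_space UNIV)"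
      by (subst nn_integral_suminf) (auto simp: nn_integral_count_space_nat)
    also have "\<dots> = (\<Sum>n. ennreal (exp (- \<tau>) / fact n) * emeasure (points n) (\<Union> (range A)))"
      using A by (simp add: nn_integral_count_space_nat suminf_emeasure)
    finally show "(\<Sum>i. \<Sum>n. ennreal (exp (- \<tau>) / fact n) * emeasure (points n) (A i)) =
        (\<Sum>n. ennreal (exp (- \<tau>) / fact n) * emeasure (points n) (\<Union> (range A)))" .
  qed
  moreover have "poisson_lists = measure_of (space LS) (sets LS)
     (\<lambda>A. \<Sum>n. ennreal (exp (- \<tau>) / fact n) * emeasure (points n) A)"
    by (rule poisson_lists_def)
  ultimately show ?thesis
    using assms sets.sigma_algebra_axioms[of LS]
    by (auto intro!: emeasure_measure_of_sigma simp: positive_def)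
qed

lemma nn_integral_poisson_lists:
  assumes "f \<in> borel_measurable LS"
  shows "(\<integral>\<^sup>+xs. f xs \<partial>poisson_lists) = (\<Sum>n. ennreal (exp (- \<tau>) / fact n) * (\<integral>\<^sup>+xs. f xs \<partial>points n))"
  using assms
proof (induction rule: borel_measurable_induct)
  case (cong f g)
  have "(\<integral>\<^sup>+xs. f xs \<partial>poisson_lists) = (\<integral>\<^sup>+xs. g xs \<partial>poisson_lists)"
    using cong(3) by (auto intro!: nn_integral_cong)
  moreover have "(\<integral>\<^sup>+xs. f xs \<partial>points n) = (\<integral>\<^sup>+xs. g xs \<partial>points n)" for n
    using cong(3) by (auto intro!: nn_integral_cong)
  ultimately show ?case using cong(4) by simp
next
  case (set A)
  then show ?case by (simp add: emeasure_poisson_lists)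
next
  case (mult u c)
  then show ?case by (simp add: nn_integral_cmult mult.left_commute)
next
  case (add u v)
  then show ?case by (simp add: nn_integral_add distrib_left suminf_add)
next
  case (seq U)
  have "(\<integral>\<^sup>+xs. (SUP i. U i) xs \<partial>poisson_lists) = (SUP i. \<integral>\<^sup>+xs. U i xs \<partial>poisson_lists)"
    using seq by (simp add: nn_integral_monotone_convergence_SUP image_comp)
  also have "\<dots> = (SUP i. \<Sum>n. ennreal (exp (- \<tau>) / fact n) * (\<integral>\<^sup>+xs. U i xs \<partial>points n))"
    using seq by simp
  also have "\<dots> = (\<Sum>n. SUP i. ennreal (exp (- \<tau>) / fact n) * (\<integral>\<^sup>+xs. U i xs \<partial>points n))"
  proof (rule ennreal_suminf_SUP_eq[symmetric])
    show "incseq (\<lambda>i. ennreal (exp (- \<tau>) / fact n) * (\<integral>\<^sup>+xs. U i xs \<partial>points n))" for n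
      using le_funD[OF incseq_SucD[OF \<open>incseq U\<close>]]
      by (auto intro!: incseq_SucI mult_left_mono nn_integral_mono)
  qed
  also have "\<dots> = (\<Sum>n. ennreal (exp (- \<tau>) / fact n) * (\<integral>\<^sup>+xs. (SUP i. U i) xs \<partial>points n))"
    using seq by (simp add: nn_integral_monotone_convergence_SUP SUP_mult_left_ennreal image_comp)
  finally show ?case .
qed

lemma suminf_exp: 
  assumes "0 \<le> a" "0 \<le> b"
  shows "(\<Sum>n. ennreal (a / fact n) * ennreal b ^ n) = ennreal (a * exp b)"
proof -
  have "(\<lambda>n. a * (b ^ n / fact n)) sums (a * exp b)"
    using exp_converges[of b] by (intro sums_mult) (simp add: field_simps)
  then have "(\<lambda>n. ennreal (a * (b ^ n / fact n))) sums ennreal (a * exp b)"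
    using assms by (subst sums_ennreal) auto
  then show ?thesis
    using assms by (simp add: sums_iff ennreal_power ennreal_mult[symmetric])
qed

lemma prob_space_poisson_lists: "prob_space poisson_lists"
proof
  have "emeasure poisson_lists (space poisson_lists) =
      (\<Sum>n. ennreal (exp (- \<tau>) / fact n) * emeasure (points n) (lists (space X)))"
    using sets.top[of LS] by (simp add: emeasure_poisson_lists)
  also have "\<dots> = (\<Sum>n. ennreal (exp (- \<tau>) / fact n) * ennreal \<tau> ^ n)"
  proof -
    have "{xs\<in>space LS. set xs \<subseteq> space X} = lists (space X)"
      by auto
    then show ?thesis
      using emeasure_points_lists_in[of "space X"] by (simp add: emeasure_eq_measure space_L)
  qed
  also have "\<dots> = 1"
    by (subst suminf_exp) (auto simp: exp_minus)
  finally show "emeasure poisson_lists (space poisson_lists) = 1" .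
qed

sublocale PL: prob_space poisson_lists
  by (rule prob_space_poisson_lists)

lemma measurable_sum_splits:
  assumes G: "(\<lambda>(as, bs). G as bs) \<in> borel_measurable (LS \<Otimes>\<^sub>M LS)"
  shows "sum_splits G \<in> borel_measurable LS"
proof (rule measurable_from_list)
  fix n
  \<comment> \<open>The prefixes \<open>a\<close> and \<open>b\<close> collect the entries that are
    already assigned, so that the induction runs over the remaining indices.\<close>
  have *: "(\<lambda>x. sum_splits (\<lambda>as bs. G (a x @ as) (b x @ bs)) (map x is)) \<in> borel_measurable SQ"
    if "a \<in> SQ \<rightarrow>\<^sub>M LS" "b \<in> SQ \<rightarrow>\<^sub>M LS" for a b "is"
    using that
  proof (induction "is" arbitrary: a b)
    case Nil
    then show ?case
      using measurable_compose[OF measurable_Pair G, of a SQ b] by simp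
  next
    case (Cons i "is")
    note [measurable] = Cons.prems
    have "(\<lambda>x. a x @ [x i]) \<in> SQ \<rightarrow>\<^sub>M LS" "(\<lambda>x. b x @ [x i]) \<in> SQ \<rightarrow>\<^sub>M LS"
      by measurable
    from Cons.IH[OF this(1) Cons.prems(2)] Cons.IH[OF Cons.prems(1) this(2)]
    show ?case by simp
  qed
  show "(\<lambda>x. sum_splits G (map x [0..<n])) \<in> borel_measurable SQ"
    using *[of "\<lambda>_. []" "\<lambda>_. []"] by simp
qed

text \<open>There are \<open>n choose m\<close> splittings with \<open>m\<close> entries on the
  left, and all of them have the same integral, since the entries are exchangeable under a power of
  \<open>L\<close>. The induction step is Pascal's rule.\<close>

lemma nn_integral_points_sum_splits:
  assumes "(\<lambda>(as, bs). G as bs) \<in> borel_measurable (LS \<Otimes>\<^sub>M LS)"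
  shows "(\<integral>\<^sup>+xs. sum_splits G xs \<partial>points n) =
    (\<Sum>m\<le>n. of_nat (n choose m) * (\<integral>\<^sup>+as. \<integral>\<^sup>+bs. G as bs \<partial>points (n - m) \<partial>points m))"
  using assms
proof (induction n arbitrary: G)
  case 0
  then have "(\<lambda>p. case p of (as, bs) \<Rightarrow> G as bs) \<in> borel_measurable (LS \<Otimes>\<^sub>M LS)" by simp
  from measurable_compose[OF measurable_Pair1'[of "[]" LS LS] this]
  have "(\<lambda>bs. G [] bs) \<in> borel_measurable LS" by simp
  moreover have "(\<lambda>as. \<integral>\<^sup>+bs. G as bs \<partial>points 0) \<in> borel_measurable LS"
    using 0
    by (intro sigma_finite_measure.borel_measurable_nn_integral[OF sigma_finite_points])
       (subst measurable_cong_sets[OF sets_pair_measure_cong[OF refl sets_points] refl])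
  ultimately show ?case
    using 0 measurable_sum_splits[OF 0]
    by (simp del: points.simps add: nn_integral_points_0)
next
  case (Suc n)
  have [measurable]: "(\<lambda>p. G (fst p) (snd p)) \<in> borel_measurable (LS \<Otimes>\<^sub>M LS)"
    using Suc.prems by (simp add: case_prod_beta)
  have [measurable]: "(\<lambda>\<omega>. G (f \<omega>) (g \<omega>)) \<in> borel_measurable \<Omega>"
    if [measurable]: "f \<in> \<Omega> \<rightarrow>\<^sub>M LS" "g \<in> \<Omega> \<rightarrow>\<^sub>M LS" for f g and \<Omega> :: "'z measure"
    using measurable_compose[OF measurable_Pair[OF that] Suc.prems] by simp
  interpret P: sigma_finite_measure "points m" for m by (rule sigma_finite_points)
  define A where "A m l = (\<integral>\<^sup>+as. \<integral>\<^sup>+bs. G as bs \<partial>points l \<partial>points m)" for m l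
  have A1: "(\<integral>\<^sup>+x. \<integral>\<^sup>+as. \<integral>\<^sup>+bs. G (x # as) bs \<partial>points l \<partial>points m \<partial>L) = A (Suc m) l" for m l
    unfolding A_def by (subst nn_integral_points_Suc) auto
  have A2: "(\<integral>\<^sup>+x. \<integral>\<^sup>+as. \<integral>\<^sup>+bs. G as (x # bs) \<partial>points l \<partial>points m \<partial>L) = A m (Suc l)" for m l
  proof -
    interpret PS: pair_sigma_finite L "points m" ..
    have "A m (Suc l) = (\<integral>\<^sup>+as. \<integral>\<^sup>+x. \<integral>\<^sup>+bs. G as (x # bs) \<partial>points l \<partial>L \<partial>points m)"
      unfolding A_def by (intro nn_integral_cong nn_integral_points_Suc) auto
    also have "\<dots> = (\<integral>\<^sup>+x. \<integral>\<^sup>+as. \<integral>\<^sup>+bs. G as (x # bs) \<partial>points l \<partial>points m \<partial>L)"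
      by (rule PS.Fubini') (simp add: case_prod_beta)
    finally show ?thesis by simp
  qed
  have x: "x \<in> space L \<Longrightarrow> (\<lambda>_. x) \<in> \<Omega> \<rightarrow>\<^sub>M X" for x and \<Omega> :: "'z measure"
    by (simp add: space_L)
  have [measurable]: "sum_splits G \<in> borel_measurable LS"
    by (rule measurable_sum_splits[OF Suc.prems])
  have "(\<integral>\<^sup>+xs. sum_splits G xs \<partial>points (Suc n)) =
      (\<integral>\<^sup>+x. \<integral>\<^sup>+xs. sum_splits (\<lambda>as bs. G (x # as) bs) xs + sum_splits (\<lambda>as bs. G as (x # bs)) xs \<partial>points n \<partial>L)"
    by (subst nn_integral_points_Suc) auto
  also have "\<dots> = (\<integral>\<^sup>+x. (\<Sum>m\<le>n. of_nat (n choose m) *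
       ((\<integral>\<^sup>+as. \<integral>\<^sup>+bs. G (x # as) bs \<partial>points (n - m) \<partial>points m) +
        (\<integral>\<^sup>+as. \<integral>\<^sup>+bs. G as (x # bs) \<partial>points (n - m) \<partial>points m))) \<partial>L)"
  proof (rule nn_integral_cong)
    fix x assume "x \<in> space L"
    note [measurable] = x[OF this]
    have m: "(\<lambda>(as, bs). G (x # as) bs) \<in> borel_measurable (LS \<Otimes>\<^sub>M LS)"
      "(\<lambda>(as, bs). G as (x # bs)) \<in> borel_measurable (LS \<Otimes>\<^sub>M LS)"
      by (auto simp: case_prod_beta)
    note [measurable] = m[THEN measurable_sum_splits]
    show "(\<integral>\<^sup>+xs. sum_splits (\<lambda>as bs. G (x # as) bs) xs + sum_splits (\<lambda>as bs. G as (x # bs)) xs \<partial>points n) =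
      (\<Sum>m\<le>n. of_nat (n choose m) *
       ((\<integral>\<^sup>+as. \<integral>\<^sup>+bs. G (x # as) bs \<partial>points (n - m) \<partial>points m) +
        (\<integral>\<^sup>+as. \<integral>\<^sup>+bs. G as (x # bs) \<partial>points (n - m) \<partial>points m)))"
      by (subst nn_integral_add) (auto simp: Suc.IH m distrib_left sum.distrib)
  qed
  also have "\<dots> = (\<Sum>m\<le>n. of_nat (n choose m) * (A (Suc m) (n - m) + A m (Suc (n - m))))"
    by (subst nn_integral_sum)
       (auto simp: nn_integral_cmult nn_integral_add A1 A2 intro!: sum.cong)
  also have "\<dots> = (\<Sum>m\<le>Suc n. of_nat (Suc n choose m) * A m (Suc n - m))"
  proof -
    have "(\<Sum>m\<le>n. of_nat (n choose m) * A m (Suc (n - m))) = (\<Sum>m\<le>Suc n. of_nat (n choose m) * A m (Suc n - m))"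
      by (auto simp: Suc_diff_le intro!: sum.cong)
    also have "\<dots> = A 0 (Suc n) + (\<Sum>m\<le>n. of_nat (n choose Suc m) * A (Suc m) (n - m))"
      by (subst sum.atMost_Suc_shift) simp
    finally show ?thesis
      by (subst sum.atMost_Suc_shift) (simp add: distrib_left distrib_right sum.distrib ac_simps)
  qed
  finally show ?case by (simp add: A_def)
qed

text \<open>The weight exp(-\<tau>)/n! times \<open>n choose m\<close> is the product of the weights
  for \<open>m\<close> and \<open>n - m\<close> points, except that one factor exp(-\<tau>) is
  missing. So summing over all splittings produces two independent copies of the process and the
  factor exp(\<tau>).\<close>

theorem nn_integral_sum_splits:
  assumes G: "(\<lambda>(as, bs). G as bs) \<in> borel_measurable (LS \<Otimes>\<^sub>M LS)"
  shows "(\<integral>\<^sup>+xs. sum_splits G xs \<partial>poisson_lists) =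
    ennreal (exp \<tau>) * (\<integral>\<^sup>+as. \<integral>\<^sup>+bs. G as bs \<partial>poisson_lists \<partial>poisson_lists)"
proof -
  have [measurable]: "(\<lambda>(as, bs). G as bs) \<in> borel_measurable (LS \<Otimes>\<^sub>M LS)" by fact
  have [measurable]: "(\<lambda>bs. G as bs) \<in> borel_measurable LS" if "as \<in> space LS" for as
    using measurable_compose[OF measurable_Pair1'[OF that, of LS] G] by simp
  have meas [measurable]: "(\<lambda>as. \<integral>\<^sup>+bs. G as bs \<partial>points l) \<in> borel_measurable LS" for l
    using sigma_finite_measure.borel_measurable_nn_integral[OF sigma_finite_points[of l], of G LS] G
    by simp
  have meas' [measurable]: "(\<lambda>as. \<integral>\<^sup>+bs. G as bs \<partial>poisson_lists) \<in> borel_measurable LS"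
    using PL.borel_measurable_nn_integral[of G LS] G by simp
  define w where "w n = exp (- \<tau>) / fact n" for n
  define A where "A m l = (\<integral>\<^sup>+as. \<integral>\<^sup>+bs. G as bs \<partial>points l \<partial>points m)" for m l
  have w: "ennreal (w n) * of_nat (n choose m) = ennreal (exp \<tau>) * (ennreal (w m) * ennreal (w (n - m)))"
    if "m \<le> n" for n m
  proof -
    have "w n * real (n choose m) = exp \<tau> * (w m * w (n - m))"
      using binomial_fact[OF that, where 'a=real] by (simp add: w_def exp_minus field_simps)
    then show ?thesis
      by (simp add: ennreal_mult[symmetric] w_def ennreal_of_nat_eq_real_of_nat)
  qed
  have "(\<integral>\<^sup>+xs. sum_splits G xs \<partial>poisson_lists) =
      (\<Sum>n. ennreal (w n) * (\<Sum>m\<le>n. of_nat (n choose m) * A m (n - m)))"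
    by (simp add: nn_integral_poisson_lists measurable_sum_splits G nn_integral_points_sum_splits
        A_def w_def)
  also have "\<dots> = (\<Sum>n. \<Sum>m\<le>n. ennreal (exp \<tau>) * (ennreal (w m) * ennreal (w (n - m)) * A m (n - m)))"
    by (auto simp: sum_distrib_left mult.assoc[symmetric] w intro!: suminf_cong sum.cong)
  also have "\<dots> = (\<Sum>m. \<Sum>l. ennreal (exp \<tau>) * (ennreal (w m) * ennreal (w l) * A m l))"
    by (rule ennreal_suminf_triangle)
  also have "\<dots> = ennreal (exp \<tau>) * (\<Sum>m. \<Sum>l. ennreal (w m) * ennreal (w l) * A m l)"
    by simp
  also have "(\<Sum>m. \<Sum>l. ennreal (w m) * ennreal (w l) * A m l) =
      (\<Sum>m. ennreal (w m) * (\<integral>\<^sup>+as. (\<Sum>l. ennreal (w l) * (\<integral>\<^sup>+bs. G as bs \<partial>points l)) \<partial>points m))"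
    by (subst nn_integral_suminf)
       (auto simp: nn_integral_cmult A_def mult.assoc simp flip: ennreal_suminf_cmult)
  also have "\<dots> = (\<Sum>m. ennreal (w m) * (\<integral>\<^sup>+as. \<integral>\<^sup>+bs. G as bs \<partial>poisson_lists \<partial>points m))"
    by (intro suminf_cong arg_cong2[where f="(*)"] refl nn_integral_cong)
       (simp add: nn_integral_poisson_lists w_def)
  also have "\<dots> = (\<integral>\<^sup>+as. \<integral>\<^sup>+bs. G as bs \<partial>poisson_lists \<partial>poisson_lists)"
    by (simp add: nn_integral_poisson_lists[OF meas'] w_def)
  finally show ?thesis .
qed

end

section \<open>Resampling outside a stopping set\<close>

text \<open>The second alternative expresses that a stopping set does not change when the points outside of it
  are deleted.\<close>

definition stopping_lists :: "'a measure \<Rightarrow> ('a list \<Rightarrow> 'a set) \<Rightarrow> bool" where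
  "stopping_lists X \<zeta> \<longleftrightarrow> Measurable.pred (list_space X \<Otimes>\<^sub>M X) (\<lambda>(xs, x). x \<in> \<zeta> xs) \<and>
     (\<forall>as\<in>lists (space X). \<forall>bs\<in>lists (space X). \<forall>xs. mset xs = mset as + mset bs \<longrightarrow>
        set as \<subseteq> \<zeta> as \<and> set bs \<inter> \<zeta> as = {} \<or> set as \<subseteq> \<zeta> xs \<and> set bs \<inter> \<zeta> xs = {} \<longrightarrow>
        \<zeta> xs = \<zeta> as)"

lemma stopping_listsD:
  assumes "stopping_lists X \<zeta>" "as \<in> lists (space X)" "bs \<in> lists (space X)" "mset xs = mset as + mset bs"
    and "set as \<subseteq> \<zeta> as \<and> set bs \<inter> \<zeta> as = {} \<or> set as \<subseteq> \<zeta> xs \<and> set bs \<inter> \<zeta> xs = {}"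
  shows "\<zeta> xs = \<zeta> as"
  using assms unfolding stopping_lists_def by blast

lemma mset_filter_split: "mset xs = mset (filter P xs) + mset (filter (\<lambda>x. \<not> P x) xs)"
  by simp

lemma stopping_lists_filter:
  assumes "stopping_lists X \<zeta>" "xs \<in> lists (space X)"
  shows "\<zeta> (filter (\<lambda>x. x \<in> \<zeta> xs) xs) = \<zeta> xs"
  by (rule stopping_listsD[OF assms(1) _ _ mset_filter_split, symmetric]) (use assms(2) in auto)

context finite_intensity
begin

lemma stopping_lists_const: "W \<in> sets X \<Longrightarrow> stopping_lists X (\<lambda>_. W)"
  by (simp add: stopping_lists_def)

lemma measurable_stopping_lists:
  "stopping_lists X \<zeta> \<Longrightarrow> Measurable.pred (LS \<Otimes>\<^sub>M X) (\<lambda>p. snd p \<in> \<zeta> (fst p))"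
  by (simp add: stopping_lists_def split_beta')

lemma measurable_filter_stopping:
  assumes Z: "stopping_lists X \<zeta>"
    and f: "f \<in> \<Omega> \<rightarrow>\<^sub>M LS" and g: "g \<in> \<Omega> \<rightarrow>\<^sub>M LS"
  shows "(\<lambda>\<omega>. filter (\<lambda>x. x \<in> \<zeta> (f \<omega>)) (g \<omega>)) \<in> \<Omega> \<rightarrow>\<^sub>M LS"
    "(\<lambda>\<omega>. filter (\<lambda>x. x \<notin> \<zeta> (f \<omega>)) (g \<omega>)) \<in> \<Omega> \<rightarrow>\<^sub>M LS"
    "Measurable.pred \<Omega> (\<lambda>\<omega>. \<forall>x\<in>set (g \<omega>). x \<in> \<zeta> (f \<omega>))"
    "Measurable.pred \<Omega> (\<lambda>\<omega>. \<forall>x\<in>set (g \<omega>). x \<notin> \<zeta> (f \<omega>))"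
proof -
  note [measurable] = f g
  have "Measurable.pred (\<Omega> \<Otimes>\<^sub>M X) (\<lambda>p. snd p \<in> \<zeta> (f (fst p)))"
    using measurable_compose[of "\<lambda>p. (f (fst p), snd p)" "\<Omega> \<Otimes>\<^sub>M X" _ "\<lambda>p. snd p \<in> \<zeta> (fst p)",
        OF _ measurable_stopping_lists[OF Z]] by simp
  then have m [measurable]: "Measurable.pred (\<Omega> \<Otimes>\<^sub>M X) (\<lambda>(\<omega>, x). x \<in> \<zeta> (f \<omega>))"
    by (simp add: case_prod_beta)
  then have [measurable]: "Measurable.pred (\<Omega> \<Otimes>\<^sub>M X) (\<lambda>(\<omega>, x). x \<notin> \<zeta> (f \<omega>))"
    by (simp add: case_prod_beta)
  show "(\<lambda>\<omega>. filter (\<lambda>x. x \<in> \<zeta> (f \<omega>)) (g \<omega>)) \<in> \<Omega> \<rightarrow>\<^sub>M LS"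
    "(\<lambda>\<omega>. filter (\<lambda>x. x \<notin> \<zeta> (f \<omega>)) (g \<omega>)) \<in> \<Omega> \<rightarrow>\<^sub>M LS"
    "Measurable.pred \<Omega> (\<lambda>\<omega>. \<forall>x\<in>set (g \<omega>). x \<in> \<zeta> (f \<omega>))"
    "Measurable.pred \<Omega> (\<lambda>\<omega>. \<forall>x\<in>set (g \<omega>). x \<notin> \<zeta> (f \<omega>))"
    by measurable
qed

text \<open>Sum over all splittings of \<open>xs\<close> under the test that the left part lies in
  its own stopping set and the right part avoids it. By the stopping property only the splitting by
  \<open>\<zeta> xs\<close> survives, and the sum over splittings integrates to a pair of
  independent processes.\<close>

lemma nn_integral_filter_stopping:
  assumes Z: "stopping_lists X \<zeta>"
    and H: "(\<lambda>(as, bs). H as bs) \<in> borel_measurable (LS \<Otimes>\<^sub>M LS)"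
  shows "(\<integral>\<^sup>+xs. H (filter (\<lambda>x. x \<in> \<zeta> xs) xs) (filter (\<lambda>x. x \<notin> \<zeta> xs) xs) \<partial>poisson_lists) =
    ennreal (exp \<tau>) * (\<integral>\<^sup>+as. \<integral>\<^sup>+bs. H as bs * of_bool (set as \<subseteq> \<zeta> as \<and> set bs \<inter> \<zeta> as = {})
      \<partial>poisson_lists \<partial>poisson_lists)"
proof -
  let ?G = "\<lambda>as bs. H as bs * of_bool (set as \<subseteq> \<zeta> as \<and> set bs \<inter> \<zeta> as = {})"
  have 1: "Measurable.pred (LS \<Otimes>\<^sub>M LS) (\<lambda>p. \<forall>x\<in>set (fst p). x \<in> \<zeta> (fst p))"
    by (rule measurable_filter_stopping(3)[OF Z]) measurable
  have 2: "Measurable.pred (LS \<Otimes>\<^sub>M LS) (\<lambda>p. \<forall>x\<in>set (snd p). x \<notin> \<zeta> (fst p))"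
    by (rule measurable_filter_stopping(4)[OF Z]) measurable
  have eq: "set as \<subseteq> \<zeta> as \<and> set bs \<inter> \<zeta> as = {} \<longleftrightarrow>
      (\<forall>x\<in>set as. x \<in> \<zeta> as) \<and> (\<forall>x\<in>set bs. x \<notin> \<zeta> as)" for as bs
    by auto
  have G: "(\<lambda>(as, bs). ?G as bs) \<in> borel_measurable (LS \<Otimes>\<^sub>M LS)"
    using 1 2 H unfolding eq case_prod_beta by measurable
  have "sum_splits ?G xs = H (filter (\<lambda>x. x \<in> \<zeta> xs) xs) (filter (\<lambda>x. x \<notin> \<zeta> xs) xs)"
    if xs: "xs \<in> lists (space X)" for xs
  proof -
    \<comment> \<open>If either indicator is one, then \<open>\<zeta> xs = \<zeta> as\<close>, and
      the other is one as well; each alternative in \<open>stopping_lists\<close> gives one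
      direction.\<close>
    have "sum_splits ?G xs = sum_splits (\<lambda>as bs. H as bs * of_bool (set as \<subseteq> \<zeta> xs \<and> set bs \<inter> \<zeta> xs = {})) xs"
    proof (rule sum_splits_cong)
      fix as bs assume s: "mset xs = mset as + mset bs"
      then have "set as \<union> set bs = set xs" by (metis set_mset_mset set_mset_union)
      then have "as \<in> lists (space X)" "bs \<in> lists (space X)"
        using xs by (auto simp: in_lists_conv_set)
      from stopping_listsD[OF Z this s] show "?G as bs =
          H as bs * of_bool (set as \<subseteq> \<zeta> xs \<and> set bs \<inter> \<zeta> xs = {})"
        by (auto simp: of_bool_def)
    qed
    then show ?thesis by (simp add: sum_splits_filter)
  qed
  then show ?thesis
    unfolding nn_integral_sum_splits[OF G, symmetric] by (intro nn_integral_cong) simp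
qed

text \<open>Write both sides by \<open>nn_integral_filter_stopping\<close>. Once the inside points
  \<open>as\<close> are fixed, \<open>\<zeta> as\<close> is a deterministic set, and the claim
  reduces to the behaviour of a Poisson process outside a fixed set.\<close>

theorem nn_integral_resample:
  assumes Z: "stopping_lists X \<zeta>"
    and H: "(\<lambda>(as, bs). H as bs) \<in> borel_measurable (LS \<Otimes>\<^sub>M LS)"
  shows "(\<integral>\<^sup>+xs. H (filter (\<lambda>x. x \<in> \<zeta> xs) xs) (filter (\<lambda>x. x \<notin> \<zeta> xs) xs) \<partial>poisson_lists) =
    (\<integral>\<^sup>+xs. \<integral>\<^sup>+bs. H (filter (\<lambda>x. x \<in> \<zeta> xs) xs) (filter (\<lambda>x. x \<notin> \<zeta> xs) bs) \<partial>poisson_lists \<partial>poisson_lists)"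
proof -
  have H': "(\<lambda>bs. H as bs) \<in> borel_measurable LS" if "as \<in> space LS" for as
    using measurable_compose[OF measurable_Pair1'[OF that, of LS] H] by simp
  \<comment> \<open>Deleting the points in \<open>W\<close> gives the same law as conditioning on
    having no points in \<open>W\<close>; the two factors in front are the reciprocal of that void
    probability.\<close>
  have fixed: "(\<integral>\<^sup>+bs. h (filter (\<lambda>x. x \<notin> W) bs) \<partial>poisson_lists) =
      ennreal (exp \<tau>) * emeasure poisson_lists {xs\<in>space LS. \<forall>x\<in>set xs. x \<in> W} *
      (\<integral>\<^sup>+bs. h bs * of_bool (set bs \<inter> W = {}) \<partial>poisson_lists)"
    if W: "W \<in> sets X" and h: "h \<in> borel_measurable LS" for W and h :: "'a list \<Rightarrow> ennreal"
  proof -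
    note [measurable] = W h
    have [simp]: "set as \<subseteq> W \<longleftrightarrow> (\<forall>x\<in>set as. x \<in> W)" "set as \<inter> W = {} \<longleftrightarrow> (\<forall>x\<in>set as. x \<notin> W)" for as
      by auto
    have [measurable]: "Measurable.pred LS (\<lambda>xs. \<forall>x\<in>set xs. x \<in> W)" 
      by (rule measurable_filter_stopping(3)[OF stopping_lists_const[OF W], of "\<lambda>x. x" _ "\<lambda>x. x"]) auto
    have [measurable]: "Measurable.pred LS (\<lambda>xs. \<forall>x\<in>set xs. x \<notin> W)" 
      by (rule measurable_filter_stopping(4)[OF stopping_lists_const[OF W], of "\<lambda>x. x" _ "\<lambda>x. x"]) auto
    have S: "{xs\<in>space LS. \<forall>x\<in>set xs. x \<in> W} \<in> sets LS" by measurable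
    note [measurable] = S[simplified]
    have "(\<integral>\<^sup>+bs. h (filter (\<lambda>x. x \<notin> W) bs) \<partial>poisson_lists) =
       ennreal (exp \<tau>) * (\<integral>\<^sup>+as. \<integral>\<^sup>+bs. h bs * of_bool (set as \<subseteq> W \<and> set bs \<inter> W = {})
         \<partial>poisson_lists \<partial>poisson_lists)"
      by (rule nn_integral_filter_stopping[OF stopping_lists_const[OF W], of "\<lambda>_. h"]) simp
    also have "\<dots> =
       ennreal (exp \<tau>) * (\<integral>\<^sup>+as. \<integral>\<^sup>+bs. indicator {xs\<in>space LS. \<forall>x\<in>set xs. x \<in> W} as *
         (h bs * of_bool (set bs \<inter> W = {})) \<partial>poisson_lists \<partial>poisson_lists)"
      by (intro arg_cong[where f="\<lambda>t. ennreal (exp \<tau>) * t"] nn_integral_cong)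
        (auto simp: indicator_def)
    also have "\<dots> = ennreal (exp \<tau>) * emeasure poisson_lists {xs\<in>space LS. \<forall>x\<in>set xs. x \<in> W} *
      (\<integral>\<^sup>+bs. h bs * of_bool (set bs \<inter> W = {}) \<partial>poisson_lists)"
      by (simp add: nn_integral_cmult nn_integral_multc mult.assoc)
    finally show ?thesis .
  qed
  define K where "K as = (\<integral>\<^sup>+bs. H as (filter (\<lambda>x. x \<notin> \<zeta> as) bs) \<partial>poisson_lists)" for as
  have K: "K \<in> borel_measurable LS"
  proof -
    have "(\<lambda>p. (fst p, filter (\<lambda>x. x \<notin> \<zeta> (fst p)) (snd p))) \<in> LS \<Otimes>\<^sub>M LS \<rightarrow>\<^sub>M LS \<Otimes>\<^sub>M LS"
      by (intro measurable_Pair measurable_filter_stopping(2)[OF Z]) auto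
    from measurable_compose[OF this H]
    have "(\<lambda>p. H (fst p) (filter (\<lambda>x. x \<notin> \<zeta> (fst p)) (snd p))) \<in> borel_measurable (LS \<Otimes>\<^sub>M poisson_lists)"
      by (simp cong: measurable_cong_sets)
    from PL.borel_measurable_nn_integral_fst[OF this] show ?thesis
      unfolding K_def by simp
  qed
  have sec: "\<zeta> as \<inter> space X \<in> sets X" if "as \<in> space LS" for as
  proof -
    have "{x\<in>space X. x \<in> \<zeta> as} \<in> sets X"
      using measurable_compose[OF measurable_Pair1'[OF that, of X] measurable_stopping_lists[OF Z]]
      by (simp add: pred_def)
    then show ?thesis by (simp add: Int_def conj_commute)
  qed
  have "(\<integral>\<^sup>+xs. \<integral>\<^sup>+bs. H (filter (\<lambda>x. x \<in> \<zeta> xs) xs) (filter (\<lambda>x. x \<notin> \<zeta> xs) bs) \<partial>poisson_lists \<partial>poisson_lists) =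
      (\<integral>\<^sup>+xs. K (filter (\<lambda>x. x \<in> \<zeta> xs) xs) \<partial>poisson_lists)"
    unfolding K_def by (intro nn_integral_cong) (simp add: stopping_lists_filter[OF Z])
  also have "\<dots> = ennreal (exp \<tau>) * (\<integral>\<^sup>+as. \<integral>\<^sup>+bs. K as * of_bool (set as \<subseteq> \<zeta> as \<and> set bs \<inter> \<zeta> as = {})
      \<partial>poisson_lists \<partial>poisson_lists)"
    by (rule nn_integral_filter_stopping[OF Z]) (use K in measurable)
  also have "\<dots> = ennreal (exp \<tau>) * (\<integral>\<^sup>+as. \<integral>\<^sup>+bs. H as bs * of_bool (set as \<subseteq> \<zeta> as \<and> set bs \<inter> \<zeta> as = {})
      \<partial>poisson_lists \<partial>poisson_lists)"
  proof (rule arg_cong[where f="\<lambda>t. ennreal (exp \<tau>) * t"], rule nn_integral_cong)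
    fix as assume "as \<in> space poisson_lists"
    then have as: "as \<in> space LS" by simp
    \<comment> \<open>\<open>\<zeta> as\<close> may contain elements outside the space. Cutting them
      off makes the set measurable and changes nothing for lists of points of the space.\<close>
    define W where "W = \<zeta> as \<inter> space X"
    note W = sec[OF as, folded W_def]
    have W': "x \<in> \<zeta> as \<longleftrightarrow> x \<in> W" if "bs \<in> lists (space X)" "x \<in> set bs" for bs x
      using that by (auto simp: W_def)
    have Wf: "filter (\<lambda>x. x \<notin> \<zeta> as) bs = filter (\<lambda>x. x \<notin> W) bs"
      and Wd: "set bs \<inter> \<zeta> as = {} \<longleftrightarrow> set bs \<inter> W = {}" if "bs \<in> lists (space X)" for bs
      using W'[OF that] by (auto intro!: filter_cong)
    define c where "c = ennreal (exp \<tau>) * emeasure poisson_lists {xs\<in>space LS. \<forall>x\<in>set xs. x \<in> W}"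
    have m: "(\<lambda>bs. h bs * of_bool (set bs \<inter> W = {})) \<in> borel_measurable LS"
      if "h \<in> borel_measurable LS" for h :: "'a list \<Rightarrow> ennreal"
    proof -
      have [simp]: "set as \<inter> W = {} \<longleftrightarrow> (\<forall>x\<in>set as. x \<notin> W)" for as by auto
      have [measurable]: "Measurable.pred LS (\<lambda>xs. \<forall>x\<in>set xs. x \<notin> W)" 
        by (rule measurable_filter_stopping(4)[OF stopping_lists_const[OF W], of "\<lambda>x. x" _ "\<lambda>x. x"]) auto
      show ?thesis using that by simp
    qed
    \<comment> \<open>The case of a constant integrand identifies \<open>c\<close> as the
      normalising constant.\<close>
    have one: "1 = c * (\<integral>\<^sup>+bs. of_bool (set bs \<inter> W = {}) \<partial>poisson_lists)"
      using fixed[OF W, of "\<lambda>_. 1"] PL.emeasure_space_1 by (simp add: c_def)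
    have "(\<integral>\<^sup>+bs. K as * of_bool (set as \<subseteq> \<zeta> as \<and> set bs \<inter> \<zeta> as = {}) \<partial>poisson_lists) =
      of_bool (set as \<subseteq> \<zeta> as) * (K as * (\<integral>\<^sup>+bs. of_bool (set bs \<inter> W = {}) \<partial>poisson_lists))"
      using m[of "\<lambda>_. 1"] by (subst nn_integral_cmult[symmetric], simp)+
        (auto intro!: nn_integral_cong simp: Wd)
    also have "K as * (\<integral>\<^sup>+bs. of_bool (set bs \<inter> W = {}) \<partial>poisson_lists) =
        (\<integral>\<^sup>+bs. H as bs * of_bool (set bs \<inter> W = {}) \<partial>poisson_lists)"
    proof -
      have "K as = (\<integral>\<^sup>+bs. H as (filter (\<lambda>x. x \<notin> W) bs) \<partial>poisson_lists)"
        unfolding K_def by (intro nn_integral_cong arg_cong[where f="H as"] Wf) simp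
      also have "\<dots> = c * (\<integral>\<^sup>+bs. H as bs * of_bool (set bs \<inter> W = {}) \<partial>poisson_lists)"
        using fixed[OF W H'[OF as]] by (simp add: c_def)
      finally show ?thesis
        using one by (metis (no_types, lifting) mult.commute mult.left_commute mult_1)
    qed
    also have "of_bool (set as \<subseteq> \<zeta> as) * \<dots> =
        (\<integral>\<^sup>+bs. H as bs * of_bool (set as \<subseteq> \<zeta> as \<and> set bs \<inter> \<zeta> as = {}) \<partial>poisson_lists)"
      using m[OF H'[OF as]] by (subst nn_integral_cmult[symmetric], simp)
        (auto intro!: nn_integral_cong simp: Wd)
    finally show "(\<integral>\<^sup>+bs. K as * of_bool (set as \<subseteq> \<zeta> as \<and> set bs \<inter> \<zeta> as = {}) \<partial>poisson_lists) =
        (\<integral>\<^sup>+bs. H as bs * of_bool (set as \<subseteq> \<zeta> as \<and> set bs \<inter> \<zeta> as = {}) \<partial>poisson_lists)" .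
  qed
  also have "\<dots> = (\<integral>\<^sup>+xs. H (filter (\<lambda>x. x \<in> \<zeta> xs) xs) (filter (\<lambda>x. x \<notin> \<zeta> xs) xs) \<partial>poisson_lists)"
    by (rule nn_integral_filter_stopping[OF Z H, symmetric])
  finally show ?thesis ..
qed

text \<open>The identity for nonnegative functions, applied to indicators. As an equality of laws it
  also serves signed integrands, including the transfer of integrability.\<close>

lemma distr_resample:
  assumes Z: "stopping_lists X \<zeta>"
  shows "distr poisson_lists (LS \<Otimes>\<^sub>M LS) (\<lambda>xs. (filter (\<lambda>x. x \<in> \<zeta> xs) xs, filter (\<lambda>x. x \<notin> \<zeta> xs) xs)) =
    distr (poisson_lists \<Otimes>\<^sub>M poisson_lists) (LS \<Otimes>\<^sub>M LS)
      (\<lambda>p. (filter (\<lambda>x. x \<in> \<zeta> (fst p)) (fst p), filter (\<lambda>x. x \<notin> \<zeta> (fst p)) (snd p)))"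
    (is "distr _ _ ?f = distr _ _ ?g")
proof (rule measure_eqI)
  have f: "?f \<in> poisson_lists \<rightarrow>\<^sub>M LS \<Otimes>\<^sub>M LS"
    by (intro measurable_Pair measurable_filter_stopping[OF Z]) (auto simp: measurable_ident_sets)
  have g: "?g \<in> poisson_lists \<Otimes>\<^sub>M poisson_lists \<rightarrow>\<^sub>M LS \<Otimes>\<^sub>M LS"
    by (intro measurable_Pair measurable_filter_stopping[OF Z]) auto
  fix A assume "A \<in> sets (distr poisson_lists (LS \<Otimes>\<^sub>M LS) ?f)"
  then have A [measurable]: "A \<in> sets (LS \<Otimes>\<^sub>M LS)" by simp
  have i: "(\<lambda>p. indicator A (?g p) :: ennreal) \<in> borel_measurable (poisson_lists \<Otimes>\<^sub>M poisson_lists)"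
    by (rule measurable_compose[OF g]) simp
  have "emeasure (distr poisson_lists (LS \<Otimes>\<^sub>M LS) ?f) A = (\<integral>\<^sup>+xs. indicator A (?f xs) \<partial>poisson_lists)"
    by (subst nn_integral_indicator[symmetric], simp, subst nn_integral_distr[OF f]) auto
  also have "\<dots> = (\<integral>\<^sup>+xs. \<integral>\<^sup>+bs. indicator A (?g (xs, bs)) \<partial>poisson_lists \<partial>poisson_lists)"
    using nn_integral_resample[OF Z, of "\<lambda>as bs. indicator A (as, bs)"] by simp
  also have "\<dots> = (\<integral>\<^sup>+p. indicator A (?g p) \<partial>(poisson_lists \<Otimes>\<^sub>M poisson_lists))"
    by (rule PL.nn_integral_fst[OF i])
  also have "\<dots> = emeasure (distr (poisson_lists \<Otimes>\<^sub>M poisson_lists) (LS \<Otimes>\<^sub>M LS) ?g) A"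
    by (subst nn_integral_indicator[symmetric], simp, subst nn_integral_distr[OF g]) auto
  finally show "emeasure (distr poisson_lists (LS \<Otimes>\<^sub>M LS) ?f) A =
      emeasure (distr (poisson_lists \<Otimes>\<^sub>M poisson_lists) (LS \<Otimes>\<^sub>M LS) ?g) A" .
qed simp

end

section \<open>Multiple integrals of a finite Poisson process\<close>

text \<open>A class closed under products in which integrability is automatic, because the number of
  points has moments of all orders.\<close>

definition poly_bounded :: "('a multiset \<Rightarrow> real) \<Rightarrow> bool" where
  "poly_bounded F \<longleftrightarrow> (\<exists>c p. \<forall>N. \<bar>F N\<bar> \<le> c * (1 + real (size N)) ^ p)"

lemma poly_boundedI: "(\<And>N. \<bar>F N\<bar> \<le> c * (1 + real (size N)) ^ p) \<Longrightarrow> poly_bounded F"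
  by (auto simp: poly_bounded_def)

lemma poly_bounded_mult:
  assumes "poly_bounded F" "poly_bounded G"
  shows "poly_bounded (\<lambda>N. F N * G N)"
proof -
  from assms obtain c p d q where
    F: "\<bar>F N\<bar> \<le> c * (1 + real (size N)) ^ p" and G: "\<bar>G N\<bar> \<le> d * (1 + real (size N)) ^ q" for N
    unfolding poly_bounded_def by blast
  have "\<bar>F N * G N\<bar> \<le> c * (1 + real (size N)) ^ p * (d * (1 + real (size N)) ^ q)" for N
    unfolding abs_mult by (intro mult_mono F G order.trans[OF _ F]) auto
  then show ?thesis
    by (intro poly_boundedI[where c="c * d" and p="p + q"]) (simp add: power_add ac_simps)
qed

lemma sum_mset_real_nonneg: "(\<And>z. z \<in># N \<Longrightarrow> 0 \<le> f z) \<Longrightarrow> 0 \<le> (\<Sum>z\<in>#N. f z :: real)"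
  by (induction N) auto

lemma sum_mset_real_diff: "(\<Sum>z\<in>#N. f z - g z) = (\<Sum>z\<in>#N. f z) - (\<Sum>z\<in>#N. g z :: real)"
  by (induction N) auto

lemma ennreal_sum_mset:
  "(\<And>z. z \<in># N \<Longrightarrow> 0 \<le> f z) \<Longrightarrow> ennreal (\<Sum>z\<in>#N. f z) = (\<Sum>z\<in>#N. ennreal (f z))"
proof (induction N)
  case (add x N)
  then have "0 \<le> f x" "0 \<le> (\<Sum>z\<in>#N. f z)" by (auto intro!: sum_mset_real_nonneg)
  then show ?case using add by simp
qed simp

lemma sum_mset_abs_le:
  fixes f :: "'a \<Rightarrow> real"
  assumes "\<And>z. z \<in># N \<Longrightarrow> \<bar>f z\<bar> \<le> b"
  shows "\<bar>\<Sum>z\<in>#N. f z\<bar> \<le> real (size N) * b"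
  using assms
proof (induction N)
  case (add x N)
  then have "\<bar>f x\<bar> \<le> b" "\<bar>\<Sum>z\<in>#N. f z\<bar> \<le> real (size N) * b" by auto
  then show ?case by (simp add: algebra_simps)
qed simp

lemma sum_mset_delete_add:
  "(\<Sum>z\<in>#add_mset x N. \<phi> z (add_mset x N - {#z#})) =
   \<phi> x N + (\<Sum>z\<in>#N. \<phi> z (add_mset x (N - {#z#})) :: 'b :: comm_monoid_add)"
  by (auto intro!: arg_cong[where f="\<lambda>t. \<phi> x N + t"] arg_cong[where f=sum_mset] image_mset_cong)

lemma power_le_fact_exp:
  fixes x :: real
  assumes "0 \<le> x"
  shows "x ^ p \<le> fact p * exp x"
proof -
  have "(\<Sum>n\<in>{p}. x ^ n / fact n) \<le> (\<Sum>n. x ^ n / fact n)"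
    using assms exp_converges[of x] by (intro sum_le_suminf) (auto simp: sums_iff field_simps)
  also have "\<dots> = exp x"
    using exp_converges[of x] by (simp add: sums_iff field_simps)
  finally show ?thesis by (simp add: field_simps)
qed

section \<open>The Mecke equation and moments of the number of points\<close>

context finite_intensity
begin

sublocale LP: pair_sigma_finite L poisson_lists ..

text \<open>Each of the \<open>n\<close> positions contributes the same by exchangeability. For
  \<open>n = 0\<close> the factor in front vanishes, so the truncated \<open>n - 1\<close> does no
  harm.\<close>

lemma nn_integral_points_delete:
  assumes "(\<lambda>(x, xs). \<phi> x (mset xs)) \<in> borel_measurable (X \<Otimes>\<^sub>M LS)"
  shows "(\<integral>\<^sup>+xs. (\<Sum>z\<in>#mset xs. \<phi> z (mset xs - {#z#})) \<partial>points n) =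
    of_nat n * (\<integral>\<^sup>+x. \<integral>\<^sup>+xs. \<phi> x (mset xs) \<partial>points (n - 1) \<partial>L)"
  using assms
proof (induction n arbitrary: \<phi>)
  case 0
  then have "(\<lambda>(\<omega>, xs). \<Sum>z\<in>#mset xs. \<phi> z (mset xs - {#z#})) \<in> borel_measurable (LS \<Otimes>\<^sub>M LS)"
    by (intro measurable_sum_delete[where \<phi>="\<lambda>_. \<phi>"])
      (simp add: case_prod_beta measurable_compose[OF measurable_snd])
  from measurable_compose[OF measurable_Pair1'[of "[]" LS LS] this]
  show ?case by (simp del: points.simps add: nn_integral_points_0)
next
  case (Suc n)
  note \<phi> = Suc.prems
  have [measurable]: "(\<lambda>\<omega>. \<phi> (f \<omega>) (mset (g \<omega>))) \<in> borel_measurable \<Omega>"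
    if [measurable]: "f \<in> \<Omega> \<rightarrow>\<^sub>M X" "g \<in> \<Omega> \<rightarrow>\<^sub>M LS" for f g and \<Omega> :: "'z measure"
    using measurable_compose[OF measurable_Pair[OF that] \<phi>] by simp
  interpret P: sigma_finite_measure "points m" for m by (rule sigma_finite_points)
  interpret LL: pair_sigma_finite L L ..
  have "(\<lambda>(\<omega>, xs). \<Sum>z\<in>#mset xs. \<phi> z (mset xs - {#z#})) \<in> borel_measurable (LS \<Otimes>\<^sub>M LS)"
    by (intro measurable_sum_delete[where \<phi>="\<lambda>_. \<phi>"]) (simp add: case_prod_beta)
  from measurable_compose[OF measurable_Pair1'[of "[]" LS LS] this]
  have [measurable]: "(\<lambda>xs. \<Sum>z\<in>#mset xs. \<phi> z (mset xs - {#z#})) \<in> borel_measurable LS" by simp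
  have "(\<integral>\<^sup>+xs. (\<Sum>z\<in>#mset xs. \<phi> z (mset xs - {#z#})) \<partial>points (Suc n)) =
      (\<integral>\<^sup>+x. \<integral>\<^sup>+xs. (\<Sum>z\<in>#mset (x # xs). \<phi> z (mset (x # xs) - {#z#})) \<partial>points n \<partial>L)"
    by (rule nn_integral_points_Suc) simp
  also have "\<dots> = (\<integral>\<^sup>+x. (\<integral>\<^sup>+xs. \<phi> x (mset xs) \<partial>points n) +
      of_nat n * (\<integral>\<^sup>+z. \<integral>\<^sup>+xs. \<phi> z (mset (x # xs)) \<partial>points (n - 1) \<partial>L) \<partial>L)"
  proof (rule nn_integral_cong)
    fix x assume x: "x \<in> space L"
    then have [measurable]: "(\<lambda>_. x) \<in> \<Omega> \<rightarrow>\<^sub>M X" for \<Omega> :: "'z measure"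
      by (simp add: space_L)
    have s: "(\<lambda>(\<omega>, xs). \<Sum>z\<in>#mset xs. \<phi> z (add_mset x (mset xs - {#z#}))) \<in> borel_measurable (LS \<Otimes>\<^sub>M LS)"
    proof (intro measurable_sum_delete[where \<phi>="\<lambda>_ z N. \<phi> z (add_mset x N)"])
      have "(\<lambda>p. \<phi> (fst (snd p)) (mset (x # snd (snd p)))) \<in> borel_measurable (LS \<Otimes>\<^sub>M X \<Otimes>\<^sub>M LS)"
        by measurable
      then show "(\<lambda>(\<omega>, z, xs). \<phi> z (add_mset x (mset xs))) \<in> borel_measurable (LS \<Otimes>\<^sub>M X \<Otimes>\<^sub>M LS)"
        by (simp add: case_prod_beta)
    qed
    from measurable_compose[OF measurable_Pair1'[of "[]" LS LS] this]
    have [measurable]: "(\<lambda>xs. \<Sum>z\<in>#mset xs. \<phi> z (add_mset x (mset xs - {#z#}))) \<in> borel_measurable LS" by simp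
    have "(\<lambda>p. \<phi> (fst p) (mset (x # snd p))) \<in> borel_measurable (X \<Otimes>\<^sub>M LS)"
      by measurable
    then have m: "(\<lambda>(z, xs). \<phi> z (add_mset x (mset xs))) \<in> borel_measurable (X \<Otimes>\<^sub>M LS)"
      by (simp add: case_prod_beta)
    have "(\<integral>\<^sup>+xs. (\<Sum>z\<in>#mset (x # xs). \<phi> z (mset (x # xs) - {#z#})) \<partial>points n) =
       (\<integral>\<^sup>+xs. \<phi> x (mset xs) + (\<Sum>z\<in>#mset xs. \<phi> z (add_mset x (mset xs - {#z#}))) \<partial>points n)"
      by (simp only: mset.simps sum_mset_delete_add)
    also have "\<dots> = (\<integral>\<^sup>+xs. \<phi> x (mset xs) \<partial>points n) +
      of_nat n * (\<integral>\<^sup>+z. \<integral>\<^sup>+xs. \<phi> z (mset (x # xs)) \<partial>points (n - 1) \<partial>L)"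
      by (subst nn_integral_add) (simp_all add: Suc.IH[OF m])
    finally show "(\<integral>\<^sup>+xs. (\<Sum>z\<in>#mset (x # xs). \<phi> z (mset (x # xs) - {#z#})) \<partial>points n) =
      (\<integral>\<^sup>+xs. \<phi> x (mset xs) \<partial>points n) +
      of_nat n * (\<integral>\<^sup>+z. \<integral>\<^sup>+xs. \<phi> z (mset (x # xs)) \<partial>points (n - 1) \<partial>L)" .
  qed
  also have "\<dots> = (\<integral>\<^sup>+x. \<integral>\<^sup>+xs. \<phi> x (mset xs) \<partial>points n \<partial>L) +
      of_nat n * (\<integral>\<^sup>+x. \<integral>\<^sup>+z. \<integral>\<^sup>+xs. \<phi> z (mset (x # xs)) \<partial>points (n - 1) \<partial>L \<partial>L)"
    by (subst nn_integral_add) (simp_all add: nn_integral_cmult del: mset.simps)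
  also have "(\<integral>\<^sup>+x. \<integral>\<^sup>+z. \<integral>\<^sup>+xs. \<phi> z (mset (x # xs)) \<partial>points (n - 1) \<partial>L \<partial>L) =
      (\<integral>\<^sup>+z. \<integral>\<^sup>+x. \<integral>\<^sup>+xs. \<phi> z (mset (x # xs)) \<partial>points (n - 1) \<partial>L \<partial>L)"
    by (rule LL.Fubini') (simp add: case_prod_beta del: mset.simps)
  also have "of_nat n * \<dots> = of_nat n * (\<integral>\<^sup>+z. \<integral>\<^sup>+xs. \<phi> z (mset xs) \<partial>points n \<partial>L)"
  proof (cases n)
    case (Suc m)
    have "(\<integral>\<^sup>+z. \<integral>\<^sup>+x. \<integral>\<^sup>+xs. \<phi> z (mset (x # xs)) \<partial>points (n - 1) \<partial>L \<partial>L) =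
        (\<integral>\<^sup>+z. \<integral>\<^sup>+xs. \<phi> z (mset xs) \<partial>points n \<partial>L)"
      unfolding Suc diff_Suc_1
      by (intro nn_integral_cong nn_integral_points_Suc[symmetric]) (simp add: space_L)
    then show ?thesis by simp
  qed simp
  finally show ?case by (simp del: points.simps add: distrib_right)
qed

text \<open>The Mecke equation: the factor \<open>n\<close> from the deleted point turns 1/n! into
  1/(n-1)!, which shifts the Poisson weights by one.\<close>

lemma nn_integral_poisson_lists_delete:
  assumes \<phi>: "(\<lambda>(x, xs). \<phi> x (mset xs)) \<in> borel_measurable (X \<Otimes>\<^sub>M LS)"
  shows "(\<integral>\<^sup>+xs. (\<Sum>z\<in>#mset xs. \<phi> z (mset xs - {#z#})) \<partial>poisson_lists) =
    (\<integral>\<^sup>+p. \<phi> (fst p) (mset (snd p)) \<partial>(L \<Otimes>\<^sub>M poisson_lists))"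
proof -
  interpret P: sigma_finite_measure "points m" for m by (rule sigma_finite_points)
  have m: "(\<lambda>p. \<phi> (fst p) (mset (snd p))) \<in> borel_measurable (X \<Otimes>\<^sub>M LS)"
    using \<phi> by (simp add: case_prod_beta)
  have [measurable]: "(\<lambda>\<omega>. \<phi> (f \<omega>) (mset (g \<omega>))) \<in> borel_measurable \<Omega>"
    if [measurable]: "f \<in> \<Omega> \<rightarrow>\<^sub>M X" "g \<in> \<Omega> \<rightarrow>\<^sub>M LS" for f g and \<Omega> :: "'z measure"
    using measurable_compose[OF measurable_Pair[OF that] \<phi>] by simp
  have "(\<lambda>(\<omega>, xs). \<Sum>z\<in>#mset xs. \<phi> z (mset xs - {#z#})) \<in> borel_measurable (LS \<Otimes>\<^sub>M LS)"
    by (intro measurable_sum_delete[where \<phi>="\<lambda>_. \<phi>"]) (simp add: case_prod_beta)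
  from measurable_compose[OF measurable_Pair1'[of "[]" LS LS] this]
  have s: "(\<lambda>xs. \<Sum>z\<in>#mset xs. \<phi> z (mset xs - {#z#})) \<in> borel_measurable LS" by simp
  define a where "a n = (\<integral>\<^sup>+x. \<integral>\<^sup>+xs. \<phi> x (mset xs) \<partial>points n \<partial>L)" for n
  have "(\<integral>\<^sup>+xs. (\<Sum>z\<in>#mset xs. \<phi> z (mset xs - {#z#})) \<partial>poisson_lists) =
      (\<Sum>n. ennreal (exp (- \<tau>) / fact n) * (of_nat n * a (n - 1)))"
    by (simp only: nn_integral_poisson_lists[OF s] nn_integral_points_delete[OF \<phi>] a_def)
  also have "\<dots> = (\<Sum>n. ennreal (exp (- \<tau>) / fact (n + 1)) * (of_nat (n + 1) * a n))"
    by (subst suminf_offset[where i=1]) auto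
  also have "\<dots> = (\<Sum>n. ennreal (exp (- \<tau>) / fact n) * a n)"
  proof (rule suminf_cong)
    fix n
    have "ennreal (exp (- \<tau>) / fact (n + 1)) * of_nat (n + 1) = ennreal (exp (- \<tau>) / fact n)"
      by (subst ennreal_of_nat_eq_real_of_nat, subst ennreal_mult[symmetric])
        (auto simp: field_simps simp del: of_nat_Suc)
    then show "ennreal (exp (- \<tau>) / fact (n + 1)) * (of_nat (n + 1) * a n) = ennreal (exp (- \<tau>) / fact n) * a n"
      by (simp only: mult.assoc[symmetric])
  qed
  also have "\<dots> = (\<integral>\<^sup>+x. (\<Sum>n. ennreal (exp (- \<tau>) / fact n) * (\<integral>\<^sup>+xs. \<phi> x (mset xs) \<partial>points n)) \<partial>L)"
    by (subst nn_integral_suminf) (auto simp: nn_integral_cmult a_def)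
  also have "\<dots> = (\<integral>\<^sup>+x. \<integral>\<^sup>+xs. \<phi> x (mset xs) \<partial>poisson_lists \<partial>L)"
    by (intro nn_integral_cong nn_integral_poisson_lists[symmetric]) (simp add: space_L)
  also have "\<dots> = (\<integral>\<^sup>+p. \<phi> (fst p) (mset (snd p)) \<partial>(L \<Otimes>\<^sub>M poisson_lists))"
    using PL.nn_integral_fst[of "\<lambda>p. \<phi> (fst p) (mset (snd p))" L] m
    by (simp cong: measurable_cong_sets)
  finally show ?thesis .
qed

lemma nn_integral_points_length: "(\<integral>\<^sup>+xs. h (length xs) \<partial>points n) = h n * ennreal \<tau> ^ n"
proof (induction n arbitrary: h)
  case 0
  show ?case by (subst nn_integral_points_0) auto
next
  case (Suc n)
  show ?case
    by (subst nn_integral_points_Suc)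
      (auto simp: Suc[of "\<lambda>n. h (Suc n)"] emeasure_eq_measure ac_simps)
qed

text \<open>Powers are dominated by exponentials, and the exponential moment of a Poisson variable
  is again an exponential series.\<close>

lemma finite_moments: "(\<integral>\<^sup>+xs. ennreal ((1 + real (length xs)) ^ p) \<partial>poisson_lists) < \<infinity>"
proof -
  have "(\<integral>\<^sup>+xs. ennreal ((1 + real (length xs)) ^ p) \<partial>poisson_lists) \<le>
      (\<integral>\<^sup>+xs. ennreal (fact p * exp (1 + real (length xs))) \<partial>poisson_lists)"
    by (intro nn_integral_mono ennreal_leI power_le_fact_exp) auto
  also have "\<dots> = (\<Sum>n. ennreal (exp (- \<tau>) / fact n) * (ennreal (fact p * exp (1 + real n)) * ennreal \<tau> ^ n))"
    by (subst nn_integral_poisson_lists)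
      (auto simp: nn_integral_points_length[where h= "\<lambda>n. ennreal (fact p * exp (1 + real n))"])
  also have "\<dots> = (\<Sum>n. ennreal (exp (- \<tau>) * fact p * exp 1 / fact n) * ennreal (exp 1 * \<tau>) ^ n)"
    by (intro suminf_cong)
      (simp add: ennreal_power ennreal_mult[symmetric] exp_add exp_of_nat_mult[symmetric] power_mult_distrib
        flip: exp_of_nat_mult)
  also have "\<dots> < \<infinity>"
    by (subst suminf_exp) auto
  finally show ?thesis .
qed

lemma integrable_poly_bounded:
  assumes "(\<lambda>xs. F (mset xs)) \<in> borel_measurable LS" "poly_bounded F"
  shows "integrable poisson_lists (\<lambda>xs. F (mset xs))"
proof -
  obtain c p where cp: "\<bar>F N\<bar> \<le> c * (1 + real (size N)) ^ p" for N
    using assms(2) by (auto simp: poly_bounded_def)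
  have "(\<integral>\<^sup>+xs. ennreal \<bar>F (mset xs)\<bar> \<partial>poisson_lists) \<le>
      (\<integral>\<^sup>+xs. ennreal \<bar>c\<bar> * ennreal ((1 + real (length xs)) ^ p) \<partial>poisson_lists)"
    using cp by (intro nn_integral_mono)
      (auto simp: ennreal_mult[symmetric] intro!: ennreal_leI order.trans[OF cp] mult_right_mono)
  also have "\<dots> < \<infinity>"
    using finite_moments[of p] by (subst nn_integral_cmult) (auto simp: ennreal_mult_less_top)
  finally show ?thesis
    using assms(1) by (intro integrableI_bounded) auto
qed

lemma integrable_pair_poly_bounded:
  assumes \<phi>: "(\<lambda>(x, xs). \<phi> x (mset xs)) \<in> borel_measurable (X \<Otimes>\<^sub>M LS)"
    and cp: "\<And>x N. \<bar>\<phi> x N\<bar> \<le> c * (1 + real (size N)) ^ p"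
  shows "integrable (L \<Otimes>\<^sub>M poisson_lists) (\<lambda>q. \<phi> (fst q) (mset (snd q)))"
proof -
  have m: "(\<lambda>q. \<phi> (fst q) (mset (snd q))) \<in> borel_measurable (L \<Otimes>\<^sub>M poisson_lists)"
    using \<phi> by (simp add: case_prod_beta cong: measurable_cong_sets)
  have "(\<integral>\<^sup>+q. ennreal \<bar>\<phi> (fst q) (mset (snd q))\<bar> \<partial>(L \<Otimes>\<^sub>M poisson_lists)) \<le>
      (\<integral>\<^sup>+q. ennreal \<bar>c\<bar> * ennreal ((1 + real (length (snd q))) ^ p) \<partial>(L \<Otimes>\<^sub>M poisson_lists))"
    using cp by (intro nn_integral_mono)
      (auto simp: ennreal_mult[symmetric] intro!: ennreal_leI order.trans[OF cp] mult_right_mono)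
  also have "\<dots> = (\<integral>\<^sup>+x. \<integral>\<^sup>+xs. ennreal \<bar>c\<bar> * ennreal ((1 + real (length xs)) ^ p) \<partial>poisson_lists \<partial>L)"
    by (subst PL.nn_integral_fst[symmetric]) auto
  also have "\<dots> < \<infinity>"
    using finite_moments[of p]
    by (simp add: nn_integral_cmult ennreal_mult_less_top emeasure_eq_measure)
  finally show ?thesis
    using m by (intro integrableI_bounded) auto
qed

lemma measurable_sum_delete':
  fixes \<phi> :: "'a \<Rightarrow> 'a multiset \<Rightarrow> 'b :: {second_countable_topology, topological_comm_monoid_add}"
  assumes "(\<lambda>(x, xs). \<phi> x (mset xs)) \<in> borel_measurable (X \<Otimes>\<^sub>M LS)"
  shows "(\<lambda>xs. \<Sum>z\<in>#mset xs. \<phi> z (mset xs - {#z#})) \<in> borel_measurable LS"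
proof -
  have "(\<lambda>(\<omega>, xs). \<Sum>z\<in>#mset xs. \<phi> z (mset xs - {#z#})) \<in> borel_measurable (LS \<Otimes>\<^sub>M LS)"
    using measurable_compose[OF measurable_snd assms]
    by (intro measurable_sum_delete[where \<phi>="\<lambda>_. \<phi>"]) (simp add: split_beta')
  from measurable_compose[OF measurable_Pair1'[of "[]" LS LS] this]
  show ?thesis by simp
qed

lemma integral_poisson_lists_delete:
  assumes \<phi>: "(\<lambda>(x, xs). \<phi> x (mset xs)) \<in> borel_measurable (X \<Otimes>\<^sub>M LS)"
    and cp: "\<And>x N. \<bar>\<phi> x N\<bar> \<le> c * (1 + real (size N)) ^ p"
  shows "(\<integral>xs. (\<Sum>z\<in>#mset xs. \<phi> z (mset xs - {#z#})) \<partial>poisson_lists) =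
    (\<integral>q. \<phi> (fst q) (mset (snd q)) \<partial>(L \<Otimes>\<^sub>M poisson_lists))"
proof -
  \<comment> \<open>The Mecke equation with integrability of both sides, to be used for the positive
    and the negative part, which inherit the bound.\<close>
  have nonneg: "(\<integral>xs. (\<Sum>z\<in>#mset xs. \<psi> z (mset xs - {#z#})) \<partial>poisson_lists) =
    (\<integral>q. \<psi> (fst q) (mset (snd q)) \<partial>(L \<Otimes>\<^sub>M poisson_lists)) \<and>
    integrable poisson_lists (\<lambda>xs. \<Sum>z\<in>#mset xs. \<psi> z (mset xs - {#z#})) \<and>
    integrable (L \<Otimes>\<^sub>M poisson_lists) (\<lambda>q. \<psi> (fst q) (mset (snd q)))"
    if \<psi>: "(\<lambda>(x, xs). \<psi> x (mset xs)) \<in> borel_measurable (X \<Otimes>\<^sub>M LS)"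
      and \<psi>0: "\<And>x N. 0 \<le> \<psi> x N"
      and b: "\<And>x N. \<bar>\<psi> x N\<bar> \<le> c * (1 + real (size N)) ^ p" for \<psi> :: "'a \<Rightarrow> 'a multiset \<Rightarrow> real"
  proof (intro conjI)
    have "0 \<le> c" using b[of undefined "{#}"] by simp
    have m: "(\<lambda>q. \<psi> (fst q) (mset (snd q))) \<in> borel_measurable (L \<Otimes>\<^sub>M poisson_lists)"
      using \<psi> by (simp add: case_prod_beta cong: measurable_cong_sets)
    have e: "(\<lambda>(x, xs). ennreal (\<psi> x (mset xs))) \<in> borel_measurable (X \<Otimes>\<^sub>M LS)"
      using \<psi> by (simp add: case_prod_beta)
    note s = measurable_sum_delete'[OF \<psi>]
    have "(\<integral>xs. (\<Sum>z\<in>#mset xs. \<psi> z (mset xs - {#z#})) \<partial>poisson_lists) =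
        enn2real (\<integral>\<^sup>+xs. ennreal (\<Sum>z\<in>#mset xs. \<psi> z (mset xs - {#z#})) \<partial>poisson_lists)"
      using s \<psi>0 by (intro integral_eq_nn_integral) (auto intro!: sum_mset_real_nonneg)
    also have "(\<integral>\<^sup>+xs. ennreal (\<Sum>z\<in>#mset xs. \<psi> z (mset xs - {#z#})) \<partial>poisson_lists) =
        (\<integral>\<^sup>+q. ennreal (\<psi> (fst q) (mset (snd q))) \<partial>(L \<Otimes>\<^sub>M poisson_lists))"
      using nn_integral_poisson_lists_delete[OF e] by (simp add: ennreal_sum_mset \<psi>0)
    also have "enn2real \<dots> = (\<integral>q. \<psi> (fst q) (mset (snd q)) \<partial>(L \<Otimes>\<^sub>M poisson_lists))"
      using m \<psi>0 by (intro integral_eq_nn_integral[symmetric]) auto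
    finally show "(\<integral>xs. (\<Sum>z\<in>#mset xs. \<psi> z (mset xs - {#z#})) \<partial>poisson_lists) =
      (\<integral>q. \<psi> (fst q) (mset (snd q)) \<partial>(L \<Otimes>\<^sub>M poisson_lists))" .
    show "integrable poisson_lists (\<lambda>xs. \<Sum>z\<in>#mset xs. \<psi> z (mset xs - {#z#}))"
    proof (rule integrable_poly_bounded[OF s poly_boundedI[where c=c and p="Suc p"]])
      fix N :: "'a multiset"
      have "\<bar>\<Sum>z\<in>#N. \<psi> z (N - {#z#})\<bar> \<le> real (size N) * (c * (1 + real (size N)) ^ p)"
      proof (rule sum_mset_abs_le)
        fix z assume "z \<in># N"
        have "\<bar>\<psi> z (N - {#z#})\<bar> \<le> c * (1 + real (size (N - {#z#}))) ^ p" by (rule b)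
        also have "\<dots> \<le> c * (1 + real (size N)) ^ p"
          using \<open>0 \<le> c\<close> by (intro mult_left_mono power_mono) (auto intro: size_mset_mono)
        finally show "\<bar>\<psi> z (N - {#z#})\<bar> \<le> c * (1 + real (size N)) ^ p" .
      qed
      also have "\<dots> \<le> c * (1 + real (size N)) ^ Suc p"
        using \<open>0 \<le> c\<close> by (simp add: algebra_simps)
      finally show "\<bar>\<Sum>z\<in>#N. \<psi> z (N - {#z#})\<bar> \<le> c * (1 + real (size N)) ^ Suc p" .
    qed
    show "integrable (L \<Otimes>\<^sub>M poisson_lists) (\<lambda>q. \<psi> (fst q) (mset (snd q)))"
      by (rule integrable_pair_poly_bounded[OF \<psi> b])
  qed
  have 1: "(\<lambda>(x, xs). max 0 (\<phi> x (mset xs))) \<in> borel_measurable (X \<Otimes>\<^sub>M LS)"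
    "(\<lambda>(x, xs). max 0 (- \<phi> x (mset xs))) \<in> borel_measurable (X \<Otimes>\<^sub>M LS)"
    using \<phi> by (auto simp: case_prod_beta)
  have 2: "\<bar>max 0 (\<phi> x N)\<bar> \<le> c * (1 + real (size N)) ^ p"
    "\<bar>max 0 (- \<phi> x N)\<bar> \<le> c * (1 + real (size N)) ^ p" for x N
    using cp[of x N] by (auto simp: max_def)
  have 3: "\<phi> x N = max 0 (\<phi> x N) - max 0 (- \<phi> x N)" for x N by auto
  note pos = nonneg[of "\<lambda>x N. max 0 (\<phi> x N)", OF 1(1) _ 2(1)]
    and neg = nonneg[of "\<lambda>x N. max 0 (- \<phi> x N)", OF 1(2) _ 2(2)]
  have "(\<integral>xs. (\<Sum>z\<in>#mset xs. \<phi> z (mset xs - {#z#})) \<partial>poisson_lists) =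
      (\<integral>xs. (\<Sum>z\<in>#mset xs. max 0 (\<phi> z (mset xs - {#z#}))) -
        (\<Sum>z\<in>#mset xs. max 0 (- \<phi> z (mset xs - {#z#}))) \<partial>poisson_lists)"
    by (subst 3) (simp add: sum_mset_real_diff)
  also have "\<dots> = (\<integral>q. max 0 (\<phi> (fst q) (mset (snd q))) - max 0 (- \<phi> (fst q) (mset (snd q))) \<partial>(L \<Otimes>\<^sub>M poisson_lists))"
    using pos neg by simp
  also have "\<dots> = (\<integral>q. \<phi> (fst q) (mset (snd q)) \<partial>(L \<Otimes>\<^sub>M poisson_lists))"
    by (simp only: 3[symmetric])
  finally show ?thesis .
qed

section \<open>Multiple integrals as iterated divergences: growth, difference rule, integration by
  parts\<close>

text \<open>The multiple integral of \<open>g\<close> against the compensated configuration, as an iterated divergence: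
  each step integrates out one variable, over the configuration without the points already used and
  over minus the intensity.\<close>

primrec chaos :: "nat \<Rightarrow> ('a multiset \<Rightarrow> real) \<Rightarrow> 'a multiset \<Rightarrow> real" where
  "chaos 0 g N = g {#}"
| "chaos (Suc k) g N = (\<Sum>z\<in>#N. chaos k (\<lambda>K. g (add_mset z K)) (N - {#z#})) -
     (\<integral>x. chaos k (\<lambda>K. g (add_mset x K)) N \<partial>L)"

lemma chaos_zero [simp]: "chaos k (\<lambda>_. 0) N = 0"
  by (induction k arbitrary: N) auto

text \<open>The recursion passes to integrands with some arguments already inserted. The list
  \<open>us\<close> holds these arguments, so that the induction hypothesis is joint measurability
  in them and in the configuration.\<close>

lemma measurable_chaos_param:
  assumes g: "(\<lambda>xs. g (mset xs)) \<in> borel_measurable LS"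
  shows "(\<lambda>(us, xs). chaos k (\<lambda>K. g (mset us + K)) (mset xs)) \<in> borel_measurable (LS \<Otimes>\<^sub>M LS)"
proof (induction k)
  case 0
  show ?case using measurable_compose[OF measurable_fst g] by (simp add: split_beta')
next
  case (Suc k)
  have *: "(\<lambda>\<omega>. chaos k (\<lambda>K. g (mset (f \<omega>) + add_mset (z \<omega>) K)) (mset (h \<omega>))) \<in> borel_measurable \<Omega>"
    if [measurable]: "f \<in> \<Omega> \<rightarrow>\<^sub>M LS" "z \<in> \<Omega> \<rightarrow>\<^sub>M X" "h \<in> \<Omega> \<rightarrow>\<^sub>M LS"
    for f z h and \<Omega> :: "'z measure"
  proof -
    have "(\<lambda>\<omega>. (f \<omega> @ [z \<omega>], h \<omega>)) \<in> \<Omega> \<rightarrow>\<^sub>M LS \<Otimes>\<^sub>M LS" by measurable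
    from measurable_compose[OF this Suc.IH] show ?thesis by simp
  qed
  have "(\<lambda>(us, xs). \<Sum>z\<in>#mset xs. chaos k (\<lambda>K. g (mset us + add_mset z K)) (mset xs - {#z#}))
      \<in> borel_measurable (LS \<Otimes>\<^sub>M LS)"
    by (rule measurable_sum_delete) (simp add: split_beta' *[simplified])
  moreover have "(\<lambda>p. \<integral>x. chaos k (\<lambda>K. g (mset (fst p) + add_mset x K)) (mset (snd p)) \<partial>L)
      \<in> borel_measurable (LS \<Otimes>\<^sub>M LS)"
    by (rule borel_measurable_lebesgue_integral) (simp add: split_beta' *[simplified] cong: measurable_cong_sets)
  ultimately show ?case by (simp add: split_beta')
qed

lemma measurable_chaos:
  assumes g: "(\<lambda>xs. g (mset xs)) \<in> borel_measurable LS"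
  shows "(\<lambda>xs. chaos k g (mset xs)) \<in> borel_measurable LS"
  using measurable_compose[OF measurable_Pair1'[of "[]" LS LS] measurable_chaos_param[OF g]] by simp

lemma measurable_chaos_add:
  assumes g: "(\<lambda>xs. g (mset xs)) \<in> borel_measurable LS"
  shows "(\<lambda>(x, xs). chaos k (\<lambda>K. g (add_mset x K)) (mset xs)) \<in> borel_measurable (X \<Otimes>\<^sub>M LS)"
proof -
  have "(\<lambda>p. ([fst p], snd p)) \<in> X \<Otimes>\<^sub>M LS \<rightarrow>\<^sub>M LS \<Otimes>\<^sub>M LS" by measurable
  from measurable_compose[OF this measurable_chaos_param[OF g]] show ?thesis
    by (simp add: split_beta')
qed

lemma measurable_chaos_add':
  assumes g: "(\<lambda>xs. g (mset xs)) \<in> borel_measurable LS" and xs: "xs \<in> lists (space X)"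
  shows "(\<lambda>x. chaos k (\<lambda>K. g (add_mset x K)) (mset xs)) \<in> borel_measurable L"
  using measurable_compose[OF measurable_Pair2'[of xs LS X] measurable_chaos_add[OF g]] xs
  by (simp cong: measurable_cong_sets)

lemma measurable_add_mset:
  assumes g: "(\<lambda>xs. g (mset xs)) \<in> borel_measurable LS" and x: "x \<in> space X"
  shows "(\<lambda>xs. g (add_mset x (mset xs))) \<in> borel_measurable LS"
proof -
  have "(\<lambda>xs. x # xs) \<in> LS \<rightarrow>\<^sub>M LS" using x by measurable
  from measurable_compose[OF this g] show ?thesis by simp
qed

text \<open>Each step integrates over the points of \<open>N\<close> and over minus
  \<open>L\<close>, of total variation at most \<open>size N + \<tau>\<close>.\<close>

lemma abs_chaos_le:
  assumes g: "\<And>K. \<bar>g K\<bar> \<le> c"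
  shows "\<bar>chaos k g N\<bar> \<le> c * (real (size N) + \<tau>) ^ k"
  using g
proof (induction k arbitrary: g N)
  case (Suc k)
  have "0 \<le> c" using Suc.prems[of "{#}"] by simp
  have IH: "\<bar>chaos k (\<lambda>K. g (add_mset x K)) N'\<bar> \<le> c * (real (size N') + \<tau>) ^ k" for x N'
    by (rule Suc.IH) (rule Suc.prems)
  have "\<bar>\<Sum>z\<in>#N. chaos k (\<lambda>K. g (add_mset z K)) (N - {#z#})\<bar> \<le> real (size N) * (c * (real (size N) + \<tau>) ^ k)"
  proof (rule sum_mset_abs_le)
    fix z assume "z \<in># N"
    have "\<bar>chaos k (\<lambda>K. g (add_mset z K)) (N - {#z#})\<bar> \<le> c * (real (size (N - {#z#})) + \<tau>) ^ k"
      by (rule IH)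
    also have "\<dots> \<le> c * (real (size N) + \<tau>) ^ k"
      using \<open>0 \<le> c\<close> by (intro mult_left_mono power_mono) (auto intro: size_mset_mono)
    finally show "\<bar>chaos k (\<lambda>K. g (add_mset z K)) (N - {#z#})\<bar> \<le> c * (real (size N) + \<tau>) ^ k" .
  qed
  moreover have "\<bar>\<integral>x. chaos k (\<lambda>K. g (add_mset x K)) N \<partial>L\<bar> \<le> \<tau> * (c * (real (size N) + \<tau>) ^ k)"
  proof (cases "integrable L (\<lambda>x. chaos k (\<lambda>K. g (add_mset x K)) N)")
    case True
    have "\<bar>\<integral>x. chaos k (\<lambda>K. g (add_mset x K)) N \<partial>L\<bar> \<le> (\<integral>x. \<bar>chaos k (\<lambda>K. g (add_mset x K)) N\<bar> \<partial>L)"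
      by (rule integral_abs_bound)
    also have "\<dots> \<le> (\<integral>x. c * (real (size N) + \<tau>) ^ k \<partial>L)"
      using True by (intro integral_mono IH) auto
    finally show ?thesis by simp
  qed (use \<open>0 \<le> c\<close> in \<open>simp add: not_integrable_integral_eq\<close>)
  ultimately show ?case by (simp add: algebra_simps)
qed simp

lemma poly_bounded_chaos:
  assumes g: "\<And>K. \<bar>g K\<bar> \<le> c"
  shows "poly_bounded (chaos k g)"
    "\<bar>chaos k g N\<bar> \<le> c * (1 + \<tau>) ^ k * (1 + real (size N)) ^ k"
proof -
  have "0 \<le> c" using g[of "{#}"] by simp
  show *: "\<bar>chaos k g N\<bar> \<le> c * (1 + \<tau>) ^ k * (1 + real (size N)) ^ k" for N
  proof -
    have "\<bar>chaos k g N\<bar> \<le> c * (real (size N) + \<tau>) ^ k" by (rule abs_chaos_le[OF g])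
    also have "\<dots> \<le> c * ((1 + \<tau>) * (1 + real (size N))) ^ k"
      using \<open>0 \<le> c\<close> by (intro mult_left_mono power_mono) (auto simp: algebra_simps)
    finally show ?thesis by (simp add: power_mult_distrib mult.assoc)
  qed
  show "poly_bounded (chaos k g)"
    by (rule poly_boundedI[OF *])
qed

lemma integrable_chaos_add:
  assumes g: "(\<lambda>xs. g (mset xs)) \<in> borel_measurable LS" "\<And>K. \<bar>g K\<bar> \<le> c"
    and xs: "xs \<in> lists (space X)"
  shows "integrable L (\<lambda>x. chaos k (\<lambda>K. g (add_mset x K)) (mset xs))"
  by (rule integrable_const_bound[where B="c * (real (size (mset xs)) + \<tau>) ^ k"])
    (auto intro!: AE_I2 abs_chaos_le g measurable_chaos_add' xs simp del: size_mset)

text \<open>The difference rule D_y I_m(h) = m I_{m-1}(h(y, .)), with \<open>m\<close> raised by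
  one. The new point is either picked in the outermost step or left for the inner integrals; the
  latter are covered by induction, because an integrand on multisets lets \<open>y\<close> move past
  the other arguments.\<close>

theorem chaos_add_mset:
  assumes h: "(\<lambda>xs. h (mset xs)) \<in> borel_measurable LS" "\<And>K. \<bar>h K\<bar> \<le> c"
    and y: "y \<in> space X" and N: "set_mset N \<subseteq> space X"
  shows "chaos (Suc m) h (add_mset y N) = chaos (Suc m) h N + real (Suc m) * chaos m (\<lambda>K. h (add_mset y K)) N"
  using h N
proof (induction m arbitrary: h N)
  case 0
  then show ?case by (simp add: sum_mset_delete_add)
next
  case (Suc m)
  let ?h = "\<lambda>x K. h (add_mset x K)"
  obtain xs where xs: "N = mset xs" "xs \<in> lists (space X)"
    using Suc.prems(3) by (metis ex_mset in_listsI set_mset_mset subsetD)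
  have c: "\<bar>?h x K\<bar> \<le> c" for x K by (rule Suc.prems)
  have m: "(\<lambda>xs. ?h x (mset xs)) \<in> borel_measurable LS" if "x \<in> space X" for x
    by (rule measurable_add_mset[OF Suc.prems(1) that])
  have IH: "chaos (Suc m) (?h x) (add_mset y N') =
      chaos (Suc m) (?h x) N' + real (Suc m) * chaos m (\<lambda>K. ?h y (add_mset x K)) N'"
    if "x \<in> space X" "set_mset N' \<subseteq> space X" for x N'
    using Suc.IH[OF m[OF that(1)] c that(2)] by (simp only: add_mset_commute[of y x])
  have "(\<Sum>z\<in>#N. chaos (Suc m) (?h z) (add_mset y (N - {#z#}))) =
     (\<Sum>z\<in>#N. chaos (Suc m) (?h z) (N - {#z#}) + real (Suc m) * chaos m (\<lambda>K. ?h y (add_mset z K)) (N - {#z#}))"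
    using Suc.prems(3)
    by (intro arg_cong[where f=sum_mset] image_mset_cong IH) (auto dest: in_diffD)
  also have "\<dots> = (\<Sum>z\<in>#N. chaos (Suc m) (?h z) (N - {#z#})) +
      real (Suc m) * (\<Sum>z\<in>#N. chaos m (\<lambda>K. ?h y (add_mset z K)) (N - {#z#}))"
    by (simp only: sum_mset.distrib sum_mset_distrib_left)
  finally have 1: "(\<Sum>z\<in>#N. chaos (Suc m) (?h z) (add_mset y (N - {#z#}))) = \<dots>" .
  have "(\<integral>x. chaos (Suc m) (?h x) (add_mset y N) \<partial>L) =
      (\<integral>x. chaos (Suc m) (?h x) N + real (Suc m) * chaos m (\<lambda>K. ?h y (add_mset x K)) N \<partial>L)"
    using Suc.prems(3) by (intro Bochner_Integration.integral_cong refl IH) (auto simp: space_L)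
  also have "\<dots> = (\<integral>x. chaos (Suc m) (?h x) N \<partial>L) + real (Suc m) * (\<integral>x. chaos m (\<lambda>K. ?h y (add_mset x K)) N \<partial>L)"
    using integrable_chaos_add[OF Suc.prems(1,2) xs(2), of "Suc m"]
      integrable_chaos_add[OF m[OF y] c xs(2), of m]
    by (subst Bochner_Integration.integral_add) (auto simp: xs(1) simp del: chaos.simps)
  finally have 2: "(\<integral>x. chaos (Suc m) (?h x) (add_mset y N) \<partial>L) = \<dots>" .
  have "chaos (Suc (Suc m)) h (add_mset y N) = (chaos (Suc m) (?h y) N +
      (\<Sum>z\<in>#N. chaos (Suc m) (?h z) (add_mset y (N - {#z#})))) - (\<integral>x. chaos (Suc m) (?h x) (add_mset y N) \<partial>L)"
    by (subst chaos.simps(2), subst sum_mset_delete_add[of "\<lambda>z. chaos (Suc m) (?h z)"]) simp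
  also have "\<dots> = ((\<Sum>z\<in>#N. chaos (Suc m) (?h z) (N - {#z#})) - (\<integral>x. chaos (Suc m) (?h x) N \<partial>L)) +
     chaos (Suc m) (?h y) N + real (Suc m) * ((\<Sum>z\<in>#N. chaos m (\<lambda>K. ?h y (add_mset z K)) (N - {#z#})) -
       (\<integral>x. chaos m (\<lambda>K. ?h y (add_mset x K)) N \<partial>L))"
    unfolding 1 2 by (simp only: algebra_simps)
  also have "\<dots> = chaos (Suc (Suc m)) h N + chaos (Suc m) (?h y) N + real (Suc m) * chaos (Suc m) (?h y) N"
    by (simp only: chaos.simps(2))
  finally show ?case by (simp add: algebra_simps del: chaos.simps)
qed

text \<open>Integration by parts. The Mecke equation turns the sum over points in the outermost step
  into an integral over \<open>L\<close> with the point added to the configuration; subtracting the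
  compensator leaves the difference operator on \<open>F\<close>. Polynomial growth makes the two
  parts integrable separately.\<close>

lemma integral_mult_chaos:
  assumes F: "(\<lambda>xs. F (mset xs)) \<in> borel_measurable LS" "\<And>N. \<bar>F N\<bar> \<le> d * (1 + real (size N)) ^ p"
    and g: "(\<lambda>xs. g (mset xs)) \<in> borel_measurable LS" "\<And>K. \<bar>g K\<bar> \<le> c"
  shows "(\<integral>xs. F (mset xs) * chaos (Suc k) g (mset xs) \<partial>poisson_lists) =
    (\<integral>x. \<integral>xs. (F (add_mset x (mset xs)) - F (mset xs)) * chaos k (\<lambda>K. g (add_mset x K)) (mset xs)
      \<partial>poisson_lists \<partial>L)"
proof -
  let ?g = "\<lambda>x K. g (add_mset x K)"
  let ?\<phi> = "\<lambda>x N. F (add_mset x N) * chaos k (?g x) N" and ?\<psi> = "\<lambda>x N. F N * chaos k (?g x) N"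
  have "0 \<le> d" using F(2)[of "{#}"] by simp
  have "0 \<le> c" using g(2)[of "{#}"] by simp
  note [measurable] = F(1)
  have gm [measurable]: "(\<lambda>p. chaos k (?g (fst p)) (mset (snd p))) \<in> borel_measurable (X \<Otimes>\<^sub>M LS)"
    using measurable_chaos_add[OF g(1)] by (simp add: split_beta')
  have "(\<lambda>p. fst p # snd p) \<in> X \<Otimes>\<^sub>M LS \<rightarrow>\<^sub>M LS" by measurable
  from measurable_compose[OF this F(1)]
  have [measurable]: "(\<lambda>p. F (add_mset (fst p) (mset (snd p)))) \<in> borel_measurable (X \<Otimes>\<^sub>M LS)" by simp
  have \<phi>: "(\<lambda>(x, xs). ?\<phi> x (mset xs)) \<in> borel_measurable (X \<Otimes>\<^sub>M LS)"
    and \<psi>: "(\<lambda>(x, xs). ?\<psi> x (mset xs)) \<in> borel_measurable (X \<Otimes>\<^sub>M LS)"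
    by (simp_all add: split_beta')
  let ?b = "d * 2 ^ p * (c * (1 + \<tau>) ^ k)"
  have g': "\<bar>chaos k (?g x) N\<bar> \<le> c * (1 + \<tau>) ^ k * (1 + real (size N)) ^ k" for x N
    by (rule poly_bounded_chaos) (rule g)
  have F': "\<bar>F (add_mset x N)\<bar> \<le> d * 2 ^ p * (1 + real (size N)) ^ p" for x N
  proof -
    have "\<bar>F (add_mset x N)\<bar> \<le> d * (2 + real (size N)) ^ p" using F(2)[of "add_mset x N"] by simp
    also have "\<dots> \<le> d * (2 * (1 + real (size N))) ^ p"
      using \<open>0 \<le> d\<close> by (intro mult_left_mono power_mono) auto
    finally show ?thesis by (simp only: power_mult_distrib mult.assoc)
  qed
  have F'': "\<bar>F N\<bar> \<le> d * 2 ^ p * (1 + real (size N)) ^ p" for N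
  proof -
    have "d * (1 + real (size N)) ^ p * 1 \<le> d * (1 + real (size N)) ^ p * 2 ^ p"
      using \<open>0 \<le> d\<close> by (intro mult_left_mono) auto
    then show ?thesis using F(2)[of N] by (simp add: ac_simps)
  qed
  have b: "\<bar>f * chaos k (?g x) N\<bar> \<le> ?b * (1 + real (size N)) ^ (p + k)"
    if "\<bar>f\<bar> \<le> d * 2 ^ p * (1 + real (size N)) ^ p" for f x N
  proof -
    have "\<bar>f * chaos k (?g x) N\<bar> \<le>
        (d * 2 ^ p * (1 + real (size N)) ^ p) * (c * (1 + \<tau>) ^ k * (1 + real (size N)) ^ k)"
      unfolding abs_mult by (intro mult_mono that g') (use \<open>0 \<le> d\<close> in auto)
    then show ?thesis by (simp add: power_add ac_simps)
  qed
  have i\<phi>: "integrable (L \<Otimes>\<^sub>M poisson_lists) (\<lambda>q. ?\<phi> (fst q) (mset (snd q)))"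
    by (rule integrable_pair_poly_bounded[OF \<phi> b[OF F']])
  have i\<psi>: "integrable (L \<Otimes>\<^sub>M poisson_lists) (\<lambda>q. ?\<psi> (fst q) (mset (snd q)))"
    by (rule integrable_pair_poly_bounded[OF \<psi> b[OF F'']])
  \<comment> \<open>Inside the sum, \<open>N\<close> is the configuration without \<open>z\<close>
    with \<open>z\<close> put back; this is the form to which the Mecke equation applies.\<close>
  have del: "F N * (\<Sum>z\<in>#N. chaos k (?g z) (N - {#z#})) = (\<Sum>z\<in>#N. ?\<phi> z (N - {#z#}))" for N
    by (auto simp: sum_mset_distrib_left intro!: arg_cong[where f=sum_mset] image_mset_cong)
  have i1: "integrable poisson_lists (\<lambda>xs. \<Sum>z\<in>#mset xs. ?\<phi> z (mset xs - {#z#}))"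
  proof (rule integrable_poly_bounded[OF measurable_sum_delete'[OF \<phi>] poly_boundedI[where c="?b" and p="Suc (p + k)"]])
    fix N :: "'a multiset"
    have "\<bar>\<Sum>z\<in>#N. ?\<phi> z (N - {#z#})\<bar> \<le> real (size N) * (?b * (1 + real (size N)) ^ (p + k))"
    proof (rule sum_mset_abs_le)
      fix z assume "z \<in># N"
      have "\<bar>?\<phi> z (N - {#z#})\<bar> \<le> ?b * (1 + real (size (N - {#z#}))) ^ (p + k)" by (rule b[OF F'])
      also have "\<dots> \<le> ?b * (1 + real (size N)) ^ (p + k)"
        using \<open>0 \<le> c\<close> \<open>0 \<le> d\<close> by (intro mult_left_mono power_mono) (auto intro: size_mset_mono)
      finally show "\<bar>?\<phi> z (N - {#z#})\<bar> \<le> ?b * (1 + real (size N)) ^ (p + k)" .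
    qed
    also have "\<dots> \<le> ?b * (1 + real (size N)) ^ Suc (p + k)"
      using \<open>0 \<le> c\<close> \<open>0 \<le> d\<close> by (simp add: algebra_simps)
    finally show "\<bar>\<Sum>z\<in>#N. ?\<phi> z (N - {#z#})\<bar> \<le> ?b * (1 + real (size N)) ^ Suc (p + k)" .
  qed
  have i\<psi>': "integrable (L \<Otimes>\<^sub>M poisson_lists) (\<lambda>(x, xs). ?\<psi> x (mset xs))"
    using i\<psi> by (simp add: split_beta')
  have i2: "integrable poisson_lists (\<lambda>xs. \<integral>x. ?\<psi> x (mset xs) \<partial>L)"
    by (rule LP.integrable_snd[OF i\<psi>'])
  have eq: "F N * chaos (Suc k) g N = (\<Sum>z\<in>#N. ?\<phi> z (N - {#z#})) - (\<integral>x. ?\<psi> x N \<partial>L)" for N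
    by (simp add: right_diff_distrib del)
  have "(\<integral>xs. F (mset xs) * chaos (Suc k) g (mset xs) \<partial>poisson_lists) =
      (\<integral>xs. (\<Sum>z\<in>#mset xs. ?\<phi> z (mset xs - {#z#})) \<partial>poisson_lists) -
      (\<integral>xs. \<integral>x. ?\<psi> x (mset xs) \<partial>L \<partial>poisson_lists)"
    unfolding eq using i1 i2 by (rule Bochner_Integration.integral_diff)
  also have "(\<integral>xs. (\<Sum>z\<in>#mset xs. ?\<phi> z (mset xs - {#z#})) \<partial>poisson_lists) =
      (\<integral>q. ?\<phi> (fst q) (mset (snd q)) \<partial>(L \<Otimes>\<^sub>M poisson_lists))"
    by (rule integral_poisson_lists_delete[OF \<phi> b[OF F']])
  also have "(\<integral>xs. \<integral>x. ?\<psi> x (mset xs) \<partial>L \<partial>poisson_lists) =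
      (\<integral>q. ?\<psi> (fst q) (mset (snd q)) \<partial>(L \<Otimes>\<^sub>M poisson_lists))"
    using LP.integral_snd[OF i\<psi>'] by (simp add: split_beta')
  also have "(\<integral>q. ?\<phi> (fst q) (mset (snd q)) \<partial>(L \<Otimes>\<^sub>M poisson_lists)) -
      (\<integral>q. ?\<psi> (fst q) (mset (snd q)) \<partial>(L \<Otimes>\<^sub>M poisson_lists)) =
      (\<integral>q. (F (add_mset (fst q) (mset (snd q))) - F (mset (snd q))) * chaos k (?g (fst q)) (mset (snd q))
        \<partial>(L \<Otimes>\<^sub>M poisson_lists))"
    using i\<phi> i\<psi> by (simp add: left_diff_distrib)
  also have "\<dots> = (\<integral>x. \<integral>xs. (F (add_mset x (mset xs)) - F (mset xs)) * chaos k (?g x) (mset xs)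
      \<partial>poisson_lists \<partial>L)"
    using LP.integral_fst'[of "\<lambda>q. (F (add_mset (fst q) (mset (snd q))) - F (mset (snd q))) * chaos k (?g (fst q)) (mset (snd q))"]
      Bochner_Integration.integrable_diff[OF i\<phi> i\<psi>] by (simp add: left_diff_distrib)
  finally show "(\<integral>xs. F (mset xs) * chaos (Suc k) g (mset xs) \<partial>poisson_lists) =
    (\<integral>x. \<integral>xs. (F (add_mset x (mset xs)) - F (mset xs)) * chaos k (\<lambda>K. g (add_mset x K)) (mset xs)
      \<partial>poisson_lists \<partial>L)" .
qed

section \<open>Orthogonality of multiple integrals when part of the configuration is frozen\<close>

lemma integrable_points:
  fixes f :: "'a list \<Rightarrow> real"
  assumes "f \<in> borel_measurable LS" "\<And>xs. \<bar>f xs\<bar> \<le> c"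
  shows "integrable (points n) f"
  by (rule finite_measure.integrable_const_bound[OF finite_measure_points, where B=c])
    (use assms in \<open>auto cong: measurable_cong_sets\<close>)

lemma integral_points_Suc:
  fixes f :: "'a list \<Rightarrow> real"
  assumes f: "f \<in> borel_measurable LS" "\<And>xs. \<bar>f xs\<bar> \<le> c"
  shows "(\<integral>xs. f xs \<partial>points (Suc n)) = (\<integral>x. \<integral>xs. f (x # xs) \<partial>points n \<partial>L)"
    and "integrable L (\<lambda>x. \<integral>xs. f (x # xs) \<partial>points n)"
proof -
  interpret P: finite_measure "points n" by (rule finite_measure_points)
  interpret LPn: pair_sigma_finite L "points n" ..
  interpret Q: finite_measure "L \<Otimes>\<^sub>M points n"
    by (intro finite_measure_pair_measure finite_measure_axioms P.finite_measure_axioms)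
  have c: "(\<lambda>p. fst p # snd p) \<in> L \<Otimes>\<^sub>M points n \<rightarrow>\<^sub>M LS" by measurable
  have m: "(\<lambda>p. f (fst p # snd p)) \<in> borel_measurable (L \<Otimes>\<^sub>M points n)"
    by (rule measurable_compose[OF c f(1)])
  have i: "integrable (L \<Otimes>\<^sub>M points n) (\<lambda>p. f (fst p # snd p))"
    by (rule Q.integrable_const_bound[where B=c]) (use f(2) m in auto)
  have "(\<integral>xs. f xs \<partial>points (Suc n)) = (\<integral>p. f (fst p # snd p) \<partial>(L \<Otimes>\<^sub>M points n))"
    using c f(1) by (simp add: integral_distr split_beta')
  also have "\<dots> = (\<integral>x. \<integral>xs. f (x # xs) \<partial>points n \<partial>L)"
    using LPn.integral_fst'[OF i] by simp
  finally show "(\<integral>xs. f xs \<partial>points (Suc n)) = (\<integral>x. \<integral>xs. f (x # xs) \<partial>points n \<partial>L)" .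
  show "integrable L (\<lambda>x. \<integral>xs. f (x # xs) \<partial>points n)"
    using LPn.integrable_fst'[OF i] by simp
qed

text \<open>For an integrand on \<open>k\<close>-tuples this multiplies by the indicator of the
  \<open>k\<close>-th power of \<open>W\<close>. The multiple integral of \<open>cut W h\<close> is
  the component of that of \<open>h\<close> carried by the points in \<open>W\<close>.\<close>

definition cut :: "'a set \<Rightarrow> ('a multiset \<Rightarrow> real) \<Rightarrow> 'a multiset \<Rightarrow> real" where
  "cut W g K = g K * of_bool (set_mset K \<subseteq> W)"

lemma cut_add:
  "(\<lambda>K. cut W g (add_mset x K)) = (if x \<in> W then cut W (\<lambda>K. g (add_mset x K)) else (\<lambda>_. 0))"
  by (auto simp: cut_def fun_eq_iff)

lemma measurable_cut:
  assumes "(\<lambda>xs. g (mset xs)) \<in> borel_measurable LS" and W [measurable]: "W \<in> sets X"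
  shows "(\<lambda>xs. cut W g (mset xs)) \<in> borel_measurable LS"
proof -
  have [measurable]: "Measurable.pred LS (\<lambda>xs. \<forall>x\<in>set xs. x \<in> W)"
    by (rule measurable_filter_stopping(3)[OF stopping_lists_const[OF W], of "\<lambda>x. x" _ "\<lambda>x. x"]) auto
  have "(\<lambda>xs. g (mset xs) * of_bool (\<forall>x\<in>set xs. x \<in> W)) \<in> borel_measurable LS"
    using assms(1) by measurable
  then show ?thesis by (simp add: cut_def subset_eq)
qed

lemma abs_cut_le: "(\<And>K. \<bar>g K\<bar> \<le> c) \<Longrightarrow> \<bar>cut W g K\<bar> \<le> c"
  using abs_ge_zero[of "g K"] by (auto simp: cut_def of_bool_def dest: meta_spec[of _ K])

lemma set_filter_subset_space: "as \<in> lists (space X) \<Longrightarrow> xs \<in> lists (space X) \<Longrightarrow>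
    set_mset (mset as + filter_mset P (mset xs)) \<subseteq> space X"
  by auto

lemma measurable_chaos_freeze:
  assumes h: "(\<lambda>xs. h (mset xs)) \<in> borel_measurable LS" and as: "as \<in> lists (space X)" and W: "W \<in> sets X"
  shows "(\<lambda>xs. chaos m h (mset as + filter_mset (\<lambda>x. x \<in> W) (mset xs))) \<in> borel_measurable LS"
proof -
  have "(\<lambda>xs. filter (\<lambda>x. x \<in> W) xs) \<in> LS \<rightarrow>\<^sub>M LS"
    by (rule measurable_filter_stopping(1)[OF stopping_lists_const[OF W], of "\<lambda>x. x" _ "\<lambda>x. x"]) auto
  then have "(\<lambda>xs. as @ filter (\<lambda>x. x \<in> W) xs) \<in> LS \<rightarrow>\<^sub>M LS"
    using as by (intro measurable_append measurable_const) auto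
  from measurable_compose[OF this measurable_chaos[OF h]] show ?thesis by simp
qed

lemma abs_chaos_freeze_le:
  assumes h: "\<And>K. \<bar>h K\<bar> \<le> c"
  shows "\<bar>chaos m h (mset as + filter_mset P N)\<bar> \<le> c * (1 + size as + \<tau>) ^ m * (1 + real (size N)) ^ m"
proof -
  have "0 \<le> c" using h[of "{#}"] by simp
  have "\<bar>chaos m h (mset as + filter_mset P N)\<bar> \<le> c * (real (size (mset as + filter_mset P N)) + \<tau>) ^ m"
    by (rule abs_chaos_le) (rule h)
  also have "\<dots> \<le> c * ((1 + size as + \<tau>) * (1 + real (size N))) ^ m"
  proof (intro mult_left_mono power_mono)
    have "real (size (filter_mset P N)) \<le> real (size N)"
      by (simp add: size_filter_mset_lesseq)
    moreover have "0 \<le> real (length as) * real (size N) + real (size N) * \<tau>" by simp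
    ultimately have "real (size (filter_mset P N)) \<le>
        1 + (real (size N) + (real (length as) * real (size N) + real (size N) * \<tau>))"
      by linarith
    then show "real (size (mset as + filter_mset P N)) + \<tau> \<le> (1 + size as + \<tau>) * (1 + real (size N))"
      by (simp add: algebra_simps)
  qed (use \<open>0 \<le> c\<close> in auto)
  finally show ?thesis by (simp add: power_mult_distrib mult.assoc)
qed

theorem integral_chaos_mult_chaos:
  assumes W: "W \<in> sets X" and as: "as \<in> lists (space X)"
    and h: "(\<lambda>xs. h (mset xs)) \<in> borel_measurable LS" "\<And>K. \<bar>h K\<bar> \<le> c"
    and g: "(\<lambda>xs. g (mset xs)) \<in> borel_measurable LS" "\<And>K. \<bar>g K\<bar> \<le> d"
    and mk: "m \<le> k"
  shows "(\<integral>xs. chaos m h (mset as + filter_mset (\<lambda>x. x \<in> W) (mset xs)) * chaos k (cut W g) (mset xs) \<partial>poisson_lists) =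
    (if m = k then fact k * (\<integral>ys. h (mset ys) * cut W g (mset ys) \<partial>points k) else 0)"
  using h g mk
proof (induction k arbitrary: m h g)
  case 0
  then have "(\<lambda>xs. h (mset xs) * cut W g (mset xs)) \<in> borel_measurable LS"
    using measurable_cut[OF 0(3) W] by measurable
  with 0 show ?case by (simp add: integral_return PL.prob_space[simplified])
next
  case (Suc k)
  note h = Suc.prems(1,2) and g = Suc.prems(3,4)
  let ?F = "\<lambda>N. chaos m h (mset as + filter_mset (\<lambda>x. x \<in> W) N)"
  let ?h = "\<lambda>x K. h (add_mset x K)" and ?g = "\<lambda>x K. g (add_mset x K)"
  have "0 \<le> c" using h(2)[of "{#}"] by simp
  have "0 \<le> d" using g(2)[of "{#}"] by simp
  have Fm: "(\<lambda>xs. ?F (mset xs)) \<in> borel_measurable LS"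
    by (rule measurable_chaos_freeze[OF h(1) as W])
  have Fb: "\<bar>?F N\<bar> \<le> c * (1 + size as + \<tau>) ^ m * (1 + real (size N)) ^ m" for N
    by (rule abs_chaos_freeze_le[OF h(2)])
  have step: "(\<integral>xs. (?F (add_mset x (mset xs)) - ?F (mset xs)) * chaos k (\<lambda>K. cut W g (add_mset x K)) (mset xs)
        \<partial>poisson_lists) =
      (if m = Suc k then fact (Suc k) * (\<integral>ys. h (mset (x # ys)) * cut W g (mset (x # ys)) \<partial>points k) else 0)"
    if x: "x \<in> space L" for x
  proof (cases "x \<in> W")
    case False
    then show ?thesis by (auto simp: cut_add cut_def)
  next
    case True
    have x': "x \<in> space X" using x by (simp add: space_L)
    show ?thesis
    proof (cases m)
      case (Suc m')
      have "(\<integral>xs. (?F (add_mset x (mset xs)) - ?F (mset xs)) * chaos k (\<lambda>K. cut W g (add_mset x K)) (mset xs)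
        \<partial>poisson_lists) = (\<integral>xs. real m * (chaos m' (?h x) (mset as + filter_mset (\<lambda>x. x \<in> W) (mset xs)) *
          chaos k (cut W (?g x)) (mset xs)) \<partial>poisson_lists)"
      proof (rule Bochner_Integration.integral_cong[OF refl])
        fix xs assume "xs \<in> space poisson_lists"
        then have "xs \<in> lists (space X)" by simp
        from chaos_add_mset[OF h x' set_filter_subset_space[OF as this], of m' "\<lambda>x. x \<in> W"]
        show "(?F (add_mset x (mset xs)) - ?F (mset xs)) * chaos k (\<lambda>K. cut W g (add_mset x K)) (mset xs) =
          real m * (chaos m' (?h x) (mset as + filter_mset (\<lambda>x. x \<in> W) (mset xs)) *
          chaos k (cut W (?g x)) (mset xs))"
          using True by (simp add: Suc cut_add del: chaos.simps)
      qed
      \<comment> \<open>The factors \<open>m\<close> from successive difference rules multiply up to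
        the factorial.\<close>
      also have "\<dots> = real m * (if m' = k then fact k * (\<integral>ys. ?h x (mset ys) * cut W (?g x) (mset ys) \<partial>points k) else 0)"
        using Suc Suc.prems(5)
        by (subst integral_mult_right_zero, subst Suc.IH)
          (auto intro!: measurable_add_mset h g x')
      finally show ?thesis using True by (simp add: Suc cut_def algebra_simps)
    qed simp
  qed
  have "(\<integral>xs. ?F (mset xs) * chaos (Suc k) (cut W g) (mset xs) \<partial>poisson_lists) =
      (\<integral>x. \<integral>xs. (?F (add_mset x (mset xs)) - ?F (mset xs)) * chaos k (\<lambda>K. cut W g (add_mset x K)) (mset xs)
        \<partial>poisson_lists \<partial>L)"
    by (rule integral_mult_chaos[OF Fm Fb measurable_cut[OF g(1) W] abs_cut_le[OF g(2)]])
  also have "\<dots> = (\<integral>x. (if m = Suc k then fact (Suc k) * (\<integral>ys. h (mset (x # ys)) * cut W g (mset (x # ys)) \<partial>points k) else 0) \<partial>L)"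
    by (rule Bochner_Integration.integral_cong[OF refl step])
  also have "\<dots> = (if m = Suc k then fact (Suc k) * (\<integral>ys. h (mset ys) * cut W g (mset ys) \<partial>points (Suc k)) else 0)"
  proof -
    have "(\<integral>ys. h (mset ys) * cut W g (mset ys) \<partial>points (Suc k)) =
        (\<integral>x. \<integral>ys. h (mset (x # ys)) * cut W g (mset (x # ys)) \<partial>points k \<partial>L)"
    proof (rule integral_points_Suc(1)[where c="c * d"])
      show "(\<lambda>ys. h (mset ys) * cut W g (mset ys)) \<in> borel_measurable LS"
        using h(1) measurable_cut[OF g(1) W] by measurable
      show "\<bar>h (mset xs) * cut W g (mset xs)\<bar> \<le> c * d" for xs
        unfolding abs_mult by (intro mult_mono h(2) abs_cut_le g(2) \<open>0 \<le> c\<close>) simp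
    qed
    then show ?thesis by simp
  qed
  finally show ?case .
qed

end

section \<open>Enumerating the points of a counting measure\<close>

definition dirac_sum :: "'a measure \<Rightarrow> 'a list \<Rightarrow> 'a measure" where
  "dirac_sum X xs = distr (count_space {..<length xs}) X (\<lambda>i. xs ! i)"

lemma sets_dirac_sum [simp]: "sets (dirac_sum X xs) = sets X"
  by (simp add: dirac_sum_def)

lemma emeasure_dirac_sum:
  assumes "xs \<in> lists (space X)" "A \<in> sets X"
  shows "emeasure (dirac_sum X xs) A = of_nat (length (filter (\<lambda>x. x \<in> A) xs))"
proof -
  have "(\<lambda>i. xs ! i) \<in> count_space {..<length xs} \<rightarrow>\<^sub>M X"
    using assms(1) by (auto simp: in_lists_conv_set)
  then have "emeasure (dirac_sum X xs) A = emeasure (count_space {..<length xs}) ((\<lambda>i. xs ! i) -` A \<inter> {..<length xs})"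
    using assms(2) by (simp add: dirac_sum_def emeasure_distr)
  also have "(\<lambda>i. xs ! i) -` A \<inter> {..<length xs} = {i. i < length xs \<and> xs ! i \<in> A}" by auto
  also have "emeasure (count_space {..<length xs}) \<dots> = of_nat (card {i. i < length xs \<and> xs ! i \<in> A})"
    by (subst emeasure_count_space) auto
  finally show ?thesis by (simp add: length_filter_conv_card)
qed

lemma sets_restr [simp]: "sets (restr \<mu> A) = sets \<mu>"
  by (simp add: restr_def)

lemma emeasure_restr': "sets \<mu> = sets X \<Longrightarrow> A \<in> sets X \<Longrightarrow> C \<in> sets X \<Longrightarrow>
    emeasure (restr \<mu> A) C = emeasure \<mu> (C \<inter> A)"
  by (rule emeasure_restr) auto

lemma dirac_sum_cong: "mset xs = mset ys \<Longrightarrow> xs \<in> lists (space X) \<Longrightarrow> dirac_sum X xs = dirac_sum X ys"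
proof (rule measure_eqI)
  fix A assume xy: "mset xs = mset ys" and x: "xs \<in> lists (space X)" and "A \<in> sets (dirac_sum X xs)"
  then have A: "A \<in> sets X" by simp
  have y: "ys \<in> lists (space X)" using x mset_eq_setD[OF xy] by (auto simp: in_lists_conv_set)
  have "length (filter (\<lambda>x. x \<in> A) xs) = length (filter (\<lambda>x. x \<in> A) ys)"
    using xy by (metis mset_filter size_mset)
  then show "emeasure (dirac_sum X xs) A = emeasure (dirac_sum X ys) A"
    by (simp add: emeasure_dirac_sum x y A)
qed simp

lemma restr_dirac_sum:
  assumes "xs \<in> lists (space X)" "W \<in> sets X"
  shows "restr (dirac_sum X xs) W = dirac_sum X (filter (\<lambda>x. x \<in> W) xs)"
proof (rule measure_eqI)
  fix A assume "A \<in> sets (restr (dirac_sum X xs) W)"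
  then have A: "A \<in> sets X" by simp
  have "filter (\<lambda>x. x \<in> W) xs \<in> lists (space X)" using assms by auto
  then show "emeasure (restr (dirac_sum X xs) W) A = emeasure (dirac_sum X (filter (\<lambda>x. x \<in> W) xs)) A"
    using assms A by (simp add: emeasure_restr' emeasure_dirac_sum conj_commute)
qed simp

section \<open>Counting measures on a Borel space with a localizing sequence\<close>

locale localized_space = nonempty_space X for X :: "'a measure" +
  fixes B :: "nat \<Rightarrow> 'a set"
  assumes borel_space: "borel_space X"
    and localizing: "localizing_sequence X B"
begin

abbreviation "CM \<equiv> counting_measures X B"
abbreviation "CS \<equiv> counting_space X B"

lemma sets_B [measurable, simp]: "B n \<in> sets X"
  using localizing by (auto simp: localizing_sequence_def)

lemma B_mono: "m \<le> n \<Longrightarrow> B m \<subseteq> B n"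
  using localizing by (auto simp: localizing_sequence_def incseq_def)

lemma UN_B: "(\<Union>n. B n) = space X"
  using localizing by (simp add: localizing_sequence_def)

lemma local_setI: "A \<in> sets X \<Longrightarrow> A \<subseteq> B n \<Longrightarrow> A \<in> local_sets X B"
  unfolding local_sets_def by (auto intro!: exI[of _ A] exI[of _ n])

lemma local_setE:
  assumes "A \<in> local_sets X B"
  obtains n where "A \<in> sets X" "A \<subseteq> B n"
proof -
  from assms obtain A' n where "A' \<in> sets X" "A = A' \<inter> B n"
    by (auto simp: local_sets_def)
  then show thesis by (intro that[of n]) auto
qed

lemma CM_sets: "\<mu> \<in> CM \<Longrightarrow> sets \<mu> = sets X"
  by (simp add: counting_measures_def)

lemma CM_space: "\<mu> \<in> CM \<Longrightarrow> space \<mu> = space X"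
  using CM_sets sets_eq_imp_space_eq by blast

lemma CM_nat: "\<mu> \<in> CM \<Longrightarrow> A \<in> sets X \<Longrightarrow> A \<subseteq> B n \<Longrightarrow> \<exists>m::nat. emeasure \<mu> A = of_nat m"
  using local_setI by (auto simp: counting_measures_def)

lemma CM_finite: "\<mu> \<in> CM \<Longrightarrow> A \<in> sets X \<Longrightarrow> A \<subseteq> B n \<Longrightarrow> emeasure \<mu> A \<noteq> \<infinity>"
  using CM_nat[of \<mu> A n] by auto

lemma CM_dirac_sum: "xs \<in> lists (space X) \<Longrightarrow> dirac_sum X xs \<in> CM"
  using emeasure_dirac_sum[of xs X] unfolding counting_measures_def by (fastforce elim!: local_setE)

lemma CM_restr: 
  assumes "\<mu> \<in> CM" "W \<in> sets X"
  shows "restr \<mu> W \<in> CM"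
  unfolding counting_measures_def
proof (safe elim!: local_setE)
  show "A \<in> sets (restr \<mu> W) \<Longrightarrow> A \<in> sets X" "A \<in> sets X \<Longrightarrow> A \<in> sets (restr \<mu> W)" for A
    using CM_sets[OF assms(1)] by auto
  fix A n assume "A \<in> sets X" "A \<subseteq> B n"
  then have "\<exists>m::nat. emeasure \<mu> (A \<inter> W) = of_nat m"
    using assms by (intro CM_nat[of _ _ n]) auto
  then show "\<exists>m::nat. emeasure (restr \<mu> W) A = of_nat m"
    using emeasure_restr'[OF CM_sets[OF assms(1)] assms(2) \<open>A \<in> sets X\<close>] by simp
qed

lemma CM_add:
  assumes "\<mu> \<in> CM" "\<nu> \<in> CM"
  shows "add_measure \<mu> \<nu> \<in> CM"
  unfolding counting_measures_def
proof (safe elim!: local_setE)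
  show "A \<in> sets (add_measure \<mu> \<nu>) \<Longrightarrow> A \<in> sets X" "A \<in> sets X \<Longrightarrow> A \<in> sets (add_measure \<mu> \<nu>)" for A
    using CM_sets[OF assms(1)] by auto
  fix A n assume A: "A \<in> sets X" "A \<subseteq> B n"
  obtain i j :: nat where "emeasure \<mu> A = of_nat i" "emeasure \<nu> A = of_nat j"
    using CM_nat[OF assms(1) A] CM_nat[OF assms(2) A] by auto
  then have "emeasure (add_measure \<mu> \<nu>) A = of_nat (i + j)"
    using A CM_sets[OF assms(1)] CM_sets[OF assms(2)] by (simp add: emeasure_add_measure)
  then show "\<exists>m::nat. emeasure (add_measure \<mu> \<nu>) A = of_nat m" ..
qed

lemma measurable_emeasure_CS [measurable]: "A \<in> sets X \<Longrightarrow> (\<lambda>\<mu>. emeasure \<mu> A) \<in> borel_measurable CS"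
  by (rule measurable_emeasure_counting_space)

lemma measurable_into_CS:
  assumes "\<And>\<omega>. \<omega> \<in> space \<Omega> \<Longrightarrow> f \<omega> \<in> CM"
    and "\<And>A. A \<in> sets X \<Longrightarrow> (\<lambda>\<omega>. emeasure (f \<omega>) A) \<in> borel_measurable \<Omega>"
  shows "f \<in> \<Omega> \<rightarrow>\<^sub>M CS"
  unfolding counting_space_def
  by (rule measurable_Sup2) (auto intro!: measurable_vimage_algebra2 assms)

text \<open>The points of a counting measure in \<open>B p\<close>, ordered by a Borel isomorphism to a subset of the
  real line; the \<open>i\<close>-th point is a quantile of the image measure and hence a measurable function
  of the counting measure.\<close>

theorem measurable_enumeration:
  "\<exists>e\<in>CS \<rightarrow>\<^sub>M LS. \<forall>\<mu>\<in>CM. set (e \<mu>) \<subseteq> B p \<and> restr \<mu> (B p) = dirac_sum X (e \<mu>)"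
proof -
  define A where "A = B p"
  have A [measurable]: "A \<in> sets X" by (simp add: A_def)
  have AX: "A \<subseteq> space X" using sets.sets_into_space[OF A] .
  obtain S \<phi> where S [measurable]: "S \<in> sets (borel :: real measure)" and S01: "S \<subseteq> {0..1}"
    and bij: "bij_betw \<phi> (space X) S" and \<phi>: "\<phi> \<in> X \<rightarrow>\<^sub>M restrict_space borel S"
    and inv: "inv_into (space X) \<phi> \<in> restrict_space borel S \<rightarrow>\<^sub>M X"
    using borel_space unfolding borel_space_def by blast
  let ?\<psi> = "inv_into (space X) \<phi>"
  have \<phi>b [measurable]: "\<phi> \<in> borel_measurable X"
    using \<phi> by (simp add: measurable_restrict_space2_iff)
  have \<phi>S: "\<phi> x \<in> S" if "x \<in> space X" for x using bij that by (auto simp: bij_betw_def)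
  define F where "F \<mu> t = emeasure \<mu> {x\<in>A. \<phi> x \<le> t}" for \<mu> t
  have Fset [measurable]: "{x\<in>A. \<phi> x \<le> t} \<in> sets X" for t
  proof -
    have "{x\<in>space X. x \<in> A \<and> \<phi> x \<le> t} \<in> sets X" by measurable
    also have "{x\<in>space X. x \<in> A \<and> \<phi> x \<le> t} = {x\<in>A. \<phi> x \<le> t}" using AX by auto
    finally show ?thesis .
  qed
  define n where "n \<mu> = nat \<lfloor>enn2real (emeasure \<mu> A)\<rfloor>" for \<mu> :: "'a measure"
  have n: "emeasure \<mu> A = of_nat (n \<mu>)" if \<mu>: "\<mu> \<in> CM" for \<mu>
    using CM_nat[OF \<mu> A, of p] by (auto simp: A_def n_def)
  have F_le_n: "F \<mu> t \<le> of_nat (n \<mu>)" if "\<mu> \<in> CM" for \<mu> t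
    unfolding F_def n[OF that, symmetric] using that A by (intro emeasure_mono) (auto simp: CM_sets)
  \<comment> \<open>Points are numbered from 0: the \<open>i\<close>-th one is at most
    \<open>t\<close> when at least \<open>i + 1\<close> points are.\<close>
  define T where "T \<mu> i = {t. of_nat (Suc i) \<le> F \<mu> t}" for \<mu> i
  define q where "q i \<mu> = Inf (T \<mu> i)" for i \<mu>
  have q_le: "q i \<mu> \<le> t \<longleftrightarrow> of_nat (Suc i) \<le> F \<mu> t" if \<mu>: "\<mu> \<in> CM" and i: "i < n \<mu>" for i \<mu> t
  proof -
    \<comment> \<open>The image lies in [0, 1], which keeps \<open>T \<mu> i\<close> nonempty and
      bounded below.\<close>
    have "{x\<in>A. \<phi> x \<le> 1} = A" using AX \<phi>S S01 by fastforce
    then have ne: "1 \<in> T \<mu> i" using n[OF \<mu>] i by (auto simp: T_def F_def simp flip: of_nat_Suc)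
    have bdd: "0 \<le> t" if "t \<in> T \<mu> i" for t
    proof (rule ccontr)
      assume "\<not> 0 \<le> t"
      then have "{x\<in>A. \<phi> x \<le> t} = {}" using AX \<phi>S S01 by fastforce
      then have "F \<mu> t = 0" by (simp only: F_def emeasure_empty)
      then show False using that by (simp add: T_def)
    qed
    have up: "t' \<in> T \<mu> i" if "t \<in> T \<mu> i" "t \<le> t'" for t t'
    proof -
      have "F \<mu> t \<le> F \<mu> t'"
        unfolding F_def using \<open>t \<le> t'\<close> \<mu> by (intro emeasure_mono) (auto simp: CM_sets)
      with that show ?thesis by (auto simp: T_def)
    qed
    \<comment> \<open>The infimum is attained by continuity from above, the measure being finite on
      \<open>A\<close>. This makes \<open>q_le\<close> an equivalence, from which measurability in
      \<mu> follows.\<close>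
    have "q i \<mu> \<in> T \<mu> i"
    proof -
      have t: "q i \<mu> + inverse (real (Suc m)) \<in> T \<mu> i" for m
      proof -
        have "\<exists>t\<in>T \<mu> i. t < q i \<mu> + inverse (real (Suc m))"
          using ne bdd by (subst cInf_less_iff[symmetric])
            (auto simp: q_def intro!: bdd_belowI)
        then show ?thesis using up by force
      qed
      have "emeasure \<mu> (\<Inter>m. {x\<in>A. \<phi> x \<le> q i \<mu> + inverse (real (Suc m))}) =
          (INF m. F \<mu> (q i \<mu> + inverse (real (Suc m))))"
        unfolding F_def
      proof (rule INF_emeasure_decseq[symmetric])
        show "range (\<lambda>m. {x\<in>A. \<phi> x \<le> q i \<mu> + inverse (real (Suc m))}) \<subseteq> sets \<mu>"
          using \<mu> by (auto simp: CM_sets)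
        show "decseq (\<lambda>m. {x\<in>A. \<phi> x \<le> q i \<mu> + inverse (real (Suc m))})"
          by (auto simp: decseq_def intro: order.trans[OF _ add_left_mono[OF le_imp_inverse_le]])
        show "emeasure \<mu> {x\<in>A. \<phi> x \<le> q i \<mu> + inverse (real (Suc m))} \<noteq> \<infinity>" for m
          using F_le_n[OF \<mu>, of "q i \<mu> + inverse (real (Suc m))"]
          by (auto simp: F_def top_unique)
      qed
      also have "(\<Inter>m. {x\<in>A. \<phi> x \<le> q i \<mu> + inverse (real (Suc m))}) = {x\<in>A. \<phi> x \<le> q i \<mu>}"
      proof safe
        fix x assume x: "x \<in> (\<Inter>m. {x\<in>A. \<phi> x \<le> q i \<mu> + inverse (real (Suc m))})"
        then show "x \<in> A" by auto
        show "\<phi> x \<le> q i \<mu>"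
        proof (rule ccontr)
          assume "\<not> \<phi> x \<le> q i \<mu>"
          then obtain m where "inverse (real (Suc m)) < \<phi> x - q i \<mu>"
            using reals_Archimedean[of "\<phi> x - q i \<mu>"] by auto
          moreover have "\<phi> x \<le> q i \<mu> + inverse (real (Suc m))" using x by blast
          ultimately show False by linarith
        qed
      qed (auto intro: order.trans[OF _ less_imp_le])
      finally have "F \<mu> (q i \<mu>) = (INF m. F \<mu> (q i \<mu> + inverse (real (Suc m))))"
        by (simp only: F_def)
      moreover have "of_nat (Suc i) \<le> (INF m. F \<mu> (q i \<mu> + inverse (real (Suc m))))"
        using t by (intro INF_greatest) (simp add: T_def)
      ultimately show ?thesis unfolding T_def by simp
    qed
    then have "q i \<mu> \<le> t \<Longrightarrow> t \<in> T \<mu> i" using up by blast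
    moreover have "t \<in> T \<mu> i \<Longrightarrow> q i \<mu> \<le> t"
      unfolding q_def using bdd by (intro cInf_lower bdd_belowI) auto
    ultimately show ?thesis by (auto simp: T_def)
  qed
  \<comment> \<open>The order statistics have the same distribution function as the image of \<mu>
    restricted to \<open>A\<close>, hence the same counting measure.\<close>
  have count: "emeasure (distr (count_space {..<n \<mu>}) borel (\<lambda>i. q i \<mu>)) C = emeasure \<mu> {x\<in>A. \<phi> x \<in> C}"
    if \<mu>: "\<mu> \<in> CM" and C: "C \<in> sets borel" for \<mu> C
  proof -
    have rm: "\<phi> \<in> restr \<mu> A \<rightarrow>\<^sub>M borel"
      using \<phi>b CM_sets[OF \<mu>] by (simp cong: measurable_cong_sets)
    have sp: "space (restr \<mu> A) = space X"
      using CM_sets[OF \<mu>] by (intro sets_eq_imp_space_eq) simp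
    have d2: "emeasure (distr (restr \<mu> A) borel \<phi>) C = emeasure \<mu> {x\<in>A. \<phi> x \<in> C}" if [measurable]: "C \<in> sets borel" for C
    proof -
      have "\<phi> -` C \<inter> space X \<in> sets X" by measurable
      moreover have "\<phi> -` C \<inter> space X \<inter> A = {x\<in>A. \<phi> x \<in> C}" using AX by auto
      ultimately show ?thesis
        using emeasure_restr'[OF CM_sets[OF \<mu>] A] by (simp add: emeasure_distr[OF rm] sp)
    qed
    have "distr (count_space {..<n \<mu>}) borel (\<lambda>i. q i \<mu>) = distr (restr \<mu> A) borel \<phi>"
    proof (rule measure_eqI_generator_eq[where \<Omega>=UNIV and E="range (\<lambda>a. {..a})" and A="\<lambda>i. {..real i}"])
      show "Int_stable (range (\<lambda>a::real. {..a}))"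
        by (auto simp: Int_stable_def)
      fix C assume "C \<in> range (\<lambda>a::real. {..a})"
      then obtain t where C: "C = {..t}" by auto
      obtain f where f: "F \<mu> t = of_nat f"
        using CM_nat[OF \<mu> Fset[of t], of p] by (auto simp: F_def A_def)
      have "f \<le> n \<mu>" using F_le_n[OF \<mu>, of t] by (simp add: f)
      have "(\<lambda>i. q i \<mu>) -` C \<inter> {..<n \<mu>} = {..<f}"
        using \<open>f \<le> n \<mu>\<close> by (auto simp: C q_le[OF \<mu>] f simp del: of_nat_Suc)
      then have "emeasure (distr (count_space {..<n \<mu>}) borel (\<lambda>i. q i \<mu>)) C = of_nat f"
        using \<open>f \<le> n \<mu>\<close> by (simp add: emeasure_distr C)
      also have "\<dots> = emeasure (distr (restr \<mu> A) borel \<phi>) C"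
        using f by (simp add: d2 C F_def)
      finally show "emeasure (distr (count_space {..<n \<mu>}) borel (\<lambda>i. q i \<mu>)) C =
        emeasure (distr (restr \<mu> A) borel \<phi>) C" .
    next
      have "sets (borel :: real measure) = sigma_sets UNIV (range (\<lambda>a. {..a}))"
        by (subst borel_eq_atMost) simp
      then show "sets (distr (count_space {..<n \<mu>}) borel (\<lambda>i. q i \<mu>)) = sigma_sets UNIV (range (\<lambda>a. {..a}))"
        "sets (distr (restr \<mu> A) borel \<phi>) = sigma_sets UNIV (range (\<lambda>a. {..a}))" by simp_all
      show "(\<Union>i. {..real i}) = UNIV" using real_arch_simple by auto
      show "emeasure (distr (count_space {..<n \<mu>}) borel (\<lambda>i. q i \<mu>)) {..real i} \<noteq> \<infinity>" for i
        by (subst emeasure_distr) auto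
    qed auto
    then show ?thesis by (simp add: d2 C)
  qed
  obtain x0 where x0: "x0 \<in> space X" using nonempty by auto
  \<comment> \<open>Beyond the last point a fixed element of \<open>S\<close> is used, so that every
    \<open>r i\<close> is a total map into \<open>S\<close>.\<close>
  define r where "r i \<mu> = (if i < n \<mu> then q i \<mu> else \<phi> x0)" for i \<mu>
  \<comment> \<open>The inverse isomorphism is meaningful only on \<open>S\<close>. The complement
    of \<open>S\<close> carries no mass and thus contains no order statistic.\<close>
  have qS: "q i \<mu> \<in> S" if \<mu>: "\<mu> \<in> CM" and i: "i < n \<mu>" for i \<mu>
  proof (rule ccontr)
    assume "q i \<mu> \<notin> S"
    have "{x\<in>A. \<phi> x \<in> - S} = {}" using AX \<phi>S by auto
    moreover have "emeasure (distr (count_space {..<n \<mu>}) borel (\<lambda>i. q i \<mu>)) (- S) =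
        emeasure \<mu> {x\<in>A. \<phi> x \<in> - S}"
      by (rule count[OF \<mu> borel_comp[OF S]])
    ultimately have "emeasure (distr (count_space {..<n \<mu>}) borel (\<lambda>i. q i \<mu>)) (- S) = 0"
      by (simp only: emeasure_empty)
    then have "(\<lambda>i. q i \<mu>) -` (- S) \<inter> {..<n \<mu>} = {}"
      using S by (subst (asm) emeasure_distr) (auto simp: borel_comp emeasure_count_space_eq_0)
    then show False using \<open>q i \<mu> \<notin> S\<close> i by auto
  qed
  have rS: "r i \<mu> \<in> S" if "\<mu> \<in> CM" for i \<mu> using qS[OF that] \<phi>S[OF x0] by (simp add: r_def)
  have nm [measurable]: "n \<in> CS \<rightarrow>\<^sub>M count_space UNIV"
    unfolding n_def by measurable
  have Fm [measurable]: "(\<lambda>\<mu>. F \<mu> t) \<in> borel_measurable CS" for t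
    unfolding F_def by measurable
  have rm: "r i \<in> CS \<rightarrow>\<^sub>M restrict_space borel S" for i
  proof (rule measurable_restrict_space2)
    show "r i \<in> space CS \<rightarrow> S" using rS by auto
    have "{\<mu>\<in>space CS. r i \<mu> \<le> t} \<in> sets CS" for t
    proof -
      have "{\<mu>\<in>space CS. i < n \<mu> \<and> of_nat (Suc i) \<le> F \<mu> t \<or> \<not> i < n \<mu> \<and> \<phi> x0 \<le> t} \<in> sets CS"
        by measurable
      also have "{\<mu>\<in>space CS. i < n \<mu> \<and> of_nat (Suc i) \<le> F \<mu> t \<or> \<not> i < n \<mu> \<and> \<phi> x0 \<le> t} =
          {\<mu>\<in>space CS. r i \<mu> \<le> t}"
        using q_le by (auto simp: r_def)
      finally show ?thesis .
    qed
    then show "r i \<in> borel_measurable CS" by (simp add: borel_measurable_iff_le)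
  qed
  define e where "e \<mu> = map (\<lambda>i. ?\<psi> (r i \<mu>)) [0..<n \<mu>]" for \<mu>
  have "(\<lambda>\<mu>. (\<lambda>m \<mu>. map (\<lambda>i. ?\<psi> (r i \<mu>)) [0..<m]) (n \<mu>) \<mu>) \<in> CS \<rightarrow>\<^sub>M LS"
  proof (rule measurable_compose_countable[OF _ nm])
    fix m show "(\<lambda>\<mu>. map (\<lambda>i. ?\<psi> (r i \<mu>)) [0..<m]) \<in> CS \<rightarrow>\<^sub>M LS"
      by (rule measurable_list_fixed_length[where n=m])
        (auto intro!: measurable_compose[OF rm inv])
  qed
  then have em: "e \<in> CS \<rightarrow>\<^sub>M LS" by (simp add: e_def[abs_def])
  moreover have "set (e \<mu>) \<subseteq> B p \<and> restr \<mu> (B p) = dirac_sum X (e \<mu>)" if \<mu>: "\<mu> \<in> CM" for \<mu>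
  proof -
    have es: "e \<mu> \<in> lists (space X)" using measurable_space[OF em] \<mu> by simp
    have eq: "emeasure (restr \<mu> A) C = emeasure (dirac_sum X (e \<mu>)) C" if C: "C \<in> sets X" for C
    proof -
      have CX: "C \<subseteq> space X" using sets.sets_into_space[OF C] .
      have "?\<psi> -` C \<inter> space (restrict_space borel S) \<in> sets (restrict_space borel S)"
        by (rule measurable_sets[OF inv C])
      then have im: "?\<psi> -` C \<inter> S \<in> sets borel"
        using S by (simp add: sets_restrict_space_iff space_restrict_space)
      have \<psi>\<phi>: "?\<psi> (\<phi> x) = x" if "x \<in> space X" for x
        using bij that by (auto simp: bij_betw_def)
      have "{x\<in>A. \<phi> x \<in> ?\<psi> -` C \<inter> S} = C \<inter> A"
        using AX \<phi>S \<psi>\<phi> by auto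
      then have "emeasure (restr \<mu> A) C = emeasure (distr (count_space {..<n \<mu>}) borel (\<lambda>i. q i \<mu>)) (?\<psi> -` C \<inter> S)"
        by (simp add: count[OF \<mu> im] emeasure_restr'[OF CM_sets[OF \<mu>] A C])
      also have "\<dots> = of_nat (card ((\<lambda>i. q i \<mu>) -` (?\<psi> -` C \<inter> S) \<inter> {..<n \<mu>}))"
        using im by (simp add: emeasure_distr)
      also have "(\<lambda>i. q i \<mu>) -` (?\<psi> -` C \<inter> S) \<inter> {..<n \<mu>} = {i. i < length (e \<mu>) \<and> e \<mu> ! i \<in> C}"
        using qS[OF \<mu>] by (auto simp: e_def r_def)
      also have "of_nat (card \<dots>) = emeasure (dirac_sum X (e \<mu>)) C"
        using es C by (simp add: emeasure_dirac_sum length_filter_conv_card)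
      finally show ?thesis .
    qed
    have "emeasure (restr \<mu> A) (space X - A) = 0"
      using emeasure_restr'[OF CM_sets[OF \<mu>] A, of "space X - A"] A by (auto simp: Diff_Int_distrib2)
    then have "filter (\<lambda>x. x \<in> space X - A) (e \<mu>) = []"
      using eq[of "space X - A"] A es by (simp add: emeasure_dirac_sum)
    then have "set (e \<mu>) \<subseteq> A" using es by (auto simp: filter_empty_conv in_lists_conv_set)
    moreover have "restr \<mu> A = dirac_sum X (e \<mu>)"
      by (rule measure_eqI) (auto simp: CM_sets[OF \<mu>] eq)
    ultimately show ?thesis by (simp add: A_def)
  qed
  ultimately show ?thesis by blast
qed

end

section \<open>Factorial measures and pathwise integrals\<close>

definition distinct_lists :: "nat \<Rightarrow> 'i set \<Rightarrow> 'i list set" where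
  "distinct_lists k I = {is. length is = k \<and> distinct is \<and> set is \<subseteq> I}"

lemma distinct_lists_0 [simp]: "distinct_lists 0 I = {[]}"
  by (auto simp: distinct_lists_def)

lemma finite_distinct_lists: "finite I \<Longrightarrow> finite (distinct_lists k I)"
  by (rule finite_subset[OF _ finite_lists_length_eq[of I k]]) (auto simp: distinct_lists_def)

text \<open>\<open>factorial_measure\<close> appends its new point at the end, whereas
  \<open>chaos\<close> picks the first point first; the tuples are therefore decomposed at both
  ends, here at the last entry.\<close>

lemma bij_distinct_lists_snoc:
  "bij_betw (\<lambda>p. fst p @ [snd p]) (SIGMA is:distinct_lists k I. I - set is) (distinct_lists (Suc k) I)"
proof (intro bij_betwI[where g="\<lambda>is. (butlast is, last is)"])
  show "(\<lambda>is. (butlast is, last is)) \<in> distinct_lists (Suc k) I \<rightarrow> (SIGMA is:distinct_lists k I. I - set is)"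
  proof
    fix "is" assume a: "is \<in> distinct_lists (Suc k) I"
    then obtain js i where "is = js @ [i]"
      by (cases "is" rule: rev_cases) (auto simp: distinct_lists_def)
    then show "(butlast is, last is) \<in> (SIGMA is:distinct_lists k I. I - set is)"
      using a by (auto simp: distinct_lists_def)
  qed
  show "fst (butlast is, last is) @ [snd (butlast is, last is)] = is" if "is \<in> distinct_lists (Suc k) I" for "is"
    using that by (cases "is" rule: rev_cases) (auto simp: distinct_lists_def)
qed (auto simp: distinct_lists_def)

lemma sum_distinct_lists_Cons:
  assumes "finite I"
  shows "(\<Sum>is\<in>distinct_lists (Suc k) I. H is) = (\<Sum>i\<in>I. \<Sum>is\<in>distinct_lists k (I - {i}). H (i # is))"
proof -
  have "bij_betw (\<lambda>p. fst p # snd p) (SIGMA i:I. distinct_lists k (I - {i})) (distinct_lists (Suc k) I)"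
  proof (intro bij_betwI[where g="\<lambda>is. (hd is, tl is)"])
    show "(\<lambda>is. (hd is, tl is)) \<in> distinct_lists (Suc k) I \<rightarrow> (SIGMA i:I. distinct_lists k (I - {i}))"
    proof
      fix "is" assume a: "is \<in> distinct_lists (Suc k) I"
      then obtain i js where "is = i # js" by (cases "is") (auto simp: distinct_lists_def)
      then show "(hd is, tl is) \<in> (SIGMA i:I. distinct_lists k (I - {i}))"
        using a by (auto simp: distinct_lists_def)
    qed
    show "fst (hd is, tl is) # snd (hd is, tl is) = is" if "is \<in> distinct_lists (Suc k) I" for "is"
      using that by (cases "is") (auto simp: distinct_lists_def)
  qed (auto simp: distinct_lists_def)
  from sum.reindex_bij_betw[OF this, of H, symmetric] show ?thesis
    using assms by (simp add: sum.Sigma finite_distinct_lists split_beta')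
qed

lemma nn_integral_count_space_Sigma:
  "(\<integral>\<^sup>+x. \<integral>\<^sup>+y. f (x, y) \<partial>count_space (B x) \<partial>count_space A) = (\<integral>\<^sup>+p. f p \<partial>count_space (Sigma A B))"
proof -
  have "(\<integral>\<^sup>+p. f p \<partial>count_space (Sigma A B)) = (\<integral>\<^sup>+p. f p * indicator (Sigma A B) p \<partial>count_space UNIV)"
    by (simp add: nn_integral_restrict_space[symmetric] restrict_count_space)
  also have "\<dots> = (\<integral>\<^sup>+x. \<integral>\<^sup>+y. f (x, y) * indicator (Sigma A B) (x, y) \<partial>count_space UNIV \<partial>count_space UNIV)"
    by (rule nn_integral_fst_count_space[symmetric])
  also have "\<dots> = (\<integral>\<^sup>+x. (\<integral>\<^sup>+y. f (x, y) * indicator (B x) y \<partial>count_space UNIV) * indicator A x \<partial>count_space UNIV)"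
    by (intro nn_integral_cong) (auto simp: indicator_def)
  also have "\<dots> = (\<integral>\<^sup>+x. (\<integral>\<^sup>+y. f (x, y) * indicator (B x) y \<partial>count_space UNIV) \<partial>count_space A)"
    by (simp add: nn_integral_restrict_space[symmetric] restrict_count_space)
  also have "\<dots> = (\<integral>\<^sup>+x. \<integral>\<^sup>+y. f (x, y) \<partial>count_space (B x) \<partial>count_space A)"
    by (simp add: nn_integral_restrict_space[symmetric] restrict_count_space)
  finally show ?thesis ..
qed

text \<open>The subtrahend is finite, so the truncated difference is a true one.\<close>

lemma nn_integral_count_space_diff:
  fixes h :: "'i \<Rightarrow> ennreal"
  assumes F: "finite F" "F \<subseteq> I" and h: "\<And>i. h i \<noteq> \<infinity>"
  shows "(\<integral>\<^sup>+i. h i \<partial>count_space I) - (\<Sum>i\<in>F. h i) = (\<integral>\<^sup>+i. h i \<partial>count_space (I - F))"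
proof -
  have "(\<integral>\<^sup>+i. h i \<partial>count_space I) = (\<integral>\<^sup>+i. h i * indicator (I - F) i + h i * indicator F i \<partial>count_space I)"
    by (intro nn_integral_cong) (auto simp: indicator_def)
  also have "\<dots> = (\<integral>\<^sup>+i. h i * indicator (I - F) i \<partial>count_space I) + (\<integral>\<^sup>+i. h i * indicator F i \<partial>count_space I)"
    by (rule nn_integral_add) auto
  also have "(\<integral>\<^sup>+i. h i * indicator (I - F) i \<partial>count_space I) = (\<integral>\<^sup>+i. h i \<partial>count_space (I - F))"
    by (simp add: nn_integral_restrict_space[symmetric] restrict_count_space Int_absorb2 Diff_subset)
  also have "(\<integral>\<^sup>+i. h i * indicator F i \<partial>count_space I) = (\<Sum>i\<in>F. h i)"
    by (subst nn_integral_count_space'[of F]) (use F in auto)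
  finally show ?thesis
    using h F by (simp add: ennreal_add_diff_cancel_right)
qed

text \<open>With \<mu> written as a sum of Dirac masses over an index set, the recursion subtracts
  exactly the indices already used. Since indices rather than locations are kept distinct,
  coinciding points are counted correctly.\<close>

theorem factorial_measure_distr:
  assumes sf: "sigma_finite_measure \<mu>" and z: "z \<in> I \<rightarrow> space \<mu>" and \<mu>: "distr (count_space I) \<mu> z = \<mu>"
  shows "factorial_measure \<mu> k =
    distr (count_space (distinct_lists k I)) (pow_measure \<mu> k) (\<lambda>is. \<lambda>i\<in>{..<k}. z (is ! i))"
proof (induction k)
  case 0
  show ?case
  proof (rule measure_eqI)
    fix A assume "A \<in> sets (factorial_measure \<mu> 0)"
    then have A: "A \<in> sets (pow_measure \<mu> 0)" by simp
    have "(\<lambda>is. \<lambda>i\<in>{..<0}. z (is ! i)) -` A \<inter> {[]} = (if (\<lambda>_. undefined) \<in> A then {[]} else {})"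
      by (auto simp: restrict_def)
    then show "emeasure (factorial_measure \<mu> 0) A =
        emeasure (distr (count_space (distinct_lists 0 I)) (pow_measure \<mu> 0) (\<lambda>is. \<lambda>i\<in>{..<0}. z (is ! i))) A"
      using A by (subst emeasure_distr) (auto simp: emeasure_return space_PiM)
  qed simp
next
  case (Suc k)
  interpret sigma_finite_measure \<mu> by (rule sf)
  let ?y = "\<lambda>k is. \<lambda>i\<in>{..<k}. z (is ! i)"
  let ?P = "pow_measure \<mu> (Suc k)"
  let ?D = "distr (count_space (distinct_lists (Suc k) I)) ?P (?y (Suc k))"
  have ymeas: "?y k \<in> count_space (distinct_lists k I) \<rightarrow>\<^sub>M pow_measure \<mu> k" for k
  proof -
    have "?y k is \<in> space (pow_measure \<mu> k)" if "is \<in> distinct_lists k I" for "is"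
      using that z by (auto simp: space_PiM distinct_lists_def PiE_iff in_set_conv_nth subset_iff)
    then show ?thesis by simp
  qed
  have zm: "z \<in> count_space I \<rightarrow>\<^sub>M \<mu>" using z by simp
  have int: "(\<integral>\<^sup>+x. f x \<partial>\<mu>) = (\<integral>\<^sup>+i. f (z i) \<partial>count_space I)" if "f \<in> borel_measurable \<mu>" for f
    using nn_integral_distr[OF zm, of f] that by (simp add: \<mu>)
  have G: "(\<integral>\<^sup>+x. ((\<integral>\<^sup>+z. indicator C (x(k := z)) \<partial>\<mu>) - (\<Sum>j<k. indicator C (x(k := x j)))) \<partial>factorial_measure \<mu> k)
      = emeasure ?D C" if C: "C \<in> sets ?P" for C
  proof -
    have add: "(\<lambda>(x, z). x(k := z)) \<in> pow_measure \<mu> k \<Otimes>\<^sub>M \<mu> \<rightarrow>\<^sub>M ?P"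
      using measurable_add_dim[of k "{..<k}" "\<lambda>_. \<mu>"] by (simp add: lessThan_Suc)
    have m1: "(\<lambda>x. \<integral>\<^sup>+z. indicator C (x(k := z)) \<partial>\<mu> :: ennreal) \<in> borel_measurable (pow_measure \<mu> k)"
    proof (rule borel_measurable_nn_integral)
      have "(\<lambda>p. indicator C ((\<lambda>(x, z). x(k := z)) p) :: ennreal) \<in> borel_measurable (pow_measure \<mu> k \<Otimes>\<^sub>M \<mu>)"
        by (rule measurable_compose[OF add]) (use C in simp)
      then show "(\<lambda>(x, z). indicator C (x(k := z)) :: ennreal) \<in> borel_measurable (pow_measure \<mu> k \<Otimes>\<^sub>M \<mu>)"
        by (simp add: split_beta')
    qed
    have m2: "(\<lambda>x. indicator C (x(k := x j)) :: ennreal) \<in> borel_measurable (pow_measure \<mu> k)" if "j < k" for j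
    proof -
      have "(\<lambda>x. (x, x j)) \<in> pow_measure \<mu> k \<rightarrow>\<^sub>M pow_measure \<mu> k \<Otimes>\<^sub>M \<mu>"
        using that by (intro measurable_Pair measurable_ident_sets refl measurable_component_singleton) simp
      from measurable_compose[OF this add] C show ?thesis by simp
    qed
    have upd: "(?y k is)(k := z i) = ?y (Suc k) (is @ [i])" if "is \<in> distinct_lists k I" for "is" i
      using that by (auto simp: distinct_lists_def fun_eq_iff nth_append)
    have inner: "(\<integral>\<^sup>+z. indicator C ((?y k is)(k := z)) \<partial>\<mu>) - (\<Sum>j<k. indicator C ((?y k is)(k := ?y k is j))) =
        (\<integral>\<^sup>+i. indicator C (?y (Suc k) (is @ [i])) \<partial>count_space (I - set is))"
      if "is": "is \<in> distinct_lists k I" for "is"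
    proof -
      have sp: "?y k is \<in> space (pow_measure \<mu> k)" using measurable_space[OF ymeas] "is" by simp
      have "(\<lambda>z. indicator C ((?y k is)(k := z)) :: ennreal) \<in> borel_measurable \<mu>"
        using measurable_compose[OF measurable_compose[OF measurable_Pair1'[OF sp] add]
            borel_measurable_indicator[OF C]]
        by simp
      then have "(\<integral>\<^sup>+z. indicator C ((?y k is)(k := z)) \<partial>\<mu>) =
          (\<integral>\<^sup>+i. indicator C ((?y k is)(k := z i)) \<partial>count_space I)"
        by (rule int)
      also have "\<dots> = (\<integral>\<^sup>+i. indicator C (?y (Suc k) (is @ [i])) \<partial>count_space I)"
        by (simp only: upd[OF "is"])
      finally have 1: "(\<integral>\<^sup>+z. indicator C ((?y k is)(k := z)) \<partial>\<mu>) = \<dots>" .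
      have "(\<Sum>j<k. indicator C ((?y k is)(k := ?y k is j)) :: ennreal) =
          (\<Sum>j<k. indicator C (?y (Suc k) (is @ [is ! j])))"
        by (intro sum.cong refl) (simp only: upd[OF "is", symmetric], simp)
      also have "\<dots> = (\<Sum>i\<in>set is. indicator C (?y (Suc k) (is @ [i])))"
        using "is" by (intro sum.reindex_bij_betw bij_betw_nth) (auto simp: distinct_lists_def)
      finally have 2: "(\<Sum>j<k. indicator C ((?y k is)(k := ?y k is j)) :: ennreal) = \<dots>" .
      have "(\<integral>\<^sup>+i. indicator C (?y (Suc k) (is @ [i])) \<partial>count_space I) -
          (\<Sum>i\<in>set is. indicator C (?y (Suc k) (is @ [i])) :: ennreal) =
          (\<integral>\<^sup>+i. indicator C (?y (Suc k) (is @ [i])) \<partial>count_space (I - set is))"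
        using "is" by (intro nn_integral_count_space_diff) (auto simp: distinct_lists_def indicator_def)
      then show ?thesis by (simp only: 1 2)
    qed
    have "(\<integral>\<^sup>+x. ((\<integral>\<^sup>+z. indicator C (x(k := z)) \<partial>\<mu>) - (\<Sum>j<k. indicator C (x(k := x j)))) \<partial>factorial_measure \<mu> k)
      = (\<integral>\<^sup>+is. ((\<integral>\<^sup>+z. indicator C ((?y k is)(k := z)) \<partial>\<mu>) - (\<Sum>j<k. indicator C ((?y k is)(k := ?y k is j))))
          \<partial>count_space (distinct_lists k I))"
      unfolding Suc by (rule nn_integral_distr[OF ymeas])
        (use m1 m2 in \<open>auto intro!: borel_measurable_minus_ennreal borel_measurable_sum\<close>)
    also have "\<dots> = (\<integral>\<^sup>+is. (\<integral>\<^sup>+i. indicator C (?y (Suc k) (is @ [i])) \<partial>count_space (I - set is))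
          \<partial>count_space (distinct_lists k I))"
      by (intro nn_integral_cong inner) simp
    also have "\<dots> = (\<integral>\<^sup>+p. indicator C (?y (Suc k) (fst p @ [snd p]))
        \<partial>count_space (SIGMA is:distinct_lists k I. I - set is))"
      by (subst nn_integral_count_space_Sigma[symmetric]) simp
    also have "\<dots> = (\<integral>\<^sup>+is. indicator C (?y (Suc k) is) \<partial>count_space (distinct_lists (Suc k) I))"
      by (rule nn_integral_bij_count_space[OF bij_distinct_lists_snoc])
    also have "\<dots> = (\<integral>\<^sup>+x. indicator C x \<partial>?D)"
      by (rule nn_integral_distr[OF ymeas, symmetric]) (use C in simp)
    also have "\<dots> = emeasure ?D C" using C by simp
    finally show ?thesis .
  qed
  have "factorial_measure \<mu> (Suc k) = measure_of (space ?P) (sets ?P) (emeasure ?D)"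
    unfolding factorial_measure.simps
    by (rule measure_of_eq[OF sets.space_closed]) (simp only: sets.sigma_sets_eq G)
  also have "\<dots> = ?D"
    using measure_of_of_measure[of ?D] by simp
  finally show ?case .
qed

section \<open>The iterated divergence as an alternating sum over factorial measures\<close>

context finite_intensity
begin

definition falling_sum :: "nat \<Rightarrow> nat \<Rightarrow> ('i \<Rightarrow> 'a) \<Rightarrow> ('a multiset \<Rightarrow> real) \<Rightarrow> 'i set \<Rightarrow> real" where
  "falling_sum j l z g I = (\<Sum>is\<in>distinct_lists j I. \<integral>ys. g (mset (map z is) + mset ys) \<partial>points l)"

text \<open>Expanding the iterated divergence; \<open>falling_sum j (k - j) z g I\<close> integrates \<open>j\<close> variables over the
  \<open>j\<close>-th factorial measure and the remaining ones over the intensity.\<close>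

lemma chaos_eq_falling_sum:
  assumes g: "(\<lambda>xs. g (mset xs)) \<in> borel_measurable LS" "\<And>K. \<bar>g K\<bar> \<le> c"
    and I: "finite I" "\<And>i. i \<in> I \<Longrightarrow> z i \<in> space X"
  shows "chaos k g (image_mset z (mset_set I)) =
    (\<Sum>j\<le>k. (-1) ^ (k - j) * real (k choose j) * falling_sum j (k - j) z g I)"
  using g I
proof (induction k arbitrary: g I)
  case 0
  have "(\<lambda>xs. g (mset xs)) \<in> borel_measurable LS" by fact
  then show ?case by (simp add: falling_sum_def integral_return)
next
  case (Suc k)
  note g = Suc.prems(1,2) and I = Suc.prems(3,4)
  let ?g = "\<lambda>x K. g (add_mset x K)"
  have gm: "(\<lambda>xs. ?g x (mset xs)) \<in> borel_measurable LS" if "x \<in> space X" for x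
    by (rule measurable_add_mset[OF g(1) that])
  define E where "E j l = falling_sum j l z g I" for j l
  \<comment> \<open>Picking a point adds a summed variable, integrating over \<open>L\<close> adds
    an intensity variable.\<close>
  have first: "(\<Sum>i\<in>I. falling_sum j l z (?g (z i)) (I - {i})) = E (Suc j) l" for j l
    unfolding E_def falling_sum_def using I by (simp add: sum_distinct_lists_Cons)
  have second: "(\<integral>x. falling_sum j l z (?g x) I \<partial>L) = E j (Suc l)"
    and second_int: "integrable L (\<lambda>x. falling_sum j l z (?g x) I)" for j l
  proof -
    have 1: "(\<integral>x. \<integral>ys. ?g x (mset (map z is) + mset ys) \<partial>points l \<partial>L) =
        (\<integral>ys. g (mset (map z is) + mset ys) \<partial>points (Suc l))" (is ?t1)
      and 2: "integrable L (\<lambda>x. \<integral>ys. ?g x (mset (map z is) + mset ys) \<partial>points l)" (is ?t2)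
      if "is \<in> distinct_lists j I" for "is"
    proof -
      have "map z is \<in> lists (space X)"
        using that I(2) by (auto simp: distinct_lists_def subset_iff)
      then have "(\<lambda>ys. map z is @ ys) \<in> LS \<rightarrow>\<^sub>M LS" 
        by (intro measurable_append measurable_const) auto
      from measurable_compose[OF this g(1)]
      have m: "(\<lambda>ys. g (mset (map z is) + mset ys)) \<in> borel_measurable LS" by simp
      show ?t1 ?t2
        using integral_points_Suc[OF m g(2), of l] by (simp_all del: points.simps)
    qed
    show "(\<integral>x. falling_sum j l z (?g x) I \<partial>L) = E j (Suc l)"
      unfolding E_def falling_sum_def
      by (subst Bochner_Integration.integral_sum[OF 2]) (simp, intro sum.cong refl, rule 1)
    show "integrable L (\<lambda>x. falling_sum j l z (?g x) I)"
      unfolding falling_sum_def by (rule Bochner_Integration.integrable_sum[OF 2])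
  qed
  have IH: "chaos k (?g x) (image_mset z (mset_set I')) =
      (\<Sum>j\<le>k. (-1) ^ (k - j) * real (k choose j) * falling_sum j (k - j) z (?g x) I')"
    if "x \<in> space X" "I' \<subseteq> I" for x I'
    using that I by (intro Suc.IH gm g) (auto intro: finite_subset)
  have "chaos (Suc k) g (image_mset z (mset_set I)) =
      (\<Sum>i\<in>I. chaos k (?g (z i)) (image_mset z (mset_set (I - {i})))) -
      (\<integral>x. chaos k (?g x) (image_mset z (mset_set I)) \<partial>L)"
  proof -
    have "(\<Sum>z\<in>#image_mset z (mset_set I). chaos k (?g z) (image_mset z' (mset_set I) - {#z#})) =
        (\<Sum>i\<in>#mset_set I. chaos k (?g (z i)) (image_mset z' (mset_set I) - {#z i#}))" for z'
      by (simp add: multiset.map_comp comp_def)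
    moreover have "image_mset z (mset_set I) - {#z i#} = image_mset z (mset_set (I - {i}))" if "i \<in> I" for i
      using that I(1) by (simp add: image_mset_Diff mset_set_Diff)
    ultimately show ?thesis
      by (simp add: sum_unfold_sum_mset[symmetric])
  qed
  also have "(\<Sum>i\<in>I. chaos k (?g (z i)) (image_mset z (mset_set (I - {i})))) =
      (\<Sum>i\<in>I. \<Sum>j\<le>k. (-1) ^ (k - j) * real (k choose j) * falling_sum j (k - j) z (?g (z i)) (I - {i}))"
    by (intro sum.cong refl IH I) auto
  also have "\<dots> = (\<Sum>j\<le>k. (-1) ^ (k - j) * real (k choose j) * E (Suc j) (k - j))"
    by (subst sum.swap) (simp add: sum_distrib_left[symmetric] first)
  also have "(\<integral>x. chaos k (?g x) (image_mset z (mset_set I)) \<partial>L) =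
      (\<integral>x. (\<Sum>j\<le>k. (-1) ^ (k - j) * real (k choose j) * falling_sum j (k - j) z (?g x) I) \<partial>L)"
    by (intro Bochner_Integration.integral_cong refl IH) (auto simp: space_L)
  also have "\<dots> = (\<Sum>j\<le>k. (-1) ^ (k - j) * real (k choose j) * E j (Suc (k - j)))"
    by (subst Bochner_Integration.integral_sum) (auto simp: second second_int)
  \<comment> \<open>Pascal's rule, after shifting the index of one of the sums.\<close>
  also have "(\<Sum>j\<le>k. (-1) ^ (k - j) * real (k choose j) * E (Suc j) (k - j)) -
      (\<Sum>j\<le>k. (-1) ^ (k - j) * real (k choose j) * E j (Suc (k - j))) =
      (\<Sum>j\<le>Suc k. (-1) ^ (Suc k - j) * real (Suc k choose j) * E j (Suc k - j))"
  proof -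
    have "- (\<Sum>j\<le>k. (-1) ^ (k - j) * real (k choose j) * E j (Suc (k - j))) =
        (\<Sum>j\<le>Suc k. (-1) ^ (Suc k - j) * real (k choose j) * E j (Suc k - j))"
      by (auto simp: Suc_diff_le sum_negf[symmetric] intro!: sum.cong)
    also have "\<dots> = (-1) ^ Suc k * E 0 (Suc k) + (\<Sum>j\<le>k. (-1) ^ (k - j) * real (k choose Suc j) * E (Suc j) (k - j))"
      by (subst sum.atMost_Suc_shift) simp
    finally show ?thesis
      by (subst sum.atMost_Suc_shift) (simp add: algebra_simps sum.distrib)
  qed
  finally show ?case by (simp only: E_def)
qed

lemma measurable_nth_point: "(\<lambda>ys. snd (list_code X ys) i) \<in> LS \<rightarrow>\<^sub>M X"
  using measurable_list_code by measurable

lemma emeasure_points_box: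
  assumes "\<And>i. i < n \<Longrightarrow> A i \<in> sets X"
  shows "emeasure (points n) {ys\<in>space LS. \<forall>i<n. snd (list_code X ys) i \<in> A i} = (\<Prod>i<n. emeasure L (A i))"
  using assms
proof (induction n arbitrary: A)
  case 0
  then show ?case using sets.top[of LS] by (simp add: emeasure_return)
next
  case (Suc n)
  have meas: "{ys\<in>space LS. \<forall>i<m. snd (list_code X ys) i \<in> C i} \<in> sets LS"
    if "\<And>i. i < m \<Longrightarrow> C i \<in> sets X" for m C
  proof -
    have "{ys\<in>space LS. \<forall>i\<in>{..<m}. snd (list_code X ys) i \<in> C i} \<in> sets LS"
    proof (rule sets.sets_Collect_finite_All)
      fix i assume "i \<in> {..<m}"
      then have "(\<lambda>ys. snd (list_code X ys) i) -` C i \<inter> space LS \<in> sets LS"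
        by (intro measurable_sets[OF measurable_nth_point] that) simp
      also have "(\<lambda>ys. snd (list_code X ys) i) -` C i \<inter> space LS =
          {ys\<in>space LS. snd (list_code X ys) i \<in> C i}" by blast
      finally show "{ys\<in>space LS. snd (list_code X ys) i \<in> C i} \<in> sets LS" .
    qed simp
    also have "{ys\<in>space LS. \<forall>i\<in>{..<m}. snd (list_code X ys) i \<in> C i} =
        {ys\<in>space LS. \<forall>i<m. snd (list_code X ys) i \<in> C i}" by blast
    finally show ?thesis .
  qed
  have IH: "emeasure (points n) {ys\<in>space LS. \<forall>i<n. snd (list_code X ys) i \<in> A (Suc i)} = (\<Prod>i<n. emeasure L (A (Suc i)))"
    by (rule Suc.IH) (use Suc.prems in auto)
  have m: "{ys\<in>space LS. \<forall>i<n. snd (list_code X ys) i \<in> A (Suc i)} \<in> sets LS"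
    by (rule meas) (use Suc.prems in auto)
  have "emeasure (points (Suc n)) {ys\<in>space LS. \<forall>i<Suc n. snd (list_code X ys) i \<in> A i} =
      (\<integral>\<^sup>+ys. indicator {ys\<in>space LS. \<forall>i<Suc n. snd (list_code X ys) i \<in> A i} ys \<partial>points (Suc n))"
    by (rule nn_integral_indicator[symmetric]) (simp only: sets_points meas Suc.prems)
  also have "\<dots> = (\<integral>\<^sup>+x. \<integral>\<^sup>+ys. indicator {ys\<in>space LS. \<forall>i<Suc n. snd (list_code X ys) i \<in> A i} (x # ys) \<partial>points n \<partial>L)"
    by (rule nn_integral_points_Suc) (rule borel_measurable_indicator[OF meas[OF Suc.prems]])
  also have "\<dots> = (\<integral>\<^sup>+x. \<integral>\<^sup>+ys. indicator (A 0) x *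
      indicator {ys\<in>space LS. \<forall>i<n. snd (list_code X ys) i \<in> A (Suc i)} ys \<partial>points n \<partial>L)"
  proof (rule nn_integral_cong, rule nn_integral_cong)
    fix x ys assume "x \<in> space L" "ys \<in> space (points n)"
    then have sp: "x # ys \<in> space LS" "ys \<in> space LS" by (auto simp: space_L)
    have cons: "snd (list_code X (x # ys)) 0 = x"
      "snd (list_code X (x # ys)) (Suc i) = snd (list_code X ys) i" for i
      by (simp_all add: list_code_def)
    have "x # ys \<in> {ys\<in>space LS. \<forall>i<Suc n. snd (list_code X ys) i \<in> A i} \<longleftrightarrow>
        x \<in> A 0 \<and> ys \<in> {ys\<in>space LS. \<forall>i<n. snd (list_code X ys) i \<in> A (Suc i)}"
      unfolding mem_Collect_eq All_less_Suc2 cons using sp by blast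
    then show "indicator {ys\<in>space LS. \<forall>i<Suc n. snd (list_code X ys) i \<in> A i} (x # ys) =
      (indicator (A 0) x * indicator {ys\<in>space LS. \<forall>i<n. snd (list_code X ys) i \<in> A (Suc i)} ys :: ennreal)"
      unfolding indicator_def by (simp only: of_bool_conj)
  qed
  also have "\<dots> = emeasure L (A 0) * (\<Prod>i<n. emeasure L (A (Suc i)))"
  proof -
    define S where "S = {ys\<in>space LS. \<forall>i<n. snd (list_code X ys) i \<in> A (Suc i)}"
    have S: "S \<in> sets (points n)" unfolding S_def sets_points by (rule m)
    have A0: "A 0 \<in> sets L" using Suc.prems[of 0] by (simp add: sets_L)
    have "(\<integral>\<^sup>+x. \<integral>\<^sup>+ys. indicator (A 0) x * indicator S ys \<partial>points n \<partial>L) =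
        emeasure L (A 0) * emeasure (points n) S"
      using S A0 by (simp add: nn_integral_cmult nn_integral_multc)
    then show ?thesis by (simp only: S_def IH)
  qed
  also have "\<dots> = (\<Prod>i<Suc n. emeasure L (A i))"
    by (simp only: prod.lessThan_Suc_shift)
  finally show ?case .
qed

text \<open>Identifies two encodings of the power of \<open>L\<close>: lists and functions on an
  index block. The offset \<open>j\<close> is needed because \<open>pathwise_integral\<close>
  integrates the coordinates from \<open>j\<close> to \<open>k - 1\<close> against the
  intensity.\<close>

lemma distr_points:
  "distr (points n) (PiM {j..<j + n} (\<lambda>_. L)) (\<lambda>ys. \<lambda>i\<in>{j..<j + n}. snd (list_code X ys) (i - j)) =
    PiM {j..<j + n} (\<lambda>_. L)"
proof -
  interpret P: product_sigma_finite "\<lambda>_. L" ..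
  let ?J = "{j..<j + n}"
  let ?f = "\<lambda>ys. \<lambda>i\<in>?J. snd (list_code X ys) (i - j)"
  have f: "?f \<in> points n \<rightarrow>\<^sub>M PiM ?J (\<lambda>_. L)"
    by (rule measurable_restrict) (subst measurable_cong_sets[OF sets_points sets_L], rule measurable_nth_point)
  show ?thesis
  proof (rule P.PiM_eqI)
    fix A assume A: "\<And>i. i \<in> ?J \<Longrightarrow> A i \<in> sets L"
    have "?f -` Pi\<^sub>E ?J A \<inter> space (points n) = {ys\<in>space LS. \<forall>i<n. snd (list_code X ys) i \<in> A (i + j)}"
    proof -
      have "(\<forall>i\<in>?J. snd (list_code X ys) (i - j) \<in> A i) \<longleftrightarrow> (\<forall>i<n. snd (list_code X ys) i \<in> A (i + j))" for ys
      proof safe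
        fix i assume "\<forall>i\<in>?J. snd (list_code X ys) (i - j) \<in> A i" "i < n"
        then show "snd (list_code X ys) i \<in> A (i + j)" by (auto dest: bspec[of _ _ "i + j"])
      next
        fix i assume h: "\<forall>i<n. snd (list_code X ys) i \<in> A (i + j)" and i: "i \<in> ?J"
        have "i - j < n" using i by auto
        from h[rule_format, OF this] show "snd (list_code X ys) (i - j) \<in> A i" using i by simp
      qed
      then show ?thesis by (auto simp: PiE_iff)
    qed
    then have "emeasure (distr (points n) (PiM ?J (\<lambda>_. L)) ?f) (Pi\<^sub>E ?J A) =
        emeasure (points n) {ys\<in>space LS. \<forall>i<n. snd (list_code X ys) i \<in> A (i + j)}"
      using A by (subst emeasure_distr[OF f]) (auto intro!: sets_PiM_I_finite)
    also have "\<dots> = (\<Prod>i<n. emeasure L (A (i + j)))"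
      by (rule emeasure_points_box) (use A in \<open>auto simp: sets_L\<close>)
    also have "\<dots> = (\<Prod>i\<in>?J. emeasure L (A i))"
      by (rule prod.reindex_bij_betw[of "\<lambda>i. i + j"], rule bij_betwI[where g="\<lambda>i. i - j"]) auto
    finally show "emeasure (distr (points n) (PiM ?J (\<lambda>_. L)) ?f) (Pi\<^sub>E ?J A) = (\<Prod>i\<in>?J. emeasure L (A i))" .
  qed simp_all
qed

lemma AE_points_length: "AE ys in points n. length ys = n"
proof -
  have "(\<integral>\<^sup>+ys. of_bool (length ys \<noteq> n) \<partial>points n) = 0"
    by (subst nn_integral_points_length[where h="\<lambda>m. of_bool (m \<noteq> n)"]) simp
  then have "AE ys in points n. of_bool (length ys \<noteq> n) = (0 :: ennreal)"
    by (subst (asm) nn_integral_0_iff_AE) auto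
  then show ?thesis by (auto elim!: AE_mp)
qed

end

text \<open>A symmetric function of \<open>k\<close>-tuples as a function of multisets:
  \<open>SOME\<close> fixes an order of the points, and symmetry makes the choice irrelevant. The
  value 0 for other sizes and outside the space yields a bounded function on all multisets.\<close>

definition lift_integrand :: "'a measure \<Rightarrow> nat \<Rightarrow> ((nat \<Rightarrow> 'a) \<Rightarrow> real) \<Rightarrow> 'a multiset \<Rightarrow> real" where
  "lift_integrand X k g N = (if size N = k \<and> set_mset N \<subseteq> space X
     then g (\<lambda>i\<in>{..<k}. (SOME xs. mset xs = N) ! i) else 0)"

lemma lift_integrand_mset:
  assumes g: "g \<in> elementary_integrands X B k" and xs: "xs \<in> lists (space X)" "length xs = k"
  shows "lift_integrand X k g (mset xs) = g (\<lambda>i\<in>{..<k}. xs ! i)"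
proof -
  define ys where "ys = (SOME ys. mset ys = mset xs)"
  have "mset ys = mset xs" unfolding ys_def by (rule someI[of _ xs]) simp
  then obtain p where p: "p permutes {..<length xs}" "permute_list p xs = ys"
    by (rule mset_eq_permutation)
  have "(\<lambda>i\<in>{..<k}. ys ! i) = (\<lambda>i\<in>{..<k}. xs ! i) \<circ> p"
  proof
    fix i show "(\<lambda>i\<in>{..<k}. ys ! i) i = ((\<lambda>i\<in>{..<k}. xs ! i) \<circ> p) i"
    proof (cases "i < k")
      case True
      then have "p i < k" using permutes_in_image[OF p(1), of i] xs(2) by simp
      then show ?thesis using p xs(2) True by (auto simp: permute_list_nth)
    next
      case False
      then have "p i = i" using p(1) xs(2) by (simp add: permutes_def)
      then show ?thesis using False by simp
    qed
  qed
  moreover have "(\<lambda>i\<in>{..<k}. xs ! i) \<in> space (pow_measure X k)"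
    using xs by (auto simp: space_PiM in_lists_conv_set)
  ultimately have "g (\<lambda>i\<in>{..<k}. ys ! i) = g (\<lambda>i\<in>{..<k}. xs ! i)"
    using g p(1) xs(2) by (auto simp: elementary_integrands_def)
  then show ?thesis using xs by (auto simp: lift_integrand_def ys_def in_lists_conv_set)
qed

lemma lift_integrand_eq_0:
  "length xs \<noteq> k \<Longrightarrow> lift_integrand X k g (mset xs) = 0"
  by (simp add: lift_integrand_def)

lemma abs_lift_integrand_le:
  assumes "\<And>x. x \<in> space (pow_measure X k) \<Longrightarrow> \<bar>g x\<bar> \<le> c" "0 \<le> c"
  shows "\<bar>lift_integrand X k g N\<bar> \<le> c"
proof -
  obtain xs where xs: "mset xs = N" using ex_mset by blast
  have "mset (SOME xs. mset xs = N) = N" by (rule someI[of _ xs]) (rule xs)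
  then have "(\<lambda>i\<in>{..<k}. (SOME xs. mset xs = N) ! i) \<in> space (pow_measure X k)"
    if "size N = k" "set_mset N \<subseteq> space X"
    using that by (auto simp: space_PiM) (metis nth_mem_mset size_mset subsetD)
  then show ?thesis using assms by (auto simp: lift_integrand_def)
qed

lemma (in nonempty_space) measurable_lift_integrand:
  assumes g: "g \<in> elementary_integrands X B k"
  shows "(\<lambda>xs. lift_integrand X k g (mset xs)) \<in> borel_measurable LS"
proof (rule measurable_from_list)
  fix n
  show "(\<lambda>x. lift_integrand X k g (mset (map x [0..<n]))) \<in> borel_measurable SQ"
  proof (cases "n = k")
    case True
    have gm: "g \<in> borel_measurable (pow_measure X k)"
      using g by (simp add: elementary_integrands_def)
    have "(\<lambda>x. g (restrict x {..<k})) \<in> borel_measurable SQ"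
      by (rule measurable_compose[OF measurable_restrict_subset gm]) simp
    moreover have "lift_integrand X k g (mset (map x [0..<n])) = g (restrict x {..<k})" if "x \<in> space SQ" for x
    proof -
      have "map x [0..<n] \<in> lists (space X)" using that by (auto simp: space_PiM PiE_iff)
      then have "lift_integrand X k g (mset (map x [0..<n])) = g (\<lambda>i\<in>{..<k}. map x [0..<n] ! i)"
        by (rule lift_integrand_mset[OF g]) (simp add: True)
      also have "(\<lambda>i\<in>{..<k}. map x [0..<n] ! i) = restrict x {..<k}"
        by (auto simp: True)
      finally show ?thesis .
    qed
    ultimately show ?thesis by (subst measurable_cong) auto
  qed (simp add: lift_integrand_def)
qed

section \<open>Restriction of the intensity to a window \<open>B p\<close>\<close>

locale local_intensity = localized_space X B for X :: "'a measure" and B +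
  fixes \<Lambda> :: "'a measure" and p :: nat
  assumes locally_finite: "locally_finite X B \<Lambda>"
begin

lemma sets_\<Lambda> [measurable_cong]: "sets \<Lambda> = sets X"
  using locally_finite by (simp add: locally_finite_def)

lemma space_\<Lambda>: "space \<Lambda> = space X"
  using sets_\<Lambda> by (rule sets_eq_imp_space_eq)

lemma \<Lambda>_finite: "A \<in> sets X \<Longrightarrow> A \<subseteq> B n \<Longrightarrow> emeasure \<Lambda> A < \<infinity>"
  using locally_finite local_setI by (auto simp: locally_finite_def)

sublocale \<Lambda>: sigma_finite_measure \<Lambda>
  by standard
    (use \<Lambda>_finite[OF sets_B order_refl] UN_B in \<open>auto simp: space_\<Lambda> sets_\<Lambda> intro!: exI[of _ "range B"] less_imp_neq\<close>)

lemma sets_restr_\<Lambda> [measurable_cong]: "sets (restr \<Lambda> (B p)) = sets X"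
  by (simp add: sets_\<Lambda>)

lemma emeasure_L: "A \<in> sets X \<Longrightarrow> emeasure (restr \<Lambda> (B p)) A = emeasure \<Lambda> (A \<inter> B p)"
  by (simp add: emeasure_restr' sets_\<Lambda>)

sublocale finite_intensity X "restr \<Lambda> (B p)"
proof (intro finite_intensity.intro finite_intensity_axioms.intro finite_measureI nonempty_space_axioms)
  have "space (restr \<Lambda> (B p)) = space X"
    using sets_restr_\<Lambda> by (rule sets_eq_imp_space_eq)
  then show "emeasure (restr \<Lambda> (B p)) (space (restr \<Lambda> (B p))) \<noteq> \<infinity>"
    using \<Lambda>_finite[of "space X \<inter> B p" p] by (auto simp: emeasure_L)
qed (rule sets_restr_\<Lambda>)

lemma PiM_restr:
  assumes "finite J"
  shows "PiM J (\<lambda>_. restr \<Lambda> (B p)) = density (PiM J (\<lambda>_. \<Lambda>)) (indicator (PiE J (\<lambda>_. B p)))"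
proof -
  interpret P: product_sigma_finite "\<lambda>_. restr \<Lambda> (B p)" ..
  interpret Q: product_sigma_finite "\<lambda>_. \<Lambda>" ..
  have eq: "sets (PiM J (\<lambda>_. \<Lambda>)) = sets (PiM J (\<lambda>_. restr \<Lambda> (B p)))"
    by (rule sets_PiM_cong) (simp_all add: sets_\<Lambda> sets_restr_\<Lambda>)
  have BJ: "PiE J (\<lambda>_. B p) \<in> sets (PiM J (\<lambda>_. \<Lambda>))"
    using assms by (intro sets_PiM_I_finite) (auto simp: sets_\<Lambda>)
  show ?thesis
  proof (rule P.PiM_eqI[symmetric])
    fix A assume "\<And>i. i \<in> J \<Longrightarrow> A i \<in> sets (restr \<Lambda> (B p))"
    then have A: "A i \<in> sets X" if "i \<in> J" for i using that by (simp add: sets_\<Lambda>)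
    then have AJ: "PiE J A \<in> sets (PiM J (\<lambda>_. \<Lambda>))"
      using assms by (intro sets_PiM_I_finite) (auto simp: sets_\<Lambda>)
    have "emeasure (density (PiM J (\<lambda>_. \<Lambda>)) (indicator (PiE J (\<lambda>_. B p)))) (PiE J A) =
        emeasure (PiM J (\<lambda>_. \<Lambda>)) (PiE J (\<lambda>i. A i \<inter> B p))"
      using AJ BJ by (subst emeasure_restricted) (auto simp: PiE_Int Int_commute)
    also have "\<dots> = (\<Prod>i\<in>J. emeasure \<Lambda> (A i \<inter> B p))"
      using A assms by (intro Q.emeasure_PiM) (auto simp: sets_\<Lambda>)
    also have "\<dots> = (\<Prod>i\<in>J. emeasure (restr \<Lambda> (B p)) (A i))"
      by (intro prod.cong refl emeasure_L[symmetric] A)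
    finally show "emeasure (density (PiM J (\<lambda>_. \<Lambda>)) (indicator (PiE J (\<lambda>_. B p)))) (PiE J A) =
        (\<Prod>i\<in>J. emeasure (restr \<Lambda> (B p)) (A i))" .
  qed (simp_all add: assms eq)
qed

text \<open>The density of the restricted product measure is the indicator of a box that contains
  the support of \<open>f\<close>.\<close>

lemma integral_PiM_supported:
  assumes J: "finite J" and f: "f \<in> borel_measurable (PiM J (\<lambda>_. X))"
    and supp: "\<And>y. y \<in> space (PiM J (\<lambda>_. X)) \<Longrightarrow> f y \<noteq> 0 \<Longrightarrow> y \<in> PiE J (\<lambda>_. B p)"
  shows "(\<integral>y. f y \<partial>PiM J (\<lambda>_. \<Lambda>)) = (\<integral>y. f y \<partial>PiM J (\<lambda>_. restr \<Lambda> (B p)) :: real)"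
proof -
  have BJ: "PiE J (\<lambda>_. B p) \<in> sets (PiM J (\<lambda>_. \<Lambda>))"
    using J by (intro sets_PiM_I_finite) (auto simp: sets_\<Lambda>)
  have s: "sets (PiM J (\<lambda>_. \<Lambda>)) = sets (PiM J (\<lambda>_. X))"
    by (rule sets_PiM_cong) (simp_all add: sets_\<Lambda>)
  have sp: "space (PiM J (\<lambda>_. \<Lambda>)) = space (PiM J (\<lambda>_. X))"
    by (rule sets_eq_imp_space_eq[OF s])
  have fm: "f \<in> borel_measurable (PiM J (\<lambda>_. \<Lambda>))"
    using f by (subst measurable_cong_sets[OF s refl])
  have ind: "indicator (PiE J (\<lambda>_. B p)) y * f y = f y" if "y \<in> space (PiM J (\<lambda>_. X))" for y
    using supp[OF that] by (auto simp: indicator_def)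
  have D: "density (PiM J (\<lambda>_. \<Lambda>)) (indicator (PiE J (\<lambda>_. B p))) =
      density (PiM J (\<lambda>_. \<Lambda>)) (\<lambda>y. ennreal (indicator (PiE J (\<lambda>_. B p)) y))"
    by (intro arg_cong[where f="density (PiM J (\<lambda>_. \<Lambda>))"] ext) (simp add: ennreal_indicator)
  show "(\<integral>y. f y \<partial>PiM J (\<lambda>_. \<Lambda>)) = (\<integral>y. f y \<partial>PiM J (\<lambda>_. restr \<Lambda> (B p)))"
    unfolding PiM_restr[OF J] D using BJ fm ind
    by (subst integral_density) (auto intro!: Bochner_Integration.integral_cong simp: sp)
qed

end

context localized_space
begin

lemma CM_sigma_finite: "\<mu> \<in> CM \<Longrightarrow> sigma_finite_measure \<mu>"
  by standard
    (use CM_finite[OF _ sets_B order_refl] UN_B in \<open>auto simp: CM_space CM_sets intro!: exI[of _ "range B"]\<close>)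

text \<open>Cut the space into \<open>B p\<close> and the shells
  \<open>B (p + m + 1) - B (p + m)\<close>, and enumerate the points in each of them. The given list
  becomes block 0, so that the points in \<open>B p\<close> are recognised by their index.\<close>

lemma CM_representation:
  assumes \<mu>: "\<mu> \<in> CM" and xs: "xs \<in> lists (space X)" "restr \<mu> (B p) = dirac_sum X xs"
  shows "\<exists>l. l 0 = xs \<and> (\<forall>n. l n \<in> lists (space X)) \<and> (\<forall>n. set (l (Suc n)) \<inter> B p = {}) \<and>
    distr (count_space (SIGMA n:UNIV. {..<length (l n)})) \<mu> (\<lambda>q. l (fst q) ! snd q) = \<mu>"
proof -
  define D where "D n = (case n of 0 \<Rightarrow> B p | Suc m \<Rightarrow> B (p + Suc m) - B (p + m))" for n
  have D [measurable]: "D n \<in> sets X" for n by (auto simp: D_def split: nat.split)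
  have "\<exists>ys\<in>lists (space X). set ys \<inter> B p = {} \<and> restr \<mu> (D (Suc m)) = dirac_sum X ys" for m
  proof -
    obtain e where e: "e \<in> CS \<rightarrow>\<^sub>M LS" "restr \<mu> (B (p + Suc m)) = dirac_sum X (e \<mu>)"
      using measurable_enumeration[of "p + Suc m"] \<mu> by blast
    have es: "e \<mu> \<in> lists (space X)" using measurable_space[OF e(1)] \<mu> by simp
    let ?ys = "filter (\<lambda>x. x \<in> D (Suc m)) (e \<mu>)"
    have "restr \<mu> (D (Suc m)) = restr (restr \<mu> (B (p + Suc m))) (D (Suc m))"
    proof (rule measure_eqI)
      fix A assume "A \<in> sets (restr \<mu> (D (Suc m)))"
      then have A: "A \<in> sets X" using CM_sets[OF \<mu>] by simp
      have "A \<inter> D (Suc m) \<inter> B (p + Suc m) = A \<inter> D (Suc m)" by (auto simp: D_def)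
      then show "emeasure (restr \<mu> (D (Suc m))) A = emeasure (restr (restr \<mu> (B (p + Suc m))) (D (Suc m))) A"
        using A CM_sets[OF \<mu>] by (simp add: emeasure_restr')
    qed simp
    also have "\<dots> = dirac_sum X ?ys" by (simp only: e(2) restr_dirac_sum[OF es D])
    finally have "restr \<mu> (D (Suc m)) = dirac_sum X ?ys" .
    moreover have "set ?ys \<inter> B p = {}" using B_mono[of p "p + m"] by (auto simp: D_def)
    moreover have "?ys \<in> lists (space X)" using es by auto
    ultimately show ?thesis by blast
  qed
  then obtain ys where ys: "\<And>m. ys m \<in> lists (space X)" "\<And>m. set (ys m) \<inter> B p = {}"
    "\<And>m. restr \<mu> (D (Suc m)) = dirac_sum X (ys m)" by metis
  define l where "l n = (case n of 0 \<Rightarrow> xs | Suc m \<Rightarrow> ys m)" for n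
  have l: "l n \<in> lists (space X)" "restr \<mu> (D n) = dirac_sum X (l n)" for n
    using xs ys by (auto simp: l_def D_def split: nat.split)
  have disj: "disjoint_family D"
  proof -
    have "D m \<inter> D n = {}" if "m < n" for m n
      using that B_mono[of "p + m" "p + (n - 1)"] B_mono[of p "p + (n - 1)"]
      by (auto simp: D_def split: nat.splits)
    then show ?thesis unfolding disjoint_family_on_def by (metis Int_commute nat_neq_iff)
  qed
  have cover: "(\<Union>n. D n) = space X"
  proof
    show "(\<Union>n. D n) \<subseteq> space X" using sets.sets_into_space[OF D] by blast
    show "space X \<subseteq> (\<Union>n. D n)"
    proof
      fix x assume "x \<in> space X"
      then obtain n where "x \<in> B n" using UN_B by blast
      then have "x \<in> B (p + n)" using B_mono[of n "p + n"] by auto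
      then show "x \<in> (\<Union>n. D n)"
      proof (induction n)
        case (Suc n)
        then show ?case
          by (cases "x \<in> B (p + n)") (auto simp: D_def intro!: exI[of _ "Suc n"])
      qed (auto simp: D_def intro!: exI[of _ 0])
    qed
  qed
  let ?I = "SIGMA n:UNIV. {..<length (l n)}" and ?z = "\<lambda>q. l (fst q) ! snd q"
  have z: "?z \<in> count_space ?I \<rightarrow>\<^sub>M \<mu>"
  proof -
    have "l a ! b \<in> space X" if "b < length (l a)" for a b
      using l(1)[of a] nth_mem[OF that] by auto
    then show ?thesis by (auto simp: CM_space[OF \<mu>])
  qed
  have "distr (count_space ?I) \<mu> ?z = \<mu>"
  proof (rule measure_eqI)
    fix A assume "A \<in> sets (distr (count_space ?I) \<mu> ?z)"
    then have A: "A \<in> sets \<mu>" "A \<in> sets X" using CM_sets[OF \<mu>] by auto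
    have "emeasure (distr (count_space ?I) \<mu> ?z) A = (\<integral>\<^sup>+q. indicator A (?z q) \<partial>count_space ?I)"
      using A by (subst nn_integral_indicator[symmetric], simp, subst nn_integral_distr[OF z]) auto
    also have "\<dots> = (\<integral>\<^sup>+n. \<integral>\<^sup>+i. indicator A (l n ! i) \<partial>count_space {..<length (l n)} \<partial>count_space UNIV)"
      by (subst nn_integral_count_space_Sigma[symmetric]) simp
    also have "\<dots> = (\<Sum>n. \<integral>\<^sup>+i. indicator A (l n ! i) \<partial>count_space {..<length (l n)})"
      by (rule nn_integral_count_space_nat)
    also have "\<dots> = (\<Sum>n. emeasure \<mu> (A \<inter> D n))"
    proof (rule suminf_cong)
      fix n
      have "(\<lambda>i. l n ! i) \<in> count_space {..<length (l n)} \<rightarrow>\<^sub>M X"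
        using l(1)[of n] nth_mem[of _ "l n"] by auto
      then have "(\<integral>\<^sup>+i. indicator A (l n ! i) \<partial>count_space {..<length (l n)}) = (\<integral>\<^sup>+x. indicator A x \<partial>dirac_sum X (l n))"
        using A(2) by (simp add: dirac_sum_def nn_integral_distr del: nn_integral_indicator)
      also have "\<dots> = emeasure (restr \<mu> (D n)) A" using A(2) l(2)[of n] by simp
      finally show "(\<integral>\<^sup>+i. indicator A (l n ! i) \<partial>count_space {..<length (l n)}) = emeasure \<mu> (A \<inter> D n)"
        using A(2) by (simp add: emeasure_restr'[OF CM_sets[OF \<mu>]])
    qed
    also have "\<dots> = emeasure \<mu> (\<Union>n. A \<inter> D n)"
      using A CM_sets[OF \<mu>] disj by (intro suminf_emeasure) (auto simp: disjoint_family_on_def)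
    also have "(\<Union>n. A \<inter> D n) = A" using cover sets.sets_into_space[OF A(2)] by auto
    finally show "emeasure (distr (count_space ?I) \<mu> ?z) A = emeasure \<mu> A" .
  qed simp
  moreover have "l 0 = xs" "\<forall>n. set (l (Suc n)) \<inter> B p = {}"
    using ys(2) by (auto simp: l_def)
  ultimately show ?thesis using l(1) by blast
qed

end

section \<open>Pathwise integrals as iterated divergences\<close>

context local_intensity
begin

definition supported :: "nat \<Rightarrow> ((nat \<Rightarrow> 'a) \<Rightarrow> real) \<Rightarrow> bool" where
  "supported k g \<longleftrightarrow> (\<forall>x\<in>space (pow_measure X k). g x \<noteq> 0 \<longrightarrow> x \<in> PiE {..<k} (\<lambda>_. B p))"

lemma lift_integrand_supported:
  assumes g: "g \<in> elementary_integrands X B k" "supported k g"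
    and xs: "xs \<in> lists (space X)" "lift_integrand X k g (mset xs) \<noteq> 0"
  shows "set xs \<subseteq> B p"
proof -
  have len: "length xs = k" using xs(2) lift_integrand_eq_0 by blast
  have "g (\<lambda>i\<in>{..<k}. xs ! i) \<noteq> 0" using lift_integrand_mset[OF g(1) xs(1) len] xs(2) by simp
  moreover have "(\<lambda>i\<in>{..<k}. xs ! i) \<in> space (pow_measure X k)"
    using xs(1) len by (auto simp: space_PiM in_lists_conv_set)
  ultimately have mem: "(\<lambda>i\<in>{..<k}. xs ! i) \<in> PiE {..<k} (\<lambda>_. B p)"
    using g(2) unfolding supported_def by blast
  have "xs ! i \<in> B p" if "i < k" for i
    using PiE_mem[OF mem, of i] that by simp
  then show ?thesis using len by (auto simp: in_set_conv_nth)
qed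

text \<open>The support of \<open>g\<close> allows the intensity to be replaced by its finite
  restriction, and \<open>distr_points\<close> then passes from functions to lists.\<close>

lemma integral_merge:
  assumes g: "g \<in> elementary_integrands X B k" "supported k g"
    and us: "us \<in> lists (space X)" "length us = j" and j: "j \<le> k"
  shows "(\<integral>y. g (merge {..<j} {j..<k} (\<lambda>i\<in>{..<j}. us ! i, y)) \<partial>PiM {j..<k} (\<lambda>_. \<Lambda>)) =
    (\<integral>ys. lift_integrand X k g (mset us + mset ys) \<partial>points (k - j))"
proof -
  let ?J = "{j..<k}" and ?x = "\<lambda>i\<in>{..<j}. us ! i"
  let ?G = "\<lambda>y. g (merge {..<j} ?J (?x, y))"
  let ?f = "\<lambda>ys. \<lambda>i\<in>{j..<j + (k - j)}. snd (list_code X ys) (i - j)"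
  have gm: "g \<in> borel_measurable (pow_measure X k)"
    using g(1) by (simp add: elementary_integrands_def)
  have un: "{..<j} \<union> ?J = {..<k}" using j by auto
  have x: "?x \<in> space (PiM {..<j} (\<lambda>_. X))"
    using us by (auto simp: space_PiM in_lists_conv_set)
  have mm: "(\<lambda>y. merge {..<j} ?J (?x, y)) \<in> PiM ?J (\<lambda>_. X) \<rightarrow>\<^sub>M pow_measure X k"
    using measurable_compose[OF measurable_Pair1'[OF x] measurable_merge[of "{..<j}" ?J "\<lambda>_. X"]] un by simp
  have G: "?G \<in> borel_measurable (PiM ?J (\<lambda>_. X))"
    by (rule measurable_compose[OF mm gm])
  have "(\<integral>y. ?G y \<partial>PiM ?J (\<lambda>_. \<Lambda>)) = (\<integral>y. ?G y \<partial>PiM ?J (\<lambda>_. restr \<Lambda> (B p)))"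
  proof (rule integral_PiM_supported[OF _ G])
    fix y assume y: "y \<in> space (PiM ?J (\<lambda>_. X))" "?G y \<noteq> 0"
    then have "merge {..<j} ?J (?x, y) \<in> PiE {..<k} (\<lambda>_. B p)"
      using g(2) measurable_space[OF mm y(1)] by (auto simp: supported_def)
    then have "y i \<in> B p" if "i \<in> ?J" for i
      using that by (auto simp: merge_def PiE_iff dest!: bspec[of _ _ i])
    then show "y \<in> PiE ?J (\<lambda>_. B p)" using y(1) by (auto simp: space_PiM PiE_iff)
  qed simp
  also have "\<dots> = (\<integral>y. ?G y \<partial>distr (points (k - j)) (PiM {j..<j + (k - j)} (\<lambda>_. restr \<Lambda> (B p))) ?f)"
    unfolding distr_points using j by simp
  also have "\<dots> = (\<integral>ys. ?G (?f ys) \<partial>points (k - j))"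
  proof (rule integral_distr)
    show "?f \<in> points (k - j) \<rightarrow>\<^sub>M PiM {j..<j + (k - j)} (\<lambda>_. restr \<Lambda> (B p))"
      by (rule measurable_restrict)
        (subst measurable_cong_sets[OF sets_points sets_restr_\<Lambda>], rule measurable_nth_point)
    have "sets (PiM ?J (\<lambda>_. restr \<Lambda> (B p))) = sets (PiM ?J (\<lambda>_. X))"
      by (rule sets_PiM_cong) (simp_all add: sets_restr_\<Lambda> sets_\<Lambda>)
    then show "?G \<in> borel_measurable (PiM {j..<j + (k - j)} (\<lambda>_. restr \<Lambda> (B p)))"
      using G j by (simp cong: measurable_cong_sets)
  qed
  also have "\<dots> = (\<integral>ys. lift_integrand X k g (mset us + mset ys) \<partial>points (k - j))"
  proof (rule integral_cong_AE)
    have "(\<lambda>ys. us @ ys) \<in> LS \<rightarrow>\<^sub>M LS"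
      using us by (intro measurable_append measurable_const) auto
    from measurable_compose[OF this measurable_lift_integrand[OF g(1)]]
    show "(\<lambda>ys. lift_integrand X k g (mset us + mset ys)) \<in> borel_measurable (points (k - j))"
      by (simp add: measurable_cong_sets[OF sets_points refl])
    have "?f \<in> LS \<rightarrow>\<^sub>M PiM ?J (\<lambda>_. X)"
      unfolding le_add_diff_inverse[OF j] by (intro measurable_restrict measurable_nth_point)
    from measurable_compose[OF this G]
    show "(\<lambda>ys. ?G (?f ys)) \<in> borel_measurable (points (k - j))"
      by (simp add: measurable_cong_sets[OF sets_points refl])
    show "AE ys in points (k - j). ?G (?f ys) = lift_integrand X k g (mset us + mset ys)"
      using AE_points_length AE_space
    proof eventually_elim
      fix ys assume ys: "length ys = k - j" "ys \<in> space (points (k - j))"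
      have "lift_integrand X k g (mset (us @ ys)) = g (\<lambda>i\<in>{..<k}. (us @ ys) ! i)"
        using us ys j by (intro lift_integrand_mset[OF g(1)]) auto
      also have "(\<lambda>i\<in>{..<k}. (us @ ys) ! i) = merge {..<j} ?J (?x, ?f ys)"
        using us ys j by (auto simp: merge_def fun_eq_iff nth_append list_code_def)
      finally show "?G (?f ys) = lift_integrand X k g (mset us + mset ys)" by simp
    qed
  qed
  finally show ?thesis .
qed

text \<open>Represent \<mu> by blocks with \<open>xs\<close> as block 0. An index in another block
  is a point outside \<open>B p\<close>, where the integrand vanishes; so every integral over a
  factorial measure collapses to a finite sum over the positions of \<open>xs\<close>, and the
  result is the expansion in \<open>chaos_eq_falling_sum\<close>.\<close>

theorem pathwise_integral_eq_chaos:
  assumes g: "g \<in> elementary_integrands X B k" "supported k g"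
    and \<mu>: "\<mu> \<in> CM" and xs: "xs \<in> lists (space X)" "restr \<mu> (B p) = dirac_sum X xs" "set xs \<subseteq> B p"
  shows "pathwise_integral \<Lambda> k g \<mu> = chaos k (lift_integrand X k g) (mset xs)"
proof -
  obtain l where l: "l 0 = xs" "\<And>n. l n \<in> lists (space X)" "\<And>n. set (l (Suc n)) \<inter> B p = {}"
    and rep: "distr (count_space (SIGMA n:UNIV. {..<length (l n)})) \<mu> (\<lambda>q. l (fst q) ! snd q) = \<mu>"
    using CM_representation[OF \<mu> xs(1,2)] by blast
  let ?I = "SIGMA n:UNIV. {..<length (l n)}" and ?z = "\<lambda>q. l (fst q) ! snd q"
  let ?J = "{0 :: nat} \<times> {..<length xs}" and ?h = "lift_integrand X k g"
  have zX: "?z q \<in> space X" if "q \<in> ?I" for q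
  proof -
    obtain n i where q: "q = (n, i)" by (cases q)
    then have "l n ! i \<in> set (l n)" using that by auto
    then show ?thesis using l(2)[of n] by (auto simp: q)
  qed
  note fm = factorial_measure_distr[OF CM_sigma_finite[OF \<mu>] _ rep]
  have I0: "?J \<subseteq> ?I" using l(1) by auto
  have zB: "q \<in> ?J" if "q \<in> ?I" "?z q \<in> B p" for q
  proof (cases "fst q")
    case 0
    then show ?thesis using that l(1) by (cases q) auto
  next
    case (Suc n)
    then have "?z q \<in> set (l (Suc n))" using that by (cases q) auto
    then show ?thesis using that(2) l(3)[of n] by blast
  qed
  obtain c where c: "\<And>x. x \<in> space (pow_measure X k) \<Longrightarrow> \<bar>g x\<bar> \<le> c"
    using g(1) by (auto simp: elementary_integrands_def)
  have hb: "\<bar>?h K\<bar> \<le> max c 0" for K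
    by (rule abs_lift_integrand_le) (auto intro: order.trans[OF c])
  have summand: "(\<integral>x. (\<integral>y. g (merge {..<j} {j..<k} (x, y)) \<partial>PiM {j..<k} (\<lambda>_. \<Lambda>)) \<partial>factorial_measure \<mu> j) =
      falling_sum j (k - j) ?z ?h ?J" if j: "j \<le> k" for j
  proof -
    let ?y = "\<lambda>is. \<lambda>i\<in>{..<j}. ?z (is ! i)"
    define G where "G x = (\<integral>y. g (merge {..<j} {j..<k} (x, y)) \<partial>PiM {j..<k} (\<lambda>_. \<Lambda>))" for x
    interpret P: product_sigma_finite "\<lambda>_::nat. \<Lambda>" ..
    interpret PJ: sigma_finite_measure "PiM {j..<k} (\<lambda>_. \<Lambda>)" by (rule P.sigma_finite) simp
    have Gm: "G \<in> borel_measurable (pow_measure \<mu> j)"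
    proof -
      have gm: "g \<in> borel_measurable (pow_measure X k)"
        using g(1) by (simp add: elementary_integrands_def)
      have un: "{..<j} \<union> {j..<k} = {..<k}" using j by auto
      have s: "sets (pow_measure \<mu> j \<Otimes>\<^sub>M PiM {j..<k} (\<lambda>_. \<Lambda>)) = sets (pow_measure X j \<Otimes>\<^sub>M PiM {j..<k} (\<lambda>_. X))"
        by (intro sets_pair_measure_cong sets_PiM_cong) (auto simp: sets_\<Lambda> CM_sets[OF \<mu>])
      have "(\<lambda>q. g (merge {..<j} {j..<k} q)) \<in> borel_measurable (pow_measure X j \<Otimes>\<^sub>M PiM {j..<k} (\<lambda>_. X))"
        using measurable_compose[OF measurable_merge[of "{..<j}" "{j..<k}" "\<lambda>_. X"], of g borel] gm un by simp
      then have "(\<lambda>(x, y). g (merge {..<j} {j..<k} (x, y))) \<in> borel_measurable (pow_measure \<mu> j \<Otimes>\<^sub>M PiM {j..<k} (\<lambda>_. \<Lambda>))"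
        by (simp add: measurable_cong_sets[OF s refl])
      then show ?thesis unfolding G_def by (rule PJ.borel_measurable_lebesgue_integral)
    qed
    have ymeas: "?y \<in> count_space (distinct_lists j ?I) \<rightarrow>\<^sub>M pow_measure \<mu> j"
    proof -
      have "?y is \<in> space (pow_measure \<mu> j)" if "is \<in> distinct_lists j ?I" for "is"
      proof -
        have "?z (is ! i) \<in> space \<mu>" if "i < j" for i
        proof -
          have "is ! i \<in> set is" using that \<open>is \<in> _\<close> by (simp add: distinct_lists_def)
          then have "is ! i \<in> ?I" using \<open>is \<in> _\<close> unfolding distinct_lists_def by blast
          then show ?thesis using zX CM_space[OF \<mu>] by simp
        qed
        then show ?thesis by (auto simp: space_PiM)
      qed
      then show ?thesis by simp
    qed
    define H where "H is = (\<integral>ys. ?h (mset (map ?z is) + mset ys) \<partial>points (k - j))" for "is"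
    have GH: "G (?y is) = H is" if "is \<in> distinct_lists j ?I" for "is"
    proof -
      have us: "map ?z is \<in> lists (space X)" "length (map ?z is) = j"
        using that zX by (auto simp: distinct_lists_def subset_iff)
      have "?y is = (\<lambda>i\<in>{..<j}. map ?z is ! i)"
        using us(2) by (auto simp: fun_eq_iff)
      then show ?thesis using integral_merge[OF g us j] by (simp add: G_def H_def)
    qed
    have H0: "is \<in> distinct_lists j ?J" if "is \<in> distinct_lists j ?I" "H is \<noteq> 0" for "is"
    proof -
      have us: "map ?z is \<in> lists (space X)"
        using that zX by (auto simp: distinct_lists_def subset_iff)
      have "set (map ?z is) \<subseteq> B p"
      proof (rule ccontr)
        assume n: "\<not> set (map ?z is) \<subseteq> B p"
        have "H is = (\<integral>ys. 0 \<partial>points (k - j))"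
          unfolding H_def
        proof (rule Bochner_Integration.integral_cong[OF refl])
          fix ys assume "ys \<in> space (points (k - j))"
          then have "map ?z is @ ys \<in> lists (space X)" using us by simp
          from lift_integrand_supported[OF g this] n
          show "?h (mset (map ?z is) + mset ys) = 0" by auto
        qed
        with that(2) show False by simp
      qed
      then have zs: "?z q \<in> B p" if "q \<in> set is" for q using that by auto
      have "set is \<subseteq> ?J"
        using that(1) zB zs unfolding distinct_lists_def by blast
      then show ?thesis using that(1) by (simp add: distinct_lists_def)
    qed
    have "(\<integral>x. G x \<partial>factorial_measure \<mu> j) = (\<integral>is. G (?y is) \<partial>count_space (distinct_lists j ?I))"
      using zX CM_space[OF \<mu>] by (subst fm, blast, subst integral_distr[OF ymeas Gm]) simp
    also have "\<dots> = (\<integral>is. H is \<partial>count_space (distinct_lists j ?I))"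
      by (intro Bochner_Integration.integral_cong refl GH) simp
    also have "\<dots> = (\<Sum>is | is \<in> distinct_lists j ?I \<and> H is \<noteq> 0. H is)"
      by (rule lebesgue_integral_count_space_finite_support)
        (rule finite_subset[OF _ finite_distinct_lists[of ?J j]], use H0 in auto)
    also have "\<dots> = (\<Sum>is\<in>distinct_lists j ?J. H is)"
    proof (rule sum.mono_neutral_left)
      have "distinct_lists j ?J \<subseteq> distinct_lists j ?I" using I0 by (auto simp: distinct_lists_def)
      then show "\<forall>is\<in>distinct_lists j ?J - {is. is \<in> distinct_lists j ?I \<and> H is \<noteq> 0}. H is = 0" by auto
    qed (use H0 in \<open>auto intro: finite_distinct_lists\<close>)
    finally show ?thesis by (simp add: falling_sum_def H_def G_def)
  qed
  have "mset xs = image_mset ?z (mset_set ?J)"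
  proof -
    have "mset_set ?J = image_mset (Pair 0) (mset_set {..<length xs})"
      by (subst image_mset_mset_set) (auto simp: inj_on_def intro!: arg_cong[where f=mset_set])
    then have "image_mset ?z (mset_set ?J) = image_mset (\<lambda>i. xs ! i) (mset_set {..<length xs})"
      by (simp only: multiset.map_comp comp_def fst_conv snd_conv l(1))
    also have "\<dots> = mset (map (\<lambda>i. xs ! i) [0..<length xs])"
      by (simp add: atLeast0LessThan flip: mset_set_upto_eq_mset_upto)
    finally show ?thesis by (simp add: map_nth)
  qed
  then have "chaos k ?h (mset xs) = (\<Sum>j\<le>k. (-1) ^ (k - j) * real (k choose j) * falling_sum j (k - j) ?z ?h ?J)"
    using chaos_eq_falling_sum[OF measurable_lift_integrand[OF g(1)] hb, of ?J ?z k] zX I0 by auto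
  then show ?thesis
    by (simp add: pathwise_integral_def summand)
qed

text \<open>A measurable enumeration of the points in \<open>B p\<close> turns it into a measurable
  function of a list.\<close>

lemma measurable_pathwise_integral:
  assumes g: "g \<in> elementary_integrands X B k" "supported k g"
  shows "pathwise_integral \<Lambda> k g \<in> borel_measurable CS"
proof -
  obtain e where e: "e \<in> CS \<rightarrow>\<^sub>M LS" "\<And>\<mu>. \<mu> \<in> CM \<Longrightarrow> set (e \<mu>) \<subseteq> B p \<and> restr \<mu> (B p) = dirac_sum X (e \<mu>)"
    using measurable_enumeration[of p] by blast
  have "(\<lambda>\<mu>. chaos k (lift_integrand X k g) (mset (e \<mu>))) \<in> borel_measurable CS"
    by (rule measurable_compose[OF e(1) measurable_chaos[OF measurable_lift_integrand[OF g(1)]]])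
  moreover have "pathwise_integral \<Lambda> k g \<mu> = chaos k (lift_integrand X k g) (mset (e \<mu>))" if "\<mu> \<in> CM" for \<mu>
    using measurable_space[OF e(1)] e(2)[OF that] that by (intro pathwise_integral_eq_chaos[OF g]) auto
  ultimately show ?thesis by (subst measurable_cong) auto
qed

end

section \<open>Replacing the points of a Poisson process in a local set\<close>

definition poisson_prob :: "ennreal \<Rightarrow> nat \<Rightarrow> ennreal" where
  "poisson_prob l n = ennreal (exp (- enn2real l) * enn2real l ^ n / fact n)"

section \<open>Joint law of the counts of the finite process\<close>

context finite_intensity
begin

lemma sets_lists_in:
  assumes W: "W \<in> sets X"
  shows "{xs\<in>space LS. set xs \<subseteq> W} \<in> sets LS"
proof -
  have [measurable]: "Measurable.pred LS (\<lambda>xs. \<forall>x\<in>set xs. x \<in> W)"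
    by (rule measurable_filter_stopping(3)[OF stopping_lists_const[OF W], of "\<lambda>x. x" _ "\<lambda>x. x"]) auto
  have "{xs\<in>space LS. set xs \<subseteq> W} = {xs\<in>space LS. \<forall>x\<in>set xs. x \<in> W}" by auto
  also have "\<dots> \<in> sets LS" by measurable
  finally show ?thesis .
qed

lemma emeasure_poisson_lists_in:
  assumes W: "W \<in> sets X"
  shows "emeasure poisson_lists {xs\<in>space LS. set xs \<subseteq> W} = ennreal (exp (measure L W - \<tau>))"
proof -
  have "emeasure poisson_lists {xs\<in>space LS. set xs \<subseteq> W} =
      (\<Sum>n. ennreal (exp (- \<tau>) / fact n) * ennreal (measure L W) ^ n)"
    by (simp only: emeasure_poisson_lists[OF sets_lists_in[OF W]] emeasure_points_lists_in[OF W] emeasure_eq_measure)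
  also have "\<dots> = ennreal (exp (measure L W - \<tau>))"
    by (subst suminf_exp) (auto simp: exp_diff exp_minus field_simps)
  finally show ?thesis .
qed

lemma measurable_count_pred:
  assumes "D \<in> sets X"
  shows "Measurable.pred LS (\<lambda>xs. length (filter (\<lambda>x. x \<in> D) xs) = n)"
  using measurable_length_filter[OF assms] by measurable

lemma emeasure_poisson_lists_Collect:
  assumes "Measurable.pred LS Q"
  shows "emeasure poisson_lists {xs\<in>space LS. Q xs} = (\<integral>\<^sup>+xs. of_bool (Q xs) \<partial>poisson_lists)"
proof -
  have "{xs\<in>space LS. Q xs} \<in> sets poisson_lists"
    using assms unfolding pred_def by (simp only: sets_poisson_lists)
  then have "(\<integral>\<^sup>+xs. indicator {xs\<in>space LS. Q xs} xs \<partial>poisson_lists) = emeasure poisson_lists {xs\<in>space LS. Q xs}"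
    by (rule nn_integral_indicator)
  moreover have "(\<integral>\<^sup>+xs. indicator {xs\<in>space LS. Q xs} xs \<partial>poisson_lists) = (\<integral>\<^sup>+xs. of_bool (Q xs) \<partial>poisson_lists)"
    by (intro nn_integral_cong) (simp add: indicator_def)
  ultimately show ?thesis by simp
qed

text \<open>Split at \<open>D\<close>, as a constant stopping set: only left parts of length
  \<open>n\<close> contribute, and the right part yields the void probability of
  \<open>D\<close>.\<close>

lemma emeasure_poisson_lists_count:
  assumes D: "D \<in> sets X"
  shows "emeasure poisson_lists {xs\<in>space LS. length (filter (\<lambda>x. x \<in> D) xs) = n} = poisson_prob (emeasure L D) n"
proof -
  have D': "D \<in> sets L" "space X - D \<in> sets X" using D by (auto simp: sets_L)
  let ?S = "\<lambda>W. {xs\<in>space LS. set xs \<subseteq> W}"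
  have S: "?S W \<in> sets LS" if "W \<in> sets X" for W by (rule sets_lists_in[OF that])
  have disj: "set xs \<inter> D = {} \<longleftrightarrow> xs \<in> ?S (space X - D)" if "xs \<in> space LS" for xs
    using that by auto
  have "emeasure poisson_lists {xs\<in>space LS. length (filter (\<lambda>x. x \<in> D) xs) = n} =
      (\<integral>\<^sup>+xs. of_bool (length (filter (\<lambda>x. x \<in> D) xs) = n) \<partial>poisson_lists)"
    by (rule emeasure_poisson_lists_Collect[OF measurable_count_pred[OF D]])
  also have "\<dots> = ennreal (exp \<tau>) * (\<integral>\<^sup>+as. \<integral>\<^sup>+bs. of_bool (length as = n) *
      of_bool (set as \<subseteq> D \<and> set bs \<inter> D = {}) \<partial>poisson_lists \<partial>poisson_lists)"
    by (rule nn_integral_filter_stopping[OF stopping_lists_const[OF D], of "\<lambda>as _. of_bool (length as = n)"]) simp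
  also have "(\<integral>\<^sup>+as. \<integral>\<^sup>+bs. of_bool (length as = n) * of_bool (set as \<subseteq> D \<and> set bs \<inter> D = {}) \<partial>poisson_lists \<partial>poisson_lists) =
     (\<integral>\<^sup>+as. \<integral>\<^sup>+bs. of_bool (length as = n) * indicator (?S D) as * indicator (?S (space X - D)) bs \<partial>poisson_lists \<partial>poisson_lists)"
    by (intro nn_integral_cong) (use disj in \<open>auto simp: indicator_def\<close>)
  also have "\<dots> = (\<integral>\<^sup>+as. of_bool (length as = n) * indicator (?S D) as \<partial>poisson_lists) *
      emeasure poisson_lists (?S (space X - D))"
    using S[OF D] S[OF D'(2)] by (simp add: nn_integral_cmult nn_integral_multc del: space_list_space)
  also have "(\<integral>\<^sup>+as. of_bool (length as = n) * indicator (?S D) as \<partial>poisson_lists) =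
      (\<Sum>m. ennreal (exp (- \<tau>) / fact m) * (\<integral>\<^sup>+as. of_bool (length as = n) * indicator (?S D) as \<partial>points m))"
    by (intro nn_integral_poisson_lists borel_measurable_times_ennreal borel_measurable_indicator S D) measurable
  also have "\<dots> = (\<Sum>m. ennreal (exp (- \<tau>) / fact m) * (of_bool (m = n) * emeasure L D ^ m))"
  proof (intro suminf_cong arg_cong2[where f="(*)"] refl)
    fix m
    have "(\<integral>\<^sup>+as. of_bool (length as = n) * indicator (?S D) as \<partial>points m) =
        (\<integral>\<^sup>+as. of_bool (m = n) * indicator (?S D) as \<partial>points m)"
      by (rule nn_integral_cong_AE) (use AE_points_length[of m] in eventually_elim, simp)
    also have "\<dots> = of_bool (m = n) * emeasure (points m) (?S D)"
      by (subst nn_integral_cmult) (simp_all only: sets_points S[OF D] nn_integral_indicator borel_measurable_indicator)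
    finally show "(\<integral>\<^sup>+as. of_bool (length as = n) * indicator (?S D) as \<partial>points m) =
        of_bool (m = n) * emeasure L D ^ m"
      by (simp only: emeasure_points_lists_in[OF D])
  qed
  also have "\<dots> = ennreal (exp (- \<tau>) / fact n) * emeasure L D ^ n"
    by (subst suminf_finite[of "{n}"]) auto
  also have "emeasure poisson_lists (?S (space X - D)) = ennreal (exp (- measure L D))"
  proof -
    have "measure L (space X - D) = \<tau> - measure L D"
      using finite_measure_compl[OF D'(1)] by (simp add: space_L)
    then show ?thesis by (simp only: emeasure_poisson_lists_in[OF D'(2)]) simp
  qed
  also have "ennreal (exp \<tau>) * (ennreal (exp (- \<tau>) / fact n) * emeasure L D ^ n * ennreal (exp (- measure L D))) =
      poisson_prob (emeasure L D) n"
    by (simp add: poisson_prob_def emeasure_eq_measure ennreal_power ennreal_mult[symmetric] exp_minus field_simps)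
  finally show ?thesis .
qed

text \<open>Resampling outside \<open>D i\<close> keeps the count in \<open>D i\<close> and makes
  the other counts independent of it, so the sets can be treated one at a time.\<close>

lemma emeasure_poisson_lists_counts:
  assumes "finite I" "disjoint_family_on D I" "\<And>i. i \<in> I \<Longrightarrow> D i \<in> sets X"
  shows "emeasure poisson_lists {xs\<in>space LS. \<forall>i\<in>I. length (filter (\<lambda>x. x \<in> D i) xs) = n i} =
    (\<Prod>i\<in>I. poisson_prob (emeasure L (D i)) (n i))"
  using assms
proof (induction I rule: finite_induct)
  case empty
  then show ?case using PL.emeasure_space_1 by simp
next
  case (insert i I)
  have Di: "D i \<in> sets X" using insert.prems by simp
  have disj: "disjoint_family_on D I" using insert.prems(1) by (auto simp: disjoint_family_on_def)
  have ij: "D j \<inter> D i = {}" if "j \<in> I" for j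
    using insert.prems(1) insert.hyps(2) that by (auto simp: disjoint_family_on_def)
  let ?P = "\<lambda>bs. \<forall>j\<in>I. length (filter (\<lambda>x. x \<in> D j) bs) = n j"
  have P: "Measurable.pred LS ?P"
    using insert.hyps(1) insert.prems(2) by (intro pred_intros_finite measurable_count_pred) auto
  have Pfilter: "?P (filter (\<lambda>x. x \<notin> D i) xs) \<longleftrightarrow> ?P xs" for xs
  proof (rule ball_cong[OF refl])
    fix j assume "j \<in> I"
    then have "filter (\<lambda>x. x \<in> D j) (filter (\<lambda>x. x \<notin> D i) xs) = filter (\<lambda>x. x \<in> D j) xs"
      using ij[of j] by (auto intro!: filter_cong)
    then show "length (filter (\<lambda>x. x \<in> D j) (filter (\<lambda>x. x \<notin> D i) xs)) = n j \<longleftrightarrow>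
        length (filter (\<lambda>x. x \<in> D j) xs) = n j" by simp
  qed
  have H: "(\<lambda>(as, bs). of_bool (length as = n i) * of_bool (?P bs) :: ennreal) \<in> borel_measurable (LS \<Otimes>\<^sub>M LS)"
  proof -
    note [measurable] = measurable_compose[OF measurable_snd P]
    show ?thesis by (simp add: split_beta')
  qed
  have m1: "(\<lambda>xs. of_bool (length (filter (\<lambda>x. x \<in> D i) xs) = n i) :: ennreal) \<in> borel_measurable poisson_lists"
    using measurable_count_pred[OF Di] by simp
  have m2: "(\<lambda>xs. of_bool (?P xs) :: ennreal) \<in> borel_measurable poisson_lists"
    using P by simp
  note ind = emeasure_poisson_lists_Collect
  have "emeasure poisson_lists {xs\<in>space LS. \<forall>j\<in>insert i I. length (filter (\<lambda>x. x \<in> D j) xs) = n j} =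
      (\<integral>\<^sup>+xs. of_bool (length (filter (\<lambda>x. x \<in> D i) xs) = n i \<and> ?P xs) \<partial>poisson_lists)"
    using P measurable_count_pred[OF Di] by (subst ind[symmetric]) (auto intro: pred_intros_logic)
  also have "\<dots> = (\<integral>\<^sup>+xs. of_bool (length (filter (\<lambda>x. x \<in> D i) xs) = n i) *
      of_bool (?P (filter (\<lambda>x. x \<notin> D i) xs)) \<partial>poisson_lists)"
    by (simp only: Pfilter of_bool_conj)
  also have "\<dots> = (\<integral>\<^sup>+xs. \<integral>\<^sup>+bs. of_bool (length (filter (\<lambda>x. x \<in> D i) xs) = n i) *
      of_bool (?P (filter (\<lambda>x. x \<notin> D i) bs)) \<partial>poisson_lists \<partial>poisson_lists)"
    by (rule nn_integral_resample[OF stopping_lists_const[OF Di] H])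
  also have "\<dots> = (\<integral>\<^sup>+xs. of_bool (length (filter (\<lambda>x. x \<in> D i) xs) = n i) \<partial>poisson_lists) *
      (\<integral>\<^sup>+bs. of_bool (?P bs) \<partial>poisson_lists)"
    unfolding Pfilter using m1 m2 by (simp only: nn_integral_cmult nn_integral_multc)
  also have "\<dots> = poisson_prob (emeasure L (D i)) (n i) * (\<Prod>i\<in>I. poisson_prob (emeasure L (D i)) (n i))"
    using insert.IH[OF disj] insert.prems(2)
    by (simp only: ind[OF P, symmetric] ind[OF measurable_count_pred[OF Di], symmetric]
        emeasure_poisson_lists_count[OF Di]) simp
  finally show ?case using insert.hyps by simp
qed

end

section \<open>Counts in disjoint local sets determine a law\<close>

context localized_space
begin

definition count_events :: "'a measure set set" where
  "count_events = {{\<mu>\<in>CM. \<forall>(A, n)\<in>F. emeasure \<mu> A = of_nat n} | F. finite F \<and> fst ` F \<subseteq> local_sets X B}"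

text \<open>Counts in local sets are natural numbers, so that events of prescribed counts generate
  them, and the mass of any set is the supremum of its local counts.\<close>

lemma sets_CS: "sets CS = sigma_sets CM count_events"
proof
  have pow: "count_events \<subseteq> Pow CM" by (auto simp: count_events_def)
  show "sigma_sets CM count_events \<subseteq> sets CS"
  proof -
    have "{\<mu>\<in>CM. \<forall>(A, n)\<in>F. emeasure \<mu> A = of_nat n} \<in> sets CS" if F: "finite F" "fst ` F \<subseteq> local_sets X B" for F
    proof -
      have "{\<mu>\<in>space CS. \<forall>q\<in>F. emeasure \<mu> (fst q) = of_nat (snd q)} \<in> sets CS"
      proof (rule sets.sets_Collect_finite_All)
        fix q assume "q \<in> F"
        then have [measurable]: "fst q \<in> sets X" using F(2) by (auto elim!: local_setE)
        show "{\<mu>\<in>space CS. emeasure \<mu> (fst q) = of_nat (snd q)} \<in> sets CS" by measurable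
      qed (rule F)
      then show ?thesis by (simp add: split_beta')
    qed
    then have "count_events \<subseteq> sets CS" by (auto simp: count_events_def)
    from sets.sigma_sets_subset[OF this] show ?thesis by simp
  qed
  show "sets CS \<subseteq> sigma_sets CM count_events"
  proof
    let ?S = "sigma CM count_events"
    have "(\<lambda>\<mu>. \<mu>) \<in> ?S \<rightarrow>\<^sub>M CS"
    proof (rule measurable_into_CS)
      fix A assume A: "A \<in> sets X"
      have m: "(\<lambda>\<mu>. emeasure \<mu> (A \<inter> B n)) \<in> borel_measurable ?S" for n
      proof -
        define c where "c \<mu> = nat \<lfloor>enn2real (emeasure \<mu> (A \<inter> B n))\<rfloor>" for \<mu> :: "'a measure"
        have c: "emeasure \<mu> (A \<inter> B n) = of_nat (c \<mu>)" if "\<mu> \<in> CM" for \<mu>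
          using CM_nat[OF that, of "A \<inter> B n" n] A by (auto simp: c_def)
        have "c \<in> ?S \<rightarrow>\<^sub>M count_space UNIV"
        proof (subst measurable_count_space_eq2_countable, intro conjI ballI)
          fix m
          have "{\<mu>\<in>CM. \<forall>(A, n)\<in>{(A \<inter> B n, m)}. emeasure \<mu> A = of_nat n} \<in> count_events"
            unfolding count_events_def using A by (intro CollectI exI[of _ "{(A \<inter> B n, m)}"]) (auto intro: local_setI)
          then have "{\<mu>\<in>CM. emeasure \<mu> (A \<inter> B n) = of_nat m} \<in> sets ?S"
            using pow by auto
          also have "{\<mu>\<in>CM. emeasure \<mu> (A \<inter> B n) = of_nat m} = c -` {m} \<inter> space ?S"
            using c pow by auto
          finally show "c -` {m} \<inter> space ?S \<in> sets ?S" .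
        qed simp
        then have "(\<lambda>\<mu>. of_nat (c \<mu>) :: ennreal) \<in> borel_measurable ?S" by measurable
        then show ?thesis using c pow by (subst measurable_cong) auto
      qed
      have "(\<lambda>\<mu>. SUP n. emeasure \<mu> (A \<inter> B n)) \<in> borel_measurable ?S"
        by (intro borel_measurable_SUP countableI_type m)
      moreover have "(SUP n. emeasure \<mu> (A \<inter> B n)) = emeasure \<mu> A" if "\<mu> \<in> CM" for \<mu>
      proof -
        have "(SUP n. emeasure \<mu> (A \<inter> B n)) = emeasure \<mu> (\<Union>n. A \<inter> B n)"
          using A CM_sets[OF that] B_mono by (intro SUP_emeasure_incseq) (auto simp: incseq_def)
        also have "(\<Union>n. A \<inter> B n) = A" using UN_B sets.sets_into_space[OF A] by auto
        finally show ?thesis .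
      qed
      ultimately show "(\<lambda>\<mu>. emeasure \<mu> A) \<in> borel_measurable ?S"
        using pow by (subst measurable_cong) auto
    qed (use pow in auto)
    fix E assume "E \<in> sets CS"
    from measurable_sets[OF \<open>(\<lambda>\<mu>. \<mu>) \<in> ?S \<rightarrow>\<^sub>M CS\<close> this] sets.sets_into_space[OF this]
    show "E \<in> sigma_sets CM count_events" using pow by (simp add: Int_absorb2)
  qed
qed

text \<open>Overlapping local sets are refined into the disjoint atoms which they generate together
  with \<open>C\<close>. Their counts are sums of atom counts, so an event in the generator is a
  countable disjoint union of events that prescribe all atom counts. The set \<open>C\<close>
  ensures that no atom straddles its boundary.\<close>

lemma measure_eqI_counts:
  assumes P: "prob_space P" "sets P = sets CS" and Q: "prob_space Q" "sets Q = sets CS"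
    and C: "C \<in> sets X"
    and eq: "\<And>(K :: ('a set set \<times> bool) set) D n. finite K \<Longrightarrow> disjoint_family_on D K \<Longrightarrow>
      (\<And>i. i \<in> K \<Longrightarrow> D i \<in> local_sets X B) \<Longrightarrow> (\<And>i. i \<in> K \<Longrightarrow> D i \<subseteq> C \<or> D i \<inter> C = {}) \<Longrightarrow>
      emeasure P {\<mu>\<in>CM. \<forall>i\<in>K. emeasure \<mu> (D i) = of_nat (n i)} =
      emeasure Q {\<mu>\<in>CM. \<forall>i\<in>K. emeasure \<mu> (D i) = of_nat (n i)}"
  shows "P = Q"
proof (rule measure_eqI_generator_eq[where \<Omega>=CM and E=count_events and A="\<lambda>_. CM"])
  show "Int_stable count_events"
  proof (rule Int_stableI)
    fix a b assume "a \<in> count_events" "b \<in> count_events"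
    then obtain F G where F: "finite F" "fst ` F \<subseteq> local_sets X B" "a = {\<mu>\<in>CM. \<forall>(A, n)\<in>F. emeasure \<mu> A = of_nat n}"
      and G: "finite G" "fst ` G \<subseteq> local_sets X B" "b = {\<mu>\<in>CM. \<forall>(A, n)\<in>G. emeasure \<mu> A = of_nat n}"
      by (auto simp: count_events_def)
    have "a \<inter> b = {\<mu>\<in>CM. \<forall>(A, n)\<in>F \<union> G. emeasure \<mu> A = of_nat n}"
      unfolding F G by blast
    then show "a \<inter> b \<in> count_events"
      unfolding count_events_def using F G by (intro CollectI exI[of _ "F \<union> G"]) auto
  qed
  show "count_events \<subseteq> Pow CM" by (auto simp: count_events_def)
  show "sets P = sigma_sets CM count_events" "sets Q = sigma_sets CM count_events"
    using P Q sets_CS by auto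
  show "range (\<lambda>_::nat. CM) \<subseteq> count_events"
    unfolding count_events_def by (auto intro!: exI[of _ "{}"])
  show "emeasure P CM \<noteq> \<infinity>"
    using P by (metis finite_measure.emeasure_finite prob_space_def infinity_ennreal_def)
  fix E assume "E \<in> count_events"
  then obtain F where F: "finite F" "fst ` F \<subseteq> local_sets X B" "E = {\<mu>\<in>CM. \<forall>(A, n)\<in>F. emeasure \<mu> A = of_nat n}"
    by (auto simp: count_events_def)
  let ?A = "fst ` F"
  \<comment> \<open>An atom is indexed by the members of the family that contain it and by its side
    of \<open>C\<close>. The empty subfamily is left out, since its atom lies in no member and may
    fail to be local.\<close>
  define K where "K = (Pow ?A - {{}}) \<times> (UNIV :: bool set)"
  define D where "D q = (\<Inter>(fst q) - \<Union>(?A - fst q)) \<inter> (if snd q then C else space X - C)" for q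
  have K: "finite K" using F(1) by (simp add: K_def)
  have Asets: "A \<in> sets X" if "A \<in> ?A" for A using that F(2) by (auto elim!: local_setE)
  have Dsub: "D q \<subseteq> A" if "A \<in> fst q" for q A using that by (auto simp: D_def)
  have Dsets: "D q \<in> sets X" if "q \<in> K" for q
  proof -
    have "(\<Inter>A\<in>fst q. A) \<in> sets X"
    proof (rule sets.finite_INT)
      show "finite (fst q)"
        by (rule finite_subset[of _ ?A]) (use that F(1) in \<open>auto simp: K_def\<close>)
      show "A \<in> sets X" if "A \<in> fst q" for A using that \<open>q \<in> K\<close> by (intro Asets) (auto simp: K_def)
    qed (use that in \<open>auto simp: K_def\<close>)
    then have "\<Inter>(fst q) \<in> sets X" by simp
    moreover have "\<Union>(?A - fst q) \<in> sets X"
      using F(1) Asets by (intro sets.finite_Union) auto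
    ultimately show ?thesis using C by (auto simp: D_def)
  qed
  have Dlocal: "D q \<in> local_sets X B" if q: "q \<in> K" for q
  proof -
    have "fst q \<noteq> {}" "fst q \<subseteq> ?A" using q by (auto simp: K_def)
    then obtain A where A: "A \<in> fst q" "A \<in> ?A" by blast
    then obtain n where "A \<subseteq> B n" using F(2) by (auto elim!: local_setE)
    then show ?thesis using Dsets[OF q] Dsub[OF A(1)] by (intro local_setI[of _ n]) auto
  qed
  have disj: "disjoint_family_on D K"
  proof -
    have "q = r" if qr: "q \<in> K" "r \<in> K" and x: "x \<in> D q" "x \<in> D r" for q r x
    proof -
      have mem: "A \<in> fst q \<longleftrightarrow> A \<in> ?A \<and> x \<in> A" if "q \<in> K" "x \<in> D q" for q A
      proof -
        have "fst q \<subseteq> ?A" using that(1) by (auto simp: K_def)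
        moreover have "x \<in> \<Inter>(fst q)" "x \<notin> \<Union>(?A - fst q)" using that(2) by (simp_all add: D_def)
        ultimately show ?thesis by blast
      qed
      have "A \<in> fst q \<longleftrightarrow> A \<in> fst r" for A
        using mem[OF qr(1) x(1)] mem[OF qr(2) x(2)] by simp
      moreover have "snd q = snd r" using x by (auto simp: D_def split: if_splits)
      ultimately show ?thesis by (auto intro: prod_eqI)
    qed
    then show ?thesis unfolding disjoint_family_on_def by blast
  qed
  have DC: "D q \<subseteq> C \<or> D q \<inter> C = {}" for q by (auto simp: D_def)
  have union: "A = (\<Union>q\<in>{q\<in>K. A \<in> fst q}. D q)" if A: "A \<in> ?A" for A
  proof
    show "A \<subseteq> (\<Union>q\<in>{q\<in>K. A \<in> fst q}. D q)"
    proof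
      fix x assume x: "x \<in> A"
      then have "x \<in> space X" using sets.sets_into_space[OF Asets[OF A]] by auto
      then have "x \<in> D ({A'\<in>?A. x \<in> A'}, x \<in> C)" by (auto simp: D_def)
      moreover have "({A'\<in>?A. x \<in> A'}, x \<in> C) \<in> {q\<in>K. A \<in> fst q}" using A x by (auto simp: K_def)
      ultimately show "x \<in> (\<Union>q\<in>{q\<in>K. A \<in> fst q}. D q)" by blast
    qed
  qed (auto simp: D_def)
  have sum: "emeasure \<mu> A = (\<Sum>q\<in>{q\<in>K. A \<in> fst q}. emeasure \<mu> (D q))" if A: "A \<in> ?A" and \<mu>: "\<mu> \<in> CM" for A \<mu>
  proof -
    have "(\<Sum>q\<in>{q\<in>K. A \<in> fst q}. emeasure \<mu> (D q)) = emeasure \<mu> (\<Union>q\<in>{q\<in>K. A \<in> fst q}. D q)"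
      using K Dsets disj CM_sets[OF \<mu>] by (intro sum_emeasure) (auto simp: disjoint_family_on_def)
    then show ?thesis using union[OF A] by simp
  qed
  define G where "G v = {\<mu>\<in>CM. \<forall>q\<in>K. emeasure \<mu> (D q) = of_nat (v q)}" for v
  \<comment> \<open>The vectors of atom counts that are compatible with the prescribed
    counts.\<close>
  define V where "V = {v\<in>K \<rightarrow>\<^sub>E (UNIV :: nat set). \<forall>(A, n)\<in>F. (\<Sum>q\<in>{q\<in>K. A \<in> fst q}. v q) = n}"
  have V: "countable V"
    by (rule countable_subset[of _ "K \<rightarrow>\<^sub>E (UNIV :: nat set)"]) (auto simp: V_def intro!: countable_PiE K)
  have Gsets: "G v \<in> sets CS" for v
  proof -
    have "{\<mu>\<in>space CS. \<forall>q\<in>K. emeasure \<mu> (D q) = of_nat (v q)} \<in> sets CS"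
    proof (rule sets.sets_Collect_finite_All)
      fix q assume "q \<in> K"
      note [measurable] = Dsets[OF this]
      show "{\<mu>\<in>space CS. emeasure \<mu> (D q) = of_nat (v q)} \<in> sets CS" by measurable
    qed (rule K)
    then show ?thesis by (simp add: G_def)
  qed
  have Gdisj: "disjoint_family_on G V"
  proof -
    have "v = w" if "v \<in> V" "w \<in> V" "\<mu> \<in> G v" "\<mu> \<in> G w" for v w \<mu>
    proof
      fix q show "v q = w q"
      proof (cases "q \<in> K")
        case True
        then have "of_nat (v q) = (of_nat (w q) :: ennreal)" using that(3,4) by (auto simp: G_def)
        then show ?thesis by simp
      next
        case False
        have "V \<subseteq> extensional K" unfolding V_def PiE_def by blast
        then have "v \<in> extensional K" "w \<in> extensional K" using that(1,2) by blast+
        then show ?thesis using extensional_arb False by metis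
      qed
    qed
    then show ?thesis unfolding disjoint_family_on_def by blast
  qed
  have "E = (\<Union>v\<in>V. G v)"
  proof
    show "E \<subseteq> (\<Union>v\<in>V. G v)"
    proof
      fix \<mu> assume "\<mu> \<in> E"
      then have \<mu>: "\<mu> \<in> CM" "\<And>A n. (A, n) \<in> F \<Longrightarrow> emeasure \<mu> A = of_nat n" by (auto simp: F(3))
      have "\<forall>q\<in>K. \<exists>m::nat. emeasure \<mu> (D q) = of_nat m"
        using \<mu>(1) Dlocal by (auto simp: counting_measures_def)
      then obtain v where v: "\<And>q. q \<in> K \<Longrightarrow> emeasure \<mu> (D q) = of_nat (v q)" by metis
      have "restrict v K \<in> V"
      proof -
        have "(\<Sum>q\<in>{q\<in>K. A \<in> fst q}. restrict v K q) = n" if An: "(A, n) \<in> F" for A n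
        proof -
          have "A \<in> ?A" using An by force
          have "(of_nat (\<Sum>q\<in>{q\<in>K. A \<in> fst q}. restrict v K q) :: ennreal) = emeasure \<mu> A"
            unfolding sum[OF \<open>A \<in> ?A\<close> \<mu>(1)] of_nat_sum by (intro sum.cong) (auto simp: v)
          then show ?thesis using \<mu>(2)[OF An] by (metis of_nat_eq_iff)
        qed
        then show ?thesis by (auto simp: V_def)
      qed
      moreover have "\<mu> \<in> G (restrict v K)" using \<mu> v by (auto simp: G_def)
      ultimately show "\<mu> \<in> (\<Union>v\<in>V. G v)" by blast
    qed
    show "(\<Union>v\<in>V. G v) \<subseteq> E"
    proof safe
      fix v \<mu> assume v: "v \<in> V" and \<mu>: "\<mu> \<in> G v"
      then have CM: "\<mu> \<in> CM" by (simp add: G_def)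
      have "emeasure \<mu> A = of_nat n" if An: "(A, n) \<in> F" for A n
      proof -
        have "A \<in> ?A" using An by force
        have "emeasure \<mu> A = (\<Sum>q\<in>{q\<in>K. A \<in> fst q}. of_nat (v q))"
          unfolding sum[OF \<open>A \<in> ?A\<close> CM] using \<mu> by (intro sum.cong) (auto simp: G_def)
        also have "\<dots> = of_nat n" using v An by (auto simp: V_def simp flip: of_nat_sum)
        finally show ?thesis .
      qed
      then show "\<mu> \<in> E" using CM by (auto simp: F(3))
    qed
  qed
  moreover have "emeasure P (\<Union>v\<in>V. G v) = (\<integral>\<^sup>+v. emeasure P (G v) \<partial>count_space V)"
    using Gsets Gdisj V P(2) by (intro emeasure_UN_countable) auto
  moreover have "emeasure Q (\<Union>v\<in>V. G v) = (\<integral>\<^sup>+v. emeasure Q (G v) \<partial>count_space V)"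
    using Gsets Gdisj V Q(2) by (intro emeasure_UN_countable) auto
  moreover have "emeasure P (G v) = emeasure Q (G v)" for v
    unfolding G_def by (rule eq[OF K disj Dlocal DC])
  ultimately show "emeasure P E = emeasure Q E" by simp
qed auto

end

section \<open>Gluing a list of points in the window to a configuration outside\<close>

context local_intensity
begin

text \<open>The filter makes every list admissible; under \<open>poisson_lists\<close> it almost
  surely removes nothing.\<close>

definition combine :: "'a list \<Rightarrow> 'a measure \<Rightarrow> 'a measure" where
  "combine xs \<psi> = add_measure (dirac_sum X (filter (\<lambda>x. x \<in> B p) xs)) (restr \<psi> (space X - B p))"

lemma combine_CM: "xs \<in> lists (space X) \<Longrightarrow> \<psi> \<in> CM \<Longrightarrow> combine xs \<psi> \<in> CM"
  unfolding combine_def by (intro CM_add CM_dirac_sum CM_restr) auto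

lemma emeasure_combine:
  assumes "xs \<in> lists (space X)" "\<psi> \<in> CM" "A \<in> sets X"
  shows "emeasure (combine xs \<psi>) A =
    of_nat (length (filter (\<lambda>x. x \<in> A \<inter> B p) xs)) + emeasure \<psi> (A \<inter> (space X - B p))"
proof -
  have "filter (\<lambda>x. x \<in> B p) xs \<in> lists (space X)" using assms(1) by auto
  then show ?thesis
    unfolding combine_def using assms CM_sets[OF assms(2)]
    by (subst emeasure_add_measure) (simp_all add: emeasure_dirac_sum emeasure_restr' conj_commute)
qed

lemma measurable_combine: "(\<lambda>q. combine (fst q) (snd q)) \<in> LS \<Otimes>\<^sub>M CS \<rightarrow>\<^sub>M CS"
proof (rule measurable_into_CS)
  fix A assume A: "A \<in> sets X"
  have [measurable]: "(\<lambda>xs. of_nat (length (filter (\<lambda>x. x \<in> A \<inter> B p) xs)) :: ennreal) \<in> borel_measurable LS"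
    by (rule measurable_compose[OF measurable_length_filter]) (use A in auto)
  have [measurable]: "(\<lambda>\<psi>. emeasure \<psi> (A \<inter> (space X - B p))) \<in> borel_measurable CS"
    using A by (intro measurable_emeasure_CS) auto
  have "(\<lambda>q. of_nat (length (filter (\<lambda>x. x \<in> A \<inter> B p) (fst q))) + emeasure (snd q) (A \<inter> (space X - B p)))
      \<in> borel_measurable (LS \<Otimes>\<^sub>M CS)"
    by measurable
  moreover have "emeasure (combine (fst q) (snd q)) A =
      of_nat (length (filter (\<lambda>x. x \<in> A \<inter> B p) (fst q))) + emeasure (snd q) (A \<inter> (space X - B p))"
    if "q \<in> space (LS \<Otimes>\<^sub>M CS)" for q
    using that by (intro emeasure_combine A) (auto simp: space_pair_measure)
  ultimately show "(\<lambda>q. emeasure (combine (fst q) (snd q)) A) \<in> borel_measurable (LS \<Otimes>\<^sub>M CS)"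
    by (subst measurable_cong) auto
qed (auto simp: space_pair_measure intro!: combine_CM)

lemma AE_poisson_lists_B: "AE xs in poisson_lists. set xs \<subseteq> B p"
proof -
  have "measure (restr \<Lambda> (B p)) (B p) = \<tau>"
    by (simp add: measure_def emeasure_L space_L Int_absorb1 sets.sets_into_space)
  then have "emeasure poisson_lists {xs\<in>space LS. set xs \<subseteq> B p} = 1"
    by (simp only: emeasure_poisson_lists_in[OF sets_B]) simp
  then have "PL.prob {xs\<in>space LS. set xs \<subseteq> B p} = 1"
    by (simp add: measure_def)
  from PL.AE_prob_1[OF this] show ?thesis by (auto elim: AE_mp)
qed

end

locale poisson_setting = local_intensity X B \<Lambda> p + Om: prob_space M
  for X :: "'a measure" and B \<Lambda> p and M :: "'w measure" +
  fixes \<eta> :: "'w \<Rightarrow> 'a measure"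
  assumes poisson: "poisson_process M X B \<Lambda> \<eta>"
begin

abbreviation "P\<eta> \<equiv> distr M CS \<eta>"

lemma measurable_\<eta> [measurable]: "\<eta> \<in> M \<rightarrow>\<^sub>M CS"
  using poisson by (simp add: poisson_process_def)

lemma prob_space_P\<eta>: "prob_space P\<eta>"
  by (rule Om.prob_space_distr) measurable

sublocale P\<eta>: prob_space P\<eta> by (rule prob_space_P\<eta>)

lemma process_counts:
  assumes K: "finite K" "disjoint_family_on D K" "\<And>i. i \<in> K \<Longrightarrow> D i \<in> local_sets X B"
  shows "emeasure P\<eta> {\<mu>\<in>CM. \<forall>i\<in>K. emeasure \<mu> (D i) = of_nat (n i)} =
    (\<Prod>i\<in>K. poisson_prob (emeasure \<Lambda> (D i)) (n i))"
proof (cases "K = {}")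
  case True
  then show ?thesis using P\<eta>.emeasure_space_1 by simp
next
  case False
  \<comment> \<open>The definition of a Poisson process speaks of sets indexed by an initial segment
    of the natural numbers, so \<open>K\<close> is enumerated by one.\<close>
  obtain h where h: "bij_betw h {..<card K} K"
    using ex_bij_betw_nat_finite[OF K(1)] by (auto simp: atLeast0LessThan)
  have "0 \<in> {..<card K}" using False K(1) by (simp add: card_gt_0_iff)
  then have ne: "{..<card K} \<noteq> {}" by blast
  have hK: "h i \<in> K" if "i < card K" for i using h that by (auto simp: bij_betw_def)
  define A where "A i = (if i < card K then D (h i) else {})" for i
  have Dsets: "D i \<in> sets X" if "i \<in> K" for i using K(3)[OF that] by (auto elim!: local_setE)
  have A: "range A \<subseteq> sets X" using Dsets hK by (auto simp: A_def)
  have dA: "disjoint_family_on A {..<card K}"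
    unfolding disjoint_family_on_def
  proof (intro ballI impI)
    fix i j assume ij: "i \<in> {..<card K}" "j \<in> {..<card K}" "i \<noteq> j"
    then have "h i \<noteq> h j" using h by (auto simp: bij_betw_def inj_on_def)
    then show "A i \<inter> A j = {}" using K(2) hK ij by (auto simp: A_def disjoint_family_on_def)
  qed
  have "prob_space.indep_vars M (\<lambda>_. borel) (\<lambda>i \<omega>. emeasure (\<eta> \<omega>) (A i)) {..<card K}"
    using poisson A dA by (simp add: poisson_process_def)
  then have "Om.prob (\<Inter>i\<in>{..<card K}. (\<lambda>\<omega>. emeasure (\<eta> \<omega>) (A i)) -` {of_nat (n (h i))} \<inter> space M) =
      (\<Prod>i\<in>{..<card K}. Om.prob ((\<lambda>\<omega>. emeasure (\<eta> \<omega>) (A i)) -` {of_nat (n (h i))} \<inter> space M))"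
    using ne by (intro Om.indep_varsD_finite) auto
  also have "(\<Inter>i\<in>{..<card K}. (\<lambda>\<omega>. emeasure (\<eta> \<omega>) (A i)) -` {of_nat (n (h i))} \<inter> space M) =
      \<eta> -` {\<mu>\<in>CM. \<forall>i\<in>K. emeasure \<mu> (D i) = of_nat (n i)} \<inter> space M" (is "_ = ?E")
  proof -
    have "(\<forall>i\<in>K. emeasure \<mu> (D i) = of_nat (n i)) \<longleftrightarrow> (\<forall>i<card K. emeasure \<mu> (A i) = of_nat (n (h i)))" for \<mu>
    proof -
      have "(\<forall>i\<in>h ` {..<card K}. emeasure \<mu> (D i) = of_nat (n i)) \<longleftrightarrow>
          (\<forall>i<card K. emeasure \<mu> (A i) = of_nat (n (h i)))"
        by (auto simp: A_def)
      then show ?thesis by (simp only: bij_betw_imp_surj_on[OF h])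
    qed
    moreover note ne
    moreover have "\<eta> \<omega> \<in> CM" if "\<omega> \<in> space M" for \<omega> using measurable_space[OF measurable_\<eta> that] by simp
    ultimately show ?thesis by auto
  qed
  also have "(\<Prod>i\<in>{..<card K}. Om.prob ((\<lambda>\<omega>. emeasure (\<eta> \<omega>) (A i)) -` {of_nat (n (h i))} \<inter> space M)) =
      (\<Prod>i\<in>{..<card K}. (\<lambda>i. exp (- enn2real (emeasure \<Lambda> (D i))) * enn2real (emeasure \<Lambda> (D i)) ^ n i / fact (n i)) (h i))"
  proof (intro prod.cong refl)
    fix i assume i: "i \<in> {..<card K}"
    then have Ai: "A i = D (h i)" by (simp add: A_def)
    have "emeasure \<Lambda> (D (h i)) \<noteq> \<infinity>"
      using K(3)[OF hK] i locally_finite by (auto simp: locally_finite_def less_top)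
    moreover have "poisson_distributed M (\<lambda>\<omega>. emeasure (\<eta> \<omega>) (D (h i))) (emeasure \<Lambda> (D (h i)))"
      using poisson Dsets hK i by (auto simp: poisson_process_def)
    moreover have "(\<lambda>\<omega>. emeasure (\<eta> \<omega>) (A i)) -` {of_nat (n (h i))} \<inter> space M =
        {\<omega>\<in>space M. emeasure (\<eta> \<omega>) (D (h i)) = of_nat (n (h i))}" by (auto simp: Ai)
    ultimately show "Om.prob ((\<lambda>\<omega>. emeasure (\<eta> \<omega>) (A i)) -` {of_nat (n (h i))} \<inter> space M) =
      (\<lambda>i. exp (- enn2real (emeasure \<Lambda> (D i))) * enn2real (emeasure \<Lambda> (D i)) ^ n i / fact (n i)) (h i)"
      by (simp add: poisson_distributed_def)
  qed
  also have "\<dots> = (\<Prod>i\<in>K. exp (- enn2real (emeasure \<Lambda> (D i))) * enn2real (emeasure \<Lambda> (D i)) ^ n i / fact (n i))"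
    by (rule prod.reindex_bij_betw[OF h])
  finally have "emeasure M ?E = ennreal (\<Prod>i\<in>K. exp (- enn2real (emeasure \<Lambda> (D i))) * enn2real (emeasure \<Lambda> (D i)) ^ n i / fact (n i))"
    by (simp only: Om.emeasure_eq_measure)
  also have "\<dots> = (\<Prod>i\<in>K. poisson_prob (emeasure \<Lambda> (D i)) (n i))"
    unfolding poisson_prob_def by (intro prod_ennreal[symmetric]) simp
  finally have "emeasure M ?E = (\<Prod>i\<in>K. poisson_prob (emeasure \<Lambda> (D i)) (n i))" .
  moreover have "{\<mu>\<in>CM. \<forall>i\<in>K. emeasure \<mu> (D i) = of_nat (n i)} \<in> sets CS"
  proof -
    have "{\<mu>\<in>space CS. \<forall>i\<in>K. emeasure \<mu> (D i) = of_nat (n i)} \<in> sets CS"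
    proof (rule sets.sets_Collect_finite_All)
      fix i assume "i \<in> K"
      note [measurable] = Dsets[OF this]
      show "{\<mu>\<in>space CS. emeasure \<mu> (D i) = of_nat (n i)} \<in> sets CS" by measurable
    qed (rule K)
    then show ?thesis by simp
  qed
  ultimately show ?thesis by (simp add: emeasure_distr)
qed

text \<open>Compare counts on sets that lie either inside or outside \<open>B p\<close>. The former
  are read from the list, the latter from the outside configuration; independence of the two gives
  the same product of Poisson probabilities as for the whole process.\<close>

theorem distr_combine: "distr (poisson_lists \<Otimes>\<^sub>M P\<eta>) CS (\<lambda>q. combine (fst q) (snd q)) = P\<eta>"
proof (rule measure_eqI_counts[OF _ _ _ _ sets_B])
  interpret PP: pair_prob_space poisson_lists P\<eta> ..
  have cm: "(\<lambda>q. combine (fst q) (snd q)) \<in> poisson_lists \<Otimes>\<^sub>M P\<eta> \<rightarrow>\<^sub>M CS"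
    using measurable_combine by (simp cong: measurable_cong_sets)
  show "prob_space (distr (poisson_lists \<Otimes>\<^sub>M P\<eta>) CS (\<lambda>q. combine (fst q) (snd q)))"
    by (rule PP.prob_space_distr[OF cm])
  fix K :: "('a set set \<times> bool) set" and D n
  assume K: "finite K" "disjoint_family_on D K" "\<And>i. i \<in> K \<Longrightarrow> D i \<in> local_sets X B"
    and DB: "\<And>i. i \<in> K \<Longrightarrow> D i \<subseteq> B p \<or> D i \<inter> B p = {}"
  have Dsets: "D i \<in> sets X" if "i \<in> K" for i using K(3)[OF that] by (auto elim!: local_setE)
  let ?E = "\<lambda>K. {\<mu>\<in>CM. \<forall>i\<in>K. emeasure \<mu> (D i) = of_nat (n i)}"
  define K1 where "K1 = {i\<in>K. D i \<subseteq> B p}"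
  define K2 where "K2 = K - K1"
  let ?E1 = "{xs\<in>space LS. \<forall>i\<in>K1. length (filter (\<lambda>x. x \<in> D i) xs) = n i}"
  have Esets: "?E K' \<in> sets CS" if K': "K' \<subseteq> K" for K'
  proof -
    have "{\<mu>\<in>space CS. \<forall>i\<in>K'. emeasure \<mu> (D i) = of_nat (n i)} \<in> sets CS"
    proof (rule sets.sets_Collect_finite_All)
      fix i assume "i \<in> K'"
      then have [measurable]: "D i \<in> sets X" using K' by (intro Dsets) blast
      show "{\<mu>\<in>space CS. emeasure \<mu> (D i) = of_nat (n i)} \<in> sets CS" by measurable
    qed (use K(1) K' finite_subset in auto)
    then show ?thesis by simp
  qed
  have E1: "?E1 \<in> sets LS"
  proof -
    have "Measurable.pred LS (\<lambda>xs. \<forall>i\<in>K1. length (filter (\<lambda>x. x \<in> D i) xs) = n i)"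
      using K(1) Dsets by (intro pred_intros_finite measurable_count_pred) (auto simp: K1_def)
    then show ?thesis by (simp only: pred_def)
  qed
  have K1: "emeasure \<psi> (D i \<inter> (space X - B p)) = 0" "D i \<inter> B p = D i" if "i \<in> K1" for i \<psi>
  proof -
    have "D i \<inter> (space X - B p) = {}" using that by (auto simp: K1_def)
    then show "emeasure \<psi> (D i \<inter> (space X - B p)) = 0" by (simp only: emeasure_empty)
    show "D i \<inter> B p = D i" using that by (auto simp: K1_def)
  qed
  have K2: "D i \<inter> (space X - B p) = D i" "D i \<inter> B p = {}" if "i \<in> K2" for i
  proof -
    have i: "i \<in> K" "\<not> D i \<subseteq> B p" using that by (simp_all add: K2_def K1_def)
    then show "D i \<inter> B p = {}" using DB[OF i(1)] by blast
    then show "D i \<inter> (space X - B p) = D i" using sets.sets_into_space[OF Dsets[OF i(1)]] by blast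
  qed
  have "(\<lambda>q. combine (fst q) (snd q)) -` ?E K \<inter> space (poisson_lists \<Otimes>\<^sub>M P\<eta>) = ?E1 \<times> ?E K2"
  proof -
    have key: "(\<forall>i\<in>K. emeasure (combine xs \<psi>) (D i) = of_nat (n i)) \<longleftrightarrow>
        (\<forall>i\<in>K1. length (filter (\<lambda>x. x \<in> D i) xs) = n i) \<and> (\<forall>i\<in>K2. emeasure \<psi> (D i) = of_nat (n i))"
      if "xs \<in> lists (space X)" "\<psi> \<in> CM" for xs \<psi>
    proof -
      have "emeasure (combine xs \<psi>) (D i) = of_nat (length (filter (\<lambda>x. x \<in> D i) xs))" if "i \<in> K1" for i
        using \<open>xs \<in> _\<close> \<open>\<psi> \<in> _\<close> Dsets that K1[OF that]
        by (subst emeasure_combine) (auto simp: K1_def)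
      moreover have "emeasure (combine xs \<psi>) (D i) = emeasure \<psi> (D i)" if "i \<in> K2" for i
        using \<open>xs \<in> _\<close> \<open>\<psi> \<in> _\<close> Dsets that K2[OF that]
        by (subst emeasure_combine) (auto simp: K2_def)
      moreover have "K = K1 \<union> K2" by (auto simp: K1_def K2_def)
      ultimately show ?thesis by auto
    qed
    show ?thesis
    proof (intro set_eqI)
      fix q :: "'a list \<times> 'a measure"
      show "q \<in> (\<lambda>q. combine (fst q) (snd q)) -` ?E K \<inter> space (poisson_lists \<Otimes>\<^sub>M P\<eta>) \<longleftrightarrow> q \<in> ?E1 \<times> ?E K2"
      proof (cases "fst q \<in> lists (space X) \<and> snd q \<in> CM")
        case True
        then show ?thesis
          using key[of "fst q" "snd q"] combine_CM[of "fst q" "snd q"]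
          by (simp add: space_pair_measure mem_Times_iff)
      next
        case False
        then show ?thesis by (auto simp: space_pair_measure)
      qed
    qed
  qed
  then have "emeasure (distr (poisson_lists \<Otimes>\<^sub>M P\<eta>) CS (\<lambda>q. combine (fst q) (snd q))) (?E K) =
      emeasure (poisson_lists \<Otimes>\<^sub>M P\<eta>) (?E1 \<times> ?E K2)"
    by (subst emeasure_distr[OF cm Esets]) auto
  also have "\<dots> = emeasure poisson_lists ?E1 * emeasure P\<eta> (?E K2)"
    using E1 Esets[of K2] by (intro P\<eta>.emeasure_pair_measure_Times) (auto simp: K2_def)
  also have "emeasure P\<eta> (?E K2) = (\<Prod>i\<in>K2. poisson_prob (emeasure \<Lambda> (D i)) (n i))"
    using K by (intro process_counts) (auto simp: K2_def disjoint_family_on_def)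
  also have "emeasure poisson_lists ?E1 = (\<Prod>i\<in>K1. poisson_prob (emeasure (restr \<Lambda> (B p)) (D i)) (n i))"
    using K Dsets by (intro emeasure_poisson_lists_counts) (auto simp: K1_def disjoint_family_on_def)
  also have "\<dots> = (\<Prod>i\<in>K1. poisson_prob (emeasure \<Lambda> (D i)) (n i))"
    by (intro prod.cong refl) (auto simp: emeasure_L Dsets K1 K1_def Int_absorb2)
  also have "\<dots> * (\<Prod>i\<in>K2. poisson_prob (emeasure \<Lambda> (D i)) (n i)) = (\<Prod>i\<in>K. poisson_prob (emeasure \<Lambda> (D i)) (n i))"
    using K(1) by (subst prod.union_disjoint[symmetric]) (auto simp: K1_def K2_def intro!: prod.cong)
  also have "\<dots> = emeasure P\<eta> (?E K)"
    by (rule process_counts[OF K, symmetric])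
  finally show "emeasure (distr (poisson_lists \<Otimes>\<^sub>M P\<eta>) CS (\<lambda>q. combine (fst q) (snd q))) (?E K) = emeasure P\<eta> (?E K)" .
qed (auto intro: prob_space_P\<eta>)

lemma nn_integral_combine:
  assumes F: "F \<in> borel_measurable CS"
  shows "(\<integral>\<^sup>+\<psi>. \<integral>\<^sup>+xs. F (combine xs \<psi>) \<partial>poisson_lists \<partial>P\<eta>) = (\<integral>\<^sup>+\<mu>. F \<mu> \<partial>P\<eta>)"
proof -
  interpret PP: pair_sigma_finite poisson_lists P\<eta> ..
  have cm: "(\<lambda>q. combine (fst q) (snd q)) \<in> poisson_lists \<Otimes>\<^sub>M P\<eta> \<rightarrow>\<^sub>M CS"
    using measurable_combine by (simp cong: measurable_cong_sets)
  have "(\<integral>\<^sup>+\<mu>. F \<mu> \<partial>P\<eta>) = (\<integral>\<^sup>+q. F (combine (fst q) (snd q)) \<partial>(poisson_lists \<Otimes>\<^sub>M P\<eta>))"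
    by (subst distr_combine[symmetric]) (rule nn_integral_distr[OF cm], use F in simp)
  also have "\<dots> = (\<integral>\<^sup>+\<psi>. \<integral>\<^sup>+xs. F (combine xs \<psi>) \<partial>poisson_lists \<partial>P\<eta>)"
    using PP.nn_integral_snd[of "\<lambda>q. F (combine (fst q) (snd q))"] measurable_compose[OF cm F] by simp
  finally show ?thesis ..
qed

lemma integral_combine:
  fixes F :: "'a measure \<Rightarrow> real"
  assumes F: "integrable P\<eta> F"
  shows "(\<integral>\<mu>. F \<mu> \<partial>P\<eta>) = (\<integral>\<psi>. \<integral>xs. F (combine xs \<psi>) \<partial>poisson_lists \<partial>P\<eta>)"
    and "integrable P\<eta> (\<lambda>\<psi>. \<integral>xs. F (combine xs \<psi>) \<partial>poisson_lists)"
proof -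
  interpret PP: pair_sigma_finite poisson_lists P\<eta> ..
  have cm: "(\<lambda>q. combine (fst q) (snd q)) \<in> poisson_lists \<Otimes>\<^sub>M P\<eta> \<rightarrow>\<^sub>M CS"
    using measurable_combine by (simp cong: measurable_cong_sets)
  have Fm: "F \<in> borel_measurable CS" using F by auto
  have i: "integrable (poisson_lists \<Otimes>\<^sub>M P\<eta>) (\<lambda>q. F (combine (fst q) (snd q)))"
    using F integrable_distr_eq[OF cm Fm] by (simp add: distr_combine)
  then have i': "integrable (poisson_lists \<Otimes>\<^sub>M P\<eta>) (\<lambda>(xs, \<psi>). F (combine xs \<psi>))"
    by (simp add: split_beta')
  have "(\<integral>\<mu>. F \<mu> \<partial>P\<eta>) = (\<integral>q. F (combine (fst q) (snd q)) \<partial>(poisson_lists \<Otimes>\<^sub>M P\<eta>))"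
    by (subst distr_combine[symmetric]) (rule integral_distr[OF cm Fm])
  also have "\<dots> = (\<integral>\<psi>. \<integral>xs. F (combine xs \<psi>) \<partial>poisson_lists \<partial>P\<eta>)"
    using PP.integral_snd[OF i'] by (simp add: split_beta')
  finally show "(\<integral>\<mu>. F \<mu> \<partial>P\<eta>) = (\<integral>\<psi>. \<integral>xs. F (combine xs \<psi>) \<partial>poisson_lists \<partial>P\<eta>)" .
  show "integrable P\<eta> (\<lambda>\<psi>. \<integral>xs. F (combine xs \<psi>) \<partial>poisson_lists)"
    by (rule PP.integrable_snd[OF i'])
qed

lemma pathwise_integral_combine:
  assumes g: "g \<in> elementary_integrands X B k" "supported k g"
    and xs: "xs \<in> lists (space X)" "set xs \<subseteq> B p" and \<psi>: "\<psi> \<in> CM"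
  shows "pathwise_integral \<Lambda> k g (combine xs \<psi>) = chaos k (lift_integrand X k g) (mset xs)"
proof (rule pathwise_integral_eq_chaos[OF g combine_CM[OF xs(1) \<psi>] xs(1) _ xs(2)])
  show "restr (combine xs \<psi>) (B p) = dirac_sum X xs"
  proof (rule measure_eqI)
    have s: "sets (combine xs \<psi>) = sets X" by (simp add: combine_def)
    then show "sets (restr (combine xs \<psi>) (B p)) = sets (dirac_sum X xs)" by simp
    fix A assume "A \<in> sets (restr (combine xs \<psi>) (B p))"
    then have A: "A \<in> sets X" by (simp add: s)
    have "A \<inter> B p \<inter> (space X - B p) = {}" by auto
    then have "emeasure \<psi> (A \<inter> B p \<inter> (space X - B p)) = 0" by (simp only: emeasure_empty)
    moreover have "filter (\<lambda>x. x \<in> A \<inter> B p \<inter> B p) xs = filter (\<lambda>x. x \<in> A) xs"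
      using xs(2) by (auto intro!: filter_cong)
    ultimately show "emeasure (restr (combine xs \<psi>) (B p)) A = emeasure (dirac_sum X xs) A"
      using A by (simp only: emeasure_restr'[OF s sets_B A] emeasure_combine[OF xs(1) \<psi>] sets.Int[OF A sets_B]
          emeasure_dirac_sum[OF xs(1) A]) simp
  qed
qed

end

section \<open>The covariance bound\<close>

lemma integrable_mult_square:
  fixes f g :: "'b \<Rightarrow> real"
  assumes [measurable]: "f \<in> borel_measurable N" "g \<in> borel_measurable N"
    and "(\<integral>\<^sup>+x. ennreal ((f x)\<^sup>2) \<partial>N) < \<infinity>" "(\<integral>\<^sup>+x. ennreal ((g x)\<^sup>2) \<partial>N) < \<infinity>"
  shows "integrable N (\<lambda>x. f x * g x)"
proof (rule integrableI_bounded)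
  have "(\<integral>\<^sup>+x. ennreal (norm (f x * g x)) \<partial>N) \<le> (\<integral>\<^sup>+x. ennreal ((f x)\<^sup>2) + ennreal ((g x)\<^sup>2) \<partial>N)"
  proof (intro nn_integral_mono)
    fix x
    have "\<bar>f x\<bar> * \<bar>g x\<bar> \<le> (f x)\<^sup>2 + (g x)\<^sup>2"
      using sum_squares_bound[of "\<bar>f x\<bar>" "\<bar>g x\<bar>"] mult_nonneg_nonneg[of "\<bar>f x\<bar>" "\<bar>g x\<bar>"]
      by (simp only: power2_abs) linarith
    then show "ennreal (norm (f x * g x)) \<le> ennreal ((f x)\<^sup>2) + ennreal ((g x)\<^sup>2)"
      by (simp add: abs_mult ennreal_leI flip: ennreal_plus)
  qed
  also have "\<dots> = (\<integral>\<^sup>+x. ennreal ((f x)\<^sup>2) \<partial>N) + (\<integral>\<^sup>+x. ennreal ((g x)\<^sup>2) \<partial>N)"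
    by (rule nn_integral_add) measurable
  also have "\<dots> < \<infinity>" using assms(3,4) by simp
  finally show "(\<integral>\<^sup>+x. ennreal (norm (f x * g x)) \<partial>N) < \<infinity>" .
qed measurable

section \<open>Isometry, conditional variance and the bound for a finite process\<close>

context finite_intensity
begin

lemma integrable_poly_bounded_mult:
  assumes "(\<lambda>xs. F (mset xs)) \<in> borel_measurable LS" "poly_bounded F"
    and "(\<lambda>xs. G (mset xs)) \<in> borel_measurable LS" "poly_bounded G"
  shows "integrable poisson_lists (\<lambda>xs. F (mset xs) * G (mset xs))"
  using assms
  by (intro integrable_poly_bounded[where F="\<lambda>N. F N * G N"] borel_measurable_times poly_bounded_mult)

lemma chaos_cong_mset:
  assumes "\<And>K. set_mset K \<subseteq> space X \<Longrightarrow> g K = h K" "set_mset N \<subseteq> space X"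
  shows "chaos k g N = chaos k h N"
  using assms
proof (induction k arbitrary: g h N)
  case 0
  then show ?case by simp
next
  case (Suc k)
  have "(\<Sum>z\<in>#N. chaos k (\<lambda>K. g (add_mset z K)) (N - {#z#})) =
      (\<Sum>z\<in>#N. chaos k (\<lambda>K. h (add_mset z K)) (N - {#z#}))"
  proof (intro arg_cong[where f=sum_mset] image_mset_cong Suc.IH)
    fix z assume z: "z \<in># N"
    then show "set_mset (N - {#z#}) \<subseteq> space X" using Suc.prems(2) in_diffD by fastforce
    show "g (add_mset z K) = h (add_mset z K)" if "set_mset K \<subseteq> space X" for K
      using that z Suc.prems by auto
  qed
  moreover have "(\<integral>x. chaos k (\<lambda>K. g (add_mset x K)) N \<partial>L) = (\<integral>x. chaos k (\<lambda>K. h (add_mset x K)) N \<partial>L)"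
    by (intro Bochner_Integration.integral_cong refl Suc.IH) (use Suc.prems in \<open>auto simp: space_L\<close>)
  ultimately show ?case by simp
qed

lemma chaos_cut_space:
  assumes "set_mset N \<subseteq> space X"
  shows "chaos k (cut (space X) h) N = chaos k h N"
  by (rule chaos_cong_mset[OF _ assms]) (simp add: cut_def)

lemma integral_points_cong:
  assumes "\<And>ys. ys \<in> lists (space X) \<Longrightarrow> f ys = f' ys"
  shows "(\<integral>ys. f ys \<partial>points k) = (\<integral>ys. f' ys \<partial>points k :: real)"
  by (rule Bochner_Integration.integral_cong) (use assms in auto)

text \<open>The case of \<open>integral_chaos_mult_chaos\<close> with no frozen points and
  \<open>W\<close> the whole space.\<close>

lemma integral_chaos_chaos:
  assumes h: "(\<lambda>xs. h (mset xs)) \<in> borel_measurable LS" "\<And>K. \<bar>h K\<bar> \<le> c"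
    and g: "(\<lambda>xs. g (mset xs)) \<in> borel_measurable LS" "\<And>K. \<bar>g K\<bar> \<le> d"
    and mk: "m \<le> k"
  shows "(\<integral>xs. chaos m h (mset xs) * chaos k g (mset xs) \<partial>poisson_lists) =
    (if m = k then fact k * (\<integral>ys. h (mset ys) * g (mset ys) \<partial>points k) else 0)"
proof -
  have "(\<integral>xs. chaos m h (mset xs) * chaos k g (mset xs) \<partial>poisson_lists) =
    (\<integral>xs. chaos m h (mset [] + filter_mset (\<lambda>x. x \<in> space X) (mset xs)) * chaos k (cut (space X) g) (mset xs) \<partial>poisson_lists)"
  proof (rule Bochner_Integration.integral_cong[OF refl])
    fix xs assume "xs \<in> space poisson_lists"
    then have xs: "set_mset (mset xs) \<subseteq> space X" by auto
    then have "filter_mset (\<lambda>x. x \<in> space X) (mset xs) = mset xs"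
      by (simp add: filter_mset_eq_conv subset_iff)
    then show "chaos m h (mset xs) * chaos k g (mset xs) =
      chaos m h (mset [] + filter_mset (\<lambda>x. x \<in> space X) (mset xs)) * chaos k (cut (space X) g) (mset xs)"
      by (simp only: chaos_cut_space[OF xs]) simp
  qed
  also have "\<dots> = (if m = k then fact k * (\<integral>ys. h (mset ys) * cut (space X) g (mset ys) \<partial>points k) else 0)"
    by (rule integral_chaos_mult_chaos[OF _ _ h g mk]) auto
  also have "(\<integral>ys. h (mset ys) * cut (space X) g (mset ys) \<partial>points k) = (\<integral>ys. h (mset ys) * g (mset ys) \<partial>points k)"
    by (rule integral_points_cong) (auto simp: cut_def)
  finally show ?thesis .
qed

text \<open>With \<open>V xs = chaos k (cut W h) (mset xs)\<close> the expectations of \<open>I V\<close> and \<open>V\<^sup>2\<close> coincide;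
  expand the second moment of \<open>I - \<integral>I - V\<close>.\<close>

lemma chaos_conditional_variance:
  assumes h: "(\<lambda>xs. h (mset xs)) \<in> borel_measurable LS" "\<And>K. \<bar>h K\<bar> \<le> c"
    and as: "as \<in> lists (space X)" and W: "W \<in> sets X" and k: "1 \<le> k"
  defines "I \<equiv> \<lambda>xs. chaos k h (mset as + filter_mset (\<lambda>x. x \<in> W) (mset xs))"
  shows "(\<integral>xs. I xs \<partial>poisson_lists)\<^sup>2 + fact k * (\<integral>ys. (cut W h (mset ys))\<^sup>2 \<partial>points k)
      \<le> (\<integral>xs. (I xs)\<^sup>2 \<partial>poisson_lists)"
    and "integrable poisson_lists I" "integrable poisson_lists (\<lambda>xs. (I xs)\<^sup>2)"
proof -
  define V where "V xs = chaos k (cut W h) (mset xs)" for xs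
  have cm: "(\<lambda>xs. cut W h (mset xs)) \<in> borel_measurable LS" by (rule measurable_cut[OF h(1) W])
  have cb: "\<bar>cut W h K\<bar> \<le> c" for K by (rule abs_cut_le[OF h(2)])
  have Im: "I \<in> borel_measurable LS" unfolding I_def by (rule measurable_chaos_freeze[OF h(1) as W])
  have Vm: "V \<in> borel_measurable LS" unfolding V_def by (rule measurable_chaos[OF cm])
  have Ib: "poly_bounded (\<lambda>N. chaos k h (mset as + filter_mset (\<lambda>x. x \<in> W) N))"
    by (rule poly_boundedI[OF abs_chaos_freeze_le[OF h(2)]])
  have Vb: "poly_bounded (chaos k (cut W h))" by (rule poly_bounded_chaos(1)[OF cb])
  note [measurable] = Im Vm
  show iI: "integrable poisson_lists I"
    using Im unfolding I_def by (intro integrable_poly_bounded Ib)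
  show iI2: "integrable poisson_lists (\<lambda>xs. (I xs)\<^sup>2)"
    unfolding I_def power2_eq_square
    by (rule integrable_poly_bounded_mult[OF _ Ib _ Ib]) (use Im in \<open>simp_all add: I_def\<close>)
  have iV: "integrable poisson_lists V"
    using Vm unfolding V_def by (intro integrable_poly_bounded Vb)
  have iV2: "integrable poisson_lists (\<lambda>xs. (V xs)\<^sup>2)"
    unfolding V_def power2_eq_square
    by (rule integrable_poly_bounded_mult[OF _ Vb _ Vb]) (use Vm in \<open>simp_all add: V_def[abs_def]\<close>)
  have iIV: "integrable poisson_lists (\<lambda>xs. I xs * V xs)"
    unfolding I_def V_def
    by (rule integrable_poly_bounded_mult[OF _ Ib _ Vb]) (use Im Vm in \<open>simp_all add: I_def V_def[abs_def]\<close>)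
  define a where "a = (\<integral>xs. I xs \<partial>poisson_lists)"
  define v where "v = fact k * (\<integral>ys. (cut W h (mset ys))\<^sup>2 \<partial>points k)"
  \<comment> \<open>The constant 1 is a multiple integral of order 0, and 0 is smaller than
    \<open>k\<close>.\<close>
  have V0: "(\<integral>xs. V xs \<partial>poisson_lists) = 0"
    using integral_chaos_chaos[of "\<lambda>_. 1" 1 "cut W h" c 0 k, OF _ _ cm cb] k by (simp add: V_def)
  have IV: "(\<integral>xs. I xs * V xs \<partial>poisson_lists) = v"
  proof -
    have "(\<integral>xs. I xs * V xs \<partial>poisson_lists) = fact k * (\<integral>ys. h (mset ys) * cut W h (mset ys) \<partial>points k)"
      using integral_chaos_mult_chaos[OF W as h h, of k k] by (simp add: I_def V_def)
    \<comment> \<open>Cutting is multiplication by an indicator, so a single cut factor already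
      equals the square of the cut integrand. This makes \<open>V\<close> a projection of
      \<open>I\<close>.\<close>
    also have "(\<integral>ys. h (mset ys) * cut W h (mset ys) \<partial>points k) = (\<integral>ys. (cut W h (mset ys))\<^sup>2 \<partial>points k)"
      by (rule integral_points_cong) (simp add: cut_def power2_eq_square)
    finally show ?thesis by (simp add: v_def)
  qed
  have VV: "(\<integral>xs. (V xs)\<^sup>2 \<partial>poisson_lists) = v"
    using integral_chaos_chaos[OF cm cb cm cb, of k k] by (simp add: V_def v_def power2_eq_square)
  have "0 \<le> (\<integral>xs. (I xs - a - V xs)\<^sup>2 \<partial>poisson_lists)" by simp
  also have "(\<lambda>xs. (I xs - a - V xs)\<^sup>2) =
      (\<lambda>xs. (I xs)\<^sup>2 + a\<^sup>2 + (V xs)\<^sup>2 - 2 * a * I xs - 2 * (I xs * V xs) + 2 * a * V xs)"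
    by (auto simp: power2_eq_square algebra_simps)
  also have "(\<integral>xs. (I xs)\<^sup>2 + a\<^sup>2 + (V xs)\<^sup>2 - 2 * a * I xs - 2 * (I xs * V xs) + 2 * a * V xs \<partial>poisson_lists) =
      (\<integral>xs. (I xs)\<^sup>2 \<partial>poisson_lists) + a\<^sup>2 + v - 2 * a * a - 2 * v + 2 * a * 0"
    using iI iI2 iV iV2 iIV PL.prob_space by (simp add: V0 IV VV a_def[symmetric])
  finally have "a\<^sup>2 + v \<le> (\<integral>xs. (I xs)\<^sup>2 \<partial>poisson_lists)"
    by (simp add: power2_eq_square)
  then show "(\<integral>xs. I xs \<partial>poisson_lists)\<^sup>2 + fact k * (\<integral>ys. (cut W h (mset ys))\<^sup>2 \<partial>points k)
      \<le> (\<integral>xs. (I xs)\<^sup>2 \<partial>poisson_lists)"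
    unfolding a_def v_def .
qed

lemma nn_integral_chaos_square:
  assumes h: "(\<lambda>xs. h (mset xs)) \<in> borel_measurable LS" "\<And>K. \<bar>h K\<bar> \<le> c"
  shows "(\<integral>\<^sup>+xs. ennreal ((chaos k h (mset xs))\<^sup>2) \<partial>poisson_lists) =
    fact k * (\<integral>\<^sup>+ys. ennreal ((h (mset ys))\<^sup>2) \<partial>points k)"
    and "(\<integral>\<^sup>+ys. ennreal ((h (mset ys))\<^sup>2) \<partial>points k) < \<infinity>"
proof -
  have cm: "(\<lambda>xs. chaos k h (mset xs)) \<in> borel_measurable LS" by (rule measurable_chaos[OF h(1)])
  have cb: "poly_bounded (chaos k h)" by (rule poly_bounded_chaos(1)[OF h(2)])
  have i: "integrable poisson_lists (\<lambda>xs. (chaos k h (mset xs))\<^sup>2)"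
    unfolding power2_eq_square by (rule integrable_poly_bounded_mult[OF cm cb cm cb])
  have "0 \<le> c" using h(2)[of "{#}"] by simp
  have b: "\<bar>(h (mset ys))\<^sup>2\<bar> \<le> c * c" for ys
    using mult_mono[OF h(2)[of "mset ys"] h(2)[of "mset ys"]] \<open>0 \<le> c\<close> by (simp add: power2_eq_square abs_mult)
  have ip: "integrable (points k) (\<lambda>ys. (h (mset ys))\<^sup>2)"
    by (rule integrable_points[OF _ b]) (use h(1) in simp)
  have "(\<integral>\<^sup>+xs. ennreal ((chaos k h (mset xs))\<^sup>2) \<partial>poisson_lists) =
      ennreal (\<integral>xs. (chaos k h (mset xs))\<^sup>2 \<partial>poisson_lists)"
    using i by (intro nn_integral_eq_integral) auto
  also have "(\<integral>xs. (chaos k h (mset xs))\<^sup>2 \<partial>poisson_lists) = fact k * (\<integral>ys. (h (mset ys))\<^sup>2 \<partial>points k)"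
    using integral_chaos_chaos[OF h h, of k k] by (simp add: power2_eq_square)
  also have "ennreal \<dots> = ennreal (fact k) * (\<integral>\<^sup>+ys. ennreal ((h (mset ys))\<^sup>2) \<partial>points k)"
    using nn_integral_eq_integral[OF ip] by (simp add: ennreal_mult)
  finally show "(\<integral>\<^sup>+xs. ennreal ((chaos k h (mset xs))\<^sup>2) \<partial>poisson_lists) =
    fact k * (\<integral>\<^sup>+ys. ennreal ((h (mset ys))\<^sup>2) \<partial>points k)"
    by (simp add: ennreal_fact)
  show "(\<integral>\<^sup>+ys. ennreal ((h (mset ys))\<^sup>2) \<partial>points k) < \<infinity>"
    using nn_integral_eq_integral[OF ip] by simp
qed

text \<open>Let \<open>w\<close> and \<open>w'\<close> be the parts of the integral of the squared
  integrand over tuples that avoid and that meet the stopping set. Integrating the conditional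
  variance bound gives E A^2 + k! E w <= E r^2, and the right side is k! E (w + w') by the isometry.
  Cancelling \<open>w\<close> leaves E A^2 <= k! E w', to which Cauchy-Schwarz is applied.\<close>

theorem integral_chaos_stopping_bound:
  assumes Z: "stopping_lists X \<zeta>"
    and \<phi>: "\<phi> \<in> borel_measurable LS" "(\<integral>\<^sup>+xs. ennreal ((\<phi> xs)\<^sup>2) \<partial>poisson_lists) < \<infinity>"
    and det: "\<And>xs. xs \<in> lists (space X) \<Longrightarrow> \<phi> (filter (\<lambda>x. x \<in> \<zeta> xs) xs) = \<phi> xs"
    and h: "(\<lambda>xs. h (mset xs)) \<in> borel_measurable LS" "\<And>K. \<bar>h K\<bar> \<le> c" and k: "1 \<le> k"
  shows "ennreal ((\<integral>xs. \<phi> xs * chaos k h (mset xs) \<partial>poisson_lists)\<^sup>2) \<le>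
    (\<integral>\<^sup>+xs. ennreal ((\<phi> xs)\<^sup>2) \<partial>poisson_lists) * (fact k *
      (\<integral>\<^sup>+xs. \<integral>\<^sup>+ys. ennreal ((h (mset ys))\<^sup>2) * of_bool (\<exists>y\<in>set ys. y \<in> \<zeta> xs) \<partial>points k \<partial>poisson_lists))"
proof -
  interpret PLL: pair_sigma_finite poisson_lists poisson_lists ..
  interpret Pk: sigma_finite_measure "points k" by (rule sigma_finite_points)
  let ?in = "\<lambda>xs ys. filter (\<lambda>x. x \<in> \<zeta> xs) ys" and ?out = "\<lambda>xs ys. filter (\<lambda>x. x \<notin> \<zeta> xs) ys"
  define r where "r xs = chaos k h (mset xs)" for xs
  have rm [measurable]: "r \<in> borel_measurable LS" unfolding r_def by (rule measurable_chaos[OF h(1)])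
  have r2: "(\<integral>\<^sup>+xs. ennreal ((r xs)\<^sup>2) \<partial>poisson_lists) = fact k * (\<integral>\<^sup>+ys. ennreal ((h (mset ys))\<^sup>2) \<partial>points k)"
    unfolding r_def by (rule nn_integral_chaos_square(1)[OF h])
  note H_fin = nn_integral_chaos_square(2)[OF h, of k]
  note [measurable] = \<phi>(1) h(1)
  have r_split: "r xs = r (?in xs xs @ ?out xs xs)" for xs by (simp add: r_def)
  \<comment> \<open>The conditional expectation of \<open>r\<close> given the inside points,
    realised by averaging over independent outside points.\<close>
  define A where "A xs = (\<integral>bs. r (?in xs xs @ ?out xs bs) \<partial>poisson_lists)" for xs
  have fm: "(\<lambda>xs. (?in xs xs, ?out xs xs)) \<in> poisson_lists \<rightarrow>\<^sub>M LS \<Otimes>\<^sub>M LS"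
    by (intro measurable_Pair measurable_filter_stopping[OF Z]) (auto simp: measurable_ident_sets)
  have gm: "(\<lambda>q. (?in (fst q) (fst q), ?out (fst q) (snd q))) \<in> poisson_lists \<Otimes>\<^sub>M poisson_lists \<rightarrow>\<^sub>M LS \<Otimes>\<^sub>M LS"
    by (intro measurable_Pair measurable_filter_stopping[OF Z]) auto
  have Fm: "(\<lambda>q. \<phi> (fst q) * r (fst q @ snd q)) \<in> borel_measurable (LS \<Otimes>\<^sub>M LS)"
    by measurable
  have rp: "(\<lambda>q. r (fst q @ snd q)) \<in> borel_measurable (LS \<Otimes>\<^sub>M LS)" by measurable
  have rin: "(\<lambda>q. r (?in (fst q) (fst q) @ ?out (fst q) (snd q))) \<in> borel_measurable (poisson_lists \<Otimes>\<^sub>M poisson_lists)"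
    using measurable_compose[OF gm rp] by simp
  have Am: "A \<in> borel_measurable poisson_lists"
    unfolding A_def by (rule PL.borel_measurable_lebesgue_integral) (use rin in \<open>simp add: split_beta'\<close>)
  have i\<phi>r: "integrable poisson_lists (\<lambda>xs. \<phi> xs * r xs)"
    using \<phi>(2) H_fin
    by (intro integrable_mult_square) (simp_all add: r2 ennreal_mult_less_top flip: ennreal_fact)
  have \<phi>r: "\<phi> xs * r xs = \<phi> (?in xs xs) * r (?in xs xs @ ?out xs xs)" if "xs \<in> lists (space X)" for xs
    using r_split[of xs] det[OF that] by simp
  have i1: "integrable poisson_lists (\<lambda>xs. \<phi> (?in xs xs) * r (?in xs xs @ ?out xs xs))"
    using i\<phi>r by (rule Bochner_Integration.integrable_cong[OF refl, THEN iffD1, rotated]) (use \<phi>r in auto)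
  \<comment> \<open>\<phi> is only square integrable, so integrability of the resampled product is
    transported along the equality of laws.\<close>
  have i2: "integrable (poisson_lists \<Otimes>\<^sub>M poisson_lists)
      (\<lambda>q. \<phi> (?in (fst q) (fst q)) * r (?in (fst q) (fst q) @ ?out (fst q) (snd q)))"
    using i1 integrable_distr_eq[OF fm Fm] integrable_distr_eq[OF gm Fm] distr_resample[OF Z] by simp
  have "(\<integral>xs. \<phi> xs * r xs \<partial>poisson_lists) = (\<integral>xs. \<phi> (?in xs xs) * r (?in xs xs @ ?out xs xs) \<partial>poisson_lists)"
    by (rule Bochner_Integration.integral_cong) (use \<phi>r in auto)
  also have "\<dots> = (\<integral>q. \<phi> (?in (fst q) (fst q)) * r (?in (fst q) (fst q) @ ?out (fst q) (snd q))
      \<partial>(poisson_lists \<Otimes>\<^sub>M poisson_lists))"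
    using integral_distr[OF fm Fm] integral_distr[OF gm Fm] distr_resample[OF Z] by simp
  also have "\<dots> = (\<integral>xs. \<integral>bs. \<phi> (?in xs xs) * r (?in xs xs @ ?out xs bs) \<partial>poisson_lists \<partial>poisson_lists)"
    using PLL.integral_fst'[OF i2] by simp
  also have "\<dots> = (\<integral>xs. \<phi> xs * A xs \<partial>poisson_lists)"
    by (rule Bochner_Integration.integral_cong) (use det in \<open>auto simp: A_def\<close>)
  finally have 1: "(\<integral>xs. \<phi> xs * r xs \<partial>poisson_lists) = (\<integral>xs. \<phi> xs * A xs \<partial>poisson_lists)" .
  define w where "w xs = (\<integral>\<^sup>+ys. ennreal ((h (mset ys))\<^sup>2) * of_bool (\<forall>y\<in>set ys. y \<notin> \<zeta> xs) \<partial>points k)" for xs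
  define w' where "w' xs = (\<integral>\<^sup>+ys. ennreal ((h (mset ys))\<^sup>2) * of_bool (\<exists>y\<in>set ys. y \<in> \<zeta> xs) \<partial>points k)" for xs
  have pm [measurable]: "Measurable.pred (poisson_lists \<Otimes>\<^sub>M points k) (\<lambda>q. \<forall>y\<in>set (snd q). y \<notin> \<zeta> (fst q))"
    by (rule measurable_filter_stopping(4)[OF Z]) auto
  have pm': "Measurable.pred (poisson_lists \<Otimes>\<^sub>M points k) (\<lambda>q. \<exists>y\<in>set (snd q). y \<in> \<zeta> (fst q))"
  proof -
    have "Measurable.pred (poisson_lists \<Otimes>\<^sub>M points k) (\<lambda>q. \<not> (\<forall>y\<in>set (snd q). y \<notin> \<zeta> (fst q)))" by measurable
    then show ?thesis by simp
  qed
  note [measurable] = pm'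
  have wm: "w \<in> borel_measurable poisson_lists"
    unfolding w_def by (rule Pk.borel_measurable_nn_integral) (simp add: split_beta')
  have w'm: "w' \<in> borel_measurable poisson_lists"
    unfolding w'_def by (rule Pk.borel_measurable_nn_integral) (simp add: split_beta')
  have ww': "w xs + w' xs = (\<integral>\<^sup>+ys. ennreal ((h (mset ys))\<^sup>2) \<partial>points k)" if xs: "xs \<in> space LS" for xs
  proof -
    have [measurable]: "Measurable.pred LS (\<lambda>ys. \<forall>y\<in>set ys. y \<notin> \<zeta> xs)"
      by (rule measurable_filter_stopping(4)[OF Z, of "\<lambda>_. xs" _ "\<lambda>x. x"]) (use xs in auto)
    have "Measurable.pred LS (\<lambda>ys. \<not> (\<forall>y\<in>set ys. y \<notin> \<zeta> xs))" by measurable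
    then have [measurable]: "Measurable.pred LS (\<lambda>ys. \<exists>y\<in>set ys. y \<in> \<zeta> xs)" by simp
    have "w xs + w' xs = (\<integral>\<^sup>+ys. ennreal ((h (mset ys))\<^sup>2) * of_bool (\<forall>y\<in>set ys. y \<notin> \<zeta> xs) +
        ennreal ((h (mset ys))\<^sup>2) * of_bool (\<exists>y\<in>set ys. y \<in> \<zeta> xs) \<partial>points k)"
      unfolding w_def w'_def by (rule nn_integral_add[symmetric]) measurable
    also have "\<dots> = (\<integral>\<^sup>+ys. ennreal ((h (mset ys))\<^sup>2) \<partial>points k)"
      by (intro nn_integral_cong) auto
    finally show ?thesis .
  qed
  \<comment> \<open>For fixed \<open>xs\<close> the inside points are frozen and \<open>W\<close> is
    the complement of \<open>\<zeta> xs\<close>; a tuple contributes to \<open>w xs\<close> exactly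
    when the cut to \<open>W\<close> keeps it.\<close>
  have cv: "ennreal ((A xs)\<^sup>2) + fact k * w xs \<le> (\<integral>\<^sup>+bs. ennreal ((r (?in xs xs @ ?out xs bs))\<^sup>2) \<partial>poisson_lists)"
    if xs: "xs \<in> space LS" for xs
  proof -
    have "{x\<in>space X. x \<in> \<zeta> xs} \<in> sets X"
      using measurable_compose[OF measurable_Pair1'[OF xs, of X] measurable_stopping_lists[OF Z]]
      by (simp add: pred_def)
    moreover define W where "W = space X - {x\<in>space X. x \<in> \<zeta> xs}"
    ultimately have W: "W \<in> sets X" by auto
    have in_xs: "?in xs xs \<in> lists (space X)" using xs by auto
    have cut: "fact k * w xs = ennreal (fact k * (\<integral>ys. (cut W h (mset ys))\<^sup>2 \<partial>points k))"
    proof -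
      have cb: "\<bar>(cut W h (mset ys))\<^sup>2\<bar> \<le> c * c" for ys
        unfolding power2_eq_square abs_mult
        using h(2)[of "{#}"] by (intro mult_mono abs_cut_le h(2)) auto
      have "integrable (points k) (\<lambda>ys. (cut W h (mset ys))\<^sup>2)"
        by (rule integrable_points[OF _ cb]) (use measurable_cut[OF h(1) W] in measurable)
      then have "ennreal (\<integral>ys. (cut W h (mset ys))\<^sup>2 \<partial>points k) = (\<integral>\<^sup>+ys. ennreal ((cut W h (mset ys))\<^sup>2) \<partial>points k)"
        by (intro nn_integral_eq_integral[symmetric]) auto
      also have "\<dots> = w xs"
        unfolding w_def by (intro nn_integral_cong) (auto simp: cut_def W_def of_bool_def)
      finally show ?thesis by (simp add: ennreal_mult ennreal_fact)
    qed
    have req: "chaos k h (mset (?in xs xs) + filter_mset (\<lambda>x. x \<in> W) (mset bs)) = r (?in xs xs @ ?out xs bs)"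
      if "bs \<in> lists (space X)" for bs
    proof -
      have "filter (\<lambda>x. x \<in> W) bs = ?out xs bs" using that by (auto simp: W_def intro!: filter_cong)
      then show ?thesis unfolding r_def by (metis mset_append mset_filter)
    qed
    note var = chaos_conditional_variance[OF h in_xs W k]
    have a: "A xs = (\<integral>bs. chaos k h (mset (?in xs xs) + filter_mset (\<lambda>x. x \<in> W) (mset bs)) \<partial>poisson_lists)"
      unfolding A_def by (rule Bochner_Integration.integral_cong) (use req in auto)
    have "ennreal ((A xs)\<^sup>2) + fact k * w xs =
        ennreal ((A xs)\<^sup>2 + fact k * (\<integral>ys. (cut W h (mset ys))\<^sup>2 \<partial>points k))"
      unfolding cut by (rule ennreal_plus[symmetric]) auto
    also have "\<dots> \<le> ennreal (\<integral>bs. (chaos k h (mset (?in xs xs) + filter_mset (\<lambda>x. x \<in> W) (mset bs)))\<^sup>2 \<partial>poisson_lists)"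
      unfolding a by (rule ennreal_leI[OF var(1)])
    also have "\<dots> = (\<integral>\<^sup>+bs. ennreal ((chaos k h (mset (?in xs xs) + filter_mset (\<lambda>x. x \<in> W) (mset bs)))\<^sup>2) \<partial>poisson_lists)"
      using var(3) by (intro nn_integral_eq_integral[symmetric]) auto
    also have "\<dots> = (\<integral>\<^sup>+bs. ennreal ((r (?in xs xs @ ?out xs bs))\<^sup>2) \<partial>poisson_lists)"
      by (rule nn_integral_cong) (use req in auto)
    finally show ?thesis .
  qed
  have fact_fin: "(fact k :: ennreal) < \<infinity>" by (simp flip: ennreal_fact)
  have "(\<integral>\<^sup>+xs. ennreal ((A xs)\<^sup>2) \<partial>poisson_lists) + fact k * (\<integral>\<^sup>+xs. w xs \<partial>poisson_lists) =
      (\<integral>\<^sup>+xs. ennreal ((A xs)\<^sup>2) + fact k * w xs \<partial>poisson_lists)"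
    using Am wm by (simp add: nn_integral_add nn_integral_cmult)
  also have "\<dots> \<le> (\<integral>\<^sup>+xs. \<integral>\<^sup>+bs. ennreal ((r (?in xs xs @ ?out xs bs))\<^sup>2) \<partial>poisson_lists \<partial>poisson_lists)"
    by (intro nn_integral_mono cv) simp
  also have "\<dots> = (\<integral>\<^sup>+xs. ennreal ((r (?in xs xs @ ?out xs xs))\<^sup>2) \<partial>poisson_lists)"
    by (rule nn_integral_resample[OF Z, of "\<lambda>as bs. ennreal ((r (as @ bs))\<^sup>2)", symmetric])
      (use rp in \<open>simp add: split_beta'\<close>)
  also have "\<dots> = fact k * (\<integral>\<^sup>+ys. ennreal ((h (mset ys))\<^sup>2) \<partial>points k)"
    by (simp only: r_split[symmetric] r2)
  also have "(\<integral>\<^sup>+ys. ennreal ((h (mset ys))\<^sup>2) \<partial>points k) = (\<integral>\<^sup>+xs. w xs + w' xs \<partial>poisson_lists)"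
  proof -
    have "(\<integral>\<^sup>+xs. w xs + w' xs \<partial>poisson_lists) =
        (\<integral>\<^sup>+xs. (\<integral>\<^sup>+ys. ennreal ((h (mset ys))\<^sup>2) \<partial>points k) \<partial>poisson_lists)"
      by (intro nn_integral_cong ww') simp
    then show ?thesis using PL.emeasure_space_1 by simp
  qed
  also have "\<dots> = (\<integral>\<^sup>+xs. w xs \<partial>poisson_lists) + (\<integral>\<^sup>+xs. w' xs \<partial>poisson_lists)"
    by (rule nn_integral_add[OF wm w'm])
  finally have "fact k * (\<integral>\<^sup>+xs. w xs \<partial>poisson_lists) + (\<integral>\<^sup>+xs. ennreal ((A xs)\<^sup>2) \<partial>poisson_lists) \<le>
      fact k * (\<integral>\<^sup>+xs. w xs \<partial>poisson_lists) + fact k * (\<integral>\<^sup>+xs. w' xs \<partial>poisson_lists)"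
    by (simp add: distrib_left add.commute)
  \<comment> \<open>Cancellation in the extended nonnegative reals requires a finite term.\<close>
  moreover have "fact k * (\<integral>\<^sup>+xs. w xs \<partial>poisson_lists) \<noteq> \<infinity>"
  proof -
    have "(\<integral>\<^sup>+xs. w xs \<partial>poisson_lists) \<le> (\<integral>\<^sup>+xs. (\<integral>\<^sup>+ys. ennreal ((h (mset ys))\<^sup>2) \<partial>points k) \<partial>poisson_lists)"
      using ww' by (intro nn_integral_mono) (metis le_iff_add space_list_space space_poisson_lists)
    also have "\<dots> < \<infinity>" using H_fin PL.emeasure_space_1 by simp
    finally show ?thesis using fact_fin by (simp add: ennreal_mult_eq_top_iff less_top)
  qed
  ultimately have 2: "(\<integral>\<^sup>+xs. ennreal ((A xs)\<^sup>2) \<partial>poisson_lists) \<le> fact k * (\<integral>\<^sup>+xs. w' xs \<partial>poisson_lists)"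
    using ennreal_add_left_cancel_le by blast
  have "ennreal \<bar>\<integral>xs. \<phi> xs * A xs \<partial>poisson_lists\<bar> \<le> (\<integral>\<^sup>+xs. ennreal \<bar>\<phi> xs\<bar> * ennreal \<bar>A xs\<bar> \<partial>poisson_lists)"
  proof (cases "integrable poisson_lists (\<lambda>xs. \<phi> xs * A xs)")
    case True
    from integral_norm_bound_ennreal[OF this] show ?thesis by (simp add: abs_mult ennreal_mult)
  qed (simp add: not_integrable_integral_eq)
  then have "(ennreal \<bar>\<integral>xs. \<phi> xs * A xs \<partial>poisson_lists\<bar>)\<^sup>2 \<le> (\<integral>\<^sup>+xs. ennreal \<bar>\<phi> xs\<bar> * ennreal \<bar>A xs\<bar> \<partial>poisson_lists)\<^sup>2"
    by (intro power_mono) auto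
  also have "\<dots> \<le> (\<integral>\<^sup>+xs. (ennreal \<bar>\<phi> xs\<bar>)\<^sup>2 \<partial>poisson_lists) * (\<integral>\<^sup>+xs. (ennreal \<bar>A xs\<bar>)\<^sup>2 \<partial>poisson_lists)"
    using Am \<phi>(1) by (intro Cauchy_Schwarz_nn_integral) (simp_all cong: measurable_cong_sets)
  also have "\<dots> = (\<integral>\<^sup>+xs. ennreal ((\<phi> xs)\<^sup>2) \<partial>poisson_lists) * (\<integral>\<^sup>+xs. ennreal ((A xs)\<^sup>2) \<partial>poisson_lists)"
    by (simp add: ennreal_power)
  also have "\<dots> \<le> (\<integral>\<^sup>+xs. ennreal ((\<phi> xs)\<^sup>2) \<partial>poisson_lists) * (fact k * (\<integral>\<^sup>+xs. w' xs \<partial>poisson_lists))"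
    by (intro mult_left_mono 2) auto
  finally show ?thesis
    using 1 by (simp add: ennreal_power r_def w'_def)
qed

end

section \<open>Stopping sets with the outside configuration frozen\<close>

context local_intensity
begin

lemma combine_cong:
  assumes "mset xs = mset ys" "xs \<in> lists (space X)"
  shows "combine xs \<psi> = combine ys \<psi>"
proof -
  have "mset (filter (\<lambda>x. x \<in> B p) xs) = mset (filter (\<lambda>x. x \<in> B p) ys)"
    using assms(1) by simp
  moreover have "filter (\<lambda>x. x \<in> B p) xs \<in> lists (space X)" using assms(2) by auto
  ultimately show ?thesis unfolding combine_def by (simp only: dirac_sum_cong)
qed

lemma sets_combine: "sets (combine xs \<psi>) = sets X"
  by (simp add: combine_def)

text \<open>Both configurations share \<psi> outside \<open>B p\<close>, so gluing them along
  \<open>W\<close> only glues their lists.\<close>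

lemma combine_split:
  assumes us: "us \<in> lists (space X)" and vs: "vs \<in> lists (space X)" and \<psi>: "\<psi> \<in> CM" and W: "W \<in> sets X"
  shows "add_measure (restr (combine us \<psi>) W) (restr (combine vs \<psi>) (space X - W)) =
    combine (filter (\<lambda>x. x \<in> W) us @ filter (\<lambda>x. x \<notin> W) vs) \<psi>"
proof (rule measure_eqI)
  fix A assume "A \<in> sets (add_measure (restr (combine us \<psi>) W) (restr (combine vs \<psi>) (space X - W)))"
  then have A: "A \<in> sets X" by (simp add: sets_combine)
  have W': "space X - W \<in> sets X" using W by auto
  have AW: "A \<inter> W \<in> sets X" "A \<inter> (space X - W) \<in> sets X" using A W by auto
  let ?ws = "filter (\<lambda>x. x \<in> W) us @ filter (\<lambda>x. x \<notin> W) vs"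
  have ws: "?ws \<in> lists (space X)" using us vs by auto
  let ?R = "space X - B p"
  have "emeasure \<psi> (A \<inter> W \<inter> ?R) + emeasure \<psi> (A \<inter> (space X - W) \<inter> ?R) =
      emeasure \<psi> ((A \<inter> W \<inter> ?R) \<union> (A \<inter> (space X - W) \<inter> ?R))"
    using AW CM_sets[OF \<psi>] by (intro plus_emeasure) auto
  also have "(A \<inter> W \<inter> ?R) \<union> (A \<inter> (space X - W) \<inter> ?R) = A \<inter> ?R" by auto
  finally have e: "emeasure \<psi> (A \<inter> ?R) = emeasure \<psi> (A \<inter> W \<inter> ?R) + emeasure \<psi> (A \<inter> (space X - W) \<inter> ?R)" ..
  have f1: "filter (\<lambda>x. x \<in> A \<inter> B p) (filter (\<lambda>x. x \<in> W) us) = filter (\<lambda>x. x \<in> A \<inter> W \<inter> B p) us"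
    by (auto intro!: filter_cong)
  have f2: "filter (\<lambda>x. x \<in> A \<inter> B p) (filter (\<lambda>x. x \<notin> W) vs) = filter (\<lambda>x. x \<in> A \<inter> (space X - W) \<inter> B p) vs"
    using vs by (auto intro!: filter_cong)
  have "emeasure (add_measure (restr (combine us \<psi>) W) (restr (combine vs \<psi>) (space X - W))) A =
      emeasure (combine us \<psi>) (A \<inter> W) + emeasure (combine vs \<psi>) (A \<inter> (space X - W))"
    using A W W' by (subst emeasure_add_measure) (simp_all add: sets_combine emeasure_restr'[OF sets_combine])
  also have "\<dots> = of_nat (length (filter (\<lambda>x. x \<in> A \<inter> B p) ?ws)) + emeasure \<psi> (A \<inter> ?R)"
    unfolding emeasure_combine[OF us \<psi> AW(1)] emeasure_combine[OF vs \<psi> AW(2)] e filter_append f1 f2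
    by (simp add: ac_simps)
  also have "\<dots> = emeasure (combine ?ws \<psi>) A"
    by (rule emeasure_combine[OF ws \<psi> A, symmetric])
  finally show "emeasure (add_measure (restr (combine us \<psi>) W) (restr (combine vs \<psi>) (space X - W))) A =
      emeasure (combine ?ws \<psi>) A" .
qed (simp add: sets_combine)

lemma restr_combine_filter:
  assumes xs: "xs \<in> lists (space X)" and \<psi>: "\<psi> \<in> CM" and W: "W \<in> sets X"
  shows "restr (combine (filter (\<lambda>x. x \<in> W) xs) \<psi>) W = restr (combine xs \<psi>) W"
proof (rule measure_eqI)
  fix A assume "A \<in> sets (restr (combine (filter (\<lambda>x. x \<in> W) xs) \<psi>) W)"
  then have A: "A \<in> sets X" by (simp add: sets_combine)
  have AW: "A \<inter> W \<in> sets X" using A W by auto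
  have ws: "filter (\<lambda>x. x \<in> W) xs \<in> lists (space X)" using xs by auto
  have "filter (\<lambda>x. x \<in> A \<inter> W \<inter> B p) (filter (\<lambda>x. x \<in> W) xs) = filter (\<lambda>x. x \<in> A \<inter> W \<inter> B p) xs"
    by (auto intro!: filter_cong)
  then show "emeasure (restr (combine (filter (\<lambda>x. x \<in> W) xs) \<psi>) W) A = emeasure (restr (combine xs \<psi>) W) A"
    by (simp only: emeasure_restr'[OF sets_combine W A] emeasure_combine[OF ws \<psi> AW] emeasure_combine[OF xs \<psi> AW])
qed (simp add: sets_combine)

text \<open>The identity that defines a stopping set allows any configuration to be inserted outside
  the set. Inserting \<open>combine bs \<psi>\<close> adds the points \<open>bs\<close>, and
  inserting \<open>combine [] \<psi>\<close> deletes them; these are the two alternatives in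
  \<open>stopping_lists\<close>.\<close>

lemma stopping_lists_combine:
  assumes Z: "stopping_set X B Z" and \<psi>: "\<psi> \<in> CM"
  shows "stopping_lists X (\<lambda>xs. Z (combine xs \<psi>))"
  unfolding stopping_lists_def
proof (intro conjI ballI allI impI)
  have "(\<lambda>q. (fst q, \<psi>)) \<in> LS \<Otimes>\<^sub>M X \<rightarrow>\<^sub>M LS \<Otimes>\<^sub>M CS" using \<psi> by simp
  from measurable_compose[OF this measurable_combine]
  have m: "(\<lambda>q. (snd q, combine (fst q) \<psi>)) \<in> LS \<Otimes>\<^sub>M X \<rightarrow>\<^sub>M X \<Otimes>\<^sub>M CS" by simp
  have "Measurable.pred (X \<Otimes>\<^sub>M CS) (\<lambda>(x, \<mu>). x \<in> Z \<mu>)" using Z by (simp add: stopping_set_def)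
  from measurable_compose[OF m this]
  show "Measurable.pred (LS \<Otimes>\<^sub>M X) (\<lambda>(xs, x). x \<in> Z (combine xs \<psi>))"
    by (simp add: split_beta')
next
  fix as bs xs
  assume as: "as \<in> lists (space X)" and bs: "bs \<in> lists (space X)" and xs: "mset xs = mset as + mset bs"
    and or: "set as \<subseteq> Z (combine as \<psi>) \<and> set bs \<inter> Z (combine as \<psi>) = {} \<or>
        set as \<subseteq> Z (combine xs \<psi>) \<and> set bs \<inter> Z (combine xs \<psi>) = {}"
  have "set xs = set as \<union> set bs" using xs by (metis set_mset_mset set_mset_union)
  then have xs_in: "xs \<in> lists (space X)" using as bs by auto
  have Zsets: "Z \<mu> \<in> sets X" if "\<mu> \<in> CM" for \<mu> using Z that by (simp add: stopping_set_def)
  have Zeq: "Z \<mu> = Z (add_measure (restr \<mu> (Z \<mu>)) (restr \<nu> (space X - Z \<mu>)))" if "\<mu> \<in> CM" "\<nu> \<in> CM" for \<mu> \<nu>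
    using Z that by (simp add: stopping_set_def)
  from or show "Z (combine xs \<psi>) = Z (combine as \<psi>)"
  proof
    assume a: "set as \<subseteq> Z (combine as \<psi>) \<and> set bs \<inter> Z (combine as \<psi>) = {}"
    let ?W = "Z (combine as \<psi>)"
    have "filter (\<lambda>x. x \<in> ?W) as = as" "filter (\<lambda>x. x \<notin> ?W) bs = bs"
      using a by (auto simp: filter_id_conv)
    then have "add_measure (restr (combine as \<psi>) ?W) (restr (combine bs \<psi>) (space X - ?W)) = combine (as @ bs) \<psi>"
      using combine_split[OF as bs \<psi> Zsets[OF combine_CM[OF as \<psi>]]] by simp
    also have "\<dots> = combine xs \<psi>" using xs xs_in by (intro combine_cong[symmetric]) auto
    finally show ?thesis using Zeq[OF combine_CM[OF as \<psi>] combine_CM[OF bs \<psi>]] by simp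
  next
    assume a: "set as \<subseteq> Z (combine xs \<psi>) \<and> set bs \<inter> Z (combine xs \<psi>) = {}"
    let ?W = "Z (combine xs \<psi>)"
    have nil: "[] \<in> lists (space X)" by simp
    have "filter (\<lambda>x. x \<in> ?W) as = as" "filter (\<lambda>x. x \<in> ?W) bs = []"
      using a by (auto simp: filter_id_conv filter_empty_conv)
    then have "mset (filter (\<lambda>x. x \<in> ?W) xs) = mset as"
      using xs by (metis add.right_neutral filter_union_mset mset.simps(1) mset_filter)
    moreover have "filter (\<lambda>x. x \<in> ?W) xs \<in> lists (space X)" using xs_in by auto
    ultimately have "combine (filter (\<lambda>x. x \<in> ?W) xs) \<psi> = combine as \<psi>" by (rule combine_cong)
    then have "add_measure (restr (combine xs \<psi>) ?W) (restr (combine [] \<psi>) (space X - ?W)) = combine as \<psi>"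
      using combine_split[OF xs_in nil \<psi> Zsets[OF combine_CM[OF xs_in \<psi>]]] by simp
    then show ?thesis using Zeq[OF combine_CM[OF xs_in \<psi>] combine_CM[OF nil \<psi>]] by simp
  qed
qed

text \<open>Deleting the points outside the stopping set changes neither the stopping set nor the
  restriction of the configuration to it.\<close>

lemma determined_combine:
  assumes Z: "stopping_set X B Z" and f: "determined_by X B f Z"
    and xs: "xs \<in> lists (space X)" and \<psi>: "\<psi> \<in> CM"
  shows "f (combine (filter (\<lambda>x. x \<in> Z (combine xs \<psi>)) xs) \<psi>) = f (combine xs \<psi>)"
proof -
  let ?W = "Z (combine xs \<psi>)" and ?q = "filter (\<lambda>x. x \<in> Z (combine xs \<psi>)) xs"
  have q: "?q \<in> lists (space X)" using xs by auto
  have W: "?W \<in> sets X" using Z combine_CM[OF xs \<psi>] by (simp add: stopping_set_def)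
  have "Z (combine ?q \<psi>) = ?W"
    by (rule stopping_lists_filter[OF stopping_lists_combine[OF Z \<psi>] xs])
  then have "f (combine ?q \<psi>) = f (restr (combine ?q \<psi>) ?W)"
    using f combine_CM[OF q \<psi>] by (auto simp: determined_by_def)
  also have "\<dots> = f (restr (combine xs \<psi>) ?W)"
    by (simp only: restr_combine_filter[OF xs \<psi> W])
  also have "\<dots> = f (combine xs \<psi>)"
    using f combine_CM[OF xs \<psi>] by (auto simp: determined_by_def)
  finally show ?thesis .
qed

end

section \<open>Averaging over the randomization and the outside configuration\<close>

context poisson_setting
begin

lemma elementary_bound:
  assumes "g \<in> elementary_integrands X B k"
  shows "\<exists>c. \<forall>K. \<bar>lift_integrand X k g K\<bar> \<le> c"
proof -
  obtain c where c: "\<And>x. x \<in> space (pow_measure X k) \<Longrightarrow> \<bar>g x\<bar> \<le> c"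
    using assms by (auto simp: elementary_integrands_def)
  have "\<bar>lift_integrand X k g K\<bar> \<le> max c 0" for K
    by (rule abs_lift_integrand_le) (auto intro: order.trans[OF c])
  then show ?thesis by blast
qed

lemma AE_pathwise_integral_combine:
  assumes g: "g \<in> elementary_integrands X B k" "supported k g" and \<psi>: "\<psi> \<in> CM"
  shows "AE xs in poisson_lists. pathwise_integral \<Lambda> k g (combine xs \<psi>) = chaos k (lift_integrand X k g) (mset xs)"
  using AE_poisson_lists_B AE_space
  by eventually_elim (rule pathwise_integral_combine[OF g _ _ \<psi>], auto)

lemma nn_integral_pathwise_square:
  assumes g: "g \<in> elementary_integrands X B k" "supported k g"
  shows "(\<integral>\<^sup>+\<omega>. ennreal ((pathwise_integral \<Lambda> k g (\<eta> \<omega>))\<^sup>2) \<partial>M) =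
    fact k * (\<integral>\<^sup>+ys. ennreal ((lift_integrand X k g (mset ys))\<^sup>2) \<partial>points k)"
    and "(\<integral>\<^sup>+\<omega>. ennreal ((pathwise_integral \<Lambda> k g (\<eta> \<omega>))\<^sup>2) \<partial>M) < \<infinity>"
proof -
  note [measurable] = measurable_pathwise_integral[OF g]
  obtain c where c: "\<And>K. \<bar>lift_integrand X k g K\<bar> \<le> c" using elementary_bound[OF g(1)] by blast
  note sq = nn_integral_chaos_square[OF measurable_lift_integrand[OF g(1)] c, of k]
  have "(\<integral>\<^sup>+\<omega>. ennreal ((pathwise_integral \<Lambda> k g (\<eta> \<omega>))\<^sup>2) \<partial>M) =
      (\<integral>\<^sup>+\<mu>. ennreal ((pathwise_integral \<Lambda> k g \<mu>)\<^sup>2) \<partial>P\<eta>)"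
    by (simp add: nn_integral_distr)
  also have "\<dots> = (\<integral>\<^sup>+\<psi>. \<integral>\<^sup>+xs. ennreal ((pathwise_integral \<Lambda> k g (combine xs \<psi>))\<^sup>2) \<partial>poisson_lists \<partial>P\<eta>)"
    by (rule nn_integral_combine[symmetric]) simp
  also have "\<dots> = (\<integral>\<^sup>+\<psi>. \<integral>\<^sup>+xs. ennreal ((chaos k (lift_integrand X k g) (mset xs))\<^sup>2) \<partial>poisson_lists \<partial>P\<eta>)"
  proof (rule nn_integral_cong, rule nn_integral_cong_AE)
    fix \<psi> assume "\<psi> \<in> space P\<eta>"
    then have "\<psi> \<in> CM" by simp
    from AE_pathwise_integral_combine[OF g this]
    show "AE xs in poisson_lists. ennreal ((pathwise_integral \<Lambda> k g (combine xs \<psi>))\<^sup>2) =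
        ennreal ((chaos k (lift_integrand X k g) (mset xs))\<^sup>2)"
      by eventually_elim simp
  qed
  also have "\<dots> = fact k * (\<integral>\<^sup>+ys. ennreal ((lift_integrand X k g (mset ys))\<^sup>2) \<partial>points k)"
    using P\<eta>.emeasure_space_1 by (simp only: sq(1) nn_integral_const) simp
  finally show 1: "(\<integral>\<^sup>+\<omega>. ennreal ((pathwise_integral \<Lambda> k g (\<eta> \<omega>))\<^sup>2) \<partial>M) =
    fact k * (\<integral>\<^sup>+ys. ennreal ((lift_integrand X k g (mset ys))\<^sup>2) \<partial>points k)" .
  show "(\<integral>\<^sup>+\<omega>. ennreal ((pathwise_integral \<Lambda> k g (\<eta> \<omega>))\<^sup>2) \<partial>M) < \<infinity>"
    unfolding 1 using sq(2) by (simp add: ennreal_mult_less_top flip: ennreal_fact)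
qed

text \<open>The orthogonality already holds for the points in \<open>B p\<close> with every frozen
  outside configuration.\<close>

lemma integral_pathwise_orthogonal:
  assumes g: "g \<in> elementary_integrands X B k" "supported k g"
    and h: "h \<in> elementary_integrands X B m" "supported m h" and "m < k"
  shows "(\<integral>\<omega>. pathwise_integral \<Lambda> m h (\<eta> \<omega>) * pathwise_integral \<Lambda> k g (\<eta> \<omega>) \<partial>M) = 0"
proof -
  note [measurable] = measurable_pathwise_integral[OF g] measurable_pathwise_integral[OF h]
  obtain c where c: "\<And>K. \<bar>lift_integrand X k g K\<bar> \<le> c" using elementary_bound[OF g(1)] by blast
  obtain d where d: "\<And>K. \<bar>lift_integrand X m h K\<bar> \<le> d" using elementary_bound[OF h(1)] by blast
  have i: "integrable P\<eta> (\<lambda>\<mu>. pathwise_integral \<Lambda> m h \<mu> * pathwise_integral \<Lambda> k g \<mu>)"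
    using nn_integral_pathwise_square(2)[OF g] nn_integral_pathwise_square(2)[OF h]
    by (intro integrable_mult_square) (simp_all add: nn_integral_distr)
  have "(\<integral>\<omega>. pathwise_integral \<Lambda> m h (\<eta> \<omega>) * pathwise_integral \<Lambda> k g (\<eta> \<omega>) \<partial>M) =
      (\<integral>\<mu>. pathwise_integral \<Lambda> m h \<mu> * pathwise_integral \<Lambda> k g \<mu> \<partial>P\<eta>)"
    by (simp add: integral_distr)
  also have "\<dots> = (\<integral>\<psi>. \<integral>xs. pathwise_integral \<Lambda> m h (combine xs \<psi>) * pathwise_integral \<Lambda> k g (combine xs \<psi>)
      \<partial>poisson_lists \<partial>P\<eta>)"
    by (rule integral_combine(1)[OF i])
  also have "\<dots> = (\<integral>\<psi>. 0 \<partial>P\<eta>)"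
  proof (rule Bochner_Integration.integral_cong[OF refl])
    fix \<psi> assume "\<psi> \<in> space P\<eta>"
    then have \<psi>: "\<psi> \<in> CM" by simp
    have "(\<lambda>xs. (xs, \<psi>)) \<in> poisson_lists \<rightarrow>\<^sub>M LS \<Otimes>\<^sub>M CS" using \<psi> by (simp cong: measurable_cong_sets)
    from measurable_compose[OF this measurable_combine]
    have [measurable]: "(\<lambda>xs. combine xs \<psi>) \<in> poisson_lists \<rightarrow>\<^sub>M CS" by simp
    note [measurable] = measurable_chaos[OF measurable_lift_integrand[OF g(1)]]
      measurable_chaos[OF measurable_lift_integrand[OF h(1)]]
    have "(\<integral>xs. pathwise_integral \<Lambda> m h (combine xs \<psi>) * pathwise_integral \<Lambda> k g (combine xs \<psi>) \<partial>poisson_lists) =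
        (\<integral>xs. chaos m (lift_integrand X m h) (mset xs) * chaos k (lift_integrand X k g) (mset xs) \<partial>poisson_lists)"
    proof (rule integral_cong_AE)
      show "AE xs in poisson_lists. pathwise_integral \<Lambda> m h (combine xs \<psi>) * pathwise_integral \<Lambda> k g (combine xs \<psi>) =
          chaos m (lift_integrand X m h) (mset xs) * chaos k (lift_integrand X k g) (mset xs)"
        using AE_pathwise_integral_combine[OF g \<psi>] AE_pathwise_integral_combine[OF h \<psi>]
        by eventually_elim simp
    qed measurable
    also have "\<dots> = 0"
      using integral_chaos_chaos[OF measurable_lift_integrand[OF h(1)] d measurable_lift_integrand[OF g(1)] c, of m k]
        \<open>m < k\<close> by simp
    finally show "(\<integral>xs. pathwise_integral \<Lambda> m h (combine xs \<psi>) * pathwise_integral \<Lambda> k g (combine xs \<psi>) \<partial>poisson_lists) = 0" .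
  qed
  finally show ?thesis by simp
qed

lemma distr_independent:
  assumes "independent_elements M CS \<eta> \<Y> Y"
  shows "distr M (\<Y> \<Otimes>\<^sub>M CS) (\<lambda>\<omega>. (Y \<omega>, \<eta> \<omega>)) = distr M \<Y> Y \<Otimes>\<^sub>M P\<eta>"
proof -
  have [measurable]: "Y \<in> M \<rightarrow>\<^sub>M \<Y>" using assms by (simp add: independent_elements_def)
  interpret PY: prob_space "distr M \<Y> Y" by (rule Om.prob_space_distr) measurable
  show ?thesis
  proof (rule pair_measure_eqI[symmetric])
    fix A C assume "A \<in> sets (distr M \<Y> Y)" "C \<in> sets P\<eta>"
    then have A [measurable]: "A \<in> sets \<Y>" and C [measurable]: "C \<in> sets CS" by auto
    have "Om.prob ((\<eta> -` C \<inter> space M) \<inter> (Y -` A \<inter> space M)) =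
        Om.prob (\<eta> -` C \<inter> space M) * Om.prob (Y -` A \<inter> space M)"
      using assms A C unfolding independent_elements_def by (intro Om.indep_setD) auto
    moreover have "(\<lambda>\<omega>. (Y \<omega>, \<eta> \<omega>)) -` (A \<times> C) \<inter> space M = (\<eta> -` C \<inter> space M) \<inter> (Y -` A \<inter> space M)"
      by auto
    ultimately show "emeasure (distr M \<Y> Y) A * emeasure P\<eta> C =
        emeasure (distr M (\<Y> \<Otimes>\<^sub>M CS) (\<lambda>\<omega>. (Y \<omega>, \<eta> \<omega>))) (A \<times> C)"
      by (simp add: emeasure_distr Om.emeasure_eq_measure ennreal_mult[symmetric] mult.commute)
  qed (simp_all add: PY.sigma_finite_measure_axioms P\<eta>.sigma_finite_measure_axioms)
qed

text \<open>By independence the law of \<open>Y\<close> and the process is a product, so the points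
  in \<open>B p\<close> can be redrawn for each fixed value of \<open>Y\<close>.\<close>

lemma nn_integral_combine_independent:
  assumes ind: "independent_elements M CS \<eta> \<Y> Y"
    and F: "(\<lambda>(y, \<mu>). F y \<mu>) \<in> borel_measurable (\<Y> \<Otimes>\<^sub>M CS)"
  shows "(\<integral>\<^sup>+t. \<integral>\<^sup>+xs. F (fst t) (combine xs (snd t)) \<partial>poisson_lists \<partial>(distr M \<Y> Y \<Otimes>\<^sub>M P\<eta>)) =
    (\<integral>\<^sup>+\<omega>. F (Y \<omega>) (\<eta> \<omega>) \<partial>M)"
proof -
  have [measurable]: "Y \<in> M \<rightarrow>\<^sub>M \<Y>" using ind by (simp add: independent_elements_def)
  have Fm: "(\<lambda>q. F (fst q) (snd q)) \<in> borel_measurable (\<Y> \<Otimes>\<^sub>M CS)" using F by (simp add: split_beta')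
  have FY: "(\<lambda>\<mu>. F y \<mu>) \<in> borel_measurable CS" if "y \<in> space \<Y>" for y
    using measurable_compose[OF measurable_Pair1'[OF that, of CS] F] by simp
  have sT: "sets (distr M \<Y> Y \<Otimes>\<^sub>M P\<eta>) = sets (\<Y> \<Otimes>\<^sub>M CS)"
    by (rule sets_pair_measure_cong) simp_all
  have cm: "(\<lambda>q. (fst (fst q), combine (snd q) (snd (fst q)))) \<in> (distr M \<Y> Y \<Otimes>\<^sub>M P\<eta>) \<Otimes>\<^sub>M poisson_lists \<rightarrow>\<^sub>M \<Y> \<Otimes>\<^sub>M CS"
  proof -
    have "(\<lambda>q. (snd q, snd (fst q))) \<in> (distr M \<Y> Y \<Otimes>\<^sub>M P\<eta>) \<Otimes>\<^sub>M poisson_lists \<rightarrow>\<^sub>M LS \<Otimes>\<^sub>M CS"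
      by measurable
    from measurable_compose[OF this measurable_combine] show ?thesis by simp
  qed
  have "(\<lambda>q. F (fst (fst q)) (combine (snd q) (snd (fst q)))) \<in> borel_measurable ((distr M \<Y> Y \<Otimes>\<^sub>M P\<eta>) \<Otimes>\<^sub>M poisson_lists)"
    using measurable_compose[OF cm Fm] by simp
  from PL.borel_measurable_nn_integral_fst[OF this]
  have m: "(\<lambda>t. \<integral>\<^sup>+xs. F (fst t) (combine xs (snd t)) \<partial>poisson_lists) \<in> borel_measurable (distr M \<Y> Y \<Otimes>\<^sub>M P\<eta>)"
    by simp
  have "(\<integral>\<^sup>+t. \<integral>\<^sup>+xs. F (fst t) (combine xs (snd t)) \<partial>poisson_lists \<partial>(distr M \<Y> Y \<Otimes>\<^sub>M P\<eta>)) =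
      (\<integral>\<^sup>+y. \<integral>\<^sup>+\<psi>. \<integral>\<^sup>+xs. F y (combine xs \<psi>) \<partial>poisson_lists \<partial>P\<eta> \<partial>distr M \<Y> Y)"
    using P\<eta>.nn_integral_fst[OF m] by simp
  also have "\<dots> = (\<integral>\<^sup>+y. \<integral>\<^sup>+\<mu>. F y \<mu> \<partial>P\<eta> \<partial>distr M \<Y> Y)"
    by (intro nn_integral_cong nn_integral_combine FY) simp
  also have "\<dots> = (\<integral>\<^sup>+q. F (fst q) (snd q) \<partial>(distr M \<Y> Y \<Otimes>\<^sub>M P\<eta>))"
    using P\<eta>.nn_integral_fst[of "\<lambda>q. F (fst q) (snd q)" "distr M \<Y> Y"] Fm by (simp add: measurable_cong_sets[OF sT refl])
  also have "\<dots> = (\<integral>\<^sup>+\<omega>. F (Y \<omega>) (\<eta> \<omega>) \<partial>M)"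
    unfolding distr_independent[OF ind, symmetric] using Fm by (subst nn_integral_distr) auto
  finally show ?thesis .
qed

text \<open>For a frozen environment t = (y, \<psi>) the stopping bound gives
  \<open>(R \<psi>)\<^sup>2 \<le> a \<psi> * v t\<close>. The revealment controls the mean of
  \<open>v\<close> over environments but no single \<open>v t\<close>; so Cauchy-Schwarz over
  \<open>t\<close> comes first and the union bound second. The remaining k! times the integral of
  the squared integrand is the second moment of the multiple integral.\<close>

theorem covariance_bound:
  fixes \<Y> :: "'y measure"
  assumes ind: "independent_elements M CS \<eta> \<Y> Y"
    and f: "f \<in> borel_measurable CS" "(\<integral>\<^sup>+\<omega>. ennreal ((f (\<eta> \<omega>))\<^sup>2) \<partial>M) < \<infinity>"
    and Z: "Measurable.pred (CS \<Otimes>\<^sub>M X \<Otimes>\<^sub>M \<Y>) (\<lambda>(\<mu>, x, y). x \<in> Z y \<mu>)"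
    and stop: "AE y in distr M \<Y> Y. stopping_set X B (Z y)"
    and det: "AE y in distr M \<Y> Y. determined_by X B f (Z y)"
    and g: "g \<in> elementary_integrands X B k" "supported k g" and k: "1 \<le> k"
  shows "ennreal ((\<integral>\<omega>. f (\<eta> \<omega>) * pathwise_integral \<Lambda> k g (\<eta> \<omega>) \<partial>M)\<^sup>2) \<le>
    of_nat k * max_revealment M X \<eta> Y Z * (\<integral>\<^sup>+\<omega>. ennreal ((f (\<eta> \<omega>))\<^sup>2) \<partial>M) *
      (\<integral>\<^sup>+\<omega>. ennreal ((pathwise_integral \<Lambda> k g (\<eta> \<omega>))\<^sup>2) \<partial>M)"
proof -
  note [measurable] = f(1) measurable_pathwise_integral[OF g]
  have Ym [measurable]: "Y \<in> M \<rightarrow>\<^sub>M \<Y>" using ind by (simp add: independent_elements_def)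
  interpret PY: prob_space "distr M \<Y> Y" by (rule Om.prob_space_distr) measurable
  interpret YP: pair_prob_space "distr M \<Y> Y" P\<eta> ..
  interpret Pk: sigma_finite_measure "points k" by (rule sigma_finite_points)
  let ?T = "distr M \<Y> Y \<Otimes>\<^sub>M P\<eta>"
  let ?h = "lift_integrand X k g"
  obtain c where c: "\<And>K. \<bar>?h K\<bar> \<le> c" using elementary_bound[OF g(1)] by blast
  note hm = measurable_lift_integrand[OF g(1)]
  note [measurable] = hm measurable_chaos[OF hm, of k]
  define a where "a \<psi> = (\<integral>\<^sup>+xs. ennreal ((f (combine xs \<psi>))\<^sup>2) \<partial>poisson_lists)" for \<psi>
  define R where "R \<psi> = (\<integral>xs. f (combine xs \<psi>) * chaos k ?h (mset xs) \<partial>poisson_lists)" for \<psi>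
  define v where "v t = fact k * (\<integral>\<^sup>+xs. \<integral>\<^sup>+ys. ennreal ((?h (mset ys))\<^sup>2) *
      of_bool (\<exists>y\<in>set ys. y \<in> Z (fst t) (combine xs (snd t))) \<partial>points k \<partial>poisson_lists)" for t
  define \<delta> where "\<delta> = max_revealment M X \<eta> Y Z"
  define H where "H = (\<integral>\<^sup>+ys. ennreal ((?h (mset ys))\<^sup>2) \<partial>points k)"
  have H_fin: "H < \<infinity>" unfolding H_def by (rule nn_integral_chaos_square(2)[OF hm c])
  have sT: "sets ?T = sets (\<Y> \<Otimes>\<^sub>M CS)" by (rule sets_pair_measure_cong) simp_all
  have comb [measurable]: "(\<lambda>xs. combine xs \<psi>) \<in> poisson_lists \<rightarrow>\<^sub>M CS" if "\<psi> \<in> CM" for \<psi>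
  proof -
    have "(\<lambda>xs. (xs, \<psi>)) \<in> poisson_lists \<rightarrow>\<^sub>M LS \<Otimes>\<^sub>M CS" using that by (simp cong: measurable_cong_sets)
    from measurable_compose[OF this measurable_combine] show ?thesis by simp
  qed
  have comb2: "(\<lambda>q. combine (fst q) (snd (snd q))) \<in> poisson_lists \<Otimes>\<^sub>M ?T \<rightarrow>\<^sub>M CS"
    "(\<lambda>q. combine (snd q) (snd (fst q))) \<in> ?T \<Otimes>\<^sub>M poisson_lists \<rightarrow>\<^sub>M CS"
  proof -
    have "(\<lambda>q. (fst q, snd (snd q))) \<in> poisson_lists \<Otimes>\<^sub>M ?T \<rightarrow>\<^sub>M LS \<Otimes>\<^sub>M CS"
      "(\<lambda>q. (snd q, snd (fst q))) \<in> ?T \<Otimes>\<^sub>M poisson_lists \<rightarrow>\<^sub>M LS \<Otimes>\<^sub>M CS"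
      by measurable
    from this[THEN measurable_compose[OF _ measurable_combine]]
    show "(\<lambda>q. combine (fst q) (snd (snd q))) \<in> poisson_lists \<Otimes>\<^sub>M ?T \<rightarrow>\<^sub>M CS"
      "(\<lambda>q. combine (snd q) (snd (fst q))) \<in> ?T \<Otimes>\<^sub>M poisson_lists \<rightarrow>\<^sub>M CS" by simp_all
  qed
  have ifr: "integrable P\<eta> (\<lambda>\<mu>. f \<mu> * pathwise_integral \<Lambda> k g \<mu>)"
    using f(2) nn_integral_pathwise_square(2)[OF g]
    by (intro integrable_mult_square) (simp_all add: nn_integral_distr)
  have Req: "(\<integral>xs. f (combine xs \<psi>) * pathwise_integral \<Lambda> k g (combine xs \<psi>) \<partial>poisson_lists) = R \<psi>" if "\<psi> \<in> CM" for \<psi>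
    unfolding R_def
  proof (rule integral_cong_AE)
    note [measurable] = comb[OF that]
    show "(\<lambda>xs. f (combine xs \<psi>) * pathwise_integral \<Lambda> k g (combine xs \<psi>)) \<in> borel_measurable poisson_lists"
      "(\<lambda>xs. f (combine xs \<psi>) * chaos k ?h (mset xs)) \<in> borel_measurable poisson_lists" by measurable
    show "AE xs in poisson_lists. f (combine xs \<psi>) * pathwise_integral \<Lambda> k g (combine xs \<psi>) =
        f (combine xs \<psi>) * chaos k ?h (mset xs)"
      using AE_pathwise_integral_combine[OF g that] by eventually_elim simp
  qed
  have iR: "integrable P\<eta> R"
    using integral_combine(2)[OF ifr] by (rule Bochner_Integration.integrable_cong[OF refl, THEN iffD1, rotated]) (simp add: Req)
  have Rm: "R \<in> borel_measurable CS" using iR by auto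
  have "(\<integral>\<omega>. f (\<eta> \<omega>) * pathwise_integral \<Lambda> k g (\<eta> \<omega>) \<partial>M) = (\<integral>\<mu>. f \<mu> * pathwise_integral \<Lambda> k g \<mu> \<partial>P\<eta>)"
    by (simp add: integral_distr)
  also have "\<dots> = (\<integral>\<psi>. \<integral>xs. f (combine xs \<psi>) * pathwise_integral \<Lambda> k g (combine xs \<psi>) \<partial>poisson_lists \<partial>P\<eta>)"
    by (rule integral_combine(1)[OF ifr])
  also have "\<dots> = (\<integral>\<psi>. R \<psi> \<partial>P\<eta>)"
    by (rule Bochner_Integration.integral_cong[OF refl]) (simp add: Req)
  finally have E_eq: "(\<integral>\<omega>. f (\<eta> \<omega>) * pathwise_integral \<Lambda> k g (\<eta> \<omega>) \<partial>M) = (\<integral>\<psi>. R \<psi> \<partial>P\<eta>)" .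
  have RT: "(\<lambda>t. ennreal \<bar>R (snd t)\<bar>) \<in> borel_measurable ?T"
    unfolding measurable_cong_sets[OF sT refl] using Rm by measurable
  have "ennreal \<bar>\<integral>\<psi>. R \<psi> \<partial>P\<eta>\<bar> \<le> (\<integral>\<^sup>+\<psi>. ennreal \<bar>R \<psi>\<bar> \<partial>P\<eta>)"
    using integral_norm_bound_ennreal[OF iR] by simp
  also have "\<dots> = (\<integral>\<^sup>+y. \<integral>\<^sup>+\<psi>. ennreal \<bar>R \<psi>\<bar> \<partial>P\<eta> \<partial>distr M \<Y> Y)"
    using PY.emeasure_space_1 by simp
  also have "\<dots> = (\<integral>\<^sup>+t. ennreal \<bar>R (snd t)\<bar> \<partial>?T)"
    using P\<eta>.nn_integral_fst[OF RT] by simp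
  finally have E_le: "ennreal \<bar>\<integral>\<psi>. R \<psi> \<partial>P\<eta>\<bar> \<le> (\<integral>\<^sup>+t. ennreal \<bar>R (snd t)\<bar> \<partial>?T)" .
  have aint: "(\<integral>\<^sup>+t. a (snd t) \<partial>?T) = (\<integral>\<^sup>+\<omega>. ennreal ((f (\<eta> \<omega>))\<^sup>2) \<partial>M)"
    unfolding a_def
    by (rule nn_integral_combine_independent[OF ind, of "\<lambda>_ \<mu>. ennreal ((f \<mu>)\<^sup>2)"]) (simp add: split_beta')
  have "(\<lambda>q. ennreal ((f (combine (snd q) (snd (fst q))))\<^sup>2)) \<in> borel_measurable (?T \<Otimes>\<^sub>M poisson_lists)"
    using measurable_compose[OF comb2(2) f(1)] by measurable
  from PL.borel_measurable_nn_integral_fst[OF this]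
  have am: "(\<lambda>t. a (snd t)) \<in> borel_measurable ?T" by (simp add: a_def)
  have a_fin: "AE t in ?T. a (snd t) \<noteq> \<infinity>"
    by (rule nn_integral_PInf_AE[OF am]) (use aint f(2) in auto)
  have Zm: "Measurable.pred \<Omega> (\<lambda>\<omega>. \<xi> \<omega> \<in> Z (\<upsilon> \<omega>) (\<mu> \<omega>))"
    if "\<xi> \<in> \<Omega> \<rightarrow>\<^sub>M X" "\<upsilon> \<in> \<Omega> \<rightarrow>\<^sub>M \<Y>" "\<mu> \<in> \<Omega> \<rightarrow>\<^sub>M CS" for \<xi> \<upsilon> \<mu> and \<Omega> :: "'z measure"
    using measurable_compose[OF measurable_Pair[OF that(3) measurable_Pair[OF that(1,2)]] Z] by simp
  have exm: "Measurable.pred \<Omega> (\<lambda>\<omega>. \<exists>x\<in>set (ys \<omega>). x \<in> Z (\<upsilon> \<omega>) (\<mu> \<omega>))"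
    if ys: "ys \<in> \<Omega> \<rightarrow>\<^sub>M LS" and \<upsilon>: "\<upsilon> \<in> \<Omega> \<rightarrow>\<^sub>M \<Y>" and \<mu>: "\<mu> \<in> \<Omega> \<rightarrow>\<^sub>M CS" for ys \<upsilon> \<mu> and \<Omega> :: "'z measure"
  proof -
    have "Measurable.pred (\<Omega> \<Otimes>\<^sub>M X) (\<lambda>q. snd q \<in> Z (\<upsilon> (fst q)) (\<mu> (fst q)))"
      by (rule Zm) (use \<upsilon> \<mu> in measurable)
    then have "Measurable.pred (\<Omega> \<Otimes>\<^sub>M X) (\<lambda>(\<omega>, x). x \<notin> Z (\<upsilon> \<omega>) (\<mu> \<omega>))"
      by (simp add: split_beta')
    note [measurable] = measurable_all_list[OF this ys]
    have "Measurable.pred \<Omega> (\<lambda>\<omega>. \<not> (\<forall>x\<in>set (ys \<omega>). x \<notin> Z (\<upsilon> \<omega>) (\<mu> \<omega>)))" by measurable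
    then show ?thesis by (rule measurable_cong[THEN iffD1, rotated]) simp
  qed
  let ?\<Omega> = "?T \<Otimes>\<^sub>M poisson_lists"
  have Tm: "(\<lambda>q. fst (fst q)) \<in> ?\<Omega> \<rightarrow>\<^sub>M \<Y>" by measurable
  have hit [measurable]: "Measurable.pred (?\<Omega> \<Otimes>\<^sub>M points k)
      (\<lambda>q. \<exists>x\<in>set (snd q). x \<in> Z (fst (fst (fst q))) (combine (snd (fst q)) (snd (fst (fst q)))))"
    by (rule exm) (use measurable_compose[OF measurable_fst Tm] measurable_compose[OF measurable_fst comb2(2)]
        measurable_snd in \<open>simp_all cong: measurable_cong_sets\<close>)
  let ?G = "\<lambda>q ys. ennreal ((?h (mset ys))\<^sup>2) * of_bool (\<exists>x\<in>set ys. x \<in> Z (fst (fst q)) (combine (snd q) (snd (fst q))))"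
  have Gm: "(\<lambda>(q, ys). ?G q ys) \<in> borel_measurable (?\<Omega> \<Otimes>\<^sub>M points k)"
    unfolding split_beta' by measurable
  have Gm1: "(\<lambda>q. \<integral>\<^sup>+ys. ?G q ys \<partial>points k) \<in> borel_measurable ?\<Omega>"
    by (rule Pk.borel_measurable_nn_integral[OF Gm])
  from PL.borel_measurable_nn_integral_fst[OF Gm1]
  have vm: "v \<in> borel_measurable ?T" unfolding v_def by simp
  have main: "AE t in ?T. ennreal ((R (snd t))\<^sup>2) \<le> a (snd t) * v t"
  proof -
    \<comment> \<open>The first marginal of \<open>?T\<close> is the law of \<open>Y\<close>, which
      carries almost sure properties of \<open>y\<close> over to pairs.\<close>
    have "AE y in distr ?T (distr M \<Y> Y) fst. stopping_set X B (Z y) \<and> determined_by X B f (Z y)"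
      unfolding P\<eta>.distr_pair_fst using stop det by (rule AE_conjI)
    from AE_distrD[OF measurable_fst this]
    have "AE t in ?T. stopping_set X B (Z (fst t)) \<and> determined_by X B f (Z (fst t))" .
    with a_fin AE_space show ?thesis
    proof eventually_elim
      case (elim t)
      have \<psi>: "snd t \<in> CM" using elim(2) by (simp add: space_pair_measure mem_Times_iff)
      have "(\<lambda>xs. f (combine xs (snd t))) \<in> borel_measurable poisson_lists"
        by (rule measurable_compose[OF comb[OF \<psi>] f(1)])
      then have \<phi>: "(\<lambda>xs. f (combine xs (snd t))) \<in> borel_measurable LS"
        by (simp cong: measurable_cong_sets)
      show ?case
        unfolding R_def a_def v_def
      proof (rule integral_chaos_stopping_bound[OF stopping_lists_combine[OF _ \<psi>] \<phi> _ _ hm c k])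
        show "stopping_set X B (Z (fst t))" using elim(3) by simp
        show "(\<integral>\<^sup>+xs. ennreal ((f (combine xs (snd t)))\<^sup>2) \<partial>poisson_lists) < \<infinity>"
          using elim(1) by (simp add: a_def less_top)
        show "f (combine (filter (\<lambda>x. x \<in> Z (fst t) (combine xs (snd t))) xs) (snd t)) = f (combine xs (snd t))"
          if "xs \<in> lists (space X)" for xs
          using elim(3) by (intro determined_combine[OF _ _ that \<psi>]) simp_all
      qed
    qed
  qed
  have fact_fin: "(fact k :: ennreal) < \<infinity>" by (simp flip: ennreal_fact)
  have v_fin: "v t < \<infinity>" for t
  proof -
    have "v t \<le> fact k * (\<integral>\<^sup>+xs. H \<partial>poisson_lists)"
      unfolding v_def H_def by (intro mult_left_mono nn_integral_mono) (auto simp: of_bool_def)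
    also have "\<dots> < \<infinity>" using H_fin fact_fin PL.emeasure_space_1 by (simp add: ennreal_mult_less_top)
    finally show ?thesis .
  qed
  \<comment> \<open>Finite square roots for Cauchy-Schwarz. On the null set where \<open>a\<close>
    is infinite the value is 0, so only an inequality is claimed for the square.\<close>
  define \<alpha> where "\<alpha> t = ennreal (sqrt (enn2real (a (snd t))))" for t :: "'y \<times> 'a measure"
  define \<beta> where "\<beta> t = ennreal (sqrt (enn2real (v t)))" for t
  have \<alpha>2: "(\<alpha> t)\<^sup>2 \<le> a (snd t)" for t
    by (cases "a (snd t)") (auto simp: \<alpha>_def ennreal_power)
  have \<beta>2: "(\<beta> t)\<^sup>2 \<le> v t" for t
    by (cases "v t") (auto simp: \<beta>_def ennreal_power)
  have "AE t in ?T. ennreal \<bar>R (snd t)\<bar> \<le> \<alpha> t * \<beta> t"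
    using main a_fin
  proof eventually_elim
    case (elim t)
    have "ennreal ((R (snd t))\<^sup>2) \<le> ennreal (enn2real (a (snd t)) * enn2real (v t))"
      using elim v_fin[of t] by (simp add: ennreal_mult ennreal_enn2real less_top)
    then have "(R (snd t))\<^sup>2 \<le> enn2real (a (snd t)) * enn2real (v t)"
      by (simp add: ennreal_le_iff)
    then have "sqrt ((R (snd t))\<^sup>2) \<le> sqrt (enn2real (a (snd t)) * enn2real (v t))"
      by (rule real_sqrt_le_mono)
    then show ?case
      by (simp add: \<alpha>_def \<beta>_def real_sqrt_mult ennreal_leI flip: ennreal_mult)
  qed
  then have "(\<integral>\<^sup>+t. ennreal \<bar>R (snd t)\<bar> \<partial>?T) \<le> (\<integral>\<^sup>+t. \<alpha> t * \<beta> t \<partial>?T)"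
    by (rule nn_integral_mono_AE)
  with E_le have "ennreal \<bar>\<integral>\<psi>. R \<psi> \<partial>P\<eta>\<bar> \<le> (\<integral>\<^sup>+t. \<alpha> t * \<beta> t \<partial>?T)" by (rule order.trans)
  then have "(ennreal \<bar>\<integral>\<psi>. R \<psi> \<partial>P\<eta>\<bar>)\<^sup>2 \<le> (\<integral>\<^sup>+t. \<alpha> t * \<beta> t \<partial>?T)\<^sup>2" by (intro power_mono) auto
  also have "\<dots> \<le> (\<integral>\<^sup>+t. (\<alpha> t)\<^sup>2 \<partial>?T) * (\<integral>\<^sup>+t. (\<beta> t)\<^sup>2 \<partial>?T)"
  proof (rule Cauchy_Schwarz_nn_integral)
    have s: "(\<lambda>x. ennreal (sqrt (enn2real x))) \<in> borel_measurable borel" by measurable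
    show "\<alpha> \<in> borel_measurable ?T" unfolding \<alpha>_def by (rule measurable_compose[OF am s])
    show "\<beta> \<in> borel_measurable ?T" unfolding \<beta>_def by (rule measurable_compose[OF vm s])
  qed
  also have "\<dots> \<le> (\<integral>\<^sup>+t. a (snd t) \<partial>?T) * (\<integral>\<^sup>+t. v t \<partial>?T)"
    by (intro mult_mono nn_integral_mono \<alpha>2 \<beta>2) auto
  also have "(\<integral>\<^sup>+t. v t \<partial>?T) \<le> fact k * (of_nat k * \<delta> * H)"
  proof -
    interpret TP: pair_prob_space ?T poisson_lists ..
    interpret O: pair_sigma_finite ?\<Omega> "points k" ..
    have pt: "(\<integral>\<^sup>+q. of_bool (x \<in> Z (fst (fst q)) (combine (snd q) (snd (fst q)))) \<partial>?\<Omega>) \<le> \<delta>"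
      if x: "x \<in> space X" for x
    proof -
      have m1: "Measurable.pred ?\<Omega> (\<lambda>q. x \<in> Z (fst (fst q)) (combine (snd q) (snd (fst q))))"
        by (rule Zm[OF _ Tm comb2(2)]) (use x in simp)
      have m2: "Measurable.pred (\<Y> \<Otimes>\<^sub>M CS) (\<lambda>q. x \<in> Z (fst q) (snd q))"
        by (rule Zm) (use x in simp_all)
      have m3: "Measurable.pred M (\<lambda>\<omega>. x \<in> Z (Y \<omega>) (\<eta> \<omega>))"
        by (rule Zm) (use x in simp_all)
      have "(\<integral>\<^sup>+q. of_bool (x \<in> Z (fst (fst q)) (combine (snd q) (snd (fst q)))) \<partial>?\<Omega>) =
          (\<integral>\<^sup>+t. \<integral>\<^sup>+xs. of_bool (x \<in> Z (fst t) (combine xs (snd t))) \<partial>poisson_lists \<partial>?T)"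
        using PL.nn_integral_fst[of "\<lambda>q. of_bool (x \<in> Z (fst (fst q)) (combine (snd q) (snd (fst q))))" ?T] m1 by simp
      also have "\<dots> = (\<integral>\<^sup>+\<omega>. of_bool (x \<in> Z (Y \<omega>) (\<eta> \<omega>)) \<partial>M)"
        by (rule nn_integral_combine_independent[OF ind, of "\<lambda>y \<mu>. of_bool (x \<in> Z y \<mu>)"])
          (use m2 in \<open>simp add: split_beta'\<close>)
      also have "\<dots> = (\<integral>\<^sup>+\<omega>. indicator {\<omega>\<in>space M. x \<in> Z (Y \<omega>) (\<eta> \<omega>)} \<omega> \<partial>M)"
        by (intro nn_integral_cong) (simp add: indicator_def)
      also have "\<dots> = emeasure M {\<omega>\<in>space M. x \<in> Z (Y \<omega>) (\<eta> \<omega>)}"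
        using m3 by (intro nn_integral_indicator) (simp add: pred_def)
      also have "\<dots> \<le> \<delta>" unfolding \<delta>_def max_revealment_def using x by (rule SUP_upper)
      finally show ?thesis .
    qed
    have pts: "(\<integral>\<^sup>+q. of_bool (\<exists>x\<in>set ys. x \<in> Z (fst (fst q)) (combine (snd q) (snd (fst q)))) \<partial>?\<Omega>) \<le> of_nat (length ys) * \<delta>"
      if "ys \<in> lists (space X)" for ys
      using that
    proof (induction ys)
      case (Cons x ys)
      then have x: "x \<in> space X" and ys: "ys \<in> lists (space X)" by auto
      have m1: "Measurable.pred ?\<Omega> (\<lambda>q. x \<in> Z (fst (fst q)) (combine (snd q) (snd (fst q))))"
        by (rule Zm[OF _ Tm comb2(2)]) (use x in simp)
      have m2: "Measurable.pred ?\<Omega> (\<lambda>q. \<exists>x\<in>set ys. x \<in> Z (fst (fst q)) (combine (snd q) (snd (fst q))))"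
        by (rule exm[OF _ Tm comb2(2)]) (use ys in simp)
      have "(\<integral>\<^sup>+q. of_bool (\<exists>x\<in>set (x # ys). x \<in> Z (fst (fst q)) (combine (snd q) (snd (fst q)))) \<partial>?\<Omega>) \<le>
          (\<integral>\<^sup>+q. of_bool (x \<in> Z (fst (fst q)) (combine (snd q) (snd (fst q)))) +
            of_bool (\<exists>x\<in>set ys. x \<in> Z (fst (fst q)) (combine (snd q) (snd (fst q)))) \<partial>?\<Omega>)"
        by (intro nn_integral_mono) (auto simp: of_bool_def)
      also have "\<dots> = (\<integral>\<^sup>+q. of_bool (x \<in> Z (fst (fst q)) (combine (snd q) (snd (fst q)))) \<partial>?\<Omega>) +
          (\<integral>\<^sup>+q. of_bool (\<exists>x\<in>set ys. x \<in> Z (fst (fst q)) (combine (snd q) (snd (fst q)))) \<partial>?\<Omega>)"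
        using m1 m2 by (intro nn_integral_add) simp_all
      also have "\<dots> \<le> \<delta> + of_nat (length ys) * \<delta>"
        by (intro add_mono pt x Cons.IH ys)
      finally show ?case by (simp add: distrib_right)
    qed simp
    have "(\<integral>\<^sup>+t. v t \<partial>?T) = fact k * (\<integral>\<^sup>+t. \<integral>\<^sup>+xs. \<integral>\<^sup>+ys. ?G (t, xs) ys \<partial>points k \<partial>poisson_lists \<partial>?T)"
      unfolding v_def using PL.borel_measurable_nn_integral_fst[OF Gm1] by (subst nn_integral_cmult) simp_all
    also have "(\<integral>\<^sup>+t. \<integral>\<^sup>+xs. \<integral>\<^sup>+ys. ?G (t, xs) ys \<partial>points k \<partial>poisson_lists \<partial>?T) = (\<integral>\<^sup>+q. \<integral>\<^sup>+ys. ?G q ys \<partial>points k \<partial>?\<Omega>)"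
      by (rule PL.nn_integral_fst[OF Gm1])
    \<comment> \<open>For a fixed tuple the average over environments and points is now innermost,
      where the revealment bounds it.\<close>
    also have "\<dots> = (\<integral>\<^sup>+ys. \<integral>\<^sup>+q. ?G q ys \<partial>?\<Omega> \<partial>points k)"
      by (rule O.Fubini'[OF Gm, symmetric])
    also have "\<dots> \<le> (\<integral>\<^sup>+ys. of_nat k * \<delta> * ennreal ((?h (mset ys))\<^sup>2) \<partial>points k)"
    proof (rule nn_integral_mono)
      fix ys assume "ys \<in> space (points k)"
      then have ys: "ys \<in> lists (space X)" by simp
      have m: "Measurable.pred ?\<Omega> (\<lambda>q. \<exists>x\<in>set ys. x \<in> Z (fst (fst q)) (combine (snd q) (snd (fst q))))"
        by (rule exm[OF _ Tm comb2(2)]) (use ys in simp)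
      have "(\<integral>\<^sup>+q. ?G q ys \<partial>?\<Omega>) = ennreal ((?h (mset ys))\<^sup>2) *
          (\<integral>\<^sup>+q. of_bool (\<exists>x\<in>set ys. x \<in> Z (fst (fst q)) (combine (snd q) (snd (fst q)))) \<partial>?\<Omega>)"
        using m by (intro nn_integral_cmult) simp
      also have "\<dots> \<le> ennreal ((?h (mset ys))\<^sup>2) * (of_nat (length ys) * \<delta>)"
        by (intro mult_left_mono pts ys) simp
      \<comment> \<open>Lists of another length have lifted integrand 0, so the length may be
        replaced by \<open>k\<close>.\<close>
      also have "\<dots> = of_nat k * \<delta> * ennreal ((?h (mset ys))\<^sup>2)"
        using lift_integrand_eq_0[of ys k X g] by (cases "length ys = k") (simp_all add: ac_simps)
      finally show "(\<integral>\<^sup>+q. ?G q ys \<partial>?\<Omega>) \<le> of_nat k * \<delta> * ennreal ((?h (mset ys))\<^sup>2)" .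
    qed
    also have "\<dots> = of_nat k * \<delta> * H" unfolding H_def by (rule nn_integral_cmult) simp
    finally show ?thesis by (simp add: mult_left_mono)
  qed
  finally have "(ennreal \<bar>\<integral>\<psi>. R \<psi> \<partial>P\<eta>\<bar>)\<^sup>2 \<le>
      (\<integral>\<^sup>+\<omega>. ennreal ((f (\<eta> \<omega>))\<^sup>2) \<partial>M) * (fact k * (of_nat k * \<delta> * H))"
    by (simp add: aint mult_left_mono)
  also have "\<dots> = of_nat k * \<delta> * (\<integral>\<^sup>+\<omega>. ennreal ((f (\<eta> \<omega>))\<^sup>2) \<partial>M) * (fact k * H)"
    by (simp add: ac_simps)
  also have "fact k * H = (\<integral>\<^sup>+\<omega>. ennreal ((pathwise_integral \<Lambda> k g (\<eta> \<omega>))\<^sup>2) \<partial>M)"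
    unfolding H_def by (rule nn_integral_pathwise_square(1)[OF g, symmetric])
  finally show ?thesis by (simp add: E_eq \<delta>_def ennreal_power)
qed

end

section \<open>Passing to the limit\<close>

lemma square_integrable_diff:
  fixes f g :: "'b \<Rightarrow> real"
  assumes [measurable]: "f \<in> borel_measurable N" "g \<in> borel_measurable N"
    and "(\<integral>\<^sup>+x. ennreal ((f x)\<^sup>2) \<partial>N) < \<infinity>" "(\<integral>\<^sup>+x. ennreal ((g x)\<^sup>2) \<partial>N) < \<infinity>"
  shows "(\<integral>\<^sup>+x. ennreal ((f x - g x)\<^sup>2) \<partial>N) < \<infinity>"
proof -
  have "(\<integral>\<^sup>+x. ennreal ((f x - g x)\<^sup>2) \<partial>N) \<le> (\<integral>\<^sup>+x. 2 * ennreal ((f x)\<^sup>2) + 2 * ennreal ((g x)\<^sup>2) \<partial>N)"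
  proof (intro nn_integral_mono)
    fix x
    have "(f x - g x)\<^sup>2 \<le> 2 * (f x)\<^sup>2 + 2 * (g x)\<^sup>2"
      using zero_le_power2[of "f x + g x"] by (simp add: power2_eq_square algebra_simps)
    then have "ennreal ((f x - g x)\<^sup>2) \<le> ennreal (2 * (f x)\<^sup>2 + 2 * (g x)\<^sup>2)" by (rule ennreal_leI)
    then show "ennreal ((f x - g x)\<^sup>2) \<le> 2 * ennreal ((f x)\<^sup>2) + 2 * ennreal ((g x)\<^sup>2)"
      by (simp add: ennreal_mult)
  qed
  also have "\<dots> = 2 * (\<integral>\<^sup>+x. ennreal ((f x)\<^sup>2) \<partial>N) + 2 * (\<integral>\<^sup>+x. ennreal ((g x)\<^sup>2) \<partial>N)"
    by (subst nn_integral_add) (auto simp: nn_integral_cmult)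
  also have "\<dots> < \<infinity>" using assms(3,4) by (simp add: ennreal_mult_less_top)
  finally show ?thesis .
qed

lemma nn_integral_square_eq:
  fixes f :: "'b \<Rightarrow> real"
  assumes f: "f \<in> borel_measurable N" "(\<integral>\<^sup>+x. ennreal ((f x)\<^sup>2) \<partial>N) < \<infinity>"
  shows "(\<integral>\<^sup>+x. ennreal ((f x)\<^sup>2) \<partial>N) = ennreal (\<integral>x. (f x)\<^sup>2 \<partial>N)"
  using f by (intro nn_integral_eq_integral integrableI_nonneg) auto

lemma Cauchy_Schwarz_integral:
  fixes f g :: "'b \<Rightarrow> real"
  assumes f: "f \<in> borel_measurable N" "(\<integral>\<^sup>+x. ennreal ((f x)\<^sup>2) \<partial>N) < \<infinity>"
    and g: "g \<in> borel_measurable N" "(\<integral>\<^sup>+x. ennreal ((g x)\<^sup>2) \<partial>N) < \<infinity>"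
  shows "\<bar>\<integral>x. f x * g x \<partial>N\<bar> \<le> sqrt (\<integral>x. (f x)\<^sup>2 \<partial>N) * sqrt (\<integral>x. (g x)\<^sup>2 \<partial>N)"
proof -
  note [measurable] = f(1) g(1)
  have "ennreal \<bar>\<integral>x. f x * g x \<partial>N\<bar> \<le> (\<integral>\<^sup>+x. ennreal \<bar>f x\<bar> * ennreal \<bar>g x\<bar> \<partial>N)"
  proof (cases "integrable N (\<lambda>x. f x * g x)")
    case True
    from integral_norm_bound_ennreal[OF this] show ?thesis by (simp add: abs_mult ennreal_mult)
  qed (simp add: not_integrable_integral_eq)
  then have "(ennreal \<bar>\<integral>x. f x * g x \<partial>N\<bar>)\<^sup>2 \<le> (\<integral>\<^sup>+x. ennreal \<bar>f x\<bar> * ennreal \<bar>g x\<bar> \<partial>N)\<^sup>2"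
    by (intro power_mono) auto
  also have "\<dots> \<le> (\<integral>\<^sup>+x. (ennreal \<bar>f x\<bar>)\<^sup>2 \<partial>N) * (\<integral>\<^sup>+x. (ennreal \<bar>g x\<bar>)\<^sup>2 \<partial>N)"
    by (intro Cauchy_Schwarz_nn_integral) measurable
  also have "\<dots> = ennreal ((\<integral>x. (f x)\<^sup>2 \<partial>N) * (\<integral>x. (g x)\<^sup>2 \<partial>N))"
    using nn_integral_square_eq[OF f] nn_integral_square_eq[OF g] by (simp add: ennreal_power ennreal_mult)
  finally have "\<bar>\<integral>x. f x * g x \<partial>N\<bar>\<^sup>2 \<le> (\<integral>x. (f x)\<^sup>2 \<partial>N) * (\<integral>x. (g x)\<^sup>2 \<partial>N)"
    by (simp add: ennreal_power)
  then have "sqrt (\<bar>\<integral>x. f x * g x \<partial>N\<bar>\<^sup>2) \<le> sqrt ((\<integral>x. (f x)\<^sup>2 \<partial>N) * (\<integral>x. (g x)\<^sup>2 \<partial>N))"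
    by (rule real_sqrt_le_mono)
  then show ?thesis by (simp add: real_sqrt_mult)
qed

text \<open>Expand f g - F G = (f - F)(g - G) + (f - F) G + F (g - G) and apply Cauchy-Schwarz to
  each term.\<close>

lemma tendsto_integral_mult_L2:
  fixes F G :: "'b \<Rightarrow> real"
  assumes F: "F \<in> borel_measurable N" "(\<integral>\<^sup>+x. ennreal ((F x)\<^sup>2) \<partial>N) < \<infinity>"
    and G: "G \<in> borel_measurable N" "(\<integral>\<^sup>+x. ennreal ((G x)\<^sup>2) \<partial>N) < \<infinity>"
    and f: "\<And>n. f n \<in> borel_measurable N" "\<And>n. (\<integral>\<^sup>+x. ennreal ((f n x)\<^sup>2) \<partial>N) < \<infinity>"
    and g: "\<And>n. g n \<in> borel_measurable N" "\<And>n. (\<integral>\<^sup>+x. ennreal ((g n x)\<^sup>2) \<partial>N) < \<infinity>"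
    and fF: "(\<lambda>n. \<integral>\<^sup>+x. ennreal ((f n x - F x)\<^sup>2) \<partial>N) \<longlonglongrightarrow> 0"
    and gG: "(\<lambda>n. \<integral>\<^sup>+x. ennreal ((g n x - G x)\<^sup>2) \<partial>N) \<longlonglongrightarrow> 0"
  shows "(\<lambda>n. \<integral>x. f n x * g n x \<partial>N) \<longlonglongrightarrow> (\<integral>x. F x * G x \<partial>N)"
proof -
  define a where "a n = (\<integral>x. (f n x - F x)\<^sup>2 \<partial>N)" for n
  define b where "b n = (\<integral>x. (g n x - G x)\<^sup>2 \<partial>N)" for n
  note fF2 = square_integrable_diff[OF f(1) F(1) f(2) F(2)]
  note gG2 = square_integrable_diff[OF g(1) G(1) g(2) G(2)]
  have fFm: "(\<lambda>x. f n x - F x) \<in> borel_measurable N" and gGm: "(\<lambda>x. g n x - G x) \<in> borel_measurable N" for n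
    using f(1) g(1) F(1) G(1) by measurable
  have ann: "a n \<ge> 0" "b n \<ge> 0" for n by (simp_all add: a_def b_def)
  have "(\<lambda>n. ennreal (a n)) \<longlonglongrightarrow> ennreal 0"
    using fF by (simp add: a_def nn_integral_square_eq[OF fFm fF2])
  then have a: "a \<longlonglongrightarrow> 0" using ann by (subst (asm) tendsto_ennreal_iff) auto
  have "(\<lambda>n. ennreal (b n)) \<longlonglongrightarrow> ennreal 0"
    using gG by (simp add: b_def nn_integral_square_eq[OF gGm gG2])
  then have b: "b \<longlonglongrightarrow> 0" using ann by (subst (asm) tendsto_ennreal_iff) auto
  let ?F = "sqrt (\<integral>x. (F x)\<^sup>2 \<partial>N)" and ?G = "sqrt (\<integral>x. (G x)\<^sup>2 \<partial>N)"
  have bound: "norm ((\<integral>x. f n x * g n x \<partial>N) - (\<integral>x. F x * G x \<partial>N)) \<le>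
      sqrt (a n) * sqrt (b n) + sqrt (a n) * ?G + ?F * sqrt (b n)" for n
  proof -
    have i: "integrable N (\<lambda>x. (f n x - F x) * (g n x - G x))" "integrable N (\<lambda>x. (f n x - F x) * G x)"
      "integrable N (\<lambda>x. F x * (g n x - G x))" "integrable N (\<lambda>x. F x * G x)"
      by (intro integrable_mult_square fFm gGm fF2 gG2 F G)+
    have "(\<integral>x. f n x * g n x \<partial>N) = (\<integral>x. (f n x - F x) * (g n x - G x) + (f n x - F x) * G x +
        F x * (g n x - G x) + F x * G x \<partial>N)"
      by (rule Bochner_Integration.integral_cong) (auto simp: algebra_simps)
    also have "\<dots> = (\<integral>x. (f n x - F x) * (g n x - G x) \<partial>N) + (\<integral>x. (f n x - F x) * G x \<partial>N) +
        (\<integral>x. F x * (g n x - G x) \<partial>N) + (\<integral>x. F x * G x \<partial>N)"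
      using i by simp
    finally have "norm ((\<integral>x. f n x * g n x \<partial>N) - (\<integral>x. F x * G x \<partial>N)) \<le>
        \<bar>\<integral>x. (f n x - F x) * (g n x - G x) \<partial>N\<bar> + \<bar>\<integral>x. (f n x - F x) * G x \<partial>N\<bar> +
        \<bar>\<integral>x. F x * (g n x - G x) \<partial>N\<bar>" by simp
    also have "\<dots> \<le> sqrt (a n) * sqrt (b n) + sqrt (a n) * ?G + ?F * sqrt (b n)"
      unfolding a_def b_def by (intro add_mono Cauchy_Schwarz_integral fFm gGm fF2 gG2 F G)
    finally show ?thesis .
  qed
  have "(\<lambda>n. sqrt (a n) * sqrt (b n) + sqrt (a n) * ?G + ?F * sqrt (b n)) \<longlonglongrightarrow>
      sqrt 0 * sqrt 0 + sqrt 0 * ?G + ?F * sqrt 0"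
    by (intro tendsto_intros a b)
  then have "(\<lambda>n. sqrt (a n) * sqrt (b n) + sqrt (a n) * ?G + ?F * sqrt (b n)) \<longlonglongrightarrow> 0" by simp
  then have "(\<lambda>n. (\<integral>x. f n x * g n x \<partial>N) - (\<integral>x. F x * G x \<partial>N)) \<longlonglongrightarrow> 0"
    by (rule Lim_null_comparison[rotated]) (intro always_eventually allI bound)
  then show ?thesis by (rule LIM_zero_cancel)
qed

text \<open>One approximant at squared distance less than 1 is enough.\<close>

lemma square_integrable_limit:
  fixes F :: "'b \<Rightarrow> real"
  assumes F: "F \<in> borel_measurable N"
    and f: "\<And>n::nat. f n \<in> borel_measurable N" "\<And>n. (\<integral>\<^sup>+x. ennreal ((f n x)\<^sup>2) \<partial>N) < \<infinity>"
    and fF: "(\<lambda>n. \<integral>\<^sup>+x. ennreal ((f n x - F x)\<^sup>2) \<partial>N) \<longlonglongrightarrow> 0"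
  shows "(\<integral>\<^sup>+x. ennreal ((F x)\<^sup>2) \<partial>N) < \<infinity>"
proof -
  have "eventually (\<lambda>n. (\<integral>\<^sup>+x. ennreal ((f n x - F x)\<^sup>2) \<partial>N) < 1) sequentially"
    using fF by (rule order_tendstoD) simp
  then obtain n where "(\<integral>\<^sup>+x. ennreal ((f n x - F x)\<^sup>2) \<partial>N) < 1"
    by (auto simp: eventually_sequentially)
  then have "(\<integral>\<^sup>+x. ennreal ((f n x - F x)\<^sup>2) \<partial>N) < \<infinity>" by (rule less_trans) simp
  with square_integrable_diff[of "f n" N "\<lambda>x. f n x - F x"] F f show ?thesis by simp
qed

text \<open>Covers the case excluded by the locales. Since \<open>k\<close> is positive, each
  summand has at least one variable, so its inner or its outer integral runs over an empty
  space.\<close>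

lemma pathwise_integral_empty:
  assumes X: "space X = {}" and \<Lambda>: "sets \<Lambda> = sets X" and \<mu>: "sets \<mu> = sets X" and k: "1 \<le> k"
  shows "pathwise_integral \<Lambda> k g \<mu> = 0"
proof -
  have sp: "space \<Lambda> = {}" "space \<mu> = {}"
    using X sets_eq_imp_space_eq[OF \<Lambda>] sets_eq_imp_space_eq[OF \<mu>] by auto
  have empty: "(\<integral>x. f x \<partial>N) = 0" if "space N = {}" for N :: "'z measure" and f :: "'z \<Rightarrow> real"
    using Bochner_Integration.integral_cong[OF refl, of N f "\<lambda>_. 0"] that by simp
  have PiM_empty: "space (PiM I (\<lambda>_. N)) = {}" if "I \<noteq> {}" "space N = {}" for I :: "nat set" and N :: "'a measure"
    using that by (auto simp: space_PiM PiE_eq_empty_iff)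
  have "(\<integral>x. (\<integral>y. g (merge {..<j} {j..<k} (x, y)) \<partial>PiM {j..<k} (\<lambda>_. \<Lambda>)) \<partial>factorial_measure \<mu> j) = 0"
    if "j \<le> k" for j
  proof (cases "j < k")
    case True
    then have "space (PiM {j..<k} (\<lambda>_. \<Lambda>)) = {}" using sp by (intro PiM_empty) auto
    then show ?thesis by (simp add: empty)
  next
    case False
    with that k obtain m where m: "j = Suc m" by (cases j) auto
    have "space (factorial_measure \<mu> j) = space (pow_measure \<mu> (Suc m))"
      unfolding m factorial_measure.simps by (rule space_measure_of) (rule sets.space_closed)
    also have "\<dots> = {}" using sp by (intro PiM_empty) auto
    finally show ?thesis by (rule empty)
  qed
  then show ?thesis by (simp add: pathwise_integral_def)
qed

theorem corollary5p3:
  fixes M :: "'w measure"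
    and X :: "'a measure" and B :: "nat \<Rightarrow> 'a set"
    and \<Lambda> :: "'a measure" and \<eta> :: "'w \<Rightarrow> 'a measure"
    and \<Y> :: "'y measure" and Y :: "'w \<Rightarrow> 'y"
    and f :: "'a measure \<Rightarrow> real"
    and u :: "nat \<Rightarrow> (nat \<Rightarrow> 'a) \<Rightarrow> real" and J :: "nat \<Rightarrow> 'w \<Rightarrow> real"
    and Z :: "'y \<Rightarrow> 'a measure \<Rightarrow> 'a set" and Zs :: "nat \<Rightarrow> 'y \<Rightarrow> 'a measure \<Rightarrow> 'a set"
    and k :: nat
  assumes "prob_space M"
    and "borel_space X" and "localizing_sequence X B"
    and "locally_finite X B \<Lambda>"
    and "poisson_process M X B \<Lambda> \<eta>"
    and "f \<in> borel_measurable (counting_space X B)"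
    and "(\<integral>\<^sup>+\<omega>. ennreal ((f (\<eta> \<omega>))\<^sup>2) \<partial>M) < \<infinity>"
    and "chaos_expansion M X B \<Lambda> \<eta> (\<lambda>\<omega>. f (\<eta> \<omega>)) u J"
    and "randomized_stopping_set M X B \<eta> \<Y> Y Z"
    and "determined_by_randomized M X B \<Y> Y f Z"
    and "\<And>j. j \<ge> 1 \<Longrightarrow> randomized_stopping_set M X B \<eta> \<Y> Y (Zs j)"
    and "AE y in distr M \<Y> Y. \<forall>\<mu>\<in>counting_measures X B. \<forall>j\<ge>1. Zs j y \<mu> \<subseteq> Zs (Suc j) y \<mu>"
    and "\<And>j. j \<ge> 1 \<Longrightarrow> AE \<omega> in M. emeasure (\<eta> \<omega>) (Zs j (Y \<omega>) (\<eta> \<omega>)) < \<infinity>"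
    and "AE y in distr M \<Y> Y. \<forall>\<mu>\<in>counting_measures X B. Z y \<mu> = (\<Union>j\<in>{1..}. Zs j y \<mu>)"
    and "k \<ge> 1"
  shows "(\<integral>\<^sup>+\<omega>. ennreal ((J k \<omega>)\<^sup>2) \<partial>M)
      \<le> of_nat k * max_revealment M X \<eta> Y Z * (\<integral>\<^sup>+\<omega>. ennreal ((f (\<eta> \<omega>))\<^sup>2) \<partial>M)"
proof -
  interpret M: prob_space M by fact
  have \<eta>m: "\<eta> \<in> M \<rightarrow>\<^sub>M counting_space X B" using assms(5) by (simp add: poisson_process_def)
  have Jm: "J i \<in> borel_measurable M" for i
    using assms(8) by (simp add: chaos_expansion_def has_wiener_ito_integral_def)
  have "\<forall>i. \<exists>g. (\<forall>n::nat. g n \<in> elementary_integrands X B i) \<and>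
      (\<lambda>n. \<integral>\<^sup>+\<omega>. ennreal ((pathwise_integral \<Lambda> i (g n) (\<eta> \<omega>) - J i \<omega>)\<^sup>2) \<partial>M) \<longlonglongrightarrow> 0"
    using assms(8) unfolding chaos_expansion_def has_wiener_ito_integral_def by blast
  then obtain g where "\<forall>i. (\<forall>n::nat. g i n \<in> elementary_integrands X B i) \<and>
      (\<lambda>n. \<integral>\<^sup>+\<omega>. ennreal ((pathwise_integral \<Lambda> i (g i n) (\<eta> \<omega>) - J i \<omega>)\<^sup>2) \<partial>M) \<longlonglongrightarrow> 0"
    by (rule choice[THEN exE])
  then have g: "g i n \<in> elementary_integrands X B i"
    and g_lim: "(\<lambda>n. \<integral>\<^sup>+\<omega>. ennreal ((pathwise_integral \<Lambda> i (g i n) (\<eta> \<omega>) - J i \<omega>)\<^sup>2) \<partial>M) \<longlonglongrightarrow> 0" for i n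
    by simp_all
  show ?thesis
  proof (cases "space X = {}")
    \<comment> \<open>All approximating integrals of order \<open>k\<close> vanish, hence so does
      \<open>J k\<close> almost surely.\<close>
    case True
    have "pathwise_integral \<Lambda> k (g k n) (\<eta> \<omega>) = 0" if "\<omega> \<in> space M" for n \<omega>
    proof (rule pathwise_integral_empty[OF True _ _ assms(15)])
      show "sets \<Lambda> = sets X" using assms(4) by (simp add: locally_finite_def)
      show "sets (\<eta> \<omega>) = sets X"
        using measurable_space[OF \<eta>m that] by (simp add: counting_measures_def)
    qed
    then have "(\<integral>\<^sup>+\<omega>. ennreal ((pathwise_integral \<Lambda> k (g k n) (\<eta> \<omega>) - J k \<omega>)\<^sup>2) \<partial>M) =
        (\<integral>\<^sup>+\<omega>. ennreal ((J k \<omega>)\<^sup>2) \<partial>M)" for n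
      by (intro nn_integral_cong) simp
    then have "(\<integral>\<^sup>+\<omega>. ennreal ((J k \<omega>)\<^sup>2) \<partial>M) = 0"
      using g_lim[of k] by (simp add: LIMSEQ_const_iff)
    then show ?thesis by simp
  next
    case False
    have ps: "poisson_setting X B \<Lambda> M \<eta>"
      using False assms(1-5)
      by (intro poisson_setting.intro local_intensity.intro localized_space.intro nonempty_space.intro
          localized_space_axioms.intro local_intensity_axioms.intro poisson_setting_axioms.intro)
    have "\<exists>p. \<forall>q\<ge>p. local_intensity.supported X B q i (g i n)" for i n
    proof -
      obtain p where p: "\<forall>x\<in>space (pow_measure X i). g i n x \<noteq> 0 \<longrightarrow> x \<in> (\<Pi>\<^sub>E j\<in>{..<i}. B p)"
        using g[of i n] unfolding elementary_integrands_def by blast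
      have "local_intensity.supported X B q i (g i n)" if "p \<le> q" for q
      proof -
        interpret poisson_setting X B \<Lambda> q M \<eta> by (rule ps)
        show ?thesis unfolding supported_def using p PiE_mono[of "{..<i}" "\<lambda>_. B p" "\<lambda>_. B q"] B_mono[OF that] by blast
      qed
      then show ?thesis by blast
    qed
    then obtain p where p: "\<And>i n q. p i n \<le> q \<Longrightarrow> local_intensity.supported X B q i (g i n)" by metis
    define r where "r i n \<omega> = pathwise_integral \<Lambda> i (g i n) (\<eta> \<omega>)" for i n \<omega>
    have rm: "r i n \<in> borel_measurable M" and r2: "(\<integral>\<^sup>+\<omega>. ennreal ((r i n \<omega>)\<^sup>2) \<partial>M) < \<infinity>" for i n
    proof -
      interpret poisson_setting X B \<Lambda> "p i n" M \<eta> by (rule ps)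
      show "r i n \<in> borel_measurable M"
        unfolding r_def by (rule measurable_compose[OF \<eta>m measurable_pathwise_integral[OF g p]]) simp
      show "(\<integral>\<^sup>+\<omega>. ennreal ((r i n \<omega>)\<^sup>2) \<partial>M) < \<infinity>"
        unfolding r_def by (rule nn_integral_pathwise_square(2)[OF g p]) simp
    qed
    have r_lim: "(\<lambda>n. \<integral>\<^sup>+\<omega>. ennreal ((r i n \<omega> - J i \<omega>)\<^sup>2) \<partial>M) \<longlonglongrightarrow> 0" for i
      unfolding r_def by (rule g_lim)
    have J2: "(\<integral>\<^sup>+\<omega>. ennreal ((J i \<omega>)\<^sup>2) \<partial>M) < \<infinity>" for i
      by (rule square_integrable_limit[OF Jm rm r2 r_lim])
    \<comment> \<open>Orthogonality passes from the pathwise integrals to their limits in mean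
      square.\<close>
    have orth: "(\<integral>\<omega>. J i \<omega> * J j \<omega> \<partial>M) = 0" if "i < j" for i j
    proof -
      have "(\<integral>\<omega>. r i n \<omega> * r j n \<omega> \<partial>M) = 0" for n
      proof -
        interpret poisson_setting X B \<Lambda> "max (p i n) (p j n)" M \<eta> by (rule ps)
        show ?thesis
          unfolding r_def by (rule integral_pathwise_orthogonal[OF g p g p that]) simp_all
      qed
      moreover have "(\<lambda>n. \<integral>\<omega>. r i n \<omega> * r j n \<omega> \<partial>M) \<longlonglongrightarrow> (\<integral>\<omega>. J i \<omega> * J j \<omega> \<partial>M)"
        by (rule tendsto_integral_mult_L2[OF Jm J2 Jm J2 rm r2 rm r2 r_lim r_lim])
      ultimately show ?thesis by (simp add: LIMSEQ_const_iff)
    qed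
    define F where "F \<omega> = f (\<eta> \<omega>)" for \<omega>
    have Fm: "F \<in> borel_measurable M" unfolding F_def by (rule measurable_compose[OF \<eta>m assms(6)])
    have F2: "(\<integral>\<^sup>+\<omega>. ennreal ((F \<omega>)\<^sup>2) \<partial>M) < \<infinity>" using assms(7) by (simp add: F_def)
    define S where "S n \<omega> = (\<Sum>i\<le>n. J i \<omega>)" for n \<omega>
    have Sm: "S n \<in> borel_measurable M" for n
      unfolding S_def by (intro borel_measurable_sum Jm)
    have S2: "(\<integral>\<^sup>+\<omega>. ennreal ((S n \<omega>)\<^sup>2) \<partial>M) < \<infinity>" for n
    proof (induction n)
      case 0
      show ?case using J2[of 0] by (simp add: S_def)
    next
      case (Suc n)
      have "(\<integral>\<^sup>+\<omega>. ennreal ((S n \<omega> - - J (Suc n) \<omega>)\<^sup>2) \<partial>M) < \<infinity>"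
        using Jm J2[of "Suc n"] by (intro square_integrable_diff Sm Suc) auto
      then show ?case by (simp add: S_def)
    qed
    have S_lim: "(\<lambda>n. \<integral>\<^sup>+\<omega>. ennreal ((S n \<omega> - F \<omega>)\<^sup>2) \<partial>M) \<longlonglongrightarrow> 0"
      using assms(8) unfolding chaos_expansion_def S_def F_def by (simp add: power2_commute)
    have orth': "(\<integral>\<omega>. J i \<omega> * J k \<omega> \<partial>M) = 0" if "i \<noteq> k" for i
      using that orth[of i k] orth[of k i] by (auto simp: nat_neq_iff mult.commute)
    \<comment> \<open>Only the \<open>k\<close>-th term of a partial sum correlates with
      \<open>J k\<close>, so from \<open>n = k\<close> on the covariance is constant, and the
      partial sums converge to \<open>F\<close> in mean square.\<close>
    have FJ: "(\<integral>\<omega>. F \<omega> * J k \<omega> \<partial>M) = (\<integral>\<omega>. (J k \<omega>)\<^sup>2 \<partial>M)"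
    proof -
      have "(\<integral>\<omega>. S n \<omega> * J k \<omega> \<partial>M) = (\<integral>\<omega>. (J k \<omega>)\<^sup>2 \<partial>M)" if "k \<le> n" for n
      proof -
        have "(\<integral>\<omega>. S n \<omega> * J k \<omega> \<partial>M) = (\<integral>\<omega>. (\<Sum>i\<le>n. J i \<omega> * J k \<omega>) \<partial>M)"
          by (simp add: S_def sum_distrib_right)
        also have "\<dots> = (\<Sum>i\<le>n. \<integral>\<omega>. J i \<omega> * J k \<omega> \<partial>M)"
          by (intro Bochner_Integration.integral_sum integrable_mult_square Jm J2)
        also have "\<dots> = (\<Sum>i\<le>n. if i = k then \<integral>\<omega>. (J k \<omega>)\<^sup>2 \<partial>M else 0)"
          by (intro sum.cong refl) (auto simp: power2_eq_square orth')
        finally show ?thesis using that by simp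
      qed
      then have "eventually (\<lambda>n. (\<integral>\<omega>. S n \<omega> * J k \<omega> \<partial>M) = (\<integral>\<omega>. (J k \<omega>)\<^sup>2 \<partial>M)) sequentially"
        by (auto simp: eventually_sequentially)
      then have "(\<lambda>n. \<integral>\<omega>. S n \<omega> * J k \<omega> \<partial>M) \<longlonglongrightarrow> (\<integral>\<omega>. (J k \<omega>)\<^sup>2 \<partial>M)"
        by (rule tendsto_eventually)
      moreover have "(\<lambda>n. \<integral>\<omega>. S n \<omega> * J k \<omega> \<partial>M) \<longlonglongrightarrow> (\<integral>\<omega>. F \<omega> * J k \<omega> \<partial>M)"
        by (rule tendsto_integral_mult_L2[OF Fm F2 Jm J2 Sm S2 Jm J2 S_lim]) simp
      ultimately show ?thesis by (rule LIMSEQ_unique[symmetric])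
    qed
    define \<delta> where "\<delta> = enn2real (max_revealment M X \<eta> Y Z)"
    \<comment> \<open>A supremum of probabilities is finite, so the estimate can be moved to the
      reals before the limit.\<close>
    have "max_revealment M X \<eta> Y Z \<le> 1"
      unfolding max_revealment_def by (intro SUP_least M.emeasure_le_1)
    then have \<delta>: "max_revealment M X \<eta> Y Z = ennreal \<delta>"
      unfolding \<delta>_def by (subst ennreal_enn2real) (auto intro: le_less_trans)
    have \<delta>0: "0 \<le> \<delta>" by (simp add: \<delta>_def)
    define a where "a = (\<integral>\<omega>. (J k \<omega>)\<^sup>2 \<partial>M)"
    define b where "b = (\<integral>\<omega>. (F \<omega>)\<^sup>2 \<partial>M)"
    have nonneg: "0 \<le> a" "0 \<le> b" by (simp_all add: a_def b_def)
    \<comment> \<open>The window depends on \<open>n\<close>, but the constant in the bound does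
      not; this is what permits the limit.\<close>
    have "(\<integral>\<omega>. F \<omega> * r k n \<omega> \<partial>M)\<^sup>2 \<le> real k * \<delta> * b * (\<integral>\<omega>. r k n \<omega> * r k n \<omega> \<partial>M)" for n
    proof -
      interpret poisson_setting X B \<Lambda> "p k n" M \<eta> by (rule ps)
      have "ennreal ((\<integral>\<omega>. F \<omega> * r k n \<omega> \<partial>M)\<^sup>2) \<le> of_nat k * max_revealment M X \<eta> Y Z *
          (\<integral>\<^sup>+\<omega>. ennreal ((F \<omega>)\<^sup>2) \<partial>M) * (\<integral>\<^sup>+\<omega>. ennreal ((r k n \<omega>)\<^sup>2) \<partial>M)"
        unfolding F_def r_def
        using assms(6,7,9,10,15)
        by (intro covariance_bound[where \<Y>=\<Y>] g p)
          (simp_all add: randomized_stopping_set_def determined_by_randomized_def)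
      also have "\<dots> = ennreal (real k * \<delta> * b * (\<integral>\<omega>. (r k n \<omega>)\<^sup>2 \<partial>M))"
        using \<delta>0 nonneg
        by (simp add: \<delta> nn_integral_square_eq[OF Fm F2] nn_integral_square_eq[OF rm r2] b_def
            ennreal_of_nat_eq_real_of_nat flip: ennreal_mult)
      finally show ?thesis
        using \<delta>0 nonneg by (subst (asm) ennreal_le_iff) (auto simp: power2_eq_square)
    qed
    moreover have "(\<lambda>n. (\<integral>\<omega>. F \<omega> * r k n \<omega> \<partial>M)\<^sup>2) \<longlonglongrightarrow> (\<integral>\<omega>. F \<omega> * J k \<omega> \<partial>M)\<^sup>2"
      by (intro tendsto_power tendsto_integral_mult_L2[OF Fm F2 Jm J2 Fm F2 rm r2 _ r_lim]) simp
    moreover have "(\<lambda>n. real k * \<delta> * b * (\<integral>\<omega>. r k n \<omega> * r k n \<omega> \<partial>M)) \<longlonglongrightarrow>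
        real k * \<delta> * b * (\<integral>\<omega>. J k \<omega> * J k \<omega> \<partial>M)"
      by (intro tendsto_mult_left tendsto_integral_mult_L2[OF Jm J2 Jm J2 rm r2 rm r2 r_lim r_lim])
    ultimately have "(\<integral>\<omega>. F \<omega> * J k \<omega> \<partial>M)\<^sup>2 \<le> real k * \<delta> * b * (\<integral>\<omega>. J k \<omega> * J k \<omega> \<partial>M)"
      by (intro LIMSEQ_le) auto
    \<comment> \<open>In the limit the covariance is \<open>a\<close> itself, so \<open>a\<close>
      occurs squared on the left and once on the right; it is cancelled unless it is zero.\<close>
    then have "a * a \<le> (real k * \<delta> * b) * a"
      by (simp add: FJ a_def power2_eq_square)
    then have "a \<le> real k * \<delta> * b"
      using nonneg \<delta>0 by (cases "a = 0") auto
    then have "ennreal a \<le> ennreal (real k * \<delta> * b)" by (rule ennreal_leI)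
    also have "\<dots> = of_nat k * max_revealment M X \<eta> Y Z * (\<integral>\<^sup>+\<omega>. ennreal ((F \<omega>)\<^sup>2) \<partial>M)"
      using \<delta>0 nonneg
      by (simp add: \<delta> nn_integral_square_eq[OF Fm F2] b_def ennreal_of_nat_eq_real_of_nat flip: ennreal_mult)
    finally show ?thesis
      by (simp add: nn_integral_square_eq[OF Jm J2] a_def F_def)
  qed
qed

end
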